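(* Let $U_{11}(x)=\sum_\Gamma x^{b(\Gamma)}$, the sum over isomorphism classes of Yukawa 1PI graphs of vertex type (external legs exactly one boson leg, one incoming fermion leg and one outgoing fermion leg), with $b(\Gamma)$ the number of boson edges including the external boson leg. Then $$U_{11}(x)=x\left.\frac{C_{\ge2}(t)}{t^2}\right|_{t=C(x)^2/x}.$$
   Context: Yukawa graphs: each vertex incident to exactly one incoming fermion, one outgoing fermion and one boson half-edge; internal edges are directed fermion edges or boson edges; unpaired half-edges are external legs; fermion cycles allowed; isomorphisms preserve types and orientations and fix each external leg. 1PI: connected and remains connected after deleting any internal edge. $C(x)$ and $C_{\ge2}(x)$ are the ordinary generating functions of connected and of $2$-connected chord diagrams (perfect matchings of $\{1,\dots,2n\}$; connected means the intersection graph, with chords $\{a<b\},\{c<d\}$ adjacent iff $a<c<b<d$ or $c<a<d<b$, is connected; $2$-connected means connected, at least two chords, and connected after deleting any single chord). Note $C_{\ge2}(t)/t^2$ is a power series and $C(x)^2/x$ has zero constant term. *)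

theory Defs
  imports "HOL-Computational_Algebra.Formal_Power_Series"
begin

text \<open>A Yukawa graph with V vertices is represented on the vertex set {..<V} by
  F : set of directed internal fermion edges (u,v): the outgoing fermion half-edge of u
      is paired with the incoming fermion half-edge of v (u = v allowed: fermion cycles);
  Bs: set of internal boson edges, each a 2-element set {u,v} of distinct vertices
      (each vertex carries exactly one boson half-edge, so boson edges are disjoint).
  Unpaired half-edges are external legs.  Since every vertex carries exactly one
  half-edge of each kind, a graph is determined up to isomorphism by these data, and an
  isomorphism is a bijection of the vertices transporting F and Bs.\<close>

type_synonym ygraph = "nat \<times> (nat \<times> nat) set \<times> nat set set"

definition yukawa_vertex_type :: "ygraph \<Rightarrow> bool" where
  "yukawa_vertex_type G = (case G of (V, F, Bs) \<Rightarrow>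
     F \<subseteq> {..<V} \<times> {..<V}
   \<and> (\<forall>u v w. (u, v) \<in> F \<longrightarrow> (u, w) \<in> F \<longrightarrow> v = w)
   \<and> (\<forall>u v w. (u, w) \<in> F \<longrightarrow> (v, w) \<in> F \<longrightarrow> u = v)
   \<and> (\<forall>e\<in>Bs. \<exists>u v. u \<noteq> v \<and> u < V \<and> v < V \<and> e = {u, v})
   \<and> (\<forall>e\<in>Bs. \<forall>e'\<in>Bs. e \<noteq> e' \<longrightarrow> e \<inter> e' = {})
   \<comment> \<open>exactly one external outgoing fermion leg\<close>
   \<and> card {u\<in>{..<V}. \<not> (\<exists>v. (u, v) \<in> F)} = 1
   \<comment> \<open>exactly one external incoming fermion leg\<close>
   \<and> card {v\<in>{..<V}. \<not> (\<exists>u. (u, v) \<in> F)} = 1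
   \<comment> \<open>exactly one external boson leg\<close>
   \<and> card ({..<V} - \<Union>Bs) = 1)"

definition yadj :: "(nat \<times> nat) set \<Rightarrow> nat set set \<Rightarrow> nat \<Rightarrow> nat \<Rightarrow> bool" where
  "yadj F Bs u v = ((u, v) \<in> F \<or> (v, u) \<in> F \<or> {u, v} \<in> Bs)"

definition yconnected :: "nat \<Rightarrow> (nat \<times> nat) set \<Rightarrow> nat set set \<Rightarrow> bool" where
  "yconnected V F Bs = (\<forall>u<V. \<forall>v<V. (yadj F Bs)\<^sup>*\<^sup>* u v)"

definition one_PI :: "ygraph \<Rightarrow> bool" where
  "one_PI G = (case G of (V, F, Bs) \<Rightarrow>
      yconnected V F Bs
    \<and> (\<forall>e\<in>F. yconnected V (F - {e}) Bs)
    \<and> (\<forall>e\<in>Bs. yconnected V F (Bs - {e})))"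

text \<open>Number of boson edges, including the external boson leg.\<close>
definition boson_count :: "ygraph \<Rightarrow> nat" where
  "boson_count G = card (snd (snd G)) + 1"

definition yiso :: "ygraph \<Rightarrow> ygraph \<Rightarrow> bool" where
  "yiso G H = (case G of (V, F, Bs) \<Rightarrow> case H of (V', F', Bs') \<Rightarrow>
     V = V' \<and> (\<exists>\<sigma>. bij_betw \<sigma> {..<V} {..<V}
                 \<and> F' = map_prod \<sigma> \<sigma> ` F \<and> Bs' = (\<lambda>e. \<sigma> ` e) ` Bs))"

definition U11_graphs :: "nat \<Rightarrow> ygraph set" where
  "U11_graphs n = {G. yukawa_vertex_type G \<and> one_PI G \<and> boson_count G = n}"

definition U11_count :: "nat \<Rightarrow> nat" where
  "U11_count n = card (U11_graphs n // {(G, H). G \<in> U11_graphs n \<and> H \<in> U11_graphs n \<and> yiso G H})"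

definition U11 :: "rat fps" where
  "U11 = Abs_fps (\<lambda>n. of_nat (U11_count n))"

definition chord_diagram :: "nat \<Rightarrow> nat set set \<Rightarrow> bool" where
  "chord_diagram n M =
     ((\<forall>c\<in>M. \<exists>a b. a < b \<and> c = {a, b})
    \<and> (\<forall>c\<in>M. \<forall>d\<in>M. c \<noteq> d \<longrightarrow> c \<inter> d = {})
    \<and> \<Union>M = {1..2*n})"

definition crosses :: "nat set \<Rightarrow> nat set \<Rightarrow> bool" where
  "crosses c d = (\<exists>a b a' b'. c = {a, b} \<and> a < b \<and> d = {a', b'} \<and> a' < b'
                   \<and> ((a < a' \<and> a' < b \<and> b < b') \<or> (a' < a \<and> a < b' \<and> b' < b)))"

definition chords_connected :: "nat set set \<Rightarrow> bool" where
  "chords_connected M = (M \<noteq> {} \<and>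
     (\<forall>c\<in>M. \<forall>d\<in>M. (\<lambda>x y. x \<in> M \<and> y \<in> M \<and> crosses x y)\<^sup>*\<^sup>* c d))"

definition chords_2connected :: "nat set set \<Rightarrow> bool" where
  "chords_2connected M = (chords_connected M \<and> card M \<ge> 2
     \<and> (\<forall>c\<in>M. chords_connected (M - {c})))"

definition C_conn :: "rat fps" where
  "C_conn = Abs_fps (\<lambda>n. of_nat (card {M. chord_diagram n M \<and> chords_connected M}))"

definition C_2conn :: "rat fps" where
  "C_2conn = Abs_fps (\<lambda>n. of_nat (card {M. chord_diagram n M \<and> chords_2connected M}))"

end

theory Submission
  imports Defs "HOL-Combinatorics.Permutations" "HOL-Library.Infinite_Set"
    "HOL-Computational_Algebra.Formal_Laurent_Series"
begin

text \<open>Write \<open>B = C(x)/x\<close>. Join the two external fermion legs of a graph and its external boson leg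
  to one extra vertex: a graph becomes a permutation \<open>\<sigma>\<close> (fermion lines) together with a matching \<open>\<alpha>\<close>
  (boson edges), and connectivity becomes a condition on the number of \<open>\<alpha>\<close>-edges leaving
  \<open>\<sigma>\<close>-closed sets. Let \<open>B\<close>, \<open>W\<close>, \<open>U\<close> count the fermion lines without boson leg and the vertex graphs
  that are connected and have no separating boson edge, and the 1PI vertex graphs, respectively.
  Deleting the vertex with the external boson gives \<open>W = xB + 2x\<^sup>2B'\<close>; deleting the first vertex of a
  line and splitting off the part behind a separating boson edge gives \<open>B - 1 = WB\<close>; cutting a line
  at its separating fermion edges gives \<open>W = BUB\<close>. The first two equations are the Stein recurrence
  for connected chord diagrams, so \<open>B\<close> is indeed \<open>C(x)/x\<close>, and \<open>U = (B - 1)/B\<^sup>3\<close>.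
  On the other side, contracting the maximal intervals from which exactly one chord emerges turns a
  connected diagram into a 2-connected one, and the root chord carries no interval at its first end;
  this gives \<open>C\<^bsub>\<ge>2\<^esub>(xB\<^sup>2) = xB(B - 1)\<close>, from which the formula follows.\<close>

section \<open>Matchings\<close>

text \<open>Matchings are functions equal to the identity off their ground set, so equal matchings
  are equal functions and matchings on disjoint sets combine by composition. Connectivity of a
  diagram is tested on intervals of points rather than on paths of chords, because intervals behave
  well under contraction. Graphs are counted with labelled vertices: relabelling acts freely, so
  dividing by a factorial counts isomorphism classes, and splitting a graph into parts becomes a
  product of exponential generating functions. Their variable y marks vertices; a vertex graph with
  n boson edges has 2n - 1 vertices, whence x = y^2. The link between the two sides is the weight 2i
  + 1 of the Stein recurrence: the coefficient of x^(i+1) in xB + 2x^2B' is (2i + 1)B_i. For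
  diagrams it is the number of gaps between the 2i + 2 endpoints of an outer component; for lines it
  is the number of places for the vertex with the external boson among 2i vertices and the extra
  one. No bijection between graphs and diagrams is built; both sides are expressed through
  B.\<close>

definition pmatch :: "'a set \<Rightarrow> ('a \<Rightarrow> 'a) \<Rightarrow> bool" where
  "pmatch S f \<longleftrightarrow> (\<forall>x\<in>S. f x \<in> S \<and> f x \<noteq> x \<and> f (f x) = x) \<and> (\<forall>x. x \<notin> S \<longrightarrow> f x = x)"

text \<open>Clauses 3, 5 and 6 hold at every point, on and off S, because f is the identity off S;
  this spares membership side conditions later.\<close>

lemma pmatchD:
  assumes "pmatch S f"
  shows "x \<in> S \<Longrightarrow> f x \<in> S" "x \<in> S \<Longrightarrow> f x \<noteq> x" "f (f x) = x" "x \<notin> S \<Longrightarrow> f x = x"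
    "f x \<in> S \<longleftrightarrow> x \<in> S" "f x = f y \<longleftrightarrow> x = y"
  using assms unfolding pmatch_def by (metis)+

lemma pmatchI:
  assumes "\<And>x. x \<in> S \<Longrightarrow> f x \<in> S" "\<And>x. x \<in> S \<Longrightarrow> f x \<noteq> x"
    "\<And>x. x \<in> S \<Longrightarrow> f (f x) = x" "\<And>x. x \<notin> S \<Longrightarrow> f x = x"
  shows "pmatch S f"
  using assms unfolding pmatch_def by blast

lemma pmatch_permutes: "pmatch S f \<Longrightarrow> f permutes S"
  unfolding permutes_def by (metis pmatchD(3,4))

lemma finite_pmatch: "finite S \<Longrightarrow> finite {f. pmatch S f}"
  by (rule finite_subset[OF _ finite_permutations[of S]]) (auto intro: pmatch_permutes)

lemma pmatch_empty [simp]: "pmatch {} f \<longleftrightarrow> f = id"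
  unfolding pmatch_def by (auto simp: fun_eq_iff)

definition edges :: "'a set \<Rightarrow> ('a \<Rightarrow> 'a) \<Rightarrow> 'a set set" where
  "edges S f = (\<lambda>x. {x, f x}) ` S"

text \<open>The part of \<open>chord_diagram\<close> that does not depend on the order of the
  points, for an arbitrary ground set. The boson edges of a graph satisfy it as well, so the passage
  from sets of edges to functions is shared by both sides.\<close>

definition pairing :: "'a set \<Rightarrow> 'a set set \<Rightarrow> bool" where
  "pairing S M \<longleftrightarrow> (\<forall>c\<in>M. \<exists>a b. a \<noteq> b \<and> c = {a, b})
     \<and> (\<forall>c\<in>M. \<forall>d\<in>M. c \<noteq> d \<longrightarrow> c \<inter> d = {}) \<and> \<Union>M = S"

lemma pairing_edges:
  assumes "pmatch S f"
  shows "pairing S (edges S f)"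
  unfolding pairing_def edges_def
  using pmatchD[OF assms] by (auto 4 4)

lemma edges_mem:
  assumes "pmatch S f" "x \<in> S"
  shows "{x, y} \<in> edges S f \<longleftrightarrow> y = f x"
  using pmatchD[OF assms(1)] assms(2) unfolding edges_def by (auto simp: doubleton_eq_iff)

lemma edges_inj: "inj_on (edges S) {f. pmatch S f}"
proof (rule inj_onI, rule ext)
  fix f g x assume *: "f \<in> {f. pmatch S f}" "g \<in> {f. pmatch S f}" "edges S f = edges S g"
  show "f x = g x"
  proof (cases "x \<in> S")
    case True
    then show ?thesis using * edges_mem[of S f x "f x"] edges_mem[of S g x "f x"] by auto
  qed (use * pmatchD(4) in \<open>metis mem_Collect_eq\<close>)
qed

lemma pairing_obtain:
  assumes "pairing S M"
  obtains f where "pmatch S f" "edges S f = M"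
proof -
  define f where "f = (\<lambda>x. if x \<in> S then THE y. {x, y} \<in> M else x)"
  have M: "\<forall>c\<in>M. \<exists>a b. a \<noteq> b \<and> c = {a, b}" "\<And>c d. c\<in>M \<Longrightarrow> d\<in>M \<Longrightarrow> c \<noteq> d \<Longrightarrow> c \<inter> d = {}" "\<Union>M = S"
    using assms unfolding pairing_def by auto
  have uniq: "y = z" if "{x, y} \<in> M" "{x, z} \<in> M" for x y z
  proof -
    have "{x,y} = {x,z}" using M(2)[OF that] by auto
    then show ?thesis by (auto simp: doubleton_eq_iff)
  qed
  have ne: "x \<noteq> y" if "{x, y} \<in> M" for x y
    using M(1) that by (metis doubleton_eq_iff)
  have ex: "\<exists>y. {x, y} \<in> M" if xS: "x \<in> S" for x
  proof -
    obtain c where c: "c \<in> M" "x \<in> c" using xS M(3) by auto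
    then obtain a b where "c = {a, b}" using M(1) by blast
    then show ?thesis using c by (auto simp: insert_commute)
  qed
  have f: "{x, y} \<in> M \<longleftrightarrow> y = f x" if xS: "x \<in> S" for x y
  proof -
    obtain z where z: "{x, z} \<in> M" using ex[OF xS] by blast
    then have "(THE y. {x, y} \<in> M) = z" using uniq by blast
    then show ?thesis using z uniq xS unfolding f_def by auto
  qed
  have sub: "y \<in> S" if "{x, y} \<in> M" for x y using M(3) that by auto
  have 1: "pmatch S f"
  proof (rule pmatchI)
    fix x assume x: "x \<in> S"
    have a: "{x, f x} \<in> M" using f x by blast
    show "f x \<in> S" using sub[OF a] .
    show "f x \<noteq> x" using ne[OF a] by auto
    show "f (f x) = x" using f[OF sub[OF a], of x] a by (metis insert_commute)
  qed (auto simp: f_def)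
  have "edges S f = M"
  proof
    show "edges S f \<subseteq> M" unfolding edges_def using f by blast
    show "M \<subseteq> edges S f"
    proof
      fix c assume c: "c \<in> M"
      obtain a b where ab: "c = {a, b}" using M(1) c by blast
      then have "a \<in> S" using M(3) c by auto
      then show "c \<in> edges S f" using f[of a b] c ab unfolding edges_def by auto
    qed
  qed
  then show thesis using that 1 by blast
qed

lemma card_pairing:
  assumes "finite S" "pairing S M"
  shows "2 * card M = card S" "finite M"
proof -
  show "finite M" using assms unfolding pairing_def by (auto intro: finite_UnionD)
  have "\<forall>c\<in>M. card c = 2" using assms(2) unfolding pairing_def by (metis card_2_iff)
  then show "2 * card M = card S"
    using card_partition[of M 2] assms \<open>finite M\<close> unfolding pairing_def by auto
qed

lemma pmatch_even: "finite S \<Longrightarrow> pmatch S f \<Longrightarrow> even (card S)"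
  using card_pairing(1)[OF _ pairing_edges] by (metis dvd_triv_left)

lemma card_edges: "finite S \<Longrightarrow> pmatch S f \<Longrightarrow> 2 * card (edges S f) = card S"
  using card_pairing(1)[OF _ pairing_edges] .

text \<open>In a connected diagram every interval that is tested has an outgoing chord, so there the
  failure of \<open>two_out\<close> means that exactly one chord leaves.\<close>

definition two_out :: "('a \<Rightarrow> 'a) \<Rightarrow> 'a set \<Rightarrow> bool" where
  "two_out f J \<longleftrightarrow> (\<exists>x\<in>J. \<exists>y\<in>J. x \<noteq> y \<and> f x \<notin> J \<and> f y \<notin> J)"

section \<open>Connectivity of chord diagrams\<close>

text \<open>Intervals are taken relative to S: once chords are deleted or blocks contracted, the
  ground set is no longer a segment of the natural numbers.\<close>

definition convex_in :: "nat set \<Rightarrow> nat set \<Rightarrow> bool" where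
  "convex_in S J \<longleftrightarrow> J \<subseteq> S \<and> (\<forall>x\<in>J. \<forall>z\<in>J. \<forall>y\<in>S. x < y \<longrightarrow> y < z \<longrightarrow> y \<in> J)"

lemma convex_inI:
  assumes "J \<subseteq> S" "\<And>x y z. x \<in> J \<Longrightarrow> z \<in> J \<Longrightarrow> y \<in> S \<Longrightarrow> x < y \<Longrightarrow> y < z \<Longrightarrow> y \<in> J"
  shows "convex_in S J"
  using assms unfolding convex_in_def by blast

lemma convex_in_subset: "convex_in S J \<Longrightarrow> J \<subseteq> S"
  unfolding convex_in_def by (rule conjunct1)

lemma convex_in_mid:
  assumes "convex_in S J" "x \<in> J" "z \<in> J" "y \<in> S" "x < y" "y < z"
  shows "y \<in> J"
  using assms unfolding convex_in_def by meson

definition interval_conn :: "nat set \<Rightarrow> (nat \<Rightarrow> nat) \<Rightarrow> bool" where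
  "interval_conn S f \<longleftrightarrow> (\<forall>J. convex_in S J \<longrightarrow> J \<noteq> {} \<longrightarrow> J \<noteq> S \<longrightarrow> (\<exists>x\<in>J. f x \<notin> J))"

text \<open>\<open>crosses\<close> refers to the smaller and the larger endpoint, whereas a chord
  {x, f x} comes without an order. Crossing is therefore expressed by one endpoint of the second
  chord lying strictly between those of the first, the other strictly outside.\<close>

lemma crosses_iff:
  assumes "x \<noteq> u" "y \<noteq> v"
  shows "crosses {x, u} {y, v} \<longleftrightarrow>
    (min x u < y \<and> y < max x u \<and> (v < min x u \<or> max x u < v)) \<or>
    (min x u < v \<and> v < max x u \<and> (y < min x u \<or> max x u < y))"
proof -
  have *: "{x, u} = {a, b} \<and> a < b \<longleftrightarrow> a = min x u \<and> b = max x u" for a b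
    using assms(1) by (auto simp: doubleton_eq_iff min_def max_def)
  have **: "{y, v} = {a, b} \<and> a < b \<longleftrightarrow> a = min y v \<and> b = max y v" for a b
    using assms(2) by (auto simp: doubleton_eq_iff min_def max_def)
  have "crosses {x, u} {y, v} \<longleftrightarrow> (\<exists>a b a' b'. ({x, u} = {a, b} \<and> a < b) \<and> ({y, v} = {a', b'} \<and> a' < b') \<and>
      ((a < a' \<and> a' < b \<and> b < b') \<or> (a' < a \<and> a < b' \<and> b' < b)))"
    unfolding crosses_def by blast
  also have "\<dots> \<longleftrightarrow> (min x u < min y v \<and> min y v < max x u \<and> max x u < max y v) \<or>
      (min y v < min x u \<and> min x u < max y v \<and> max y v < max x u)"
    unfolding * ** by blast
  finally have *: "crosses {x, u} {y, v} \<longleftrightarrow> \<dots>" .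
  consider "x < u" "y < v" | "x < u" "v < y" | "u < x" "y < v" | "u < x" "v < y"
    using assms by linarith
  then show ?thesis
  proof cases
    case 1
    then show ?thesis unfolding * by (simp add: min_def max_def) linarith
  next
    case 2
    then show ?thesis unfolding * by (simp add: min_def max_def) linarith
  next
    case 3
    then show ?thesis unfolding * by (simp add: min_def max_def) linarith
  next
    case 4
    then show ?thesis unfolding * by (simp add: min_def max_def) linarith
  qed
qed

lemma crosses_commute: "crosses c d \<longleftrightarrow> crosses d c"
  unfolding crosses_def by blast

text \<open>Colour the points by membership in U; every chord is monochromatic, and chords of
  different colours do not cross. A chord leaving a maximal monochromatic interval spans a point of
  the other colour. If no chord does so, every such interval is closed. Otherwise take a shortest
  chord spanning a point y of the other colour: the interval of y lies below that chord, and a chord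
  leaving it would have to stay below too and would be shorter.\<close>

lemma closed_convex_of_noncrossing:
  assumes S: "finite S" "pmatch S f"
    and U: "U \<subseteq> S" "U \<noteq> {}" "U \<noteq> S" "\<And>x. x \<in> U \<Longrightarrow> f x \<in> U"
    and nc: "\<And>x y. x \<in> U \<Longrightarrow> y \<in> S - U \<Longrightarrow> \<not> crosses {x, f x} {y, f y}"
  shows "\<exists>J. convex_in S J \<and> J \<noteq> {} \<and> J \<noteq> S \<and> (\<forall>x\<in>J. f x \<in> J)"
proof -
  \<comment> \<open>\<open>run y\<close> is the maximal interval around y of the colour of y;
    \<open>X\<close> collects the left ends of the chords that span a point of the other
    colour.\<close>
  define run where "run = (\<lambda>y. {z \<in> S. \<forall>w\<in>S. min y z \<le> w \<longrightarrow> w \<le> max y z \<longrightarrow> (w \<in> U) = (y \<in> U)})"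
  define X where "X = {x \<in> S. x < f x \<and> (\<exists>y\<in>S. x < y \<and> y < f x \<and> (y \<in> U) \<noteq> (x \<in> U))}"
  note fD = pmatchD[OF S(2)]
  have col: "f x \<in> U \<longleftrightarrow> x \<in> U" for x using U(4) fD(3) by metis
  have self: "y \<in> run y" if "y \<in> S" for y
    using that unfolding run_def by auto
  have mono: "(z \<in> U) = (y \<in> U)" if "z \<in> run y" for y z
    using that unfolding run_def by auto
  have neS: "run y \<noteq> S" if "y \<in> S" for y
    using U(1-3) mono that by blast
  have conv: "convex_in S (run y)" if "y \<in> S" for y
  proof (rule convex_inI)
    fix x z w assume xz: "x \<in> run y" "z \<in> run y" and w: "w \<in> S" "x < w" "w < z"
    show "w \<in> run y"
    proof (cases "y \<le> w")
      case True
      then have "max y w \<le> max y z" "min y z \<le> min y w" using w by auto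
      then show ?thesis using xz(2) w(1) unfolding run_def by (auto 0 0 dest: order_trans)
    next
      case False
      then have "max y w \<le> max y x" "min y x \<le> min y w" using w by auto
      then show ?thesis using xz(1) w(1) unfolding run_def by (auto 0 0 dest: order_trans)
    qed
  qed (auto simp: run_def)
  have exit: "\<exists>v\<in>X. min z (f z) = v \<and> f v - v = max z (f z) - min z (f z)"
    if y: "y \<in> S" and z: "z \<in> run y" "f z \<notin> run y" for y z
  proof -
    have zS: "z \<in> S" "f z \<in> S" using z(1) fD(1) unfolding run_def by auto
    have c: "(f z \<in> U) = (y \<in> U)" "(z \<in> U) = (y \<in> U)" using col mono[OF z(1)] by auto
    obtain w where w: "w \<in> S" "min y (f z) \<le> w" "w \<le> max y (f z)" "(w \<in> U) \<noteq> (y \<in> U)"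
      using z(2) zS unfolding run_def by auto
    have "\<not> (min y z \<le> w \<and> w \<le> max y z)" using z(1) w unfolding run_def by auto
    moreover have "w \<noteq> z" "w \<noteq> f z" using c w(4) by auto
    ultimately have "(w < z \<and> f z < w) \<or> (z < w \<and> w < f z)"
      using w(2,3) by linarith
    then have *: "min z (f z) < w" "w < max z (f z)" by auto
    have "min z (f z) \<in> X"
    proof (cases "z < f z")
      case True
      then show ?thesis using * w zS c unfolding X_def by auto
    next
      case False
      then show ?thesis using * w zS c fD(2)[OF zS(1)] unfolding X_def
        by (auto simp: fD(3) min_def max_def split: if_splits)
    qed
    then show ?thesis by (auto simp: fD(3) min_def max_def)
  qed
  show ?thesis
  proof (cases "X = {}")
    case True
    obtain y where "y \<in> U" using U by auto
    then have "y \<in> S" using U by auto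
    then show ?thesis using conv self neS exit True by blast
  next
    case False
    obtain a where a: "a \<in> X" and amin: "\<And>v. v \<in> X \<Longrightarrow> f a - a \<le> f v - v"
      using arg_min_nat_lemma[of "\<lambda>x. x \<in> X" _ "\<lambda>x. f x - x"] False by blast
    obtain y where y: "y \<in> S" "a < y" "y < f a" "(y \<in> U) \<noteq> (a \<in> U)" and aS: "a \<in> S" "a < f a"
      using a unfolding X_def by auto
    have in_ab: "a < z \<and> z < f a" if z: "z \<in> run y" for z
    proof (rule ccontr)
      assume "\<not> ?thesis"
      then have "(min y z \<le> a \<and> a \<le> max y z) \<or> (min y z \<le> f a \<and> f a \<le> max y z)"
        using y by auto
      then show False
      proof (elim disjE)
        assume *: "min y z \<le> a \<and> a \<le> max y z"
        have "\<forall>w\<in>S. min y z \<le> w \<longrightarrow> w \<le> max y z \<longrightarrow> (w \<in> U) = (y \<in> U)"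
          using z unfolding run_def by blast
        then show False using y(4) aS * by blast
      next
        assume *: "min y z \<le> f a \<and> f a \<le> max y z"
        have "\<forall>w\<in>S. min y z \<le> w \<longrightarrow> w \<le> max y z \<longrightarrow> (w \<in> U) = (y \<in> U)"
          using z unfolding run_def by blast
        then show False using y(4) col[of a] fD(1)[OF aS(1)] * by blast
      qed
    qed
    have "f z \<in> run y" if z: "z \<in> run y" for z
    proof (rule ccontr)
      assume n: "f z \<notin> run y"
      have zS: "z \<in> S" using z unfolding run_def by auto
      have c: "(z \<in> U) = (y \<in> U)" using mono[OF z] .
      have "\<not> crosses {a, f a} {z, f z}" "\<not> crosses {z, f z} {a, f a}"
        using nc[of a z] nc[of z a] c y(4) aS zS
        by (auto simp: crosses_commute)
      moreover have "min a (f a) = a" "max a (f a) = f a" using aS(2) by auto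
      moreover have "a < z" "z < f a" using in_ab[OF z] by auto
      ultimately have "a \<le> f z \<and> f z \<le> f a"
        using crosses_iff[of a "f a" z "f z"] aS(2) fD(2)[OF zS] by auto
      moreover have "f z \<noteq> a" "f z \<noteq> f a" using in_ab[OF z] fD(3)[of z] fD(3)[of a] by auto
      ultimately have "max z (f z) - min z (f z) < f a - a" using in_ab[OF z] by linarith
      then show False using exit[OF y(1) z n] amin by force
    qed
    then show ?thesis using conv self neS y(1) by blast
  qed
qed

text \<open>No path of crossings leads out of a closed interval: by convexity, a chord crossing one
  with both ends inside has an end inside as well. Conversely, the endpoints of a component of the
  intersection graph form a closed set whose chords do not cross the others, so a proper component
  yields a closed proper interval by the preceding lemma.\<close>

lemma chords_connected_iff:
  assumes S: "finite S" "pmatch S f"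
  shows "chords_connected (edges S f) \<longleftrightarrow> S \<noteq> {} \<and> interval_conn S f"
proof -
  note fD = pmatchD[OF S(2)]
  let ?R = "\<lambda>x y. x \<in> edges S f \<and> y \<in> edges S f \<and> crosses x y"
  have ne: "edges S f \<noteq> {} \<longleftrightarrow> S \<noteq> {}" unfolding edges_def by auto
  show ?thesis
  proof
    assume con: "chords_connected (edges S f)"
    have "\<exists>x\<in>J. f x \<notin> J" if J: "convex_in S J" "J \<noteq> {}" "J \<noteq> S" for J
    proof (rule ccontr)
      assume "\<not> ?thesis"
      then have cl: "\<And>x. x \<in> J \<Longrightarrow> f x \<in> J" by auto
      have "J \<subseteq> S" using J(1) by (rule convex_in_subset)
      then obtain x y where xy: "x \<in> J" "y \<in> S" "y \<notin> J" using J(2,3) by blast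
      have xS: "x \<in> S" using xy(1) \<open>J \<subseteq> S\<close> by blast
      have "{x, f x} \<in> edges S f" "{y, f y} \<in> edges S f" using xS xy(2) unfolding edges_def by blast+
      then have "?R\<^sup>*\<^sup>* {x, f x} {y, f y}" using con unfolding chords_connected_def by blast
      moreover have "d \<subseteq> J" if "?R\<^sup>*\<^sup>* {x, f x} d" for d
        using that
      proof (induction)
        case base
        then show ?case using xy cl by auto
      next
        case (step c d)
        obtain z where z: "z \<in> S" "d = {z, f z}" using step(2) unfolding edges_def by blast
        obtain a b a' b' where ab: "c = {a, b}" "a < b" "d = {a', b'}" "a' < b'" 
          "(a < a' \<and> a' < b \<and> b < b') \<or> (a' < a \<and> a < b' \<and> b' < b)"
          using step(2) unfolding crosses_def by blast
        have "a \<in> J" "b \<in> J" using step(3) ab(1) by auto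
        moreover have "d \<subseteq> S" using z fD(1)[OF z(1)] by simp
        then have "a' \<in> S" "b' \<in> S" using ab(3) by auto
        ultimately have "a' \<in> J \<or> b' \<in> J" using ab(5) convex_in_mid[OF J(1)] by blast
        then have "\<exists>v\<in>d. v \<in> J" using ab(3) by blast
        then have "z \<in> J \<or> f z \<in> J" using z(2) by blast
        then show ?case using cl fD(3) z by (metis empty_subsetI insert_subset)
      qed
      ultimately show False using xy by auto
    qed
    then show "S \<noteq> {} \<and> interval_conn S f" using con ne unfolding interval_conn_def chords_connected_def by auto
  next
    assume A: "S \<noteq> {} \<and> interval_conn S f"
    show "chords_connected (edges S f)"
    proof (rule ccontr)
      assume "\<not> ?thesis"
      then obtain c d where cd: "c \<in> edges S f" "d \<in> edges S f" "\<not> ?R\<^sup>*\<^sup>* c d"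
        using A ne unfolding chords_connected_def by blast
      define U where "U = {x \<in> S. ?R\<^sup>*\<^sup>* c {x, f x}}"
      have 1: "f x \<in> U" if "x \<in> U" for x
        using that fD(1,3) unfolding U_def by (auto simp: insert_commute)
      have 2: "\<not> crosses {x, f x} {y, f y}" if "x \<in> U" "y \<in> S - U" for x y
      proof
        assume cr: "crosses {x, f x} {y, f y}"
        have "?R {x, f x} {y, f y}" using cr that unfolding U_def edges_def by auto
        moreover have "?R\<^sup>*\<^sup>* c {x, f x}" using that(1) unfolding U_def by auto
        ultimately have "?R\<^sup>*\<^sup>* c {y, f y}" by (simp add: rtranclp.rtrancl_into_rtrancl)
        then show False using that unfolding U_def by auto
      qed
      obtain x y where "x \<in> S" "c = {x, f x}" "y \<in> S" "d = {y, f y}"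
        using cd unfolding edges_def by auto
      then have "x \<in> U" "y \<in> S - U" using cd unfolding U_def by auto
      then have "U \<noteq> {}" "U \<noteq> S" by auto
      moreover have "U \<subseteq> S" unfolding U_def by blast
      ultimately have "\<exists>J. convex_in S J \<and> J \<noteq> {} \<and> J \<noteq> S \<and> (\<forall>x\<in>J. f x \<in> J)"
        using closed_convex_of_noncrossing[OF S, of U] 1 2 by presburger
      then show False using A unfolding interval_conn_def by blast
    qed
  qed
qed

text \<open>Below, a diagram on \<open>insert s S\<close> has root \<open>s\<close>, and only intervals of \<open>S\<close> are tested: the complement
  of an interval containing the minimum is again an interval.\<close>

definition leaky :: "nat set \<Rightarrow> (nat \<Rightarrow> nat) \<Rightarrow> bool" where
  "leaky S f \<longleftrightarrow> (\<forall>J. convex_in S J \<longrightarrow> J \<noteq> {} \<longrightarrow> (\<exists>x\<in>J. f x \<notin> J))"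

definition conn_set :: "nat \<Rightarrow> nat set \<Rightarrow> (nat \<Rightarrow> nat) set" where
  "conn_set s S = {f. pmatch (insert s S) f \<and> leaky S f}"

text \<open>A block is an interval with exactly one outgoing chord; single points and all of \<open>S\<close> are trivial
  blocks. For connected diagrams, \<open>no_block\<close> says that no nontrivial block meets \<open>T\<close>. With \<open>T = {}\<close> there is no restriction, with \<open>T = S\<close> the diagram is 2-connected.\<close>

definition no_block :: "nat set \<Rightarrow> nat set \<Rightarrow> (nat \<Rightarrow> nat) \<Rightarrow> bool" where
  "no_block S T f \<longleftrightarrow> (\<forall>J. convex_in S J \<longrightarrow> J \<noteq> S \<longrightarrow> J \<inter> T \<noteq> {} \<longrightarrow> (\<forall>x. J \<noteq> {x}) \<longrightarrow> two_out f J)"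

text \<open>\<open>card S \<noteq> 1\<close> discards the diagram with the root chord alone: it
  satisfies \<open>no_block\<close> trivially, but a 2-connected diagram has at least two
  chords.\<close>

definition block_free :: "nat \<Rightarrow> nat set \<Rightarrow> nat set \<Rightarrow> (nat \<Rightarrow> nat) set" where
  "block_free s S T = {f \<in> conn_set s S. card S \<noteq> 1 \<and> no_block S T f}"

lemma interval_conn_iff_leaky:
  assumes "\<forall>x\<in>S. s < x" "pmatch (insert s S) f"
  shows "interval_conn (insert s S) f \<longleftrightarrow> leaky S f"
proof
  assume i: "interval_conn (insert s S) f"
  show "leaky S f" unfolding leaky_def
  proof (intro allI impI)
    fix J assume J: "convex_in S J" "J \<noteq> {}"
    have "s \<notin> S" using assms(1) by auto
    have JS: "J \<subseteq> S" using J(1) by (rule convex_in_subset)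
    then have "J \<noteq> insert s S" using \<open>s \<notin> S\<close> by blast
    moreover have "convex_in (insert s S) J"
    proof (rule convex_inI)
      fix x z y assume *: "x \<in> J" "z \<in> J" "y \<in> insert s S" "x < y" "y < z"
      then have "s < x" using JS assms(1) by blast
      then have "y \<noteq> s" using *(4) by linarith
      then have "y \<in> S" using *(3) by blast
      then show "y \<in> J" using convex_in_mid[OF J(1) *(1,2) _ *(4,5)] by blast
    qed (use JS in blast)
    ultimately show "\<exists>x\<in>J. f x \<notin> J" using i J unfolding interval_conn_def by blast
  qed
next
  assume l: "leaky S f"
  note fD = pmatchD[OF assms(2)]
  have s: "s \<notin> S" using assms(1) by auto
  show "interval_conn (insert s S) f" unfolding interval_conn_def
  proof (intro allI impI)
    fix J assume J: "convex_in (insert s S) J" "J \<noteq> {}" "J \<noteq> insert s S"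
    show "\<exists>x\<in>J. f x \<notin> J"
    proof (cases "s \<in> J")
      case False
      then have "J \<subseteq> S" using convex_in_subset[OF J(1)] by blast
      moreover have "y \<in> J" if "x \<in> J" "z \<in> J" "y \<in> S" "x < y" "y < z" for x y z
        using convex_in_mid[OF J(1) that(1,2) insertI2[OF that(3)] that(4,5)] .
      ultimately have "convex_in S J" by (rule convex_inI)
      then show ?thesis using l J unfolding leaky_def by blast
    next
      case True
      have "convex_in S (S - J)"
      proof (rule convex_inI)
        fix x y z assume *: "x \<in> S - J" "z \<in> S - J" "y \<in> S" "x < y" "y < z"
        have "s < x" using * assms(1) by blast
        then have "y \<in> J \<Longrightarrow> x \<in> J" using convex_in_mid[OF J(1) True _ _ _ *(4)] *(1) by blast
        then show "y \<in> S - J" using *(1,3) by blast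
      qed (rule Diff_subset)
      moreover have "S - J \<noteq> {}" using J convex_in_subset[OF J(1)] True by blast
      ultimately obtain x where "x \<in> S - J" "f x \<notin> S - J" using l unfolding leaky_def by blast
      then have "f x \<in> J" "f (f x) \<notin> J" using True fD(1)[of x] fD(3)[of x] by (blast, simp)
      then show ?thesis by blast
    qed
  qed
qed

lemma finite_conn_set: "finite S \<Longrightarrow> finite (conn_set s S)"
  by (rule finite_subset[OF _ finite_pmatch[of "insert s S"]]) (auto simp: conn_set_def)

lemma finite_block_free: "finite S \<Longrightarrow> finite (block_free s S T)"
  by (rule finite_subset[OF _ finite_conn_set[of S s]]) (auto simp: block_free_def)

lemma remove_edge:
  assumes f: "pmatch S f" and x: "x \<in> S"
  defines "g \<equiv> \<lambda>z. if z = x \<or> z = f x then z else f z"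
  shows "pmatch (S - {x, f x}) g" "edges (S - {x, f x}) g = edges S f - {{x, f x}}"
proof -
  note fD = pmatchD[OF f]
  show "pmatch (S - {x, f x}) g"
  proof (rule pmatchI)
    fix z assume z: "z \<in> S - {x, f x}"
    have fz: "f z \<in> S - {x, f x}"
      using z fD(1)[of z] fD(6)[of z x] fD(3)[of z] by auto
    have gz: "g z = f z" "g (f z) = f (f z)" using z fz unfolding g_def by auto
    show "g z \<in> S - {x, f x}" "g z \<noteq> z" "g (g z) = z"
      using gz z fz fD(2)[of z] fD(3)[of z] by simp_all
  next
    fix z assume "z \<notin> S - {x, f x}"
    then show "g z = z" using fD(4)[of z] unfolding g_def by auto
  qed
  show "edges (S - {x, f x}) g = edges S f - {{x, f x}}"
  proof
    show "edges (S - {x, f x}) g \<subseteq> edges S f - {{x, f x}}"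
      unfolding edges_def g_def by (auto simp: doubleton_eq_iff)
    show "edges S f - {{x, f x}} \<subseteq> edges (S - {x, f x}) g"
    proof
      fix c assume "c \<in> edges S f - {{x, f x}}"
      then obtain z where z: "z \<in> S" "c = {z, f z}" "c \<noteq> {x, f x}" unfolding edges_def by auto
      then have "z \<noteq> x" "z \<noteq> f x" using fD(3)[of x] by auto
      then show "c \<in> edges (S - {x, f x}) g" using z unfolding edges_def g_def by auto
    qed
  qed
qed

text \<open>A nontrivial block, stripped of the endpoint of its outgoing chord, becomes a closed
  interval when that chord is deleted. Conversely, a closed interval of the diagram without one
  chord, filled up by the deleted endpoints between its points and complemented if it then contains
  s, is left by the deleted chord only and is thus a block.\<close>

lemma chords_2connected_iff:
  assumes S: "finite S" "\<forall>x\<in>S. s < x" "pmatch (insert s S) f"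
  shows "chords_2connected (edges (insert s S) f) \<longleftrightarrow> f \<in> block_free s S S"
proof -
  let ?S = "insert s S"
  note fD = pmatchD[OF S(3)]
  have sS: "s \<notin> S" using S(2) by auto
  have fin: "finite ?S" using S(1) by simp
  have con: "chords_connected (edges ?S f) \<longleftrightarrow> leaky S f"
    using chords_connected_iff[OF fin S(3)] interval_conn_iff_leaky[OF S(2,3)] by simp
  have card: "2 * card (edges ?S f) = card S + 1"
    using card_edges[OF fin S(3)] sS S(1) by simp
  define rem where "rem = (\<lambda>x z. if z = x \<or> z = f x then z else f z)"
  have con2: "chords_connected (edges ?S f - {{x, f x}}) \<longleftrightarrow>
      ?S - {x, f x} \<noteq> {} \<and> interval_conn (?S - {x, f x}) (rem x)" if "x \<in> ?S" for x
    using chords_connected_iff[of "?S - {x, f x}" "rem x"] remove_edge[OF S(3) that] fin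
    unfolding rem_def by simp
  have all: "(\<forall>c\<in>edges ?S f. chords_connected (edges ?S f - {c})) \<longleftrightarrow>
      (\<forall>x\<in>?S. ?S - {x, f x} \<noteq> {} \<and> interval_conn (?S - {x, f x}) (rem x))"
  proof -
    have "(\<forall>c\<in>edges ?S f. Q c) \<longleftrightarrow> (\<forall>x\<in>?S. Q {x, f x})" for Q
      unfolding edges_def by blast
    then have "(\<forall>c\<in>edges ?S f. chords_connected (edges ?S f - {c})) \<longleftrightarrow>
        (\<forall>x\<in>?S. chords_connected (edges ?S f - {{x, f x}}))" .
    also have "\<dots> \<longleftrightarrow> (\<forall>x\<in>?S. ?S - {x, f x} \<noteq> {} \<and> interval_conn (?S - {x, f x}) (rem x))"
      by (rule ball_cong[OF refl con2])
    finally show ?thesis .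
  qed
  show ?thesis
  proof
    assume A: "chords_2connected (edges ?S f)"
    then have l: "leaky S f" and c2: "card (edges ?S f) \<ge> 2"
      and ic: "\<And>x. x \<in> ?S \<Longrightarrow> interval_conn (?S - {x, f x}) (rem x)"
      using con all unfolding chords_2connected_def by auto
    have "no_block S S f" unfolding no_block_def
    proof (intro allI impI, rule ccontr)
      fix J assume J: "convex_in S J" "J \<noteq> S" "J \<inter> S \<noteq> {}" "\<forall>x. J \<noteq> {x}" and n: "\<not> two_out f J"
      have JS: "J \<subseteq> S" using convex_in_subset[OF J(1)] by auto
      obtain x where x: "x \<in> J" "f x \<notin> J" using l J unfolding leaky_def by blast
      have u: "y = x" if "y \<in> J" "f y \<notin> J" for y
        using n x that unfolding two_out_def by blast
      let ?S2 = "?S - {x, f x}" and ?J = "J - {x}"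
      have xS: "x \<in> ?S" using x JS by auto
      have "convex_in ?S2 ?J"
      proof (rule convex_inI)
        show "?J \<subseteq> ?S2" using JS x by blast
        fix u v w assume *: "u \<in> ?J" "w \<in> ?J" "v \<in> ?S2" "u < v" "v < w"
        have "s < u" using * JS S(2) by blast
        then have "v \<noteq> s" using *(4) by linarith
        then have "v \<in> S" using *(3) by blast
        then show "v \<in> ?J" using convex_in_mid[OF J(1), of u w v] * by blast
      qed
      moreover have "?J \<noteq> {}" using J(4) x by auto
      moreover have "?J \<noteq> ?S2"
      proof -
        obtain w where w: "w \<in> S" "w \<notin> J" using J(2) JS by auto
        then have "w \<noteq> s" "s \<notin> J" using sS JS by auto
        then have "w \<in> ?S2 - ?J \<or> s \<in> ?S2 - ?J" using w x by auto
        then show ?thesis by blast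
      qed
      ultimately obtain y where y: "y \<in> ?J" "rem x y \<notin> ?J" using ic[OF xS] unfolding interval_conn_def by blast
      then have "y \<in> J" "y \<noteq> x" "y \<noteq> f x" using x by auto
      then have "f y \<noteq> x" "f y \<notin> J" using y fD(3) unfolding rem_def by auto
      then show False using u \<open>y \<in> J\<close> \<open>y \<noteq> x\<close> by blast
    qed
    then show "f \<in> block_free s S S" using l S(3) card c2 unfolding block_free_def conn_set_def by auto
  next
    assume A: "f \<in> block_free s S S"
    then have l: "leaky S f" and p: "no_block S S f" and c1: "card S \<noteq> 1"
      unfolding block_free_def conn_set_def by auto
    have c2: "card (edges ?S f) \<ge> 2"
    proof -
      have "edges ?S f \<noteq> {}" unfolding edges_def by auto
      moreover have "finite (edges ?S f)" unfolding edges_def using fin by auto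
      ultimately have "card (edges ?S f) \<noteq> 0" by simp
      then show ?thesis using card c1 by linarith
    qed
    have "?S - {x, f x} \<noteq> {} \<and> interval_conn (?S - {x, f x}) (rem x)" if x: "x \<in> ?S" for x
    proof
      let ?S2 = "?S - {x, f x}"
      have "card ?S = 2 * card (edges ?S f)" using card sS S(1) by simp
      then have "card ?S > card {x, f x}" using c2 fD(2)[OF x] by simp
      then show ne: "?S2 \<noteq> {}" by (metis card_mono finite.emptyI finite_insert Diff_eq_empty_iff leD)
      show "interval_conn ?S2 (rem x)" unfolding interval_conn_def
      proof (intro allI impI, rule ccontr)
        fix J assume J: "convex_in ?S2 J" "J \<noteq> {}" "J \<noteq> ?S2" and n: "\<not> (\<exists>y\<in>J. rem x y \<notin> J)"
        have JS: "J \<subseteq> ?S2" using J(1) by (rule convex_in_subset)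
        have cl: "f y \<in> J" if "y \<in> J" for y
        proof -
          have "y \<in> ?S2" using that JS by blast
          then have "rem x y = f y" unfolding rem_def by simp
          then show ?thesis using n that by metis
        qed
        \<comment> \<open>The hull of J regains a deleted endpoint that lies between two points of
          J.\<close>
        define H where "H = {z \<in> ?S. \<exists>a\<in>J. \<exists>b\<in>J. a \<le> z \<and> z \<le> b}"
        have HJ: "H \<inter> ?S2 = J"
        proof (intro equalityI subsetI)
          fix z assume z: "z \<in> H \<inter> ?S2"
          then obtain a b where "a \<in> J" "b \<in> J" "a \<le> z" "z \<le> b" unfolding H_def by blast
          then show "z \<in> J" using convex_in_mid[OF J(1), of a b z] z by (cases "z = a \<or> z = b") auto
        qed (use JS in \<open>auto simp: H_def\<close>)
        \<comment> \<open>Blocks are sought among the intervals of S, which avoid the root; a set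
          and its complement are left by the same chords.\<close>
        define G where "G = (if s \<in> H then ?S - H else H)"
        have G2: "G \<inter> ?S2 = J \<or> G \<inter> ?S2 = ?S2 - J" using HJ unfolding G_def by auto
        have Gcl: "f y \<in> G" if "y \<in> G" "y \<noteq> x" "y \<noteq> f x" for y
        proof -
          have "y \<in> ?S" using that unfolding G_def H_def by (auto split: if_splits)
          then have y2: "y \<in> ?S2" using that by auto
          then have fy2: "f y \<in> ?S2" using fD(1)[of y] fD(3)[of x] fD(6)[of y x] fD(3)[of y] by auto
          have "f y \<in> J \<longleftrightarrow> y \<in> J" using cl fD(3) by metis
          then show ?thesis using G2 y2 fy2 that by blast
        qed
        have Gconv: "convex_in S G"
        proof (cases "s \<in> H")
          case False
          then have "G = H" "H \<subseteq> S" unfolding G_def H_def by auto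
          moreover have "convex_in S H"
          proof (rule convex_inI)
            fix u w v assume *: "u \<in> H" "w \<in> H" "v \<in> S" "u < v" "v < w"
            obtain a where a: "a \<in> J" "a \<le> u" using *(1) unfolding H_def by blast
            obtain b where b: "b \<in> J" "w \<le> b" using *(2) unfolding H_def by blast
            have "a \<le> v" "v \<le> b" using a b * by auto
            then show "v \<in> H" using a b *(3) unfolding H_def by blast
          qed (use \<open>H \<subseteq> S\<close> in blast)
          ultimately show ?thesis by simp
        next
          case True
          then obtain a where a: "a \<in> J" "a \<le> s" unfolding H_def by auto
          have GG: "G = ?S - H" "G \<subseteq> S" using True unfolding G_def by auto
          show ?thesis
          proof (rule convex_inI)
            show "G \<subseteq> S" by fact
            fix u w v assume uw: "u \<in> G" "w \<in> G" and v: "v \<in> S" "u < v" "v < w"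
            have us: "u \<in> ?S" "s < u" using uw GG S(2) by auto
            have "v \<notin> H"
            proof
              assume "v \<in> H"
              then obtain b where "b \<in> J" "v \<le> b" unfolding H_def by blast
              moreover have "a \<le> u" "u \<le> b" using a us v \<open>v \<le> b\<close> by auto
              ultimately have "u \<in> H" using a us(1) unfolding H_def by blast
              then show False using uw GG by auto
            qed
            then show "v \<in> G" using v GG by auto
          qed
        qed
        have Gne: "G \<inter> ?S2 \<noteq> {}" "\<not> ?S2 \<subseteq> G" using G2 J JS by auto
        then have "G \<noteq> {}" by auto
        then obtain y where y: "y \<in> G" "f y \<notin> G" using l Gconv unfolding leaky_def by blast
        then have yx: "y = x \<or> y = f x" using Gcl by blast
        have u: "z = y" if "z \<in> G" "f z \<notin> G" for z
          using Gcl that y yx fD(3) by metis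
        have "G \<noteq> S"
        proof
          assume "G = S"
          then have "f y = s" using y fD(1)[of y] by auto
          then have "?S2 \<subseteq> G" using \<open>G = S\<close> yx fD(3)[of x] by auto
          then show False using Gne by auto
        qed
        moreover have "G \<inter> S \<noteq> {}" using convex_in_subset[OF Gconv] y by blast
        moreover have "G \<noteq> {z}" for z
          using Gne(1) y yx fD(3)[of x] by auto
        ultimately have "two_out f G" using p Gconv unfolding no_block_def by blast
        then show False using u unfolding two_out_def by metis
      qed
    qed
    then show "chords_2connected (edges ?S f)"
      using con l c2 all unfolding chords_2connected_def by blast
  qed
qed

section \<open>Order-preserving relabelling of diagrams\<close>

lemma relabel_chords:
  assumes S: "finite S" "s \<notin> S" and s': "s' \<notin> S'"
    and \<phi>: "\<phi> ` S = S'" "\<phi> s = s'" "\<And>x y. x \<in> S \<Longrightarrow> y \<in> S \<Longrightarrow> x < y \<Longrightarrow> \<phi> x < \<phi> y"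
  obtains \<Phi> where "inj_on \<Phi> {f. pmatch (insert s S) f}" "\<And>f. f \<in> conn_set s S \<Longrightarrow> \<Phi> f \<in> conn_set s' S'"
    "\<And>f T. T \<subseteq> S \<Longrightarrow> f \<in> conn_set s S \<Longrightarrow> no_block S T f \<Longrightarrow> no_block S' (\<phi> ` T) (\<Phi> f)"
proof -
  let ?S = "insert s S" and ?S' = "insert s' S'"
  have lt: "\<phi> x < \<phi> y \<longleftrightarrow> x < y" if "x \<in> S" "y \<in> S" for x y
    using \<phi>(3)[OF that] \<phi>(3)[OF that(2,1)] by (cases x y rule: linorder_cases) auto
  have injS: "inj_on \<phi> S" using lt by (metis inj_onI less_irrefl not_less_iff_gr_or_eq)
  have inj: "inj_on \<phi> ?S" unfolding inj_on_insert
  proof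
    show "\<phi> s \<notin> \<phi> ` (S - {s})" using \<phi>(1,2) s' by blast
  qed (rule injS)
  have im: "\<phi> ` ?S = ?S'" using \<phi> by auto
  define \<psi> where "\<psi> = inv_into ?S \<phi>"
  have \<psi>: "\<psi> (\<phi> x) = x" if "x \<in> ?S" for x unfolding \<psi>_def using inj that by (rule inv_into_f_f)
  define \<Phi> where "\<Phi> = (\<lambda>f y. if y \<in> ?S' then \<phi> (f (\<psi> y)) else y)"
  have \<Phi>: "\<Phi> f (\<phi> x) = \<phi> (f x)" if "x \<in> ?S" for f x
    using that \<psi> im unfolding \<Phi>_def by auto
  have eq: "\<phi> x = \<phi> y \<longleftrightarrow> x = y" if "x \<in> ?S" "y \<in> ?S" for x y
    using inj that by (auto simp: inj_on_def)
  have inj\<Phi>: "inj_on \<Phi> {f. pmatch ?S f}"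
  proof (rule inj_onI, rule ext)
    fix f g x assume fg: "f \<in> {f. pmatch ?S f}" "g \<in> {f. pmatch ?S f}" "\<Phi> f = \<Phi> g"
    then have "pmatch ?S f" "pmatch ?S g" by auto
    note fD = pmatchD[OF this(1)] and gD = pmatchD[OF this(2)]
    show "f x = g x"
    proof (cases "x \<in> ?S")
      case True
      then have "\<phi> (f x) = \<phi> (g x)" using \<Phi>[OF True] fg(3) by metis
      then show ?thesis using eq[OF fD(1)[OF True] gD(1)[OF True]] by simp
    qed (use fD(4) gD(4) in auto)
  qed
  have pm: "pmatch ?S' (\<Phi> f)" if "pmatch ?S f" for f
  proof -
    note fD = pmatchD[OF that]
    show ?thesis
    proof (rule pmatchI)
      fix y assume "y \<in> ?S'"
      then obtain x where x: "x \<in> ?S" "y = \<phi> x" using im by auto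
      note fx = fD(1)[OF x(1)]
      show "\<Phi> f y \<in> ?S'" "\<Phi> f y \<noteq> y" "\<Phi> f (\<Phi> f y) = y"
        using \<Phi>[OF x(1)] \<Phi>[OF fx] fx x fD(2)[OF x(1)] fD(3)[of x] eq[OF fx x(1)] im by auto
    qed (simp add: \<Phi>_def)
  qed
  have pull: "\<exists>J. convex_in S J \<and> J' = \<phi> ` J" if "convex_in S' J'" for J'
  proof (intro exI conjI)
    let ?J = "{x \<in> S. \<phi> x \<in> J'}"
    have J': "J' \<subseteq> S'" using that by (rule convex_in_subset)
    then show "J' = \<phi> ` ?J" using \<phi>(1) by auto
    show "convex_in S ?J"
    proof (rule convex_inI)
      fix x y z assume *: "x \<in> ?J" "z \<in> ?J" "y \<in> S" "x < y" "y < z"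
      then have xz: "x \<in> S" "z \<in> S" "\<phi> x \<in> J'" "\<phi> z \<in> J'" by blast+
      have "\<phi> y \<in> S'" using \<phi>(1) *(3) by blast
      then have "\<phi> y \<in> J'"
        using convex_in_mid[OF that xz(3,4) _ \<phi>(3)[OF xz(1) *(3,4)] \<phi>(3)[OF *(3) xz(2) *(5)]] by blast
      then show "y \<in> ?J" using * by blast
    qed blast
  qed
  have leave: "\<Phi> f (\<phi> x) \<notin> \<phi> ` J \<longleftrightarrow> f x \<notin> J" if "pmatch ?S f" "J \<subseteq> S" "x \<in> ?S" for f x J
  proof -
    have "J \<subseteq> ?S" using that(2) by blast
    then have "\<phi> (f x) \<in> \<phi> ` J \<longleftrightarrow> f x \<in> J"
      using inj_on_image_mem_iff[OF inj pmatchD(1)[OF that(1,3)]] by simp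
    then show ?thesis using \<Phi>[OF that(3)] by simp
  qed
  have cs: "\<Phi> f \<in> conn_set s' S'" if f: "f \<in> conn_set s S" for f
  proof -
    have p: "pmatch ?S f" and l: "leaky S f" using f unfolding conn_set_def by auto
    have "leaky S' (\<Phi> f)" unfolding leaky_def
    proof (intro allI impI)
      fix J' assume J': "convex_in S' J'" "J' \<noteq> {}"
      obtain J where J: "convex_in S J" "J' = \<phi> ` J" using pull J' by blast
      then obtain x where x: "x \<in> J" "f x \<notin> J" using l J' unfolding leaky_def by blast
      have "J \<subseteq> S" using convex_in_subset[OF J(1)] by auto
      then show "\<exists>x\<in>J'. \<Phi> f x \<notin> J'" using leave[OF p, of J x] x J by auto
    qed
    then show ?thesis using pm[OF p] unfolding conn_set_def by simp
  qed
  have pr: "no_block S' (\<phi> ` T) (\<Phi> f)" if T: "T \<subseteq> S" and f: "f \<in> conn_set s S" "no_block S T f" for f T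
    unfolding no_block_def
  proof (intro allI impI)
    fix J' assume J': "convex_in S' J'" "J' \<noteq> S'" "J' \<inter> \<phi> ` T \<noteq> {}" "\<forall>x. J' \<noteq> {x}"
    have p: "pmatch ?S f" using f unfolding conn_set_def by auto
    obtain J where J: "convex_in S J" "J' = \<phi> ` J" using pull J' by blast
    have JS: "J \<subseteq> S" using convex_in_subset[OF J(1)] by auto
    have "J \<inter> T \<noteq> {}"
    proof -
      obtain j t where "j \<in> J" "t \<in> T" "\<phi> j = \<phi> t" using J'(3) J(2) by auto
      moreover then have "j = t" using eq JS T by blast
      ultimately show ?thesis by auto
    qed
    moreover have "J \<noteq> S" using J' J \<phi> by auto
    moreover have "\<forall>x. J \<noteq> {x}" using J' J by auto
    ultimately obtain x y where xy: "x \<in> J" "y \<in> J" "x \<noteq> y" "f x \<notin> J" "f y \<notin> J"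
      using f(2) J(1) unfolding no_block_def two_out_def by blast
    have xyS: "x \<in> ?S" "y \<in> ?S" using xy JS by auto
    show "two_out (\<Phi> f) J'" unfolding two_out_def J(2)
      using xy leave[OF p JS xyS(1)] leave[OF p JS xyS(2)] eq[OF xyS] by blast
  qed
  show thesis using that[OF inj\<Phi> cs pr] .
qed

lemma down_closed_image_lessThan:
  fixes A :: "nat set"
  assumes "finite A" "\<And>i j. i \<in> A \<Longrightarrow> j < i \<Longrightarrow> j \<in> A"
  shows "A = {..<card A}"
proof (cases "A = {}")
  case False
  have "A = {..Max A}"
  proof
    show "A \<subseteq> {..Max A}" using assms(1) by auto
    show "{..Max A} \<subseteq> A"
    proof
      fix i assume "i \<in> {..Max A}"
      then show "i \<in> A" using Max_in[OF assms(1) False] assms(2) by (cases "i = Max A") auto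
    qed
  qed
  then have "card A = Suc (Max A)" by (metis card_atMost)
  then show ?thesis using \<open>A = {..Max A}\<close> lessThan_Suc_atMost by metis
qed simp

definition conn_num :: "nat \<Rightarrow> nat" where "conn_num N = card (conn_set 0 {1..N})"
definition block_free_num :: "nat \<Rightarrow> nat \<Rightarrow> nat" where "block_free_num N t = card (block_free 0 {1..N} {1..t})"

text \<open>The increasing enumeration of S, with the root sent to 0, identifies S with {1..N} and
  an initial segment T of S with {1..card T}; intervals correspond, so the counts depend on
  cardinalities only. Each inequality comes from one of two injections, obtained from the
  enumeration and from its inverse, so the two need not be shown to be inverse to each
  other.\<close>

lemma
  assumes S: "finite S" "s \<notin> S" 
  shows card_conn_set: "card (conn_set s S) = conn_num (card S)"
    and card_block_free: "\<And>T. T \<subseteq> S \<Longrightarrow> (\<And>x y. x \<in> T \<Longrightarrow> y \<in> S \<Longrightarrow> y < x \<Longrightarrow> y \<in> T) \<Longrightarrow>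
      card (block_free s S T) = block_free_num (card S) (card T)"
proof -
  define N where "N = card S"
  let ?R = "{1..N}"
  obtain h where h: "bij_betw h {..<N} S" "strict_mono_on {..<N} h"
    using ex_bij_betw_strict_mono_card[OF S(1)] unfolding N_def by blast
  define \<phi> where "\<phi> = (\<lambda>x. if x = 0 then s else h (x - 1))"
  define \<psi> where "\<psi> = (\<lambda>y. if y = s then 0 else the_inv_into {..<N} h y + 1)"
  have hinj: "inj_on h {..<N}" and him: "h ` {..<N} = S" using h by (auto simp: bij_betw_def)
  have hlt: "h i < h j \<longleftrightarrow> i < j" if "i < N" "j < N" for i j
    using strict_mono_onD[OF h(2), of i j] strict_mono_onD[OF h(2), of j i] that
    by (cases i j rule: linorder_cases) auto
  have sub1: "(\<lambda>x. x - 1) ` {1..M} = {..<M}" for M :: nat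
    by (force simp: image_iff intro: bexI[of _ "Suc _"])
  have \<phi>im: "\<phi> ` {1..M} = h ` {..<M}" for M
  proof -
    have "\<phi> ` {1..M} = h ` ((\<lambda>x. x - 1) ` {1..M})" unfolding image_image \<phi>_def by (intro image_cong) auto
    then show ?thesis unfolding sub1 .
  qed
  have \<psi>h: "\<psi> (h i) = i + 1" if "i < N" for i
    using that hinj him S(2) unfolding \<psi>_def by (auto simp: the_inv_into_f_f)
  have \<psi>im: "\<psi> ` h ` {..<M} = {1..M}" if "M \<le> N" for M
  proof -
    have "\<psi> ` h ` {..<M} = (\<lambda>i. i + 1) ` {..<M}" unfolding image_image
      using that by (intro image_cong) (auto simp: \<psi>h)
    then show ?thesis by (simp add: image_Suc_lessThan)
  qed
  have a1: "\<phi> ` ?R = S" "\<phi> 0 = s" "0 \<notin> ?R" using \<phi>im him by (auto simp: \<phi>_def)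
  have a2: "\<phi> x < \<phi> y" if "x \<in> ?R" "y \<in> ?R" "x < y" for x y
    using that hlt[of "x - 1" "y - 1"] unfolding \<phi>_def by auto
  have b1: "\<psi> ` S = ?R" "\<psi> s = 0" using \<psi>im[of N] him by (auto simp: \<psi>_def)
  have b2: "\<psi> x < \<psi> y" if "x \<in> S" "y \<in> S" "x < y" for x y
  proof -
    obtain i j where "x = h i" "y = h j" "i < N" "j < N" using \<open>x \<in> S\<close> \<open>y \<in> S\<close> him by auto
    then show ?thesis using that hlt \<psi>h by simp
  qed
  obtain \<Phi> where \<Phi>: "inj_on \<Phi> {f. pmatch (insert 0 ?R) f}" "\<And>f. f \<in> conn_set 0 ?R \<Longrightarrow> \<Phi> f \<in> conn_set s S"
    "\<And>f T. T \<subseteq> ?R \<Longrightarrow> f \<in> conn_set 0 ?R \<Longrightarrow> no_block ?R T f \<Longrightarrow> no_block S (\<phi> ` T) (\<Phi> f)"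
    using relabel_chords[of ?R 0 s S \<phi>] a1 a2 S by auto
  obtain \<Psi> where \<Psi>: "inj_on \<Psi> {f. pmatch (insert s S) f}" "\<And>f. f \<in> conn_set s S \<Longrightarrow> \<Psi> f \<in> conn_set 0 ?R"
    "\<And>f T. T \<subseteq> S \<Longrightarrow> f \<in> conn_set s S \<Longrightarrow> no_block S T f \<Longrightarrow> no_block ?R (\<psi> ` T) (\<Psi> f)"
    using relabel_chords[of S s 0 ?R \<psi>] b1 b2 S a1 by auto
  have sub: "conn_set s S \<subseteq> {f. pmatch (insert s S) f}" for s S unfolding conn_set_def by auto
  have suba: "block_free s S T \<subseteq> {f. pmatch (insert s S) f}" for s S T unfolding block_free_def conn_set_def by auto
  have "card (conn_set s S) \<le> card (conn_set 0 ?R)"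
    by (rule card_inj_on_le[of \<Psi>]) (use \<Psi> inj_on_subset[OF \<Psi>(1) sub] finite_conn_set in auto)
  moreover have "card (conn_set 0 ?R) \<le> card (conn_set s S)"
    by (rule card_inj_on_le[of \<Phi>]) (use \<Phi> inj_on_subset[OF \<Phi>(1) sub] finite_conn_set S in auto)
  ultimately show "card (conn_set s S) = conn_num (card S)" unfolding conn_num_def N_def by simp
  fix T assume T: "T \<subseteq> S" "\<And>x y. x \<in> T \<Longrightarrow> y \<in> S \<Longrightarrow> y < x \<Longrightarrow> y \<in> T"
  define A where "A = {i. i < N \<and> h i \<in> T}"
  have hA: "h ` A = T" using T(1) him unfolding A_def by auto
  have "A = {..<card A}"
    by (rule down_closed_image_lessThan) (use T him hlt in \<open>auto simp: A_def\<close>)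
  moreover have "card A = card T"
    using hA hinj by (metis (no_types, lifting) A_def card_image inj_on_subset lessThan_iff mem_Collect_eq subsetI)
  ultimately have At: "A = {..<card T}" by simp
  let ?T = "{1..card T}"
  have Tle: "card T \<le> N" unfolding N_def using T(1) S(1) by (rule card_mono[rotated])
  have T1: "\<phi> ` ?T = T" using \<phi>im At hA by simp
  have T2: "\<psi> ` T = ?T" using \<psi>im[OF Tle] At hA by simp
  have "card (block_free s S T) \<le> card (block_free 0 ?R ?T)"
  proof (rule card_inj_on_le[of \<Psi>])
    show "\<Psi> ` block_free s S T \<subseteq> block_free 0 ?R ?T"
      using \<Psi>(2) \<Psi>(3)[OF T(1)] T2 unfolding block_free_def N_def by auto
  qed (use inj_on_subset[OF \<Psi>(1) suba] finite_block_free in auto)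
  moreover have "card (block_free 0 ?R ?T) \<le> card (block_free s S T)"
  proof (rule card_inj_on_le[of \<Phi>])
    show "\<Phi> ` block_free 0 ?R ?T \<subseteq> block_free s S T"
      using \<Phi>(2) \<Phi>(3)[of ?T] T1 Tle unfolding block_free_def N_def by auto
  qed (use inj_on_subset[OF \<Phi>(1) suba] finite_block_free S in auto)
  ultimately show "card (block_free s S T) = block_free_num (card S) (card T)" unfolding block_free_num_def N_def by simp
qed

section \<open>The Stein recurrence\<close>

text \<open>An interval avoiding both extremes of S is surrounded by the rest of S on both sides, as
  a nested component must be.\<close>

definition gaps :: "nat set \<Rightarrow> nat set set" where
  "gaps S = {I. convex_in S I \<and> I \<noteq> {} \<and> Min S \<notin> I \<and> Max S \<notin> I}"

lemma ex_max_card: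
  assumes "finite F" "F \<noteq> {}"
  shows "\<exists>I\<in>F. \<forall>J\<in>F. card J \<le> card I"
proof -
  obtain I where "I \<in> F" "card I = Max (card ` F)"
    using Max_in[of "card ` F"] assms by fastforce
  then show ?thesis using assms Max_ge[of "card ` F"] by force
qed

definition restr :: "'a set \<Rightarrow> ('a \<Rightarrow> 'a) \<Rightarrow> 'a \<Rightarrow> 'a" where
  "restr A f = (\<lambda>x. if x \<in> A then f x else x)"

lemma pmatch_restr:
  assumes "pmatch S f" "A \<subseteq> S" "\<And>x. x \<in> A \<Longrightarrow> f x \<in> A"
  shows "pmatch A (restr A f)"
proof (rule pmatchI)
  fix x assume x: "x \<in> A"
  then have "x \<in> S" using assms(2) by blast
  then show "restr A f x \<in> A" "restr A f x \<noteq> x" "restr A f (restr A f x) = x"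
    using x assms(3)[OF x] pmatchD(2,3)[OF assms(1)] unfolding restr_def by auto
qed (simp add: restr_def)

text \<open>A component without the outer root is rooted at its own minimum, so it is counted by
  \<open>conn_num\<close> as well.\<close>

lemma conn_set_Min_iff:
  assumes "finite S" "S \<noteq> {}" "pmatch S f"
  shows "f \<in> conn_set (Min S) (S - {Min S}) \<longleftrightarrow> interval_conn S f"
proof -
  have S: "insert (Min S) (S - {Min S}) = S" using Min_in[OF assms(1,2)] by blast
  have "\<forall>x\<in>S - {Min S}. Min S < x"
  proof
    fix x assume "x \<in> S - {Min S}"
    then show "Min S < x" using Min_le[OF assms(1), of x] by simp
  qed
  then show ?thesis using interval_conn_iff_leaky[of "S - {Min S}" "Min S" f] assms(3) S unfolding conn_set_def by simp
qed

lemma gap_inside: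
  assumes I: "I \<in> gaps S" and S: "finite S" and J: "convex_in S J" "S - I \<subseteq> J"
  shows "J = S"
proof -
  have Iconv: "convex_in S I" and mM: "Min S \<notin> I" "Max S \<notin> I" and ne: "I \<noteq> {}"
    using I unfolding gaps_def by auto
  have "S \<noteq> {}" using convex_in_subset[OF Iconv] ne by blast
  then have m: "Min S \<in> S" "Max S \<in> S" using S by auto
  then have mJ: "Min S \<in> J" "Max S \<in> J" using mM J(2) by auto
  have "x \<in> J" if x: "x \<in> S" for x
  proof (cases "x \<in> I")
    case True
    then have "Min S < x" "x < Max S"
      using mM Min_le[OF S x] Max_ge[OF S x] by (metis le_neq_implies_less)+
    then show ?thesis using convex_in_mid[OF J(1) mJ x] by blast
  qed (use x J in auto)
  then show ?thesis using convex_in_subset[OF J(1)] by blast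
qed

lemma convex_in_restrict: "convex_in S J \<Longrightarrow> J \<subseteq> R \<Longrightarrow> R \<subseteq> S \<Longrightarrow> convex_in R J"
  by (rule convex_inI) (auto intro: convex_in_mid)

lemma convex_in_trans:
  assumes "convex_in S I" "convex_in I J"
  shows "convex_in S J"
proof (rule convex_inI)
  show "J \<subseteq> S" using assms convex_in_subset by blast
  fix x y z assume *: "x \<in> J" "z \<in> J" "y \<in> S" "x < y" "y < z"
  then have "x \<in> I" "z \<in> I" using convex_in_subset[OF assms(2)] by auto
  then have "y \<in> I" using convex_in_mid[OF assms(1)] * by blast
  then show "y \<in> J" using convex_in_mid[OF assms(2) *(1,2) _ *(4,5)] by blast
qed

lemma convex_in_Diff_restrict: "convex_in S J \<Longrightarrow> convex_in (S - I) (J - I)"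
  by (rule convex_inI) (auto dest: convex_in_subset intro: convex_in_mid)

text \<open>Deleting the root chord of a connected diagram leaves components nested around the other
  end of that chord. The outermost one is \<open>K\<close>; the gap of \<open>K\<close> containing that end holds
  everything else, that is, another connected diagram once the root is put back.\<close>

definition outer_split :: "nat \<Rightarrow> nat set \<Rightarrow> (nat \<Rightarrow> nat) \<Rightarrow> nat set \<Rightarrow> bool" where
  "outer_split s S f I \<longleftrightarrow> I \<in> gaps S \<and> (\<forall>x\<in>insert s I. f x \<in> insert s I)
     \<and> restr (insert s I) f \<in> conn_set s I
     \<and> restr (S - I) f \<in> conn_set (Min S) (S - I - {Min S})"

lemma Min_gap:
  assumes "I \<in> gaps S" "finite S"
  shows "Min (S - I) = Min S" "Min S \<in> S - I" "finite (S - I)" "S - I \<noteq> {}"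
proof -
  have "S \<noteq> {}" using assms(1) convex_in_subset unfolding gaps_def by blast
  then show 1: "Min S \<in> S - I" using assms unfolding gaps_def by auto
  show "Min (S - I) = Min S"
    by (rule Min_eqI) (use 1 assms Min_le in auto)
  show "finite (S - I)" "S - I \<noteq> {}" using assms 1 by auto
qed

text \<open>I is a largest proper interval that contains the partner of the root and is left by the
  root chord only. If I contained an extreme of S, then S - I would be a closed interval. The rest S
  - I is connected: a closed proper interval J of it is not closed as an interval of S, hence it
  encloses I, and then J \<union> I would be a larger candidate.\<close>

lemma outer_split_exists:
  assumes S: "finite S" "s \<notin> S" "card S \<noteq> 1" and f: "f \<in> conn_set s S"
  shows "\<exists>I. outer_split s S f I"
proof -
  have p: "pmatch (insert s S) f" and l: "leaky S f" using f unfolding conn_set_def by auto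
  note fD = pmatchD[OF p]
  define q where "q = f s"
  have qs: "q \<in> S" using fD(1,2)[of s] unfolding q_def by auto
  have fq: "f q = s" unfolding q_def using fD(3) .
  define \<J> where "\<J> = {J. convex_in S J \<and> q \<in> J \<and> J \<noteq> S \<and> (\<forall>x\<in>J. x \<noteq> q \<longrightarrow> f x \<in> J)}"
  have fin: "finite \<J>"
    by (rule finite_subset[of _ "Pow S"]) (use S convex_in_subset in \<open>auto simp: \<J>_def\<close>)
  have "{q} \<in> \<J>"
  proof -
    have "convex_in S {q}" by (rule convex_inI) (use qs in auto)
    moreover have "{q} \<noteq> S" using S(3) by auto
    ultimately show ?thesis unfolding \<J>_def by simp
  qed
  then have "\<J> \<noteq> {}" by blast
  then obtain I where I: "I \<in> \<J>" and maxI: "\<And>J. J \<in> \<J> \<Longrightarrow> card J \<le> card I"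
    using ex_max_card[OF fin] by blast
  have Ic: "convex_in S I" and qI: "q \<in> I" and IS: "I \<noteq> S" and Icl: "\<And>x. x \<in> I \<Longrightarrow> x \<noteq> q \<Longrightarrow> f x \<in> I"
    using I unfolding \<J>_def by auto
  have Isub: "I \<subseteq> S" using Ic by (rule convex_in_subset)
  have pres: "f x \<in> insert s I" if "x \<in> insert s I" for x
    using that Icl fq q_def qI by (cases "x = q") auto
  have pres': "f x \<in> S - I" if "x \<in> S - I" for x
  proof -
    have "x \<noteq> s" "x \<notin> I" using that S(2) by auto
    then have "f x \<notin> insert s I" using pres[of "f x"] fD(3)[of x] by auto
    then show ?thesis using fD(1)[of x] that by blast
  qed
  have nc: "\<not> convex_in S (S - I)"
  proof
    assume "convex_in S (S - I)"
    then have "\<exists>x\<in>S - I. f x \<notin> S - I" using l Isub IS unfolding leaky_def by blast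
    then show False using pres' by blast
  qed
  have mI: "Min S \<notin> I"
  proof
    assume m: "Min S \<in> I"
    have "convex_in S (S - I)"
    proof (rule convex_inI)
      fix x y z assume *: "x \<in> S - I" "z \<in> S - I" "y \<in> S" "x < y" "y < z"
      have "Min S < x" using Min_le[OF S(1), of x] m *(1) by (metis Diff_iff le_neq_implies_less)
      then show "y \<in> S - I" using convex_in_mid[OF Ic m, of y x] * by blast
    qed blast
    then show False using nc by blast
  qed
  have MI: "Max S \<notin> I"
  proof
    assume m: "Max S \<in> I"
    have "convex_in S (S - I)"
    proof (rule convex_inI)
      fix x y z assume *: "x \<in> S - I" "z \<in> S - I" "y \<in> S" "x < y" "y < z"
      have "z < Max S" using Max_ge[OF S(1), of z] m *(2) by (metis Diff_iff le_neq_implies_less)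
      then show "y \<in> S - I" using convex_in_mid[OF Ic _ m, of y z] * by blast
    qed blast
    then show False using nc by blast
  qed
  have gap: "I \<in> gaps S" unfolding gaps_def using Ic qI mI MI by auto
  note M = Min_gap[OF gap S(1)]
  have T: "restr (insert s I) f \<in> conn_set s I"
  proof -
    have "leaky I (restr (insert s I) f)" unfolding leaky_def
    proof (intro allI impI)
      fix J assume J: "convex_in I J" "J \<noteq> {}"
      then obtain x where x: "x \<in> J" "f x \<notin> J" using l convex_in_trans[OF Ic J(1)] unfolding leaky_def by blast
      then have "restr (insert s I) f x = f x" using convex_in_subset[OF J(1)] unfolding restr_def by auto
      then show "\<exists>x\<in>J. restr (insert s I) f x \<notin> J" using x by metis
    qed
    moreover have "pmatch (insert s I) (restr (insert s I) f)"
      by (rule pmatch_restr[OF p]) (use Isub pres in auto)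
    ultimately show ?thesis unfolding conn_set_def by simp
  qed
  have pK: "pmatch (S - I) (restr (S - I) f)"
    by (rule pmatch_restr[OF p]) (use pres' in auto)
  have "interval_conn (S - I) (restr (S - I) f)" unfolding interval_conn_def
  proof (intro allI impI, rule ccontr)
    fix J assume J: "convex_in (S - I) J" "J \<noteq> {}" "J \<noteq> S - I" and n: "\<not> (\<exists>x\<in>J. restr (S - I) f x \<notin> J)"
    have JS: "J \<subseteq> S - I" using J(1) by (rule convex_in_subset)
    have cl: "f x \<in> J" if "x \<in> J" for x
    proof -
      have "restr (S - I) f x = f x" using that JS unfolding restr_def by auto
      then show ?thesis using n that by metis
    qed
    have "\<not> convex_in S J" using l J(2) cl unfolding leaky_def by blast
    then obtain x y z where xyz: "x \<in> J" "z \<in> J" "y \<in> S" "y \<notin> J" "x < y" "y < z"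
      using convex_inI[of J S] JS by blast
    then have yI: "y \<in> I" using convex_in_mid[OF J(1), of x z y] by blast
    have lo: "x < i" if "i \<in> I" for i
    proof (rule ccontr)
      assume "\<not> x < i"
      then have "i < x" using that xyz JS by (metis DiffD2 linorder_neqE_nat subsetD)
      then have "x \<in> I" using convex_in_mid[OF Ic that yI _ _ xyz(5)] xyz(1) JS by blast
      then show False using xyz JS by blast
    qed
    have hi: "i < z" if "i \<in> I" for i
    proof (rule ccontr)
      assume "\<not> i < z"
      then have "z < i" using that xyz JS by (metis DiffD2 linorder_neqE_nat subsetD)
      then have "z \<in> I" using convex_in_mid[OF Ic yI that _ xyz(6)] xyz(2) JS by blast
      then show False using xyz JS by blast
    qed
    \<comment> \<open>J has points on both sides of I, so I fills the hole that J has in S.\<close>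
    have "convex_in S (J \<union> I)"
    proof (rule convex_inI)
      show "J \<union> I \<subseteq> S" using JS Isub by blast
      fix u v w assume *: "u \<in> J \<union> I" "w \<in> J \<union> I" "v \<in> S" "u < v" "v < w"
      show "v \<in> J \<union> I"
      proof (cases "v \<in> I")
        case False
        then have vS: "v \<in> S - I" using * by blast
        have "\<exists>u'\<in>J. u' < v"
        proof (cases "u \<in> J")
          case False
          then have "x < v" using lo[of u] * by auto
          then show ?thesis using xyz(1) by blast
        qed (use * in blast)
        moreover have "\<exists>w'\<in>J. v < w'"
        proof (cases "w \<in> J")
          case False
          then have "v < z" using hi[of w] * by auto
          then show ?thesis using xyz(2) by blast
        qed (use * in blast)
        ultimately show ?thesis using convex_in_mid[OF J(1) _ _ vS] by blast
      qed blast
    qed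
    moreover have "J \<union> I \<noteq> S" using J(3) JS by blast
    ultimately have "J \<union> I \<in> \<J>" unfolding \<J>_def using qI cl Icl by auto
    then have "card (J \<union> I) \<le> card I" by (rule maxI)
    moreover have "I \<subset> J \<union> I" using J(2) JS by blast
    moreover have "finite (J \<union> I)" using finite_subset[OF _ S(1)] JS Isub by blast
    ultimately show False using psubset_card_mono[of "J \<union> I" I] by linarith
  qed
  then have "restr (S - I) f \<in> conn_set (Min S) (S - I - {Min S})"
    using conn_set_Min_iff[OF M(3,4) pK] M(1) by simp
  then show ?thesis using gap pres T unfolding outer_split_def by blast
qed

text \<open>I' - I is an interval of S - I left by no chord. As the diagram on S - I is connected,
  it is empty or all of S - I; the latter is impossible because the gap I' misses
  \<open>Min S\<close>.\<close>

lemma outer_split_subset: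
  assumes S: "finite S" "s \<notin> S" and f: "pmatch (insert s S) f"
    and I: "outer_split s S f I" and I': "outer_split s S f I'"
  shows "I' \<subseteq> I"
proof (rule ccontr)
  assume n: "\<not> I' \<subseteq> I"
  note fD = pmatchD[OF f]
  have gI: "I \<in> gaps S" and pI: "\<And>x. x \<in> insert s I \<Longrightarrow> f x \<in> insert s I"
    and K: "restr (S - I) f \<in> conn_set (Min S) (S - I - {Min S})"
    using I unfolding outer_split_def by auto
  have gI': "I' \<in> gaps S" and pI': "\<And>x. x \<in> insert s I' \<Longrightarrow> f x \<in> insert s I'"
    using I' unfolding outer_split_def by auto
  note M = Min_gap[OF gI S(1)]
  have sub: "I' \<subseteq> S" using gI' convex_in_subset unfolding gaps_def by blast
  have pK: "pmatch (S - I) (restr (S - I) f)"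
    using K M(1,2) unfolding conn_set_def by (simp add: insert_absorb)
  have ic: "interval_conn (S - I) (restr (S - I) f)"
    using K conn_set_Min_iff[OF M(3,4) pK] M(1) by simp
  have "convex_in (S - I) (I' - I)"
    by (rule convex_in_Diff_restrict) (use gI' in \<open>simp add: gaps_def\<close>)
  moreover have "restr (S - I) f x \<in> I' - I" if x: "x \<in> I' - I" for x
  proof -
    have xS: "x \<in> S" "x \<noteq> s" using x sub S(2) by auto
    have "f x \<notin> insert s I" using pI[of "f x"] fD(3)[of x] x xS by auto
    moreover have "f x \<in> insert s I'" using pI' x by blast
    ultimately show ?thesis using x xS unfolding restr_def by auto
  qed
  ultimately have "I' - I = S - I" using ic n unfolding interval_conn_def by blast
  then have "Min S \<in> I'" using M(2) by blast
  then show False using gI' unfolding gaps_def by blast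
qed

text \<open>A closed interval J of S meets S - I in nothing or in all of it, because the diagram
  there is connected. In the first case J lies in I, where T is leaky; in the second J is all of S
  and contains the partner of the root.\<close>

lemma outer_split_glue:
  assumes S: "finite S" "s \<notin> S" and I: "I \<in> gaps S"
    and T: "T \<in> conn_set s I" and K: "K \<in> conn_set (Min S) (S - I - {Min S})"
  defines "f \<equiv> \<lambda>x. if x \<in> insert s I then T x else K x"
  shows "f \<in> conn_set s S" "outer_split s S f I" "restr (insert s I) f = T" "restr (S - I) f = K"
proof -
  note M = Min_gap[OF I S(1)]
  have Ic: "convex_in S I" using I unfolding gaps_def by blast
  have Isub: "I \<subseteq> S" using Ic by (rule convex_in_subset)
  have pT: "pmatch (insert s I) T" and lT: "leaky I T" using T unfolding conn_set_def by auto
  have pK: "pmatch (S - I) K" using K M(1,2) unfolding conn_set_def by (simp add: insert_absorb)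
  have iK: "interval_conn (S - I) K" using K conn_set_Min_iff[OF M(3,4) pK] M(1) by simp
  note TD = pmatchD[OF pT] and KD = pmatchD[OF pK]
  have fI: "f x = T x" "f x \<in> insert s I" if "x \<in> insert s I" for x
    using that TD(1)[of x] unfolding f_def by auto
  have fK: "f x = K x" "f x \<in> S - I" if "x \<in> S - I" for x
  proof -
    have "x \<notin> insert s I" using that S(2) by auto
    then show "f x = K x" unfolding f_def by simp
    then show "f x \<in> S - I" using KD(1)[OF that] by simp
  qed
  have p: "pmatch (insert s S) f"
  proof (rule pmatchI)
    fix x assume "x \<in> insert s S"
    then consider "x \<in> insert s I" | "x \<in> S - I" by blast
    then have "f x \<in> insert s S \<and> f x \<noteq> x \<and> f (f x) = x"
    proof cases
      case 1
      note fx = fI[OF 1]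
      have "f x \<in> insert s S" using fx Isub by blast
      moreover have "f x \<noteq> x" using fx TD(2)[OF 1] by simp
      moreover have "f (f x) = x" using fI(1)[OF fx(2)] fx TD(3)[of x] by simp
      ultimately show ?thesis by blast
    next
      case 2
      note fx = fK[OF 2]
      have "f x \<in> insert s S" using fx by blast
      moreover have "f x \<noteq> x" using fx KD(2)[OF 2] by simp
      moreover have "f (f x) = x" using fK(1)[OF fx(2)] fx KD(3)[of x] by simp
      ultimately show ?thesis by blast
    qed
    then show "f x \<in> insert s S" "f x \<noteq> x" "f (f x) = x" by blast+
  next
    fix x assume "x \<notin> insert s S"
    then have "x \<notin> insert s I" "x \<notin> S - I" using Isub by auto
    then show "f x = x" using KD(4)[of x] unfolding f_def by simp
  qed
  have "leaky S f" unfolding leaky_def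
  proof (intro allI impI, rule ccontr)
    fix J assume J: "convex_in S J" "J \<noteq> {}" and n: "\<not> (\<exists>x\<in>J. f x \<notin> J)"
    have cl: "f x \<in> J" if "x \<in> J" for x using n that by blast
    have JS: "J \<subseteq> S" using J(1) by (rule convex_in_subset)
    have c: "K x \<in> J - I" if "x \<in> J - I" for x
    proof -
      have "x \<in> S - I" using that JS by blast
      then show ?thesis using fK[of x] cl[of x] that by auto
    qed
    have "J - I = {} \<or> J - I = S - I"
      using iK convex_in_Diff_restrict[OF J(1), of I] c unfolding interval_conn_def by blast
    then show False
    proof
      assume "J - I = S - I"
      then have "J = S" using gap_inside[OF I S(1) J(1)] by blast
      moreover have "f s \<in> S" using pmatchD(1,2)[OF p, of s] by auto
      ultimately have "s \<in> S" using cl[of "f s"] pmatchD(3)[OF p, of s] by auto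
      then show False using S(2) by blast
    next
      assume e: "J - I = {}"
      then have "convex_in I J" using convex_in_restrict[OF J(1) _ Isub] by blast
      then obtain x where x: "x \<in> J" "T x \<notin> J" using lT J(2) unfolding leaky_def by blast
      then have "x \<in> insert s I" using e by blast
      then show False using fI(1) cl[OF x(1)] x(2) by simp
    qed
  qed
  then show "f \<in> conn_set s S" using p unfolding conn_set_def by simp
  show rT: "restr (insert s I) f = T"
    unfolding restr_def using fI(1) TD(4) by fastforce
  show rK: "restr (S - I) f = K"
    unfolding restr_def using fK(1) KD(4) by fastforce
  show "outer_split s S f I"
    unfolding outer_split_def rT rK using I T K fI(2) by blast
qed

lemma card_conn_set_split:
  assumes S: "finite S" "s \<notin> S" "card S \<noteq> 1"
  shows "card (conn_set s S) = (\<Sum>I\<in>gaps S. conn_num (card I) * conn_num (card S - card I - 1))"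
proof -
  define X where "X = (SIGMA I:gaps S. conn_set s I \<times> conn_set (Min S) (S - I - {Min S}))"
  define g where "g = (\<lambda>(I, T, K) x. if x \<in> insert s I then T x else (K x :: nat))"
  have sub: "I \<subseteq> S" if "I \<in> gaps S" for I using that convex_in_subset unfolding gaps_def by blast
  have fin: "finite (gaps S)" by (rule finite_subset[of _ "Pow S"]) (use sub S(1) in auto)
  have "bij_betw g X (conn_set s S)" unfolding bij_betw_def
  proof
    show "inj_on g X"
    proof (rule inj_onI)
      fix a b assume a: "a \<in> X" and b: "b \<in> X" and eq: "g a = g b"
      obtain I T K where a': "a = (I, T, K)" "I \<in> gaps S" "T \<in> conn_set s I" "K \<in> conn_set (Min S) (S - I - {Min S})"
        using a unfolding X_def by auto
      obtain I' T' K' where b': "b = (I', T', K')" "I' \<in> gaps S" "T' \<in> conn_set s I'" "K' \<in> conn_set (Min S) (S - I' - {Min S})"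
        using b unfolding X_def by auto
      have ga: "g a = (\<lambda>x. if x \<in> insert s I then T x else K x)" unfolding a'(1) g_def by simp
      have gb: "g b = (\<lambda>x. if x \<in> insert s I' then T' x else K' x)" unfolding b'(1) g_def by simp
      note A = outer_split_glue[OF S(1,2) a'(2-4), folded ga]
      note B = outer_split_glue[OF S(1,2) b'(2-4), folded gb, folded eq]
      have p: "pmatch (insert s S) (g a)" using A(1) unfolding conn_set_def by simp
      have "I = I'" using outer_split_subset[OF S(1,2) p A(2) B(2)] outer_split_subset[OF S(1,2) p B(2) A(2)] by blast
      then show "a = b" using A(3,4) B(3,4) a'(1) b'(1) by simp
    qed
    show "g ` X = conn_set s S"
    proof
      show "g ` X \<subseteq> conn_set s S"
      proof
        fix f assume "f \<in> g ` X"
        then obtain I T K where "f = g (I, T, K)" "I \<in> gaps S" "T \<in> conn_set s I" "K \<in> conn_set (Min S) (S - I - {Min S})"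
          unfolding X_def by blast
        then show "f \<in> conn_set s S" using outer_split_glue(1)[OF S(1,2), of I T K] unfolding g_def by simp
      qed
      show "conn_set s S \<subseteq> g ` X"
      proof
        fix f assume f: "f \<in> conn_set s S"
        then obtain I where I: "outer_split s S f I" using outer_split_exists[OF S] by blast
        have "f = g (I, restr (insert s I) f, restr (S - I) f)"
        proof
          fix x show "f x = g (I, restr (insert s I) f, restr (S - I) f) x"
          proof (cases "x \<in> insert s S")
            case False
            have "pmatch (insert s S) f" using f unfolding conn_set_def by blast
            then have "f x = x" using False by (rule pmatchD(4))
            then show ?thesis unfolding g_def restr_def by simp
          qed (auto simp: g_def restr_def)
        qed
        then show "f \<in> g ` X" using I unfolding outer_split_def X_def by blast
      qed
    qed
  qed
  then have "card (conn_set s S) = card X" using bij_betw_same_card by metis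
  also have "\<dots> = (\<Sum>I\<in>gaps S. card (conn_set s I \<times> conn_set (Min S) (S - I - {Min S})))"
    unfolding X_def
  proof (rule card_SigmaI[OF fin], rule ballI)
    fix I assume "I \<in> gaps S"
    then have "finite I" using sub S(1) finite_subset by blast
    then show "finite (conn_set s I \<times> conn_set (Min S) (S - I - {Min S}))"
      using S(1) by (intro finite_cartesian_product finite_conn_set) auto
  qed
  also have "\<dots> = (\<Sum>I\<in>gaps S. conn_num (card I) * conn_num (card S - card I - 1))"
  proof (rule sum.cong[OF refl])
    fix I assume I: "I \<in> gaps S"
    note M = Min_gap[OF I S(1)]
    have fI: "finite I" using sub[OF I] S(1) finite_subset by blast
    have "card (conn_set s I) = conn_num (card I)" using card_conn_set[OF fI] sub[OF I] S(2) by blast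
    moreover have "card (conn_set (Min S) (S - I - {Min S})) = conn_num (card (S - I - {Min S}))"
      by (rule card_conn_set) (use M in auto)
    \<comment> \<open>One point fewer than the outer part has, since its minimum serves as its
      root.\<close>
    moreover have "card (S - I - {Min S}) = card S - card I - 1"
      using M(2,3) sub[OF I] fI by (simp add: card_Diff_subset)
    ultimately show "card (conn_set s I \<times> conn_set (Min S) (S - I - {Min S})) = conn_num (card I) * conn_num (card S - card I - 1)"
      by (simp add: card_cartesian_product)
  qed
  finally show ?thesis .
qed

lemma convex_in_interval:
  fixes a b :: nat
  assumes "convex_in {a..b} I" "I \<noteq> {}"
  shows "I = {Min I..Max I}" "Min I \<in> I" "Max I \<in> I" "card I = Suc (Max I) - Min I"
proof -
  have fin: "finite I" using convex_in_subset[OF assms(1)] finite_subset by blast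
  show m: "Min I \<in> I" "Max I \<in> I" using fin assms(2) by auto
  have "x \<in> I" if "x \<in> {Min I..Max I}" for x
  proof (cases "x = Min I \<or> x = Max I")
    case False
    then have "Min I < x" "x < Max I" using that by auto
    moreover have "Min I \<in> {a..b}" "Max I \<in> {a..b}" using m convex_in_subset[OF assms(1)] by blast+
    then have "x \<in> {a..b}" using that unfolding atLeastAtMost_iff by linarith
    ultimately show ?thesis using convex_in_mid[OF assms(1) m] by blast
  qed (use m in auto)
  moreover have "x \<in> {Min I..Max I}" if "x \<in> I" for x using fin that by simp
  ultimately show eq: "I = {Min I..Max I}" by blast
  show "card I = Suc (Max I) - Min I"     by (rule trans[OF arg_cong[OF eq, of card] card_atLeastAtMost])
qed

lemma interval_convex_in: "{c..d} \<subseteq> {a..b} \<Longrightarrow> convex_in {a..b} {c..d::nat}"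
  by (rule convex_inI) auto

text \<open>An interval of length l has to fit between 2 and N - 1, which leaves N - 1 - l
  positions.\<close>

lemma sum_gaps:
  fixes g :: "nat \<Rightarrow> nat"
  assumes "N \<ge> 1"
  shows "(\<Sum>I\<in>gaps {1..N}. g (card I)) = (\<Sum>l=1..N. (N - 1 - l) * g l)"
proof -
  define X where "X = (SIGMA l:{1..N}. {..<N - 1 - l})"
  define h where "h = (\<lambda>(l, a). {a + 2..a + 1 + l :: nat})"
  have mm: "Min {1..N} = 1" "Max {1..N} = N" using assms by (auto intro: Min_eqI Max_eqI)
  have "bij_betw h X (gaps {1..N})" unfolding bij_betw_def
  proof
    show "inj_on h X"
    proof (rule inj_onI)
      fix u v assume u: "u \<in> X" and v: "v \<in> X" and eq: "h u = h v"
      obtain l a where u': "u = (l, a)" "1 \<le> l" using u unfolding X_def by auto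
      obtain l' a' where v': "v = (l', a')" "1 \<le> l'" using v unfolding X_def by auto
      have "{a + 2..a + 1 + l} = {a' + 2..a' + 1 + l'}" using eq u' v' unfolding h_def by simp
      then show "u = v" using u' v' by (auto simp: Icc_eq_Icc)
    qed
    show "h ` X = gaps {1..N}"
    proof
      show "h ` X \<subseteq> gaps {1..N}"
      proof
        fix I assume "I \<in> h ` X"
        then obtain l a where la: "1 \<le> l" "a < N - 1 - l" "I = {a + 2..a + 1 + l}"
          unfolding X_def h_def by auto
        then have "I \<subseteq> {1..N}" by auto
        then have "convex_in {1..N} I" unfolding la(3) by (rule interval_convex_in)
        then show "I \<in> gaps {1..N}" unfolding gaps_def mm using la by auto
      qed
      show "gaps {1..N} \<subseteq> h ` X"
      proof
        fix I assume I: "I \<in> gaps {1..N}"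
        then have c: "convex_in {1..N} I" "I \<noteq> {}" and n: "1 \<notin> I" "N \<notin> I"
          unfolding gaps_def mm by auto
        note J = convex_in_interval[OF c]
        have sub: "I \<subseteq> {1..N}" using c(1) by (rule convex_in_subset)
        have "Min I \<in> {1..N}" "Max I \<in> {1..N}" "Min I \<noteq> 1" "Max I \<noteq> N" "Min I \<le> Max I"
          using J(1-3) sub n by (blast, blast, metis, metis, metis atLeastAtMost_iff)
        then have "(Suc (Max I) - Min I, Min I - 2) \<in> X" "h (Suc (Max I) - Min I, Min I - 2) = {Min I..Max I}"
          unfolding X_def h_def by auto
        then show "I \<in> h ` X" using J(1) by (metis image_eqI)
      qed
    qed
  qed
  then have "(\<Sum>I\<in>gaps {1..N}. g (card I)) = (\<Sum>x\<in>X. g (card (h x)))"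
    by (rule sum.reindex_bij_betw[symmetric])
  also have "\<dots> = (\<Sum>(l, a)\<in>X. g l)"
    unfolding h_def by (intro sum.cong) auto
  also have "\<dots> = (\<Sum>l=1..N. \<Sum>a<N - 1 - l. g l)"
    unfolding X_def by (rule sum.Sigma[symmetric]) auto
  finally show ?thesis by simp
qed

lemma conn_num_even: "even N \<Longrightarrow> conn_num N = 0"
proof -
  assume e: "even N"
  have "conn_set 0 {1..N} = {}"
  proof (rule ccontr)
    assume "conn_set 0 {1..N} \<noteq> {}"
    then obtain f where "pmatch (insert 0 {1..N}) f" unfolding conn_set_def by auto
    then have "even (card (insert 0 {1..N}))" by (rule pmatch_even[rotated]) simp
    then show False using e by simp
  qed
  then show "conn_num N = 0" unfolding conn_num_def by simp
qed

lemma conn_num_1: "conn_num 1 = 1"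
proof -
  have "conn_set 0 {1..1} = {\<lambda>x. if x = 0 then 1 else if x = 1 then 0 else x}" (is "_ = {?f}")
  proof
    have "pmatch {0, 1} ?f" by (rule pmatchI) auto
    moreover have "leaky {1..1} ?f" unfolding leaky_def
    proof (intro allI impI)
      fix J assume "convex_in {1..1::nat} J" "J \<noteq> {}"
      then have "J = {1}" using convex_in_subset by fastforce
      then show "\<exists>x\<in>J. ?f x \<notin> J" by simp
    qed
    ultimately show "{?f} \<subseteq> conn_set 0 {1..1}" unfolding conn_set_def by simp
    show "conn_set 0 {1..1} \<subseteq> {?f}"
    proof
      fix f assume "f \<in> conn_set 0 {1..1}"
      then have p: "pmatch {0, 1} f" unfolding conn_set_def by simp
      have "f x = ?f x" for x
        using pmatchD(1,2)[OF p, of x] pmatchD(4)[OF p, of x] by (cases "x = 0"; cases "x = 1") auto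
      then show "f \<in> {?f}" by blast
    qed
  qed
  then show ?thesis unfolding conn_num_def by simp
qed

text \<open>\<open>conn_num\<close> does not count the root: n + 1 chords have 2 * n + 2 endpoints,
  hence 2 * n + 1 besides the root. So these are the coefficients of C(x)/x.\<close>

definition B_num :: "nat \<Rightarrow> nat" where "B_num n = conn_num (2 * n + 1)"

lemma B_num_0: "B_num 0 = 1" unfolding B_num_def using conn_num_1 by simp

text \<open>The outer component has i + 1 chords and therefore 2 * i + 1 gaps; the chosen gap holds
  2 * (n - i) + 1 points, which together with the root carry the inner diagram.\<close>

lemma stein_recurrence: "B_num (Suc n) = (\<Sum>i\<le>n. (2 * i + 1) * B_num i * B_num (n - i))"
proof -
  let ?N = "2 * Suc n + 1"
  let ?g = "\<lambda>l. (?N - 1 - l) * (conn_num l * conn_num (?N - l - 1))"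
  have "B_num (Suc n) = (\<Sum>I\<in>gaps {1..?N}. conn_num (card I) * conn_num (?N - card I - 1))"
    unfolding B_num_def conn_num_def[of ?N] using card_conn_set_split[of "{1..?N}" 0] by simp
  also have "\<dots> = (\<Sum>l=1..?N. ?g l)"
    by (rule sum_gaps) simp
  \<comment> \<open>Even gap sizes contribute nothing by parity, and a size above 2 * n + 1 leaves
    no position.\<close>
  also have "\<dots> = (\<Sum>l\<in>(\<lambda>i. 2 * (n - i) + 1) ` {..n}. ?g l)"
  proof (rule sum.mono_neutral_right)
    show "\<forall>l\<in>{1..?N} - (\<lambda>i. 2 * (n - i) + 1) ` {..n}. ?g l = 0"
    proof
      fix l assume l: "l \<in> {1..?N} - (\<lambda>i. 2 * (n - i) + 1) ` {..n}"
      show "?g l = 0"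
      proof (cases "even l")
        case False
        then obtain j where j: "l = 2 * j + 1" by (elim oddE)
        have "\<not> j \<le> n"
        proof
          assume "j \<le> n"
          then have "l = 2 * (n - (n - j)) + 1" "n - j \<in> {..n}" using j by auto
          then show False using l by blast
        qed
        then have "?N - 1 - l = 0" using j by simp
        then show ?thesis by simp
      qed (simp add: conn_num_even)
    qed
  qed auto
  also have "\<dots> = (\<Sum>i\<le>n. ?g (2 * (n - i) + 1))"
    by (rule sum.reindex_cong[OF _ refl refl]) (auto simp: inj_on_def)
  also have "\<dots> = (\<Sum>i\<le>n. (2 * i + 1) * B_num i * B_num (n - i))"
  proof (rule sum.cong[OF refl])
    fix i assume "i \<in> {..n}"
    then have "?N - 1 - (2 * (n - i) + 1) = 2 * i + 1" "?N - (2 * (n - i) + 1) - 1 = 2 * i + 1" by auto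
    then show "?g (2 * (n - i) + 1) = (2 * i + 1) * B_num i * B_num (n - i)"
      unfolding B_num_def by (simp only: mult.assoc mult.commute mult.left_commute)
  qed
  finally show ?thesis .
qed

section \<open>Contracting blocks\<close>

text \<open>\<open>Y\<close> arises from \<open>f\<close> by contracting the block \<open>I\<close>, whose only outgoing chord is \<open>{p, q}\<close>, to the point \<open>m\<close>.\<close>

definition linked :: "'a \<Rightarrow> 'a set \<Rightarrow> 'a \<Rightarrow> 'a \<Rightarrow> ('a \<Rightarrow> 'a) \<Rightarrow> ('a \<Rightarrow> 'a) \<Rightarrow> bool" where
  "linked m I p q f Y \<longleftrightarrow> p \<in> I \<and> m \<in> I \<and> q \<notin> I \<and> f p = q \<and> f q = p \<and> Y m = q \<and> Y q = m
     \<and> (\<forall>x\<in>I. x \<noteq> p \<longrightarrow> f x \<in> I) \<and> (\<forall>x. x \<notin> I \<longrightarrow> x \<noteq> q \<longrightarrow> f x = Y x \<and> Y x \<notin> I)"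

lemma linkedD:
  assumes "linked m I p q f Y"
  shows "p \<in> I" "m \<in> I" "q \<notin> I" "f p = q" "f q = p" "Y m = q" "Y q = m"
    "\<And>x. x \<in> I \<Longrightarrow> x \<noteq> p \<Longrightarrow> f x \<in> I" "\<And>x. x \<notin> I \<Longrightarrow> x \<noteq> q \<Longrightarrow> f x = Y x"
    "\<And>x. x \<notin> I \<Longrightarrow> x \<noteq> q \<Longrightarrow> Y x \<notin> I"
  using assms unfolding linked_def by simp_all

text \<open>Undoes the contraction on sets of points: a set containing m regains the whole
  block.\<close>

definition expand :: "'a \<Rightarrow> 'a set \<Rightarrow> 'a set \<Rightarrow> 'a set" where
  "expand m I J = (if m \<in> J then J \<union> I else J)"

text \<open>The chord at m in the contracted diagram is the chord at p in the original one, and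
  chords inside I leave no expanded set. Hence \<rho>, which moves m to p, carries the outgoing
  points of J onto those of its expansion.\<close>

lemma expand_leave:
  assumes l: "linked m I p q f Y" and J: "J \<inter> I \<subseteq> {m}"
  shows "(\<exists>x\<in>expand m I J. f x \<notin> expand m I J) \<longleftrightarrow> (\<exists>x\<in>J. Y x \<notin> J)"
    "two_out f (expand m I J) \<longleftrightarrow> two_out Y J"
proof -
  note L = linkedD[OF l]
  let ?E = "expand m I J"
  define \<rho> where "\<rho> = (\<lambda>x. if x = m then p else x)"
  have E: "x \<in> ?E \<longleftrightarrow> (if x \<in> I then m \<in> J else x \<in> J)" for x
    using J L(2) unfolding expand_def by auto
  have mem: "\<rho> x \<in> ?E" if "x \<in> J" for x
    using that J L(1,2) E[of "\<rho> x"] unfolding \<rho>_def by auto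
  have out: "f (\<rho> x) \<notin> ?E \<longleftrightarrow> Y x \<notin> J" if x: "x \<in> J" for x
  proof -
    consider "x = m" | "x \<noteq> m" "x = q" | "x \<noteq> m" "x \<noteq> q" by blast
    then show ?thesis
    proof cases
      case 1
      then show ?thesis using L(3,4,6) E[of q] unfolding \<rho>_def by simp
    next
      case 2
      then show ?thesis using L(1,5,7) E[of p] unfolding \<rho>_def by simp
    next
      case 3
      then have "x \<notin> I" using x J by blast
      then show ?thesis using 3 L(9,10)[of x] E[of "Y x"] unfolding \<rho>_def by simp
    qed
  qed
  have surj: "\<exists>x\<in>J. \<rho> x = y" if y: "y \<in> ?E" "f y \<notin> ?E" for y
  proof (cases "y \<in> I")
    case True
    then have m: "m \<in> J" using E y by simp
    have "y = p"
    proof (rule ccontr)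
      assume "y \<noteq> p"
      then have "f y \<in> I" using L(8)[OF True] by blast
      then show False using y(2) E[of "f y"] m by simp
    qed
    then show ?thesis using m unfolding \<rho>_def by auto
  next
    case False
    then have "y \<in> J" "y \<noteq> m" using E y L(2) by auto
    then show ?thesis unfolding \<rho>_def by auto
  qed
  have inj: "x = y" if "x \<in> J" "y \<in> J" "\<rho> x = \<rho> y" for x y
  proof -
    have "z \<noteq> p" if "z \<in> J" "z \<noteq> m" for z using that J L(1) by blast
    then show ?thesis using that unfolding \<rho>_def by (cases "x = m"; cases "y = m") auto
  qed
  show "(\<exists>x\<in>?E. f x \<notin> ?E) \<longleftrightarrow> (\<exists>x\<in>J. Y x \<notin> J)"
    using mem out surj by blast
  show "two_out f ?E \<longleftrightarrow> two_out Y J"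
  proof
    assume "two_out f ?E"
    then obtain u v where uv: "u \<in> ?E" "v \<in> ?E" "u \<noteq> v" "f u \<notin> ?E" "f v \<notin> ?E" unfolding two_out_def by blast
    obtain x where x: "x \<in> J" "\<rho> x = u" using surj[OF uv(1,4)] by blast
    obtain y where y: "y \<in> J" "\<rho> y = v" using surj[OF uv(2,5)] by blast
    have "Y x \<notin> J" "Y y \<notin> J" using out[OF x(1)] out[OF y(1)] uv(4,5) x(2) y(2) by simp_all
    moreover have "x \<noteq> y" using uv(3) x(2) y(2) by auto
    ultimately show "two_out Y J" using x(1) y(1) unfolding two_out_def by blast
  next
    assume "two_out Y J"
    then obtain x y where *: "x \<in> J" "y \<in> J" "x \<noteq> y" "Y x \<notin> J" "Y y \<notin> J" unfolding two_out_def by blast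
    then have "\<rho> x \<noteq> \<rho> y" using inj by blast
    then show "two_out f ?E" using * mem out unfolding two_out_def by blast
  qed
qed

text \<open>The chord leaving the block is stored as two half-chords: K joins its inner end to the
  root s, and Y joins m to its outer end. Gluing splices them. In this way the block itself becomes
  a diagram rooted at s; \<open>core\<close> and \<open>skel\<close> below recover the two
  diagrams.\<close>

definition glue :: "'a \<Rightarrow> 'a \<Rightarrow> 'a set \<Rightarrow> ('a \<Rightarrow> 'a) \<Rightarrow> ('a \<Rightarrow> 'a) \<Rightarrow> 'a \<Rightarrow> 'a" where
  "glue s m I K Y = (\<lambda>x. if x \<in> I then (if K x = s then Y m else K x)
     else if Y x = m then K s else Y x)"

definition core :: "'a \<Rightarrow> 'a set \<Rightarrow> ('a \<Rightarrow> 'a) \<Rightarrow> 'a \<Rightarrow> 'a \<Rightarrow> 'a" where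
  "core s I f p = (\<lambda>x. if x = s then p else if x = p then s else if x \<in> I then f x else x)"

definition skel :: "'a \<Rightarrow> 'a set \<Rightarrow> ('a \<Rightarrow> 'a) \<Rightarrow> 'a \<Rightarrow> 'a \<Rightarrow> 'a" where
  "skel m I f p = (\<lambda>x. if x = m then f p else if x = f p then m else if x \<in> I then x else f x)"

lemma glue_linked:
  assumes S: "I \<subseteq> S" "m \<in> I" "s \<notin> S"
    and K: "pmatch (insert s I) K" and Y: "pmatch (insert s (insert m (S - I))) Y"
  shows "linked m I (K s) (Y m) (glue s m I K Y) Y" "pmatch (insert s S) (glue s m I K Y)"
    "core s I (glue s m I K Y) (K s) = K" "skel m I (glue s m I K Y) (K s) = Y"
    "\<And>x. x \<in> I \<Longrightarrow> x \<noteq> K s \<Longrightarrow> glue s m I K Y x = K x"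
proof -
  note KD = pmatchD[OF K] and YD = pmatchD[OF Y]
  let ?f = "glue s m I K Y" and ?p = "K s" and ?q = "Y m"
  have sI: "s \<notin> I" using S by blast
  have p: "?p \<in> I" using KD(1,2)[of s] by auto
  have q: "?q \<in> insert s S" "?q \<notin> I" using YD(1,2)[of m] sI by auto
  have Kp: "K ?p = s" using KD(3) .
  have Yq: "Y ?q = m" using YD(3) .
  have fp: "?f ?p = ?q" using p Kp unfolding glue_def by simp
  have fq: "?f ?q = ?p" using q Yq unfolding glue_def by simp
  have fI: "?f x = K x" "K x \<in> I" if "x \<in> I" "x \<noteq> ?p" for x
  proof -
    have "K x \<noteq> s" using that(2) KD(3)[of x] by auto
    then show "?f x = K x" "K x \<in> I" using that KD(1)[of x] unfolding glue_def by auto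
  qed
  have fO: "?f x = Y x" "Y x \<notin> I" if "x \<notin> I" "x \<noteq> ?q" for x
  proof -
    have "Y x \<noteq> m" using that(2) YD(3)[of x] by auto
    then show "?f x = Y x" using that unfolding glue_def by simp
    show "Y x \<notin> I"
    proof
      assume yI: "Y x \<in> I"
      then have "Y x \<notin> insert s (insert m (S - I))" using \<open>Y x \<noteq> m\<close> sI by auto
      then have "x \<notin> insert s (insert m (S - I))" using YD(5)[of x] by blast
      then show False using YD(4)[of x] yI that by simp
    qed
  qed
  show "linked m I ?p ?q ?f Y"
    unfolding linked_def using p q S(2) fp fq Yq fI fO by auto
  show "\<And>x. x \<in> I \<Longrightarrow> x \<noteq> K s \<Longrightarrow> ?f x = K x" using fI by blast
  show "core s I ?f ?p = K"
  proof
    fix x show "core s I ?f ?p x = K x"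
      using fI(1)[of x] Kp KD(4)[of x] unfolding core_def by auto
  qed
  show "skel m I ?f ?p = Y"
  proof
    fix x
    have "x \<in> I \<Longrightarrow> x \<noteq> m \<Longrightarrow> Y x = x" using YD(4)[of x] sI by auto
    then show "skel m I ?f ?p x = Y x"
      using fO(1)[of x] Yq fp q(2) unfolding skel_def by auto
  qed
  show "pmatch (insert s S) ?f"
  proof (rule pmatchI)
    fix x assume x: "x \<in> insert s S"
    consider "x = ?p" | "x = ?q" | "x \<in> I" "x \<noteq> ?p" | "x \<notin> I" "x \<noteq> ?q" by blast
    then have "?f x \<in> insert s S \<and> ?f x \<noteq> x \<and> ?f (?f x) = x"
    proof cases
      case 1
      then show ?thesis using fp fq p q by auto
    next
      case 2
      then show ?thesis using fp fq p q S(1) by auto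
    next
      case 3
      have "K x \<noteq> ?p" using 3(1) KD(6)[of x s] sI by auto
      then have "?f (K x) = K (K x)" using fI(1)[of "K x"] fI(2)[OF 3] by blast
      moreover have "K x \<noteq> x" using KD(2)[of x] 3(1) by blast
      ultimately show ?thesis using fI[OF 3] KD(3)[of x] S(1) by auto
    next
      case 4
      have xin: "x \<in> insert s (insert m (S - I))" using x 4(1) by blast
      have "Y x \<noteq> ?q" using YD(6)[of x m] 4(1) S(2) by auto
      then have "?f (Y x) = Y (Y x)" using fO(1)[of "Y x"] fO(2)[OF 4] by blast
      moreover have "Y x \<noteq> x" using YD(2)[OF xin] .
      moreover have "Y x \<in> insert s S" using YD(1)[OF xin] S(1,2) by blast
      ultimately show ?thesis using fO[OF 4] YD(3)[of x] by simp
    qed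
    then show "?f x \<in> insert s S" "?f x \<noteq> x" "?f (?f x) = x" by blast+
  next
    fix x assume x: "x \<notin> insert s S"
    then have "x \<notin> I" "x \<notin> insert s (insert m (S - I))" "x \<noteq> ?q" using S q(1) by auto
    then show "?f x = x" using fO(1)[of x] YD(4)[of x] by simp
  qed
qed

lemma core_skel_linked:
  assumes S: "I \<subseteq> S" "m \<in> I" "s \<notin> S" and f: "pmatch (insert s S) f"
    and p: "p \<in> I" "f p \<notin> I" "\<And>x. x \<in> I \<Longrightarrow> x \<noteq> p \<Longrightarrow> f x \<in> I"
  shows "linked m I p (f p) f (skel m I f p)" "pmatch (insert s I) (core s I f p)"
    "pmatch (insert s (insert m (S - I))) (skel m I f p)"
    "glue s m I (core s I f p) (skel m I f p) = f"
proof -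
  note fD = pmatchD[OF f]
  have sI: "s \<notin> I" using S by blast
  let ?q = "f p" and ?K = "core s I f p" and ?Y = "skel m I f p"
  have qm: "?q \<noteq> m" using S(2) p(2) by auto
  have sp: "s \<noteq> p" using sI p by auto
  have fO: "f x \<notin> I" if "x \<notin> I" "x \<noteq> ?q" for x
    using p(3)[of "f x"] fD(3)[of x] fD(3)[of p] that by metis
  have Kv: "?K s = p" "?K p = s" "\<And>x. x \<in> I \<Longrightarrow> x \<noteq> p \<Longrightarrow> ?K x = f x"
    using sI sp unfolding core_def by auto
  have Yv: "?Y m = ?q" "?Y ?q = m" "\<And>x. x \<notin> I \<Longrightarrow> x \<noteq> ?q \<Longrightarrow> ?Y x = f x"
    using qm S(2) unfolding skel_def by auto
  show "linked m I p ?q f ?Y"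
    unfolding linked_def using p S(2) fD(3) Yv fO by auto
  show "pmatch (insert s I) ?K"
  proof (rule pmatchI)
    fix x assume "x \<in> insert s I"
    then consider "x = s" | "x = p" | "x \<in> I" "x \<noteq> p" by blast
    then have "?K x \<in> insert s I \<and> ?K x \<noteq> x \<and> ?K (?K x) = x"
    proof cases
      case 1
      then show ?thesis using Kv(1,2) p(1) sp by auto
    next
      case 2
      then show ?thesis using Kv(1,2) sp by auto
    next
      case 3
      have "f x \<noteq> p" using 3(1) p(2) fD(3)[of x] by auto
      then show ?thesis using Kv(3)[of x] Kv(3)[of "f x"] p(3)[OF 3] 3 fD(2)[of x] fD(3)[of x] S(1) by auto
    qed
    then show "?K x \<in> insert s I" "?K x \<noteq> x" "?K (?K x) = x" by blast+
  next
    fix x assume "x \<notin> insert s I"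
    then show "?K x = x" using p(1) unfolding core_def by auto
  qed
  show "pmatch (insert s (insert m (S - I))) ?Y"
  proof (rule pmatchI)
    fix x assume "x \<in> insert s (insert m (S - I))"
    then consider "x = m" | "x = ?q" | "x \<in> insert s S" "x \<notin> I" "x \<noteq> ?q" using sI by blast
    then have "?Y x \<in> insert s (insert m (S - I)) \<and> ?Y x \<noteq> x \<and> ?Y (?Y x) = x"
    proof cases
      case 1
      have "?q \<in> insert s S" using fD(1)[of p] p S(1) by blast
      then show ?thesis using 1 Yv(1,2) p(2) qm by auto
    next
      case 2
      then show ?thesis using Yv(1,2) qm by auto
    next
      case 3
      have "f x \<noteq> ?q" using fD(6)[of x p] p 3 by auto
      then show ?thesis
        using Yv(3)[OF 3(2,3)] Yv(3)[OF fO[OF 3(2,3)]] fO[OF 3(2,3)] fD(1-3)[of x] 3(1) by auto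
    qed
    then show "?Y x \<in> insert s (insert m (S - I))" "?Y x \<noteq> x" "?Y (?Y x) = x" by blast+
  next
    fix x assume x: "x \<notin> insert s (insert m (S - I))"
    have "?q \<in> insert s S" using fD(1)[of p] p S(1) by blast
    then have "x \<noteq> ?q" using x p(2) by blast
    then show "?Y x = x" using x fD(4)[of x] unfolding skel_def by auto
  qed
  show "glue s m I ?K ?Y = f"
  proof
    fix x
    consider "x = p" | "x = ?q" | "x \<in> I" "x \<noteq> p" | "x \<notin> I" "x \<noteq> ?q" by blast
    then show "glue s m I ?K ?Y x = f x"
    proof cases
      case 1
      then show ?thesis using p(1) Kv Yv unfolding glue_def by simp
    next
      case 2
      then show ?thesis using p(2) Kv Yv fD(3) unfolding glue_def by simp
    next
      case 3
      then have "f x \<noteq> s" using p(3) sI by metis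
      then show ?thesis using 3 Kv(3)[OF 3] unfolding glue_def by simp
    next
      case 4
      then have "f x \<noteq> m" using fO S(2) by metis
      then show ?thesis using 4 Yv(3)[OF 4] unfolding glue_def by simp
    qed
  qed
qed

text \<open>Since I is an interval, a point of S outside I lies on the same side of every element of
  I as of m. Replacing m by I thus opens no hole.\<close>

lemma convex_in_expand:
  assumes I: "convex_in S I" "m \<in> I" "\<And>x. x \<in> I \<Longrightarrow> m \<le> x"
    and J: "convex_in (insert m (S - I)) J"
  shows "convex_in S (expand m I J)"
proof -
  have JS: "J \<subseteq> insert m (S - I)" using J by (rule convex_in_subset)
  have IS: "I \<subseteq> S" using I(1) by (rule convex_in_subset)
  note Jm = convex_in_mid[OF J] and Im = convex_in_mid[OF I(1)]
  show ?thesis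
  proof (cases "m \<in> J")
    case True
    have "convex_in S (J \<union> I)"
    proof (rule convex_inI)
      show "J \<union> I \<subseteq> S" using JS IS I(2) by blast
      fix u w v assume *: "u \<in> J \<union> I" "w \<in> J \<union> I" "v \<in> S" "u < v" "v < w"
      show "v \<in> J \<union> I"
      proof (cases "v \<in> I")
        case False
        then have v: "v \<in> insert m (S - I)" "v \<noteq> m" using * I(2) by auto
        have "\<exists>u'\<in>J. u' < v"
        proof (cases "u \<in> J")
          case False
          then have "m \<le> u" using I(3)[of u] *(1) by blast
          then have "m < v" using *(4) by linarith
          then show ?thesis using True by blast
        qed (use *(4) in blast)
        then obtain u' where u': "u' \<in> J" "u' < v" by blast
        show ?thesis
        proof (cases "w \<in> J")
          case True
          then show ?thesis using Jm[OF u'(1) True v(1) u'(2) *(5)] by blast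
        next
          case False
          then have wI: "w \<in> I" using *(2) by blast
          have "v < m"
          proof (rule ccontr)
            assume "\<not> v < m"
            then have "m < v" using v(2) by simp
            then show False using Im[OF I(2) wI *(3) _ *(5)] \<open>v \<notin> I\<close> by blast
          qed
          then show ?thesis using Jm[OF u'(1) \<open>m \<in> J\<close> v(1) u'(2)] by blast
        qed
      qed blast
    qed
    then show ?thesis using True unfolding expand_def by simp
  next
    case False
    have "convex_in S J"
    proof (rule convex_inI)
      show "J \<subseteq> S" using JS IS I(2) by blast
      fix u w v assume *: "u \<in> J" "w \<in> J" "v \<in> S" "u < v" "v < w"
      have uw: "u \<notin> I" using * JS False by blast
      show "v \<in> J"
      proof (cases "v \<in> I")
        case True
        have "u < m"
        proof (rule ccontr)
          assume "\<not> u < m"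
          then have "m < u" using uw I(2) by (metis linorder_neqE_nat)
          moreover have "u \<in> S" using * JS False by blast
          ultimately show False using Im[OF I(2) True _ _ *(4)] uw by blast
        qed
        moreover have "m < w" using I(3)[OF True] *(5) by linarith
        ultimately show ?thesis using Jm[OF *(1,2)] False by blast
      qed (use Jm[OF *(1,2) _ *(4,5)] * in blast)
    qed
    then show ?thesis using False unfolding expand_def by simp
  qed
qed

text \<open>If a point of I lay between two points of J - I, then all of I would be caught between
  them and hence inside J. So I cuts off an end of J only.\<close>

lemma convex_in_Diff:
  assumes J: "convex_in S J" and I: "convex_in S I" and n: "\<not> I \<subseteq> J"
    and meet: "J \<inter> I \<noteq> {}"
  shows "convex_in S (J - I)"
proof (rule convex_inI)
  show "J - I \<subseteq> S" using J convex_in_subset by blast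
  fix u w v assume *: "u \<in> J - I" "w \<in> J - I" "v \<in> S" "u < v" "v < w"
  have vJ: "v \<in> J" using convex_in_mid[OF J] * by blast
  have "v \<notin> I"
  proof
    assume v: "v \<in> I"
    obtain i where i: "i \<in> I" "i \<notin> J" using n by blast
    have IS: "i \<in> S" "u \<in> S" "w \<in> S" using i * J I convex_in_subset by blast+
    consider "i < u" | "u < i" "i < w" | "w < i" using i * by (metis DiffD1 linorder_neqE_nat)
    then show False
    proof cases
      case 1
      then show ?thesis using convex_in_mid[OF I i(1) v IS(2) _ *(4)] * by blast
    next
      case 2
      then show ?thesis using convex_in_mid[OF J _ _ IS(1), of u w] * i by blast
    next
      case 3
      then show ?thesis using convex_in_mid[OF I v i(1) IS(3) *(5)] * by blast
    qed
  qed
  then show "v \<in> J - I" using vJ by blast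
qed

text \<open>Candidates for the block at m when T is the set of points already treated. With m the
  first point outside T, such an interval starts at m.\<close>

definition blocks :: "nat set \<Rightarrow> nat set \<Rightarrow> nat \<Rightarrow> nat set set" where
  "blocks S T m = {I. convex_in S I \<and> m \<in> I \<and> I \<inter> T = {} \<and> I \<noteq> S}"

text \<open>Maximality of I is hidden in the last clause: after the contraction no nontrivial block
  contains m any more.\<close>

definition block_split where
  "block_split s S T m f I \<longleftrightarrow> I \<in> blocks S T m \<and> (\<exists>p\<in>I. f p \<notin> I \<and> (\<forall>x\<in>I. x \<noteq> p \<longrightarrow> f x \<in> I)
     \<and> core s I f p \<in> conn_set s I \<and> skel m I f p \<in> block_free s (insert m (S - I)) (insert m T))"

context
  fixes s m :: nat and S T :: "nat set"
  assumes S: "finite S" "s \<notin> S" "card S \<noteq> 1"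
    and T: "T \<subseteq> S" and m: "m \<in> S" "m \<notin> T" "\<forall>x\<in>S. x \<notin> T \<longrightarrow> m \<le> x"
begin

lemma blocksD:
  assumes "I \<in> blocks S T m"
  shows "convex_in S I" "I \<subseteq> S" "m \<in> I" "I \<inter> T = {}" "I \<noteq> S" "\<And>x. x \<in> I \<Longrightarrow> m \<le> x" "finite I"
    "card (insert m (S - I)) \<noteq> 1"
proof -
  show c: "convex_in S I" "m \<in> I" "I \<inter> T = {}" "I \<noteq> S" using assms unfolding blocks_def by auto
  show sub: "I \<subseteq> S" using c(1) by (rule convex_in_subset)
  show "\<And>x. x \<in> I \<Longrightarrow> m \<le> x" using m(3) sub c(3) by blast
  show "finite I" using sub S(1) finite_subset by blast
  have "card (S - I) \<noteq> 0" using sub c(4) S(1) by auto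
  then show "card (insert m (S - I)) \<noteq> 1" using S(1) c(2) by simp
qed

text \<open>I is a largest candidate with exactly one outgoing chord; {m} is one. In the contracted
  diagram, an interval meeting T has two outgoing chords because its expansion has, by hypothesis; a
  nontrivial interval through m that avoids T expands to a candidate larger than I, which therefore
  has two as well.\<close>

lemma block_split_exists:
  assumes f: "f \<in> block_free s S T"
  shows "\<exists>I. block_split s S T m f I"
proof -
  have p: "pmatch (insert s S) f" and l: "leaky S f" and pr: "no_block S T f"
    using f unfolding block_free_def conn_set_def by auto
  note fD = pmatchD[OF p]
  define one where "one = (\<lambda>I. \<exists>p\<in>I. f p \<notin> I \<and> (\<forall>x\<in>I. x \<noteq> p \<longrightarrow> f x \<in> I))"
  define F where "F = {I \<in> blocks S T m. one I}"
  have "finite F" by (rule finite_subset[of _ "Pow S"]) (use S blocksD in \<open>auto simp: F_def\<close>)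
  moreover have "{m} \<in> F"
  proof -
    have "convex_in S {m}" by (rule convex_inI) (use m in auto)
    moreover have "{m} \<noteq> S" using S(3) by auto
    moreover have "one {m}" unfolding one_def using fD(2)[of m] m(1) by simp
    ultimately show ?thesis using m unfolding F_def blocks_def by simp
  qed
  ultimately obtain I where I: "I \<in> F" and maxI: "\<And>J. J \<in> F \<Longrightarrow> card J \<le> card I"
    using ex_max_card[of F] by blast
  have Ib: "I \<in> blocks S T m" using I unfolding F_def by blast
  note B = blocksD[OF Ib]
  obtain q0 where q0: "q0 \<in> I" "f q0 \<notin> I" "\<And>x. x \<in> I \<Longrightarrow> x \<noteq> q0 \<Longrightarrow> f x \<in> I"
    using I unfolding F_def one_def by blast
  let ?K = "core s I f q0" and ?Y = "skel m I f q0" and ?S = "insert m (S - I)" and ?T = "insert m T"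
  note CS = core_skel_linked[OF B(2,3) S(2) p q0]
  have sI: "s \<notin> I" using B(2) S(2) by blast
  have "leaky I ?K" unfolding leaky_def
  proof (intro allI impI)
    fix J assume J: "convex_in I J" "J \<noteq> {}"
    then obtain x where x: "x \<in> J" "f x \<notin> J" using l convex_in_trans[OF B(1) J(1)] unfolding leaky_def by blast
    have "x \<in> I" "s \<notin> J" using x convex_in_subset[OF J(1)] sI by auto
    then have "?K x = f x \<or> ?K x = s" using sI unfolding core_def by auto
    then show "\<exists>x\<in>J. ?K x \<notin> J" using x \<open>s \<notin> J\<close> by metis
  qed
  then have K: "?K \<in> conn_set s I" using CS(2) unfolding conn_set_def by simp
  have JI: "J \<inter> I \<subseteq> {m}" if "convex_in ?S J" for J using convex_in_subset[OF that] by blast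
  have "leaky ?S ?Y" unfolding leaky_def
  proof (intro allI impI)
    fix J assume J: "convex_in ?S J" "J \<noteq> {}"
    have "convex_in S (expand m I J)" using convex_in_expand[OF B(1,3,6) J(1)] .
    moreover have "expand m I J \<noteq> {}" using J(2) unfolding expand_def by auto
    ultimately have "\<exists>x\<in>expand m I J. f x \<notin> expand m I J" using l unfolding leaky_def by blast
    then show "\<exists>x\<in>J. ?Y x \<notin> J" using expand_leave(1)[OF CS(1) JI[OF J(1)]] by simp
  qed
  then have Y: "?Y \<in> conn_set s ?S" using CS(3) unfolding conn_set_def by simp
  have "no_block ?S ?T ?Y" unfolding no_block_def
  proof (intro allI impI)
    fix J assume J: "convex_in ?S J" "J \<noteq> ?S" "J \<inter> ?T \<noteq> {}" "\<forall>x. J \<noteq> {x}"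
    let ?E = "expand m I J"
    have Ec: "convex_in S ?E" using convex_in_expand[OF B(1,3,6) J(1)] .
    have JS: "J \<subseteq> ?S" using J(1) by (rule convex_in_subset)
    have EJ: "J \<subseteq> ?E" unfolding expand_def by auto
    have ES: "?E \<noteq> S"
    proof
      assume E: "?E = S"
      then have "m \<in> J" using m(1) unfolding expand_def by (auto split: if_splits)
      then have "?S \<subseteq> J" using E unfolding expand_def by auto
      then show False using J(2) JS by blast
    qed
    have "two_out f ?E"
    proof (cases "J \<inter> T = {}")
      case False
      have "?E \<noteq> {x}" for x
        using J(3,4) EJ by (metis empty_iff inf_bot_left subset_singletonD)
      then show ?thesis using pr Ec ES False EJ unfolding no_block_def by blast
    next
      case True
      then have mJ: "m \<in> J" using J(3) by blast
      then have E: "?E = J \<union> I" unfolding expand_def by simp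
      obtain y where y: "y \<in> J" "y \<noteq> m" using mJ J(4) by blast
      then have yI: "y \<notin> I" using JS by blast
      have Eb: "?E \<in> blocks S T m" using Ec ES E True B(3,4) unfolding blocks_def by auto
      have "card I < card ?E" using E y yI blocksD(7)[OF Eb] by (intro psubset_card_mono) auto
      then have "?E \<notin> F" using maxI by fastforce
      then have "\<not> one ?E" using Eb unfolding F_def by blast
      moreover obtain x where "x \<in> ?E" "f x \<notin> ?E" using l Ec B(3) E unfolding leaky_def by blast
      ultimately show ?thesis unfolding one_def two_out_def by blast
    qed
    then show "two_out ?Y J" using expand_leave(2)[OF CS(1) JI[OF J(1)]] by simp
  qed
  then have "?Y \<in> block_free s ?S ?T" using Y B(8) unfolding block_free_def by blast
  then show ?thesis using Ib q0 K unfolding block_split_def by blast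
qed

text \<open>Both blocks are intervals starting at m, hence nested. If I' were the larger one, its
  image under the contraction of I would be a nontrivial block through m.\<close>

lemma block_split_unique:
  assumes f: "pmatch (insert s S) f" and I: "block_split s S T m f I" and I': "block_split s S T m f I'"
  shows "I' \<subseteq> I"
proof (rule ccontr)
  assume n: "\<not> I' \<subseteq> I"
  have Ib: "I \<in> blocks S T m" and Ib': "I' \<in> blocks S T m" using I I' unfolding block_split_def by auto
  note B = blocksD[OF Ib] and B' = blocksD[OF Ib']
  obtain p where p: "p \<in> I" "f p \<notin> I" "\<And>x. x \<in> I \<Longrightarrow> x \<noteq> p \<Longrightarrow> f x \<in> I"
    "skel m I f p \<in> block_free s (insert m (S - I)) (insert m T)"
    using I unfolding block_split_def by blast
  obtain p' where p': "\<And>x. x \<in> I' \<Longrightarrow> x \<noteq> p' \<Longrightarrow> f x \<in> I'"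
    using I' unfolding block_split_def by blast
  note CS = core_skel_linked[OF B(2,3) S(2) f p(1-3)]
  have "I \<subseteq> I'"
  proof
    fix x assume x: "x \<in> I"
    obtain y where y: "y \<in> I'" "y \<notin> I" using n by blast
    have "x < y"
    proof (rule ccontr)
      assume "\<not> x < y"
      then have "y < x" using x y by (metis linorder_neqE_nat)
      moreover have "m < y" using B'(6)[OF y(1)] y(2) B(3) by (metis le_neq_implies_less)
      ultimately have "y \<in> I" using convex_in_mid[OF B(1,3) x, of y] y B'(2) by blast
      then show False using y by blast
    qed
    moreover have "x = m \<or> m < x" using B(6)[OF x] by linarith
    ultimately show "x \<in> I'" using convex_in_mid[OF B'(1,3) y(1), of x] x B(2) B'(3) by blast
  qed
  let ?J = "insert m (I' - I)"
  have E: "expand m I ?J = I'" using \<open>I \<subseteq> I'\<close> B(3) unfolding expand_def by auto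
  have "convex_in (insert m (S - I)) ?J"
  proof (rule convex_inI)
    fix u w v assume *: "u \<in> ?J" "w \<in> ?J" "v \<in> insert m (S - I)" "u < v" "v < w"
    have "v \<in> I'" using convex_in_mid[OF B'(1), of u w v] * B'(3) m(1) by blast
    then show "v \<in> ?J" using * by blast
  qed (use B'(2) in blast)
  moreover have "?J \<noteq> insert m (S - I)"
  proof
    assume eq: "?J = insert m (S - I)"
    have "x \<in> I'" if "x \<in> S" for x
    proof (cases "x \<in> I")
      case False
      then have "x \<in> ?J" "x \<noteq> m" using eq that B(3) by auto
      then show ?thesis by blast
    qed (use \<open>I \<subseteq> I'\<close> in blast)
    then show False using B'(2,5) by blast
  qed
  moreover have "?J \<noteq> {x}" for x using n B(3) by blast
  ultimately have "two_out (skel m I f p) ?J" using p(4) unfolding block_free_def no_block_def by blast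
  then have "two_out f I'" using expand_leave(2)[OF CS(1), of ?J] E by auto
  then obtain u v where "u \<in> I'" "v \<in> I'" "u \<noteq> v" "f u \<notin> I'" "f v \<notin> I'" unfolding two_out_def by blast
  then show False using p'[of u] p'[of v] by blast
qed

text \<open>Intervals inside I are controlled by K, those disjoint from I or containing I by Y. The
  difficulty lies in an interval J that overlaps I: then J - I and I - J are intervals too, each
  with an outgoing chord, and {p, q} is the only chord between I and its complement.\<close>

lemma block_split_glue:
  assumes I: "I \<in> blocks S T m" and K: "K \<in> conn_set s I"
    and Y: "Y \<in> block_free s (insert m (S - I)) (insert m T)"
  defines "f \<equiv> glue s m I K Y"
  shows "f \<in> block_free s S T" "block_split s S T m f I"
proof -
  note B = blocksD[OF I]
  let ?S = "insert m (S - I)" and ?T = "insert m T"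
  define p where "p = K s"
  define q where "q = Y m"
  have pK: "pmatch (insert s I) K" and lK: "leaky I K" using K unfolding conn_set_def by auto
  have pY: "pmatch (insert s ?S) Y" and lY: "leaky ?S Y" and prY: "no_block ?S ?T Y"
    using Y unfolding block_free_def conn_set_def by auto
  note G = glue_linked[OF B(2,3) S(2) pK pY, folded f_def p_def q_def]
  note L = linkedD[OF G(1)]
  note fD = pmatchD[OF G(2)]
  have JI: "J \<inter> I \<subseteq> {m}" if "convex_in ?S J" for J using convex_in_subset[OF that] by blast
  have inner: "\<exists>x\<in>J. f x \<notin> J" if J: "convex_in S J" "J \<noteq> {}" "J \<subseteq> I" for J
  proof -
    obtain x where x: "x \<in> J" "K x \<notin> J"
      using lK convex_in_restrict[OF J(1,3) B(2)] J(2) unfolding leaky_def by blast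
    show ?thesis
    proof (cases "x = p")
      case True
      then show ?thesis using x L(3,4) J(3) by blast
    next
      case False
      moreover have "x \<in> I" using x J(3) by blast
      ultimately have "f x = K x" using G(5) by blast
      then show ?thesis using x by metis
    qed
  qed
  have whole: "convex_in ?S (insert m (J - I))" "expand m I (insert m (J - I)) = J"
    if J: "convex_in S J" "I \<subseteq> J" for J
  proof -
    show "expand m I (insert m (J - I)) = J" using J(2) B(3) unfolding expand_def by auto
    show "convex_in ?S (insert m (J - I))"
    proof (rule convex_inI)
      show "insert m (J - I) \<subseteq> ?S" using convex_in_subset[OF J(1)] by blast
      fix u w v assume *: "u \<in> insert m (J - I)" "w \<in> insert m (J - I)" "v \<in> ?S" "u < v" "v < w"
      have "v \<in> J" using convex_in_mid[OF J(1), of u w v] * B(3) J(2) m(1) by blast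
      then show "v \<in> insert m (J - I)" using * by blast
    qed
  qed
  have apart: "convex_in ?S J" "expand m I J = J" if J: "convex_in S J" "J \<inter> I = {}" for J
  proof -
    show "expand m I J = J" using J(2) B(3) unfolding expand_def by auto
    show "convex_in ?S J" using convex_in_restrict[OF J(1), of ?S] J convex_in_subset[OF J(1)] m(1) by blast
  qed
  have outer: "\<exists>x\<in>J. f x \<notin> J" if J: "convex_in S J" "J \<noteq> {}" "J \<inter> I = {} \<or> I \<subseteq> J" for J
    using J(3)
  proof
    assume "J \<inter> I = {}"
    note A = apart[OF J(1) this]
    then have "\<exists>x\<in>J. Y x \<notin> J" using lY J(2) unfolding leaky_def by blast
    then show ?thesis using expand_leave(1)[OF G(1) JI[OF A(1)]] A(2) by simp
  next
    assume "I \<subseteq> J"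
    note A = whole[OF J(1) this]
    then have "\<exists>x\<in>insert m (J - I). Y x \<notin> insert m (J - I)" using lY unfolding leaky_def by blast
    then show ?thesis using expand_leave(1)[OF G(1) JI[OF A(1)]] A(2) by simp
  qed
  have lf: "leaky S f" unfolding leaky_def
  proof (intro allI impI, rule ccontr)
    fix J assume J: "convex_in S J" "J \<noteq> {}" and n: "\<not> (\<exists>x\<in>J. f x \<notin> J)"
    have cl: "f x \<in> J" if "x \<in> J" for x using n that by blast
    have c: "\<not> J \<subseteq> I" "J \<inter> I \<noteq> {}" "\<not> I \<subseteq> J" using inner[OF J] outer[OF J] n by blast+
    \<comment> \<open>A closed J is refuted by the position of p: the chord leaving J - I must end
      in I, so p is in J; the chord leaving I - J cannot enter J, so it starts at p and p is not in
      J.\<close>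
    have D1: "convex_in S (J - I)" using convex_in_Diff[OF J(1) B(1) c(3,2)] .
    have D2: "convex_in S (I - J)" using convex_in_Diff[OF B(1) J(1) c(1)] c(2) by blast
    obtain x where x: "x \<in> J" "x \<notin> I" "f x \<notin> J - I" using outer[OF D1] c(1) by blast
    then have "f x \<in> I" using cl by blast
    then have "f x = p" using L(8)[of "f x"] fD(3)[of x] x(2) by auto
    then have pJ: "p \<in> J" using cl x(1) by metis
    obtain y where y: "y \<in> I" "y \<notin> J" "f y \<notin> I - J" using inner[OF D2] c(3) by blast
    have "f y \<notin> J" using cl[of "f y"] fD(3)[of y] y(2) by auto
    then have "f y \<notin> I" using y(3) by blast
    then have "y = p" using L(8)[OF y(1)] by blast
    then show False using pJ y(2) by blast
  qed
  have "no_block S T f" unfolding no_block_def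
  proof (intro allI impI, rule ccontr)
    fix J assume J: "convex_in S J" "J \<noteq> S" "J \<inter> T \<noteq> {}" "\<forall>x. J \<noteq> {x}" and n: "\<not> two_out f J"
    obtain t where t: "t \<in> J" "t \<in> T" "t \<notin> I" using J(3) B(4) by blast
    have u: "x = y" if "x \<in> J" "f x \<notin> J" "y \<in> J" "f y \<notin> J" for x y
      using n that unfolding two_out_def by blast
    have c1: "J \<inter> I \<noteq> {}"
    proof
      assume e: "J \<inter> I = {}"
      note A = apart[OF J(1) e]
      have "J \<noteq> ?S" using e B(3) by blast
      then have "two_out Y J" using prY A(1) J(3,4) unfolding no_block_def by blast
      then show False using n expand_leave(2)[OF G(1) JI[OF A(1)]] A(2) by simp
    qed
    have c2: "\<not> I \<subseteq> J"
    proof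
      assume e: "I \<subseteq> J"
      note A = whole[OF J(1) e]
      have "insert m (J - I) \<noteq> ?S"
      proof
        assume "insert m (J - I) = ?S"
        then have "x \<in> J" if "x \<in> S - I" for x using that B(3) by auto
        then have "S \<subseteq> J" using e by blast
        then show False using J(2) convex_in_subset[OF J(1)] by blast
      qed
      moreover have "insert m (J - I) \<noteq> {x}" for x using t B(3) by blast
      ultimately have "two_out Y (insert m (J - I))" using prY A(1) unfolding no_block_def by blast
      then show False using n expand_leave(2)[OF G(1) JI[OF A(1)]] A(2) by simp
    qed
    have c3: "\<not> J \<subseteq> I" using t by blast
    have D1: "convex_in S (J - I)" using convex_in_Diff[OF J(1) B(1) c2 c1] .
    have D2: "convex_in S (I - J)" using convex_in_Diff[OF B(1) J(1) c3] c1 by blast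
    have D1I: "(J - I) \<inter> I = {}" by blast
    note A = apart[OF D1 D1I]
    obtain z where z: "z \<in> I" "z \<notin> J" "f z \<notin> I - J" using inner[OF D2] c2 by blast
    have zw: "f z \<in> I \<Longrightarrow> f z \<in> J \<and> f (f z) \<notin> J" using z fD(3)[of z] by auto
    have into: "x = q \<and> p \<in> J" if "x \<in> J - I" "f x \<notin> J - I" "f x \<in> J" for x
    proof -
      have "f x \<in> I" using that by blast
      then have "f x = p" using L(8)[of "f x"] fD(3)[of x] that(1) by auto
      then show ?thesis using that fD(3)[of x] L(4) by auto
    qed
    have pz: "f z \<in> I" if "p \<in> J"
      using L(8)[OF z(1)] that z(2) by blast
    show False
    proof (cases "\<exists>x. J - I = {x}")
      case False
      \<comment> \<open>Two chords leave J - I. If one of them ends in J, it is {q, p} and p is in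
        J; then the chord leaving I - J stays inside I and enters J, so it supplies the missing
        outgoing chord of J.\<close>
      have "J - I \<noteq> ?S" using B(3) by blast
      moreover have "(J - I) \<inter> ?T \<noteq> {}" using t by blast
      ultimately have "two_out Y (J - I)" using prY A(1) False unfolding no_block_def by blast
      then have "two_out f (J - I)" using expand_leave(2)[OF G(1) JI[OF A(1)]] A(2) by simp
      then obtain x y where xy: "x \<in> J - I" "y \<in> J - I" "x \<noteq> y" "f x \<notin> J - I" "f y \<notin> J - I"
        unfolding two_out_def by blast
      show False
      proof (cases "f x \<in> J")
        case True
        note xx = into[OF xy(1,4) True]
        have fy: "f y \<notin> J" using into[OF xy(2,5)] xx xy(3) by blast
        have "f z \<in> J" "f (f z) \<notin> J" "f z \<in> I" using zw pz xx by blast+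
        then show False using u[of "f z" y] fy xy(2) by blast
      next
        case False
        note fx = this
        show False
        proof (cases "f y \<in> J")
          case True
          note yy = into[OF xy(2,5) True]
          have "f z \<in> J" "f (f z) \<notin> J" "f z \<in> I" using zw pz yy by blast+
          then show False using u[of "f z" x] fx xy(1) by blast
        next
          case False
          then show False using u[of x y] fx xy by blast
        qed
      qed
    next
      case True
      then obtain t' where "J - I = {t'}" by blast
      moreover have "t \<in> J - I" using t by blast
      ultimately have Jt: "J - I = {t}" by simp
      obtain x where x: "x \<in> J" "x \<notin> I" "f x \<notin> J - I" using outer[OF D1] Jt by blast
      then have "x = t" using Jt by blast
      show False
      proof (cases "f t \<in> J")
        case False
        \<comment> \<open>The chord at t already leaves J, so a chord leaving J \<inter> I must stay
          in J and thus end at t, although the partner of t lies outside J.\<close>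
        have "convex_in S (J \<inter> I)"
        proof (rule convex_inI)
          fix u w v assume *: "u \<in> J \<inter> I" "w \<in> J \<inter> I" "v \<in> S" "u < v" "v < w"
          then show "v \<in> J \<inter> I" using convex_in_mid[OF J(1), of u w v] convex_in_mid[OF B(1), of u w v] by blast
        qed (use B(2) in blast)
        then obtain v where v: "v \<in> J" "v \<in> I" "f v \<notin> J \<inter> I" using inner[of "J \<inter> I"] c1 by blast
        have "f v \<in> J"
          using u[of v t] v t False by blast
        then have "f v = t" using v(3) Jt by blast
        then have "f t \<in> J" using fD(3)[of v] v(1) by metis
        then show False using False by blast
      next
        case True
        \<comment> \<open>Now the chord at t is {q, p}, the only connection between I and the
          outside, so J \<union> I would be closed.\<close>
        have tq: "t = q" "p \<in> J" using into[of t] t(1,3) x(3) \<open>x = t\<close> True by blast+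
        have tI: "convex_in S (J \<union> I)"
        proof (rule convex_inI)
          show "J \<union> I \<subseteq> S" using convex_in_subset[OF J(1)] B(2) by blast
          fix u w v assume *: "u \<in> J \<union> I" "w \<in> J \<union> I" "v \<in> S" "u < v" "v < w"
          obtain i where i: "i \<in> J" "i \<in> I" using c1 by blast
          show "v \<in> J \<union> I"
          proof (rule ccontr)
            assume vn: "v \<notin> J \<union> I"
            then have "v \<noteq> i" using i by blast
            then consider "v < i" | "i < v" by linarith
            then show False
            proof cases
              case 1
              then show ?thesis using convex_in_mid[OF J(1) _ i(1) *(3,4)] convex_in_mid[OF B(1) _ i(2) *(3,4)] *(1) vn by blast
            next
              case 2
              then show ?thesis using convex_in_mid[OF J(1) i(1) _ *(3) _ *(5)] convex_in_mid[OF B(1) i(2) _ *(3) _ *(5)] *(2) vn by blast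
            qed
          qed
        qed
        then obtain v where v: "v \<in> J \<union> I" "f v \<notin> J \<union> I" using lf t(1) unfolding leaky_def by blast
        then have "v \<in> I \<or> v = t" using Jt by blast
        then have "v = p \<or> v = t" using v(2) L(8)[of v] by blast
        moreover have "f t = p" using tq L(5) by simp
        moreover have "f p = t" using tq L(4) by simp
        ultimately have "f v \<in> J" using t(1) tq(2) by metis
        then show False using v(2) by blast
      qed
    qed
  qed
  then show fa: "f \<in> block_free s S T" using lf G(2) S(3) unfolding block_free_def conn_set_def by blast
  have "f p \<notin> I" using L(3,4) by simp
  then show "block_split s S T m f I"
    unfolding block_split_def using I L(1,8) G(3,4) K Y by auto
qed

lemma card_block_free_split:
  "card (block_free s S T) = (\<Sum>I\<in>blocks S T m. card (conn_set s I) * card (block_free s (insert m (S - I)) (insert m T)))"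
proof -
  define X where "X = (SIGMA I:blocks S T m. conn_set s I \<times> block_free s (insert m (S - I)) (insert m T))"
  define g where "g = (\<lambda>(I, K, Y). glue s m I K Y)"
  have fin: "finite (blocks S T m)"
    by (rule finite_subset[of _ "Pow S"]) (use S(1) blocksD in auto)
  have pms: "pmatch (insert s I) K" "pmatch (insert s (insert m (S - I))) Y"
    if "K \<in> conn_set s I" "Y \<in> block_free s (insert m (S - I)) (insert m T)" for I K Y
    using that unfolding block_free_def conn_set_def by auto
  have "bij_betw g X (block_free s S T)" unfolding bij_betw_def
  proof
    show "inj_on g X"
    proof (rule inj_onI)
      fix a b assume a: "a \<in> X" and b: "b \<in> X" and eq: "g a = g b"
      obtain I K Y where a': "a = (I, K, Y)" "I \<in> blocks S T m" "K \<in> conn_set s I" "Y \<in> block_free s (insert m (S - I)) (insert m T)"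
        using a unfolding X_def by auto
      obtain I' K' Y' where b': "b = (I', K', Y')" "I' \<in> blocks S T m" "K' \<in> conn_set s I'" "Y' \<in> block_free s (insert m (S - I')) (insert m T)"
        using b unfolding X_def by auto
      have ga: "g a = glue s m I K Y" unfolding a'(1) g_def by simp
      have gb: "g b = glue s m I' K' Y'" unfolding b'(1) g_def by simp
      note A = block_split_glue[OF a'(2-4), folded ga]
      note B = block_split_glue[OF b'(2-4), folded gb, folded eq]
      have p: "pmatch (insert s S) (g a)" using A(1) unfolding block_free_def conn_set_def by simp
      have II: "I = I'" using block_split_unique[OF p A(2) B(2)] block_split_unique[OF p B(2) A(2)] by blast
      note Bl = blocksD[OF a'(2)]
      note G = glue_linked[OF Bl(2,3) S(2) pms[OF a'(3,4)], folded ga]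
      note G' = glue_linked[OF Bl(2,3) S(2) pms[OF b'(3,4)[folded II]], folded gb[folded II], folded eq]
      \<comment> \<open>The inner end of the outgoing chord is determined by the glued diagram: it
        is the only point of I matched outside I.\<close>
      have "K s = K' s"
      proof (rule ccontr)
        assume "K s \<noteq> K' s"
        then have "g a (K s) \<in> I" using linkedD(8)[OF G'(1) linkedD(1)[OF G(1)]] by blast
        then show False using linkedD(3,4)[OF G(1)] by simp
      qed
      then show "a = b" using G(3,4) G'(3,4) a'(1) b'(1) II by simp
    qed
    show "g ` X = block_free s S T"
    proof
      show "g ` X \<subseteq> block_free s S T"
      proof
        fix f assume "f \<in> g ` X"
        then obtain I K Y where "f = g (I, K, Y)" "I \<in> blocks S T m" "K \<in> conn_set s I" "Y \<in> block_free s (insert m (S - I)) (insert m T)"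
          unfolding X_def by blast
        then show "f \<in> block_free s S T" using block_split_glue(1)[of I K Y] unfolding g_def by simp
      qed
      show "block_free s S T \<subseteq> g ` X"
      proof
        fix f assume f: "f \<in> block_free s S T"
        then obtain I where "block_split s S T m f I" using block_split_exists by blast
        then obtain p where I: "I \<in> blocks S T m" and p: "p \<in> I" "f p \<notin> I" "\<And>x. x \<in> I \<Longrightarrow> x \<noteq> p \<Longrightarrow> f x \<in> I"
          "core s I f p \<in> conn_set s I" "skel m I f p \<in> block_free s (insert m (S - I)) (insert m T)"
          unfolding block_split_def by blast
        have pf: "pmatch (insert s S) f" using f unfolding block_free_def conn_set_def by blast
        note Bl = blocksD[OF I]
        have "f = g (I, core s I f p, skel m I f p)"
          unfolding g_def using core_skel_linked(4)[OF Bl(2,3) S(2) pf p(1-3)] by simp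
        then show "f \<in> g ` X" using I p unfolding X_def by blast
      qed
    qed
  qed
  then have "card (block_free s S T) = card X" using bij_betw_same_card by metis
  also have "\<dots> = (\<Sum>I\<in>blocks S T m. card (conn_set s I \<times> block_free s (insert m (S - I)) (insert m T)))"
    unfolding X_def
  proof (rule card_SigmaI[OF fin], rule ballI)
    fix I assume "I \<in> blocks S T m"
    then have "finite I" by (rule blocksD(7))
    then show "finite (conn_set s I \<times> block_free s (insert m (S - I)) (insert m T))"
      using S(1) by (intro finite_cartesian_product finite_conn_set finite_block_free) auto
  qed
  finally show ?thesis by (simp add: card_cartesian_product)
qed

end

text \<open>A block at t + 1 is {t + 1..t + u}. It exhausts the ground set exactly if u = N, which
  is possible for t = 0 only.\<close>

lemma sum_blocks:
  fixes g :: "nat \<Rightarrow> nat"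
  assumes "t < N"
  shows "(\<Sum>I\<in>blocks {1..N} {1..t} (t + 1). g (card I)) = (\<Sum>u\<in>{u \<in> {1..N - t}. u \<noteq> N}. g u)"
proof -
  let ?h = "\<lambda>u. {t + 1..t + u}"
  have "bij_betw ?h {u \<in> {1..N - t}. u \<noteq> N} (blocks {1..N} {1..t} (t + 1))" unfolding bij_betw_def
  proof
    show "inj_on ?h {u \<in> {1..N - t}. u \<noteq> N}"
      by (rule inj_onI) (auto simp: Icc_eq_Icc)
    show "?h ` {u \<in> {1..N - t}. u \<noteq> N} = blocks {1..N} {1..t} (t + 1)"
    proof
      show "?h ` {u \<in> {1..N - t}. u \<noteq> N} \<subseteq> blocks {1..N} {1..t} (t + 1)"
      proof
        fix I assume "I \<in> ?h ` {u \<in> {1..N - t}. u \<noteq> N}"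
        then obtain u where u: "1 \<le> u" "u \<le> N - t" "u \<noteq> N" "I = ?h u" by auto
        have "I \<subseteq> {1..N}" using u assms by auto
        then have "convex_in {1..N} I" unfolding u(4) by (rule interval_convex_in)
        moreover have "I \<noteq> {1..N}" using u assms by (auto simp: Icc_eq_Icc)
        ultimately show "I \<in> blocks {1..N} {1..t} (t + 1)" using u unfolding blocks_def by auto
      qed
      show "blocks {1..N} {1..t} (t + 1) \<subseteq> ?h ` {u \<in> {1..N - t}. u \<noteq> N}"
      proof
        fix I assume "I \<in> blocks {1..N} {1..t} (t + 1)"
        then have I: "convex_in {1..N} I" "t + 1 \<in> I" "I \<inter> {1..t} = {}" "I \<noteq> {1..N}"
          unfolding blocks_def by auto
        have ne: "I \<noteq> {}" using I(2) by auto
        note J = convex_in_interval[OF I(1) ne]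
        have fin: "finite I" using J(1) finite_atLeastAtMost by metis
        have sub: "I \<subseteq> {1..N}" using I(1) by (rule convex_in_subset)
        have "Min I \<le> t + 1" using Min_le[OF fin I(2)] .
        moreover have "\<not> Min I \<le> t"
        proof
          assume "Min I \<le> t"
          moreover have "1 \<le> Min I" using J(2) sub atLeastAtMost_iff by blast
          ultimately have "Min I \<in> {1..t}" by simp
          then show False using J(2) I(3) by blast
        qed
        ultimately have mn: "Min I = t + 1" by linarith
        have mx: "t + 1 \<le> Max I" "Max I \<le> N" using Max_ge[OF fin I(2)] J(3) sub by auto
        define u where "u = Max I - t"
        have Iu: "I = ?h u" using J(1) mn mx unfolding u_def by simp
        moreover have "u \<noteq> N"
        proof
          assume "u = N"
          then have "t = 0" using mx assms unfolding u_def by linarith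
          then show False using Iu I(4) \<open>u = N\<close> by simp
        qed
        moreover have "u \<in> {1..N - t}" using mx unfolding u_def by auto
        ultimately show "I \<in> ?h ` {u \<in> {1..N - t}. u \<noteq> N}" by blast
      qed
    qed
  qed
  then have "(\<Sum>I\<in>blocks {1..N} {1..t} (t + 1). g (card I)) = (\<Sum>u\<in>{u \<in> {1..N - t}. u \<noteq> N}. g (card (?h u)))"
    by (rule sum.reindex_bij_betw[symmetric])
  then show ?thesis by simp
qed

text \<open>Contracting a block of u points leaves N - u + 1 points, of which one more is treated.
  The excluded value u = N may be added to the sum, because \<open>block_free\<close> rules out a
  ground set with one point besides the root.\<close>

lemma block_free_num_rec:
  assumes "t < N" "N \<noteq> 1"
  shows "block_free_num N t = (\<Sum>u=1..N - t. conn_num u * block_free_num (N - u + 1) (t + 1))"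
proof -
  let ?S = "{1..N}" and ?T = "{1..t}" and ?m = "t + 1"
  have st: "finite ?S" "0 \<notin> ?S" "card ?S \<noteq> 1" "?T \<subseteq> ?S" "?m \<in> ?S" "?m \<notin> ?T"
    using assms by auto
  have mm: "\<forall>x\<in>?S. x \<notin> ?T \<longrightarrow> ?m \<le> x" by auto
  note B = blocksD[OF st mm]
  have "block_free_num N t = (\<Sum>I\<in>blocks ?S ?T ?m. card (conn_set 0 I) * card (block_free 0 (insert ?m (?S - I)) (insert ?m ?T)))"
    unfolding block_free_num_def by (rule card_block_free_split[OF st mm])
  also have "\<dots> = (\<Sum>I\<in>blocks ?S ?T ?m. conn_num (card I) * block_free_num (N - card I + 1) (t + 1))"
  proof (rule sum.cong[OF refl])
    fix I assume I: "I \<in> blocks ?S ?T ?m"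
    note BI = B[OF I]
    have 1: "card (conn_set 0 I) = conn_num (card I)"
      by (rule card_conn_set[OF BI(7)]) (use BI(2) in auto)
    have 2: "card (block_free 0 (insert ?m (?S - I)) (insert ?m ?T)) = block_free_num (card (insert ?m (?S - I))) (card (insert ?m ?T))"
    proof (rule card_block_free)
      have "?T \<subseteq> ?S - I" using BI(4) st(4) by blast
      then show "insert ?m ?T \<subseteq> insert ?m (?S - I)" by blast
      fix x y assume "x \<in> insert ?m ?T" "y \<in> insert ?m (?S - I)" "y < x"
      then show "y \<in> insert ?m ?T" using st(5) by auto
    qed (use st in auto)
    have "card (insert ?m (?S - I)) = N - card I + 1" "card (insert ?m ?T) = t + 1"
      using BI(2,3,7) by (auto simp: card_Diff_subset)
    then show "card (conn_set 0 I) * card (block_free 0 (insert ?m (?S - I)) (insert ?m ?T)) = conn_num (card I) * block_free_num (N - card I + 1) (t + 1)"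
      using 1 2 by simp
  qed
  also have "\<dots> = (\<Sum>u\<in>{u \<in> {1..N - t}. u \<noteq> N}. conn_num u * block_free_num (N - u + 1) (t + 1))"
    by (rule sum_blocks[OF assms(1)])
  also have "\<dots> = (\<Sum>u=1..N - t. conn_num u * block_free_num (N - u + 1) (t + 1))"
  proof (rule sum.mono_neutral_left)
    have "block_free_num 1 t' = 0" for t' unfolding block_free_num_def block_free_def by simp
    then show "\<forall>u\<in>{1..N - t} - {u \<in> {1..N - t}. u \<noteq> N}. conn_num u * block_free_num (N - u + 1) (t + 1) = 0" by auto
  qed auto
  finally show ?thesis .
qed

section \<open>The block decomposition in terms of power series\<close>

definition B_fps :: "rat fps" where "B_fps = Abs_fps (\<lambda>n. of_nat (B_num n))"
text \<open>The number of 2-connected diagrams with k + 1 chords: 2 * k + 1 points besides the root,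
  all of them treated.\<close>

definition conn2_num :: "nat \<Rightarrow> nat" where "conn2_num k = block_free_num (2 * k + 1) (2 * k + 1)"

lemma block_free_num_rec_odd:
  assumes "t \<le> 2 * n" "n \<ge> 1"
  shows "block_free_num (2 * n + 1) t = (\<Sum>j\<in>{j. j \<le> n \<and> t \<le> 2 * (n - j)}. B_num j * block_free_num (2 * (n - j) + 1) (t + 1))"
proof -
  let ?N = "2 * n + 1" and ?J = "{j. j \<le> n \<and> t \<le> 2 * (n - j)}"
  let ?g = "\<lambda>u. conn_num u * block_free_num (?N - u + 1) (t + 1)"
  have "block_free_num ?N t = (\<Sum>u=1..?N - t. ?g u)" by (rule block_free_num_rec) (use assms in auto)
  also have "\<dots> = (\<Sum>u\<in>(\<lambda>j. 2 * j + 1) ` ?J. ?g u)"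
  proof (rule sum.mono_neutral_right)
    show "(\<lambda>j. 2 * j + 1) ` ?J \<subseteq> {1..?N - t}" by auto
    show "\<forall>u\<in>{1..?N - t} - (\<lambda>j. 2 * j + 1) ` ?J. ?g u = 0"
    proof
      fix u assume u: "u \<in> {1..?N - t} - (\<lambda>j. 2 * j + 1) ` ?J"
      have "even u"
      proof (rule ccontr)
        assume "odd u"
        then obtain j where "u = 2 * j + 1" by (elim oddE)
        then show False using u assms by auto
      qed
      then show "?g u = 0" by (simp add: conn_num_even)
    qed
  qed simp
  also have "\<dots> = (\<Sum>j\<in>?J. ?g (2 * j + 1))"
    by (rule sum.reindex_cong[OF _ refl refl]) (auto simp: inj_on_def)
  also have "\<dots> = (\<Sum>j\<in>?J. B_num j * block_free_num (2 * (n - j) + 1) (t + 1))"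
  proof (rule sum.cong[OF refl])
    fix j assume "j \<in> ?J"
    then have "?N - (2 * j + 1) + 1 = 2 * (n - j) + 1" by auto
    then show "?g (2 * j + 1) = B_num j * block_free_num (2 * (n - j) + 1) (t + 1)" unfolding B_num_def by simp
  qed
  finally show ?thesis .
qed

text \<open>Processing the points of \<open>S\<close> from left to right, each point independently carries a factor \<open>B\<close>.\<close>

lemma block_free_num_closed_form:
  assumes "t \<le> 2 * n + 1" "n \<ge> 1"
  shows "of_nat (block_free_num (2 * n + 1) t) =
    (\<Sum>k\<in>{k. k \<le> n \<and> t \<le> 2 * k + 1}. of_nat (conn2_num k) * fps_nth (B_fps ^ (2 * k + 1 - t)) (n - k))"
  using assms
proof (induction "2 * n + 1 - t" arbitrary: n t rule: less_induct)
  case less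
  let ?K = "\<lambda>n t. {k. k \<le> n \<and> t \<le> 2 * k + (1::nat)}"
  let ?J = "{j. j \<le> n \<and> t \<le> 2 * (n - j)}" and ?K' = "{k. k \<le> n \<and> t \<le> 2 * k}"
  have e0: "block_free_num 1 u = 0" for u unfolding block_free_num_def block_free_def by simp
  have e00: "conn2_num 0 = 0" unfolding conn2_num_def using e0 by simp
  show ?case
  proof (cases "t = 2 * n + 1")
    case True
    then have "?K n t = {n}" by auto
    then show ?thesis using True unfolding conn2_num_def by simp
  next
    case False
    then have t: "t \<le> 2 * n" using less(2) by linarith
    \<comment> \<open>For j = n the contracted diagram has one point besides the root and the
      induction hypothesis does not cover it; both sides are zero there.\<close>
    have IH: "of_nat (block_free_num (2 * (n - j) + 1) (t + 1)) =
      (\<Sum>k\<in>?K (n - j) (t + 1). of_nat (conn2_num k) * fps_nth (B_fps ^ (2 * k - t)) (n - j - k))" if j: "j \<in> ?J" for j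
    proof (cases "n - j = 0")
      case True
      then show ?thesis using e0[of "t + 1"] e00 by (auto intro!: sum.neutral[symmetric])
    next
      case False
      have "of_nat (block_free_num (2 * (n - j) + 1) (t + 1)) =
        (\<Sum>k\<in>?K (n - j) (t + 1). of_nat (conn2_num k) * fps_nth (B_fps ^ (2 * k + 1 - (t + 1))) (n - j - k))"
        by (rule less(1)) (use t j False in auto)
      then show ?thesis by simp
    qed
    have "of_nat (block_free_num (2 * n + 1) t) = (\<Sum>j\<in>?J. of_nat (B_num j) * of_nat (block_free_num (2 * (n - j) + 1) (t + 1)) :: rat)"
      unfolding block_free_num_rec_odd[OF t less(3)] by simp
    also have "\<dots> = (\<Sum>j\<in>?J. \<Sum>k\<in>{k \<in> ?K'. j + k \<le> n}.
        of_nat (conn2_num k) * (fps_nth B_fps j * fps_nth (B_fps ^ (2 * k - t)) (n - k - j)))"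
    proof (rule sum.cong[OF refl])
      fix j assume j: "j \<in> ?J"
      then have "?K (n - j) (t + 1) = {k \<in> ?K'. j + k \<le> n}" by auto
      moreover have "n - j - k = n - k - j" for k by simp
      ultimately show "of_nat (B_num j) * of_nat (block_free_num (2 * (n - j) + 1) (t + 1)) = (\<Sum>k\<in>{k \<in> ?K'. j + k \<le> n}.
        of_nat (conn2_num k) * (fps_nth B_fps j * fps_nth (B_fps ^ (2 * k - t)) (n - k - j)))"
        unfolding IH[OF j] sum_distrib_left by (intro sum.cong) (simp_all add: B_fps_def)
    qed
    also have "\<dots> = (\<Sum>k\<in>?K'. \<Sum>j\<in>{j \<in> ?J. j + k \<le> n}.
        of_nat (conn2_num k) * (fps_nth B_fps j * fps_nth (B_fps ^ (2 * k - t)) (n - k - j)))"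
      by (rule sum.swap_restrict) auto
    also have "\<dots> = (\<Sum>k\<in>?K'. of_nat (conn2_num k) * fps_nth (B_fps ^ (2 * k + 1 - t)) (n - k))"
    proof (rule sum.cong[OF refl])
      fix k assume k: "k \<in> ?K'"
      then have J: "{j \<in> ?J. j + k \<le> n} = {0..n - k}" by auto
      \<comment> \<open>The exponent is the number of points of the 2-connected core still to be
        treated; the block at the present point contributes one factor B.\<close>
      have "2 * k + 1 - t = Suc (2 * k - t)" using k by auto
      then have "fps_nth (B_fps ^ (2 * k + 1 - t)) (n - k) = fps_nth (B_fps * B_fps ^ (2 * k - t)) (n - k)" by simp
      then show "(\<Sum>j\<in>{j \<in> ?J. j + k \<le> n}.
        of_nat (conn2_num k) * (fps_nth B_fps j * fps_nth (B_fps ^ (2 * k - t)) (n - k - j)))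
        = of_nat (conn2_num k) * fps_nth (B_fps ^ (2 * k + 1 - t)) (n - k)"
        unfolding J fps_mult_nth sum_distrib_left[symmetric] by simp
    qed
    also have "\<dots> = (\<Sum>k\<in>?K n t. of_nat (conn2_num k) * fps_nth (B_fps ^ (2 * k + 1 - t)) (n - k))"
    proof (rule sum.mono_neutral_left)
      show "\<forall>k\<in>?K n t - ?K'. of_nat (conn2_num k) * fps_nth (B_fps ^ (2 * k + 1 - t)) (n - k) = 0"
      proof
        fix k assume "k \<in> ?K n t - ?K'"
        then have "2 * k + 1 = t" "n - k > 0" using t by auto
        then show "of_nat (conn2_num k) * fps_nth (B_fps ^ (2 * k + 1 - t)) (n - k) = 0" by simp
      qed
    qed auto
    finally show ?thesis .
  qed
qed

section \<open>From sets of chords to matchings on {1..2n}\<close>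

lemma pairing_chords:
  "{M. chord_diagram n M} = {M. pairing {1..2 * n} M}"
  unfolding chord_diagram_def pairing_def
  by (intro Collect_cong conj_cong refl ball_cong) (metis doubleton_eq_iff insert_commute linorder_neqE_nat less_irrefl)

lemma card_chord_diagrams:
  assumes "\<And>f. pmatch {1..2 * n} f \<Longrightarrow> P (edges {1..2 * n} f) \<longleftrightarrow> Q f"
  shows "card {M. chord_diagram n M \<and> P M} = card {f. pmatch {1..2 * n} f \<and> Q f}"
proof -
  let ?S = "{1..2 * n}"
  have "bij_betw (edges ?S) {f \<in> {f. pmatch ?S f}. Q f} {M \<in> {M. pairing ?S M}. P M}"
    unfolding bij_betw_def
  proof
    show "inj_on (edges ?S) {f \<in> {f. pmatch ?S f}. Q f}"
      by (rule inj_on_subset[OF edges_inj]) blast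
    show "edges ?S ` {f \<in> {f. pmatch ?S f}. Q f} = {M \<in> {M. pairing ?S M}. P M}"
    proof (intro equalityI subsetI)
      fix M assume "M \<in> {M \<in> {M. pairing ?S M}. P M}"
      then have M: "pairing ?S M" "P M" by blast+
      obtain f where "pmatch ?S f" "edges ?S f = M" using pairing_obtain[OF M(1)] by blast
      then show "M \<in> edges ?S ` {f \<in> {f. pmatch ?S f}. Q f}" using M(2) assms[of f] by blast
    next
      fix M assume "M \<in> edges ?S ` {f \<in> {f. pmatch ?S f}. Q f}"
      then obtain f where "pmatch ?S f" "Q f" "M = edges ?S f" by blast
      then show "M \<in> {M \<in> {M. pairing ?S M}. P M}" using pairing_edges[of ?S f] assms[of f] by blast
    qed
  qed
  then have "card {f \<in> {f. pmatch ?S f}. Q f} = card {M \<in> {M. pairing ?S M}. P M}"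
    by (rule bij_betw_same_card)
  moreover have "{M \<in> {M. pairing ?S M}. P M} = {M. chord_diagram n M \<and> P M}"
    using pairing_chords[of n] by blast
  ultimately show ?thesis by simp
qed

lemma chord_diagram_0: "chord_diagram 0 M \<Longrightarrow> M = {}"
proof (rule equals0I)
  fix c assume M: "chord_diagram 0 M" and c: "c \<in> M"
  then have "\<exists>a b. a < b \<and> c = {a, b}" unfolding chord_diagram_def by simp
  then obtain a b where "c = {a, b}" by blast
  moreover have "\<Union>M = {}" using M unfolding chord_diagram_def by simp
  ultimately show False using c by blast
qed

lemma C_conn_B: "C_conn = fps_X * B_fps"
proof (rule fps_ext)
  fix n
  show "fps_nth C_conn n = fps_nth (fps_X * B_fps) n"
  proof (cases n)
    case 0
    have "{M. chord_diagram 0 M \<and> chords_connected M} = {}"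
      using chord_diagram_0 unfolding chords_connected_def by blast
    then show ?thesis using 0 unfolding C_conn_def by (simp del: Collect_empty_eq)
  next
    case (Suc k)
    let ?S = "{2..2 * n}"
    have S: "{1..2 * n} = insert 1 ?S" using Suc by auto
    have lt: "\<forall>x\<in>?S. 1 < x" by auto
    have "card {M. chord_diagram n M \<and> chords_connected M} = card {f. pmatch {1..2 * n} f \<and> leaky ?S f}"
    proof (rule card_chord_diagrams)
      fix f assume p: "pmatch {1..2 * n} f"
      show "chords_connected (edges {1..2 * n} f) \<longleftrightarrow> leaky ?S f"
        using chords_connected_iff[OF _ p] interval_conn_iff_leaky[OF lt, of f] p unfolding S by simp
    qed
    also have "\<dots> = card (conn_set 1 ?S)" unfolding conn_set_def S by simp
    also have "\<dots> = conn_num (card ?S)" by (rule card_conn_set) auto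
    also have "card ?S = 2 * k + 1" using Suc by simp
    finally show ?thesis using Suc unfolding C_conn_def B_fps_def B_num_def by simp
  qed
qed

lemma C_2conn_nth: "fps_nth C_2conn (Suc k) = of_nat (conn2_num k)" "fps_nth C_2conn 0 = 0"
proof -
  have "{M. chord_diagram 0 M \<and> chords_2connected M} = {}"
    using chord_diagram_0 unfolding chords_2connected_def chords_connected_def by blast
  then show "fps_nth C_2conn 0 = 0" unfolding C_2conn_def by (simp del: Collect_empty_eq)
  let ?n = "Suc k"
  let ?S = "{2..2 * ?n}"
  have S: "{1..2 * ?n} = insert 1 ?S" by auto
  have lt: "\<forall>x\<in>?S. 1 < x" by auto
  have "card {M. chord_diagram ?n M \<and> chords_2connected M} = card {f. pmatch {1..2 * ?n} f \<and> f \<in> block_free 1 ?S ?S}"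
  proof (rule card_chord_diagrams)
    fix f assume p: "pmatch {1..2 * ?n} f"
    show "chords_2connected (edges {1..2 * ?n} f) \<longleftrightarrow> f \<in> block_free 1 ?S ?S"
      using chords_2connected_iff[OF _ lt, of f] p unfolding S by simp
  qed
  also have "{f. pmatch {1..2 * ?n} f \<and> f \<in> block_free 1 ?S ?S} = block_free 1 ?S ?S" unfolding block_free_def conn_set_def S by auto
  also have "card (block_free 1 ?S ?S) = block_free_num (card ?S) (card ?S)" by (rule card_block_free) auto
  also have "card ?S = 2 * k + 1" by simp
  finally show "fps_nth C_2conn (Suc k) = of_nat (conn2_num k)" unfolding C_2conn_def conn2_num_def by simp
qed

text \<open>With t = 0 no block is forbidden, so \<open>block_free\<close> differs from
  \<open>conn_set\<close> in the size condition only, and n \<ge> 1 meets it.\<close>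

lemma B_num_conn2_num:
  assumes "n \<ge> 1"
  shows "of_nat (B_num n) = (\<Sum>k\<le>n. of_nat (conn2_num k) * fps_nth (B_fps ^ (2 * k + 1)) (n - k))"
proof -
  have "conn_set 0 {1..2 * n + 1} = block_free 0 {1..2 * n + 1} {1..0}"
    unfolding block_free_def no_block_def using assms by auto
  then have "B_num n = block_free_num (2 * n + 1) 0" unfolding B_num_def conn_num_def block_free_num_def by simp
  then show ?thesis using block_free_num_closed_form[of 0 n] assms by (simp add: atMost_def)
qed

text \<open>All endpoints of a 2-connected core with k + 1 chords except the root carry a factor B,
  so B - 1 is the sum of the terms \<open>conn2_num k\<close> x^k B^(2k+1). One further factor xB
  turns x^k B^(2k+1) into the power k + 1 of xB^2.\<close>

lemma C_2conn_compose: "C_2conn oo (fps_X * B_fps ^ 2) = fps_X * (B_fps * (B_fps - 1))"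
proof (rule fps_ext)
  fix n
  have B0: "fps_nth B_fps 0 = 1" unfolding B_fps_def by (simp add: B_num_0)
  have inner: "B_fps - 1 = Abs_fps (\<lambda>n. \<Sum>k\<le>n. of_nat (conn2_num k) * fps_nth (B_fps ^ (2 * k + 1)) (n - k))" (is "_ = ?R")
  proof (rule fps_ext)
    fix n
    show "fps_nth (B_fps - 1) n = fps_nth ?R n"
    proof (cases "n = 0")
      case True
      have "conn2_num 0 = 0" unfolding conn2_num_def block_free_num_def block_free_def by simp
      then show ?thesis using True B0 by simp
    next
      case False
      then have "fps_nth (B_fps - 1) n = of_nat (B_num n)" unfolding B_fps_def by simp
      then show ?thesis using B_num_conn2_num[of n] False by simp
    qed
  qed
  show "fps_nth (C_2conn oo (fps_X * B_fps ^ 2)) n = fps_nth (fps_X * (B_fps * (B_fps - 1))) n"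
  proof (cases n)
    case 0
    then show ?thesis by (simp add: C_2conn_nth)
  next
    case (Suc m)
    have pw: "(fps_X * B_fps ^ 2) ^ i = fps_X ^ i * B_fps ^ (2 * i)" for i
      by (simp add: power_mult_distrib power_mult)
    have "fps_nth (C_2conn oo (fps_X * B_fps ^ 2)) n = (\<Sum>i\<in>{0..n}. fps_nth C_2conn i * fps_nth (fps_X ^ i * B_fps ^ (2 * i)) n)"
      unfolding fps_compose_nth pw ..
    also have "\<dots> = (\<Sum>k\<le>m. of_nat (conn2_num k) * fps_nth (B_fps ^ (2 * Suc k)) (m - k))"
    proof -
      have "fps_nth (fps_X ^ Suc k * G) (Suc m) = fps_nth G (m - k)" if "k \<le> m" for k and G :: "rat fps"
        using that by (simp only: fps_X_power_mult_nth) simp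
      then show ?thesis
        unfolding Suc atLeast0AtMost sum.atMost_Suc_shift C_2conn_nth
        by (simp only: mult_zero_left add_0_left) (intro sum.cong refl, simp)
    qed
    also have "\<dots> = fps_nth (B_fps * ?R) m"
    proof -
      have "fps_nth (B_fps * ?R) m = (\<Sum>i\<in>{0..m}. \<Sum>k\<in>{..m - i}. fps_nth B_fps i * (of_nat (conn2_num k) * fps_nth (B_fps ^ (2 * k + 1)) (m - i - k)))"
        unfolding fps_mult_nth by (simp add: sum_distrib_left)
      also have "\<dots> = (\<Sum>i\<in>{0..m}. \<Sum>k\<in>{k \<in> {..m}. i + k \<le> m}. fps_nth B_fps i * (of_nat (conn2_num k) * fps_nth (B_fps ^ (2 * k + 1)) (m - k - i)))"
      proof (rule sum.cong[OF refl])
        fix i assume "i \<in> {0..m}"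
        then have "{..m - i} = {k \<in> {..m}. i + k \<le> m}" by auto
        moreover have "m - i - k = m - k - i" for k by simp
        ultimately show "(\<Sum>k\<in>{..m - i}. fps_nth B_fps i * (of_nat (conn2_num k) * fps_nth (B_fps ^ (2 * k + 1)) (m - i - k))) = (\<Sum>k\<in>{k \<in> {..m}. i + k \<le> m}. fps_nth B_fps i * (of_nat (conn2_num k) * fps_nth (B_fps ^ (2 * k + 1)) (m - k - i)))"
          by simp
      qed
      also have "\<dots> = (\<Sum>k\<in>{..m}. \<Sum>i\<in>{i \<in> {0..m}. i + k \<le> m}. fps_nth B_fps i * (of_nat (conn2_num k) * fps_nth (B_fps ^ (2 * k + 1)) (m - k - i)))"
        by (rule sum.swap_restrict) auto
      also have "\<dots> = (\<Sum>k\<le>m. of_nat (conn2_num k) * fps_nth (B_fps * B_fps ^ (2 * k + 1)) (m - k))"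
      proof (rule sum.cong[OF refl])
        fix k assume "k \<in> {..m}"
        then have "{i \<in> {0..m}. i + k \<le> m} = {0..m - k}" by auto
        then show "(\<Sum>i\<in>{i \<in> {0..m}. i + k \<le> m}. fps_nth B_fps i * (of_nat (conn2_num k) * fps_nth (B_fps ^ (2 * k + 1)) (m - k - i))) = of_nat (conn2_num k) * fps_nth (B_fps * B_fps ^ (2 * k + 1)) (m - k)"
          unfolding fps_mult_nth sum_distrib_left by (simp add: mult_ac)
      qed
      finally show ?thesis by simp
    qed
    finally show ?thesis unfolding inner[symmetric] Suc by simp
  qed
qed

section \<open>Fermion lines\<close>

text \<open>The \<open>\<sigma>\<close>-cycle of the extra vertex \<open>r\<close> is the open fermion line. In \<open>Bset\<close> there is no external boson
  and \<open>r\<close> is fixed by \<open>\<alpha>\<close>; in \<open>Wset\<close> the external boson is the edge at \<open>r\<close>, which is not counted as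
  leaving a set. Asking for two leaving edges excludes disconnected graphs and separating boson edges at once.\<close>

definition outs2 :: "('a \<Rightarrow> 'a) \<Rightarrow> 'a \<Rightarrow> 'a set \<Rightarrow> bool" where
  "outs2 \<alpha> r A \<longleftrightarrow> (\<exists>x\<in>A. \<exists>y\<in>A. x \<noteq> y \<and> \<alpha> x \<notin> insert r A \<and> \<alpha> y \<notin> insert r A)"

text \<open>A finite \<sigma>-closed set without r is a union of fermion cycles off the line. No
  fermion edge connects it to anything else, so its attachment to the rest is measured by boson
  edges alone.\<close>

definition good :: "('a \<Rightarrow> 'a) \<Rightarrow> ('a \<Rightarrow> 'a) \<Rightarrow> 'a \<Rightarrow> 'a set \<Rightarrow> bool" where
  "good \<sigma> \<alpha> r S \<longleftrightarrow> (\<forall>A. A \<subseteq> S \<longrightarrow> A \<noteq> {} \<longrightarrow> (\<forall>x\<in>A. \<sigma> x \<in> A) \<longrightarrow> outs2 \<alpha> r A)"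

definition Bset :: "'a set \<Rightarrow> 'a \<Rightarrow> (('a \<Rightarrow> 'a) \<times> ('a \<Rightarrow> 'a)) set" where
  "Bset S r = {(\<sigma>, \<alpha>). \<sigma> permutes insert r S \<and> pmatch S \<alpha> \<and> good \<sigma> \<alpha> r S}"

definition Wset :: "'a set \<Rightarrow> 'a \<Rightarrow> (('a \<Rightarrow> 'a) \<times> ('a \<Rightarrow> 'a)) set" where
  "Wset S r = {(\<sigma>, \<alpha>). \<sigma> permutes insert r S \<and> pmatch (insert r S) \<alpha> \<and> good \<sigma> \<alpha> r S}"

lemma outs2I: "x \<in> A \<Longrightarrow> y \<in> A \<Longrightarrow> x \<noteq> y \<Longrightarrow> \<alpha> x \<notin> insert r A \<Longrightarrow> \<alpha> y \<notin> insert r A \<Longrightarrow> outs2 \<alpha> r A"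
  unfolding outs2_def by blast

lemma outs2E:
  assumes "outs2 \<alpha> r A"
  obtains x y where "x \<in> A" "y \<in> A" "x \<noteq> y" "\<alpha> x \<notin> insert r A" "\<alpha> y \<notin> insert r A"
  using assms unfolding outs2_def by blast

lemma goodD: "good \<sigma> \<alpha> r S \<Longrightarrow> A \<subseteq> S \<Longrightarrow> A \<noteq> {} \<Longrightarrow> (\<And>x. x \<in> A \<Longrightarrow> \<sigma> x \<in> A) \<Longrightarrow> outs2 \<alpha> r A"
  unfolding good_def by blast

lemma goodI: "(\<And>A. A \<subseteq> S \<Longrightarrow> A \<noteq> {} \<Longrightarrow> (\<And>x. x \<in> A \<Longrightarrow> \<sigma> x \<in> A) \<Longrightarrow> outs2 \<alpha> r A) \<Longrightarrow> good \<sigma> \<alpha> r S"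
  unfolding good_def by blast

lemma finite_Bset: "finite S \<Longrightarrow> finite (Bset S r)"
  by (rule finite_subset[OF _ finite_cartesian_product[OF finite_permutations[of "insert r S"] finite_pmatch[of S]]])
    (auto simp: Bset_def)

lemma finite_Wset: "finite S \<Longrightarrow> finite (Wset S r)"
  by (rule finite_subset[OF _ finite_cartesian_product[OF finite_permutations[of "insert r S"] finite_pmatch[of "insert r S"]]])
    (auto simp: Wset_def)

text \<open>An injection of a finite set into itself is onto, so closure under a permutation and
  under its inverse coincide.\<close>

lemma permutes_closed_iff:
  assumes p: "p permutes X" and A: "finite A"
  shows "(\<forall>x\<in>A. p x \<in> A) \<longleftrightarrow> (\<forall>x. p x \<in> A \<longrightarrow> x \<in> A)"
proof
  assume "\<forall>x\<in>A. p x \<in> A"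
  then have "p ` A \<subseteq> A" by blast
  then have "p ` A = A" using endo_inj_surj[OF A] inj_on_subset[OF permutes_inj[OF p]] by blast
  then show "\<forall>x. p x \<in> A \<longrightarrow> x \<in> A" using permutes_inj[OF p] by (metis image_iff injD)
next
  assume *: "\<forall>x. p x \<in> A \<longrightarrow> x \<in> A"
  have "inv p ` A \<subseteq> A"
  proof
    fix y assume "y \<in> inv p ` A"
    then obtain x where "x \<in> A" "y = inv p x" by blast
    then have "p y \<in> A" using permutes_inverses(1)[OF p] by simp
    then show "y \<in> A" using * by blast
  qed
  moreover have "inj_on (inv p) A"
    using inj_on_subset[OF permutes_inj[OF permutes_inv[OF p]]] by blast
  ultimately have eq: "inv p ` A = A" using endo_inj_surj[OF A] by blast
  show "\<forall>x\<in>A. p x \<in> A"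
  proof
    fix x assume "x \<in> A"
    then obtain z where z: "z \<in> A" "x = inv p z" using eq by blast
    then show "p x \<in> A" using permutes_inverses(1)[OF p] by simp
  qed
qed

text \<open>The vertex b with the external boson is spliced out of its fermion cycle and can be put
  back before any c in insert r (S - {b}), which gives card S places. It never forms a cycle of its
  own: its only boson edge goes to r and does not count as leaving {b}.\<close>

lemma card_Wset:
  assumes S: "finite S" "r \<notin> S"
  shows "card (Wset S r) = (\<Sum>b\<in>S. card S * card (Bset (S - {b}) r))"
proof -
  define X where "X = (SIGMA b:S. insert r (S - {b}) \<times> Bset (S - {b}) r)"
  define ext where "ext = (\<lambda>b \<alpha> x. if x = b then r else if x = r then b else (\<alpha> x :: 'a))"
  \<comment> \<open>If \<sigma> fixes b, then \<open>transpose b c \<circ> \<sigma>\<close> inserts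
    b immediately before c; applied once more, the transposition splices b out again.\<close>
  define g where "g = (\<lambda>(b, c, \<sigma> :: 'a \<Rightarrow> 'a, \<alpha>). (transpose b c \<circ> \<sigma>, ext b \<alpha>))"
  define h where "h = (\<lambda>(\<sigma> :: 'a \<Rightarrow> 'a, \<alpha>). (\<alpha> r, \<sigma> (\<alpha> r), transpose (\<alpha> r) (\<sigma> (\<alpha> r)) \<circ> \<sigma>, restr (S - {\<alpha> r}) \<alpha>))"
  have "bij_betw g X (Wset S r)"
  proof (rule bij_betw_byWitness[where f' = h])
    show "\<forall>u\<in>X. h (g u) = u"
    proof
      fix u assume "u \<in> X"
      then obtain b c \<sigma> \<alpha> where u: "u = (b, c, \<sigma>, \<alpha>)" "b \<in> S" "(\<sigma>, \<alpha>) \<in> Bset (S - {b}) r"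
        unfolding X_def by auto
      have p: "\<sigma> permutes insert r (S - {b})" "pmatch (S - {b}) \<alpha>" using u(3) unfolding Bset_def by auto
      have br: "b \<noteq> r" using u(2) S by auto
      have "\<sigma> b = b" using permutes_not_in[OF p(1)] br by auto
      then have sb: "(transpose b c \<circ> \<sigma>) b = c" by simp
      have "restr (S - {b}) (ext b \<alpha>) = \<alpha>"
        using pmatchD(4)[OF p(2)] S(2) unfolding restr_def ext_def by (auto simp: fun_eq_iff)
      moreover have "ext b \<alpha> r = b" using br unfolding ext_def by auto
      moreover have "transpose b c \<circ> (transpose b c \<circ> \<sigma>) = \<sigma>" by (simp add: fun_eq_iff)
      ultimately show "h (g u) = u" unfolding u(1) g_def h_def using sb by simp
    qed
    show "\<forall>w\<in>Wset S r. g (h w) = w"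
    proof
      fix w assume "w \<in> Wset S r"
      then obtain \<sigma> \<alpha> where w: "w = (\<sigma>, \<alpha>)" "pmatch (insert r S) \<alpha>" unfolding Wset_def by auto
      note aD = pmatchD[OF w(2)]
      have "ext (\<alpha> r) (restr (S - {\<alpha> r}) \<alpha>) x = \<alpha> x" for x
        using aD(3)[of r] aD(4)[of x] unfolding ext_def restr_def by auto
      moreover have "transpose b c \<circ> (transpose b c \<circ> \<sigma>) = \<sigma>" for b c by (simp add: fun_eq_iff)
      ultimately show "g (h w) = w" unfolding w(1) g_def h_def by (simp add: fun_eq_iff)
    qed
    show "g ` X \<subseteq> Wset S r"
    proof
      fix w assume "w \<in> g ` X"
      then obtain b c \<sigma>' \<alpha>' where w: "w = (transpose b c \<circ> \<sigma>', ext b \<alpha>')" and b: "b \<in> S"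
        and c: "c \<in> insert r (S - {b})" and B: "(\<sigma>', \<alpha>') \<in> Bset (S - {b}) r"
        unfolding X_def g_def by auto
      let ?\<sigma> = "transpose b c \<circ> \<sigma>'" and ?\<alpha> = "ext b \<alpha>'"
      have p: "\<sigma>' permutes insert r (S - {b})" "pmatch (S - {b}) \<alpha>'" and gd: "good \<sigma>' \<alpha>' r (S - {b})"
        using B unfolding Bset_def by auto
      note aD = pmatchD[OF p(2)]
      have br: "b \<noteq> r" using b S by auto
      have bc: "b \<noteq> c" using c br by auto
      have sb: "\<sigma>' b = b" using permutes_not_in[OF p(1)] br by auto
      have sx: "\<sigma>' x \<noteq> b" if "x \<noteq> b" for x using that sb permutes_inj[OF p(1)] by (metis injD)
      have "\<sigma>' permutes insert r S" using permutes_subset[OF p(1)] by blast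
      moreover have "transpose b c permutes insert r S" using b c by (intro permutes_swap_id) auto
      ultimately have P: "?\<sigma> permutes insert r S" by (rule permutes_compose)
      have al: "?\<alpha> x = \<alpha>' x" if "x \<noteq> b" "x \<noteq> r" for x using that unfolding ext_def by simp
      have M: "pmatch (insert r S) ?\<alpha>"
      proof (rule pmatchI)
        fix x assume "x \<in> insert r S"
        then consider "x = b" | "x = r" | "x \<in> S - {b}" "x \<noteq> b" "x \<noteq> r" using S(2) by blast
        then have "?\<alpha> x \<in> insert r S \<and> ?\<alpha> x \<noteq> x \<and> ?\<alpha> (?\<alpha> x) = x"
        proof cases
          case 3
          have m: "\<alpha>' x \<in> S - {b}" using aD(1)[OF 3(1)] .
          then have "\<alpha>' x \<noteq> r" "\<alpha>' x \<noteq> b" using S(2) by auto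
          then have "?\<alpha> (?\<alpha> x) = x" using al[OF 3(2,3)] al[of "\<alpha>' x"] aD(3)[of x] by simp
          then show ?thesis using al[OF 3(2,3)] m aD(2)[OF 3(1)] by auto
        qed (use b br in \<open>auto simp: ext_def\<close>)
        then show "?\<alpha> x \<in> insert r S" "?\<alpha> x \<noteq> x" "?\<alpha> (?\<alpha> x) = x" by blast+
      next
        fix x assume "x \<notin> insert r S"
        then show "?\<alpha> x = x" using b aD(4)[of x] unfolding ext_def by auto
      qed
      have "good ?\<sigma> ?\<alpha> r S"
      proof (rule goodI)
        fix A assume A: "A \<subseteq> S" "A \<noteq> {}" "\<And>x. x \<in> A \<Longrightarrow> ?\<sigma> x \<in> A"
        have "A \<noteq> {b}" using A(3)[of b] sb bc by auto
        then have ne: "A - {b} \<noteq> {}" using A(2) by blast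
        have cl: "\<sigma>' x \<in> A - {b}" if x: "x \<in> A - {b}" for x
        proof (cases "\<sigma>' x = c")
          case True
          then have "b \<in> A" using A(3)[of x] x by simp
          then have "c \<in> A" using A(3)[of b] sb by simp
          then show ?thesis using True bc by simp
        next
          case False
          then have "?\<sigma> x = \<sigma>' x" using sx[of x] x by simp
          then show ?thesis using A(3)[of x] x sx[of x] by simp
        qed
        have "outs2 \<alpha>' r (A - {b})"
          by (rule goodD[OF gd _ ne]) (use A(1) cl in auto)
        then obtain x y where xy: "x \<in> A - {b}" "y \<in> A - {b}" "x \<noteq> y"
          "\<alpha>' x \<notin> insert r (A - {b})" "\<alpha>' y \<notin> insert r (A - {b})" by (rule outs2E)
        have *: "?\<alpha> z \<notin> insert r A" if z: "z \<in> A - {b}" "\<alpha>' z \<notin> insert r (A - {b})" for z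
        proof -
          have "z \<in> S - {b}" "z \<noteq> r" using z A(1) S(2) by auto
          then have "\<alpha>' z \<noteq> b" "?\<alpha> z = \<alpha>' z" using aD(1)[of z] al[of z] by auto
          then show ?thesis using z by auto
        qed
        show "outs2 ?\<alpha> r A"
          by (rule outs2I[of x A y]) (use xy * in auto)
      qed
      then show "w \<in> Wset S r" unfolding w Wset_def using P M by simp
    qed
    show "h ` Wset S r \<subseteq> X"
    proof
      fix u assume "u \<in> h ` Wset S r"
      then obtain \<sigma> \<alpha> where u: "u = h (\<sigma>, \<alpha>)" and P: "\<sigma> permutes insert r S"
        and M: "pmatch (insert r S) \<alpha>" and gd: "good \<sigma> \<alpha> r S" unfolding Wset_def by auto
      note aD = pmatchD[OF M]
      define b where "b = \<alpha> r"
      define c where "c = \<sigma> b"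
      let ?\<sigma> = "transpose b c \<circ> \<sigma>" and ?\<alpha> = "restr (S - {b}) \<alpha>"
      have b: "b \<in> S" using aD(1,2)[of r] unfolding b_def by auto
      have ab: "\<alpha> b = r" unfolding b_def using aD(3) .
      have bc: "c \<noteq> b"
      proof
        assume "c = b"
        then have "outs2 \<alpha> r {b}" using goodD[OF gd, of "{b}"] b unfolding c_def by auto
        then show False by (auto elim!: outs2E)
      qed
      have c: "c \<in> insert r (S - {b})" using permutes_in_image[OF P, of b] b bc unfolding c_def by auto
      have sb: "?\<sigma> b = b" unfolding c_def by simp
      have sx: "?\<sigma> x \<noteq> b" if "x \<noteq> b" for x
      proof
        assume "?\<sigma> x = b"
        then have "\<sigma> x = c" by (auto simp: transpose_eq_iff)
        then show False using that permutes_inj[OF P] unfolding c_def by (metis injD)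
      qed
      have "?\<sigma> permutes insert r S"
        using permutes_compose[OF P] permutes_swap_id[of b "insert r S" c] b c by auto
      then have P': "?\<sigma> permutes insert r (S - {b})"
        by (rule permutes_superset) (use sb in auto)
      have pres: "\<alpha> x \<in> S - {b}" if "x \<in> S - {b}" for x
        using that aD(1)[of x] aD(3)[of x] aD(6)[of x r] S(2) ab unfolding b_def by auto
      have M': "pmatch (S - {b}) ?\<alpha>"
        by (rule pmatch_restr[OF M]) (use pres in auto)
      have "good ?\<sigma> ?\<alpha> r (S - {b})"
      proof (rule goodI)
        fix A assume A: "A \<subseteq> S - {b}" "A \<noteq> {}" "\<And>x. x \<in> A \<Longrightarrow> ?\<sigma> x \<in> A"
        \<comment> \<open>A set closed under the spliced permutation becomes \<sigma>-closed when b
          is put back together with its successor c.\<close>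
        define A' where "A' = (if c \<in> A then insert b A else A)"
        have "outs2 \<alpha> r A'"
        proof (rule goodD[OF gd])
          show "A' \<subseteq> S" "A' \<noteq> {}" using A b unfolding A'_def by auto
          fix x assume x: "x \<in> A'"
          show "\<sigma> x \<in> A'"
          proof (cases "x = b")
            case True
            then have "c \<in> A" using x A(1) unfolding A'_def by (auto split: if_splits)
            then show ?thesis using True unfolding A'_def c_def by simp
          next
            case False
            then have xA: "x \<in> A" using x unfolding A'_def by (auto split: if_splits)
            have s: "\<sigma> x = transpose b c (?\<sigma> x)" by simp
            show ?thesis
            proof (cases "?\<sigma> x = c")
              case True
              then have "c \<in> A" using A(3)[OF xA] by simp
              moreover have "\<sigma> x = b" using s True by (metis transpose_apply_second)
              ultimately show ?thesis unfolding A'_def by simp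
            next
              case False
              then have "\<sigma> x = ?\<sigma> x" using s sx[OF \<open>x \<noteq> b\<close>] by (metis transpose_apply_other)
              then show ?thesis using A(3)[OF xA] unfolding A'_def by auto
            qed
          qed
        qed
        then obtain x y where xy: "x \<in> A'" "y \<in> A'" "x \<noteq> y" "\<alpha> x \<notin> insert r A'" "\<alpha> y \<notin> insert r A'"
          by (rule outs2E)
        have *: "z \<in> A \<and> ?\<alpha> z \<notin> insert r A" if z: "z \<in> A'" "\<alpha> z \<notin> insert r A'" for z
        proof -
          have "z \<noteq> b" using z ab by auto
          then have "z \<in> A" using z unfolding A'_def by (auto split: if_splits)
          moreover then have "?\<alpha> z = \<alpha> z" using A(1) unfolding restr_def by auto
          ultimately show ?thesis using z unfolding A'_def by (auto split: if_splits)
        qed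
        show "outs2 ?\<alpha> r A"
          by (rule outs2I[of x A y]) (use xy * in auto)
      qed
      then have "(?\<sigma>, ?\<alpha>) \<in> Bset (S - {b}) r" using P' M' unfolding Bset_def by simp
      then show "u \<in> X" unfolding u h_def X_def using b c b_def c_def by simp
    qed
  qed
  then have "card (Wset S r) = card X" by (metis bij_betw_same_card)
  also have "\<dots> = (\<Sum>b\<in>S. card (insert r (S - {b}) \<times> Bset (S - {b}) r))"
    unfolding X_def
    by (rule card_SigmaI[OF S(1)], intro ballI finite_cartesian_product finite_Bset) (use S in auto)
  also have "\<dots> = (\<Sum>b\<in>S. card S * card (Bset (S - {b}) r))"
  proof (rule sum.cong[OF refl])
    fix b assume b: "b \<in> S"
    then have "card S > 0" using S(1) by (auto simp: card_gt_0_iff)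
    then have "card (insert r (S - {b})) = card S" using S b by simp
    then show "card (insert r (S - {b}) \<times> Bset (S - {b}) r) = card S * card (Bset (S - {b}) r)"
      by (simp add: card_cartesian_product)
  qed
  finally show ?thesis .
qed

text \<open>The extra vertex is itself chosen in A: the cycle through a is opened at a into a line,
  and the edge at a is regarded as the external boson.\<close>

definition rooted_W :: "'a set \<Rightarrow> ('a \<times> ('a \<Rightarrow> 'a) \<times> ('a \<Rightarrow> 'a)) set" where
  "rooted_W A = (SIGMA a:A. Wset (A - {a}) a)"

lemma card_rooted_W: "finite A \<Longrightarrow> card (rooted_W A) = (\<Sum>a\<in>A. card (Wset (A - {a}) a))"
  unfolding rooted_W_def by (rule card_SigmaI) (auto intro: finite_Wset)

text \<open>A set of fermion cycles avoiding the fermion line that is joined to the rest by exactly two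
  boson edges, one of which is attached to the first vertex of the line.\<close>

definition cutset :: "'a set \<Rightarrow> 'a \<Rightarrow> ('a \<Rightarrow> 'a) \<Rightarrow> ('a \<Rightarrow> 'a) \<Rightarrow> 'a \<Rightarrow> 'a set \<Rightarrow> bool" where
  "cutset S r \<sigma> \<alpha> q A \<longleftrightarrow> A \<subseteq> S \<and> \<alpha> (\<sigma> r) \<in> A \<and> (\<forall>x\<in>A. \<sigma> x \<in> A) \<and> q \<in> A \<and> q \<noteq> \<alpha> (\<sigma> r) \<and> \<alpha> q \<notin> A
     \<and> (\<forall>x\<in>A. x \<noteq> \<alpha> (\<sigma> r) \<longrightarrow> x \<noteq> q \<longrightarrow> \<alpha> x \<in> A)"

text \<open>The first vertex a of the line takes the place of r, so its boson edge becomes the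
  external one and edges ending in a no longer count. A union of cycles with two outgoing edges can
  fail the new test only if one of its edges goes to a and just one other leaves it, and that is a
  cutset.\<close>

lemma card_no_cutset:
  assumes S: "finite S" "r \<notin> S" "S \<noteq> {}"
  shows "card {(\<sigma>, \<alpha>) \<in> Bset S r. \<forall>q A. \<not> cutset S r \<sigma> \<alpha> q A} = card (rooted_W S)"
proof -
  define N where "N = {(\<sigma>, \<alpha>) \<in> Bset S r. \<forall>q A. \<not> cutset S r \<sigma> \<alpha> q A}"
  \<comment> \<open>\<open>transpose r a \<circ> \<sigma>\<close> inserts r immediately before a if
    \<sigma> fixes r, and removes r if \<sigma> sends r to a.\<close>
  define g where "g = (\<lambda>(a, \<sigma> :: 'a \<Rightarrow> 'a, \<alpha>). (transpose r a \<circ> \<sigma>, \<alpha> :: 'a \<Rightarrow> 'a))"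
  define h where "h = (\<lambda>(\<sigma> :: 'a \<Rightarrow> 'a, \<alpha>). (\<sigma> r, transpose r (\<sigma> r) \<circ> \<sigma>, \<alpha> :: 'a \<Rightarrow> 'a))"
  have inv: "transpose b c \<circ> (transpose b c \<circ> \<sigma>) = \<sigma>" for b c :: 'a and \<sigma> by (simp add: fun_eq_iff)
  have "bij_betw g (rooted_W S) N"
  proof (rule bij_betw_byWitness[where f' = h])
    show "\<forall>u\<in>rooted_W S. h (g u) = u"
    proof
      fix u assume "u \<in> rooted_W S"
      then obtain a \<sigma> \<alpha> where u: "u = (a, \<sigma>, \<alpha>)" "a \<in> S" "\<sigma> permutes insert a (S - {a})"
        unfolding rooted_W_def Wset_def by auto
      have "r \<notin> insert a (S - {a})" using u(2) S(2) by auto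
      then have "\<sigma> r = r" by (rule permutes_not_in[OF u(3)])
      then show "h (g u) = u" unfolding u(1) g_def h_def using inv by simp
    qed
    show "\<forall>w\<in>N. g (h w) = w" unfolding g_def h_def using inv by auto
    show "g ` rooted_W S \<subseteq> N"
    proof
      fix w assume "w \<in> g ` rooted_W S"
      then obtain a \<sigma>1 \<alpha> where w: "w = (transpose r a \<circ> \<sigma>1, \<alpha>)" and a: "a \<in> S" and W: "(\<sigma>1, \<alpha>) \<in> Wset (S - {a}) a"
        unfolding rooted_W_def g_def by auto
      have ins: "insert a (S - {a}) = S" using a by blast
      have p: "\<sigma>1 permutes S" "pmatch S \<alpha>" and gd: "good \<sigma>1 \<alpha> a (S - {a})"
        using W unfolding Wset_def ins by auto
      note aD = pmatchD[OF p(2)]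
      let ?\<sigma> = "transpose r a \<circ> \<sigma>1"
      have "\<sigma>1 permutes insert r S" using permutes_subset[OF p(1)] by blast
      then have P: "?\<sigma> permutes insert r S"
        using permutes_compose permutes_swap_id[of r "insert r S" a] a by blast
      have sr: "?\<sigma> r = a" using permutes_not_in[OF p(1) S(2)] by simp
      have key: "a \<notin> A \<and> outs2 \<alpha> a A" if A: "A \<subseteq> S" "A \<noteq> {}" "\<And>x. x \<in> A \<Longrightarrow> ?\<sigma> x \<in> A" for A
      proof -
        have fin: "finite A" using A(1) S(1) finite_subset by blast
        have aA: "a \<notin> A"
        proof
          assume "a \<in> A"
          then have "r \<in> A" using permutes_closed_iff[OF P fin] A(3) sr by metis
          then show False using A(1) S(2) by blast
        qed
        have cl: "\<sigma>1 x \<in> A" if "x \<in> A" for x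
        proof -
          have "?\<sigma> x \<in> A" using A(3) that .
          moreover then have "?\<sigma> x \<noteq> r" "?\<sigma> x \<noteq> a" using aA A(1) S(2) by auto
          then have "\<sigma>1 x \<noteq> r" "\<sigma>1 x \<noteq> a" by (auto simp: transpose_def split: if_splits)
          then have "?\<sigma> x = \<sigma>1 x" by simp
          ultimately show ?thesis by simp
        qed
        have "outs2 \<alpha> a A" by (rule goodD[OF gd]) (use A aA cl in auto)
        then show ?thesis using aA by blast
      qed
      have "good ?\<sigma> \<alpha> r S"
      proof (rule goodI)
        fix A assume A: "A \<subseteq> S" "A \<noteq> {}" "\<And>x. x \<in> A \<Longrightarrow> ?\<sigma> x \<in> A"
        have "outs2 \<alpha> a A" using key[OF A] by blast
        then obtain x y where xy: "x \<in> A" "y \<in> A" "x \<noteq> y" "\<alpha> x \<notin> insert a A" "\<alpha> y \<notin> insert a A" by (rule outs2E)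
        have "\<alpha> x \<noteq> r" "\<alpha> y \<noteq> r" using aD(1)[of x] aD(1)[of y] xy A(1) S(2) by auto
        then show "outs2 \<alpha> r A" using xy by (intro outs2I[of x A y]) auto
      qed
      moreover have "\<not> cutset S r ?\<sigma> \<alpha> q A" for q A
      proof
        assume c: "cutset S r ?\<sigma> \<alpha> q A"
        then have A: "A \<subseteq> S" "A \<noteq> {}" "\<And>x. x \<in> A \<Longrightarrow> ?\<sigma> x \<in> A" 
          and q: "\<And>x. x \<in> A \<Longrightarrow> x \<noteq> \<alpha> a \<Longrightarrow> x \<noteq> q \<Longrightarrow> \<alpha> x \<in> A" unfolding cutset_def sr by blast+
        have "outs2 \<alpha> a A" using key[OF A] by blast
        then obtain x y where xy: "x \<in> A" "y \<in> A" "x \<noteq> y" "\<alpha> x \<notin> insert a A" "\<alpha> y \<notin> insert a A" by (rule outs2E)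
        then have "x \<noteq> \<alpha> a" "y \<noteq> \<alpha> a" using aD(3)[of a] by auto
        then show False using q[of x] q[of y] xy by blast
      qed
      ultimately show "w \<in> N" unfolding w N_def Bset_def using P p(2) by simp
    qed
    show "h ` N \<subseteq> rooted_W S"
    proof
      fix u assume "u \<in> h ` N"
      then obtain \<sigma> \<alpha> where u: "u = h (\<sigma>, \<alpha>)" and P: "\<sigma> permutes insert r S" and M: "pmatch S \<alpha>"
        and gd: "good \<sigma> \<alpha> r S" and nc: "\<And>q A. \<not> cutset S r \<sigma> \<alpha> q A" unfolding N_def Bset_def by auto
      note aD = pmatchD[OF M]
      define a where "a = \<sigma> r"
      let ?\<sigma> = "transpose r a \<circ> \<sigma>"
      have "a \<noteq> r"
      proof
        assume "a = r"
        have cl: "\<sigma> x \<in> S" if "x \<in> S" for x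
        proof -
          have "\<sigma> x \<noteq> r" using that \<open>a = r\<close> permutes_inj[OF P] S(2) unfolding a_def by (metis injD)
          then show ?thesis using permutes_in_image[OF P, of x] that by auto
        qed
        have "outs2 \<alpha> r S" by (rule goodD[OF gd]) (use S cl in auto)
        then show False using aD(1) by (auto elim!: outs2E)
      qed
      then have a: "a \<in> S" using permutes_in_image[OF P, of r] unfolding a_def by auto
      have ins: "insert a (S - {a}) = S" using a by blast
      have "?\<sigma> permutes insert r S" using permutes_compose[OF P] permutes_swap_id[of r "insert r S" a] a by blast
      then have P': "?\<sigma> permutes S" by (rule permutes_superset) (auto simp: a_def)
      have "good ?\<sigma> \<alpha> a (S - {a})"
      proof (rule goodI)
        fix A assume A: "A \<subseteq> S - {a}" "A \<noteq> {}" "\<And>x. x \<in> A \<Longrightarrow> ?\<sigma> x \<in> A"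
        have cl: "\<sigma> x \<in> A" if "x \<in> A" for x
        proof -
          have s: "?\<sigma> x \<in> A" using A(3)[OF that] .
          then have "?\<sigma> x \<noteq> r" "?\<sigma> x \<noteq> a" using A(1) S(2) by auto
          then have "\<sigma> x \<noteq> r" "\<sigma> x \<noteq> a" by (auto simp: transpose_def split: if_splits)
          then show ?thesis using s by simp
        qed
        have "outs2 \<alpha> r A" by (rule goodD[OF gd]) (use A cl in auto)
        then obtain x y where xy: "x \<in> A" "y \<in> A" "x \<noteq> y" "\<alpha> x \<notin> A" "\<alpha> y \<notin> A" by (auto elim!: outs2E)
        \<comment> \<open>If one of the two outgoing edges goes to a, the absence of a cutset yields
          a third one.\<close>
        have *: "outs2 \<alpha> a A" if u: "u \<in> A" "v \<in> A" "u \<noteq> v" "\<alpha> u \<notin> A" "\<alpha> v \<notin> A" "v = \<alpha> a" for u v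
        proof -
          have "\<not> cutset S r \<sigma> \<alpha> u A" using nc .
          then obtain z where z: "z \<in> A" "z \<noteq> \<alpha> a" "z \<noteq> u" "\<alpha> z \<notin> A"
            unfolding cutset_def a_def[symmetric] using u A(1) cl by blast
          have "\<alpha> z \<noteq> a" "\<alpha> u \<noteq> a" using z u aD(3)[of z] aD(3)[of u] by auto
          then show ?thesis using z u by (intro outs2I[of u A z]) auto
        qed
        show "outs2 \<alpha> a A"
        proof (cases "x = \<alpha> a \<or> y = \<alpha> a")
          case True
          then show ?thesis using *[of x y] *[of y x] xy by blast
        next
          case False
          then have "\<alpha> x \<noteq> a" "\<alpha> y \<noteq> a" using aD(3)[of x] aD(3)[of y] by auto
          then show ?thesis using xy by (intro outs2I[of x A y]) auto
        qed
      qed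
      then have "(?\<sigma>, \<alpha>) \<in> Wset (S - {a}) a" using P' M unfolding Wset_def ins by simp
      then show "u \<in> rooted_W S" unfolding u h_def rooted_W_def using a a_def by simp
    qed
  qed
  then show ?thesis unfolding N_def[symmetric] by (rule bij_betw_same_card[symmetric])
qed

lemma pmatch_conj:
  assumes "pmatch S \<alpha>" "\<tau> permutes S" "\<tau> \<circ> \<tau> = id"
  shows "pmatch S (\<tau> \<circ> \<alpha> \<circ> \<tau>)"
proof (rule pmatchI)
  note aD = pmatchD[OF assms(1)]
  have t: "\<tau> (\<tau> x) = x" for x using fun_cong[OF assms(3), of x] by simp
  fix x assume x: "x \<in> S"
  have tx: "\<tau> x \<in> S" using permutes_in_image[OF assms(2)] x by blast
  show "(\<tau> \<circ> \<alpha> \<circ> \<tau>) x \<in> S" using permutes_in_image[OF assms(2)] aD(1)[OF tx] by simp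
  show "(\<tau> \<circ> \<alpha> \<circ> \<tau>) x \<noteq> x"
  proof
    assume "(\<tau> \<circ> \<alpha> \<circ> \<tau>) x = x"
    then have "\<tau> (\<tau> (\<alpha> (\<tau> x))) = \<tau> x" by simp
    then show False using aD(2)[OF tx] t by simp
  qed
  show "(\<tau> \<circ> \<alpha> \<circ> \<tau>) ((\<tau> \<circ> \<alpha> \<circ> \<tau>) x) = x" using aD(3) t by simp
next
  fix x assume x: "x \<notin> S"
  then have tx: "\<tau> x = x" by (rule permutes_not_in[OF assms(2)])
  then show "(\<tau> \<circ> \<alpha> \<circ> \<tau>) x = x" using pmatchD(4)[OF assms(1) x] by simp
qed

lemma pmatch_Un:
  assumes "pmatch A f" "pmatch C g" "A \<inter> C = {}"
  shows "pmatch (A \<union> C) (f \<circ> g)" "x \<in> A \<Longrightarrow> (f \<circ> g) x = f x" "x \<notin> A \<Longrightarrow> (f \<circ> g) x = g x"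
    "restr A (f \<circ> g) = f" "restr C (f \<circ> g) = g"
proof -
  note fD = pmatchD[OF assms(1)] and gD = pmatchD[OF assms(2)]
  have 1: "(f \<circ> g) x = f x" if "x \<in> A" for x
  proof -
    have "x \<notin> C" using that assms(3) by blast
    then show ?thesis using gD(4) by simp
  qed
  have 2: "(f \<circ> g) x = g x" if "x \<notin> A" for x
  proof (cases "x \<in> C")
    case True
    then have "g x \<notin> A" using gD(1)[of x] assms(3) by blast
    then show ?thesis using fD(4) by simp
  next
    case False
    then show ?thesis using gD(4) fD(4)[OF that] by simp
  qed
  show "x \<in> A \<Longrightarrow> (f \<circ> g) x = f x" "x \<notin> A \<Longrightarrow> (f \<circ> g) x = g x" using 1 2 by auto
  show "restr A (f \<circ> g) = f" unfolding restr_def using 1 fD(4) by (auto simp: fun_eq_iff)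
  have "x \<in> C \<Longrightarrow> x \<notin> A" for x using assms(3) by blast
  then show "restr C (f \<circ> g) = g" unfolding restr_def using 2 gD(4) by (auto simp: fun_eq_iff)
  show "pmatch (A \<union> C) (f \<circ> g)"
  proof (rule pmatchI)
    fix x assume x: "x \<in> A \<union> C"
    show "(f \<circ> g) x \<in> A \<union> C" "(f \<circ> g) x \<noteq> x" "(f \<circ> g) ((f \<circ> g) x) = x"
    proof -
      have "(f \<circ> g) x \<in> A \<union> C \<and> (f \<circ> g) x \<noteq> x \<and> (f \<circ> g) ((f \<circ> g) x) = x"
      proof (cases "x \<in> A")
        case True
        then show ?thesis using 1[of x] 1[of "f x"] fD(1-3)[of x] by auto
      next
        case False
        then have "x \<in> C" using x by blast
        then have "g x \<in> C" "g x \<notin> A" using gD(1)[of x] assms(3) by auto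
        then show ?thesis using 2[OF False] 2[of "g x"] gD(2,3)[of x] \<open>x \<in> C\<close> by auto
      qed
      then show "(f \<circ> g) x \<in> A \<union> C" "(f \<circ> g) x \<noteq> x" "(f \<circ> g) ((f \<circ> g) x) = x" by blast+
    qed
  next
    fix x assume "x \<notin> A \<union> C"
    then show "(f \<circ> g) x = x" using 2[of x] gD(4)[of x] by auto
  qed
qed

lemma restr_Un:
  assumes "\<And>x. x \<in> C \<Longrightarrow> f x \<in> C" "A \<inter> C = {}" "\<And>x. x \<notin> A \<union> C \<Longrightarrow> f x = x"
  shows "restr A f \<circ> restr C f = f"
proof
  fix x
  have "x \<in> C \<Longrightarrow> f x \<notin> A" "x \<in> C \<Longrightarrow> x \<notin> A" using assms(1,2) by blast+
  then show "(restr A f \<circ> restr C f) x = f x" using assms(3)[of x] unfolding restr_def by auto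
qed

lemma permutes_restr:
  assumes "f permutes S" "A \<subseteq> S" "finite A" "\<And>x. x \<in> A \<Longrightarrow> f x \<in> A"
  shows "restr A f permutes A"
proof (rule bij_imp_permutes)
  have "inj_on f A" using permutes_inj[OF assms(1)] inj_on_subset by blast
  moreover have "f ` A = A" using endo_inj_surj[OF assms(3)] assms(4) calculation by blast
  ultimately have "bij_betw f A A" unfolding bij_betw_def by blast
  then show "bij_betw (restr A f) A A" by (rule bij_betw_cong[THEN iffD1, rotated]) (simp add: restr_def)
qed (simp add: restr_def)

lemma permutes_Un:
  assumes "f permutes A" "g permutes C" "A \<inter> C = {}"
  shows "f \<circ> g permutes A \<union> C" "x \<in> A \<Longrightarrow> (f \<circ> g) x = f x" "x \<notin> A \<Longrightarrow> (f \<circ> g) x = g x"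
    "restr A (f \<circ> g) = f" "restr C (f \<circ> g) = g"
proof -
  show "f \<circ> g permutes A \<union> C"
    by (rule permutes_compose) (use assms permutes_subset in blast)+
  have 1: "(f \<circ> g) x = f x" if "x \<in> A" for x
  proof -
    have "x \<notin> C" using that assms(3) by blast
    then show ?thesis using permutes_not_in[OF assms(2)] by simp
  qed
  have 2: "(f \<circ> g) x = g x" if "x \<notin> A" for x
  proof (cases "x \<in> C")
    case True
    then have "g x \<notin> A" using permutes_in_image[OF assms(2)] assms(3) by blast
    then show ?thesis using permutes_not_in[OF assms(1)] by simp
  next
    case False
    then show ?thesis using permutes_not_in[OF assms(2)] permutes_not_in[OF assms(1) that] by simp
  qed
  show "x \<in> A \<Longrightarrow> (f \<circ> g) x = f x" "x \<notin> A \<Longrightarrow> (f \<circ> g) x = g x" using 1 2 by auto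
  show "restr A (f \<circ> g) = f" unfolding restr_def using 1 permutes_not_in[OF assms(1)] by (auto simp: fun_eq_iff)
  have "x \<in> C \<Longrightarrow> x \<notin> A" for x using assms(3) by blast
  then show "restr C (f \<circ> g) = g" unfolding restr_def using 2 permutes_not_in[OF assms(2)] by (auto simp: fun_eq_iff)
qed

text \<open>A minimal cutset \<open>A\<close>, its two boson half-edges closed up to an edge, is a structure of type \<open>W\<close>;
  the last clause expresses this in terms of the original matching.\<close>

definition min_cut :: "'a set \<Rightarrow> 'a \<Rightarrow> ('a \<Rightarrow> 'a) \<Rightarrow> ('a \<Rightarrow> 'a) \<Rightarrow> 'a \<Rightarrow> 'a set \<Rightarrow> bool" where
  "min_cut S r \<sigma> \<alpha> q A \<longleftrightarrow> cutset S r \<sigma> \<alpha> q A \<and>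
     (\<forall>D. D \<subseteq> A - {\<alpha> (\<sigma> r)} \<longrightarrow> D \<noteq> {} \<longrightarrow> (\<forall>x\<in>D. \<sigma> x \<in> D) \<longrightarrow>
       (\<exists>x\<in>D. \<exists>y\<in>D. x \<noteq> y \<and> x \<noteq> q \<and> y \<noteq> q \<and> \<alpha> x \<notin> D \<and> \<alpha> y \<notin> D))"

text \<open>If r were a fixed point, all of S would be a union of cycles, and no boson edge leaves
  S.\<close>

lemma Bset_root:
  assumes S: "finite S" "r \<notin> S" "S \<noteq> {}" and B: "(\<sigma>, \<alpha>) \<in> Bset S r"
  shows "\<sigma> r \<in> S"
proof -
  have P: "\<sigma> permutes insert r S" and M: "pmatch S \<alpha>" and gd: "good \<sigma> \<alpha> r S" using B unfolding Bset_def by auto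
  have "\<sigma> r \<noteq> r"
  proof
    assume a: "\<sigma> r = r"
    have cl: "\<sigma> x \<in> S" if "x \<in> S" for x
    proof -
      have "\<sigma> x \<noteq> r" using that a permutes_inj[OF P] S(2) by (metis injD)
      then show ?thesis using permutes_in_image[OF P, of x] that by auto
    qed
    have "outs2 \<alpha> r S" by (rule goodD[OF gd]) (use S cl in auto)
    then show False using pmatchD(1)[OF M] by (auto elim!: outs2E)
  qed
  then show ?thesis using permutes_in_image[OF P, of r] by auto
qed

lemma cutset_root_notin:
  assumes S: "finite S" "r \<notin> S" and P: "\<sigma> permutes insert r S" and c: "cutset S r \<sigma> \<alpha> q A"
  shows "\<sigma> r \<notin> A" "finite A"
proof -
  show fin: "finite A" using c S(1) finite_subset unfolding cutset_def by blast
  show "\<sigma> r \<notin> A"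
  proof
    assume "\<sigma> r \<in> A"
    then have "r \<in> A" using permutes_closed_iff[OF P fin] c unfolding cutset_def by blast
    then show False using c S(2) unfolding cutset_def by blast
  qed
qed

text \<open>A cutset A of least size is minimal in the required sense. Let D be a union of cycles in
  A - {b} without two outgoing edges at points other than q. Since D has two outgoing edges, q lies
  in D. Then A - D is left by the edge at b and, as its other edges enter D away from q, by exactly
  one more; it would be a smaller cutset.\<close>

lemma cutset_imp_min_cut:
  assumes S: "finite S" "r \<notin> S" and B: "(\<sigma>, \<alpha>) \<in> Bset S r" and c: "cutset S r \<sigma> \<alpha> q0 A0"
  shows "\<exists>q A. min_cut S r \<sigma> \<alpha> q A"
proof -
  have P: "\<sigma> permutes insert r S" and M: "pmatch S \<alpha>" and gd: "good \<sigma> \<alpha> r S" using B unfolding Bset_def by auto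
  note aD = pmatchD[OF M]
  obtain A where A: "\<exists>q. cutset S r \<sigma> \<alpha> q A" and mn: "\<And>D. \<exists>q. cutset S r \<sigma> \<alpha> q D \<Longrightarrow> card A \<le> card D"
    using ex_has_least_nat[of "\<lambda>A. \<exists>q. cutset S r \<sigma> \<alpha> q A" A0 card] c by blast
  obtain q where q: "cutset S r \<sigma> \<alpha> q A" using A by blast
  define b where "b = \<alpha> (\<sigma> r)"
  have Q: "A \<subseteq> S" "b \<in> A" "\<And>x. x \<in> A \<Longrightarrow> \<sigma> x \<in> A" "q \<in> A" "q \<noteq> b" "\<alpha> q \<notin> A"
    "\<And>x. x \<in> A \<Longrightarrow> x \<noteq> b \<Longrightarrow> x \<noteq> q \<Longrightarrow> \<alpha> x \<in> A"
    using q unfolding cutset_def b_def by blast+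
  note N = cutset_root_notin[OF S P q]
  have ab: "\<alpha> b = \<sigma> r" unfolding b_def using aD(3) .
  have "\<exists>x\<in>D. \<exists>y\<in>D. x \<noteq> y \<and> x \<noteq> q \<and> y \<noteq> q \<and> \<alpha> x \<notin> D \<and> \<alpha> y \<notin> D"
    if D: "D \<subseteq> A - {b}" "D \<noteq> {}" "\<forall>x\<in>D. \<sigma> x \<in> D" for D
  proof (rule ccontr)
    assume n: "\<not> ?thesis"
    have "outs2 \<alpha> r D" by (rule goodD[OF gd]) (use D Q(1) in auto)
    then obtain x y where xy: "x \<in> D" "y \<in> D" "x \<noteq> y" "\<alpha> x \<notin> D" "\<alpha> y \<notin> D" by (auto elim!: outs2E)
    then have qD: "q \<in> D" using n by metis
    let ?E = "A - D"
    have Ecl: "\<sigma> x \<in> ?E" if "x \<in> ?E" for x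
    proof -
      have "finite D" using D(1) N(2) finite_subset by blast
      then have "\<sigma> x \<notin> D" using permutes_closed_iff[OF P] D(3) that by blast
      then show ?thesis using Q(3) that by blast
    qed
    have bE: "b \<in> ?E" using Q(2) D(1) by blast
    have *: "\<alpha> u \<in> D \<and> u \<noteq> q \<and> \<alpha> (\<alpha> u) \<notin> D \<and> \<alpha> u \<noteq> q" if "u \<in> ?E" "u \<noteq> b" "\<alpha> u \<notin> ?E" for u
    proof -
      have "u \<noteq> q" using that qD by blast
      then have "\<alpha> u \<in> A" using Q(7)[of u] that by blast
      then have "\<alpha> u \<in> D" using that by blast
      moreover have "\<alpha> u \<noteq> q" using Q(6) aD(3)[of u] that by auto
      ultimately show ?thesis using \<open>u \<noteq> q\<close> aD(3)[of u] that by auto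
    qed
    have "outs2 \<alpha> r ?E" by (rule goodD[OF gd]) (use Q(1) bE Ecl in auto)
    then obtain u v where uv: "u \<in> ?E" "v \<in> ?E" "u \<noteq> v" "\<alpha> u \<notin> ?E" "\<alpha> v \<notin> ?E" by (auto elim!: outs2E)
    have one: "w = w'" if "w \<in> ?E" "w \<noteq> b" "\<alpha> w \<notin> ?E" "w' \<in> ?E" "w' \<noteq> b" "\<alpha> w' \<notin> ?E" for w w'
    proof (rule ccontr)
      assume "w \<noteq> w'"
      then have "\<alpha> w \<noteq> \<alpha> w'" using aD(6) by blast
      then show False using n *[OF that(1-3)] *[OF that(4-6)] by blast
    qed
    then obtain w where w: "w \<in> ?E" "w \<noteq> b" "\<alpha> w \<notin> ?E" using uv by metis
    have "cutset S r \<sigma> \<alpha> w ?E"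
      unfolding cutset_def b_def[symmetric] using Q(1) bE Ecl w one[OF w] by blast
    then have "card A \<le> card ?E" using mn by blast
    moreover have "card ?E < card A" using N(2) D(1,2) by (intro psubset_card_mono) auto
    ultimately show False by simp
  qed
  then show ?thesis using q unfolding min_cut_def b_def[symmetric] by blast
qed

text \<open>Otherwise A - A' is a union of cycles avoiding b, and minimality of A gives two edges
  leaving it at points other than q. These edges stay in A, so they enter A'; but q' is the only
  point where A' can be entered apart from b. Two edges cannot both end in q'.\<close>

lemma min_cut_subset:
  assumes S: "finite S" "r \<notin> S" and P: "\<sigma> permutes insert r S" and M: "pmatch S \<alpha>"
    and c: "min_cut S r \<sigma> \<alpha> q A" "min_cut S r \<sigma> \<alpha> q' A'"
  shows "A \<subseteq> A'"
proof (rule ccontr)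
  assume n: "\<not> A \<subseteq> A'"
  note aD = pmatchD[OF M]
  define b where "b = \<alpha> (\<sigma> r)"
  have cs: "cutset S r \<sigma> \<alpha> q A" "cutset S r \<sigma> \<alpha> q' A'" using c unfolding min_cut_def by auto
  note N = cutset_root_notin[OF S P cs(1)] and N' = cutset_root_notin[OF S P cs(2)]
  have Q: "b \<in> A" "\<And>x. x \<in> A \<Longrightarrow> \<sigma> x \<in> A" "\<And>x. x \<in> A \<Longrightarrow> x \<noteq> b \<Longrightarrow> x \<noteq> q \<Longrightarrow> \<alpha> x \<in> A"
    and Q': "b \<in> A'" "\<And>x. x \<in> A' \<Longrightarrow> \<sigma> x \<in> A'" "\<And>x. x \<in> A' \<Longrightarrow> x \<noteq> b \<Longrightarrow> x \<noteq> q' \<Longrightarrow> \<alpha> x \<in> A'"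
    using cs unfolding cutset_def b_def by blast+
  let ?D = "A - A'"
  have "\<sigma> x \<in> ?D" if "x \<in> ?D" for x
  proof -
    have "\<forall>x. \<sigma> x \<in> A' \<longrightarrow> x \<in> A'" using permutes_closed_iff[OF P N'(2)] Q'(2) by blast
    then show ?thesis using Q(2)[of x] that by blast
  qed
  moreover have "?D \<subseteq> A - {b}" using Q'(1) by blast
  ultimately obtain x y where xy: "x \<in> ?D" "y \<in> ?D" "x \<noteq> y" "x \<noteq> q" "y \<noteq> q" "\<alpha> x \<notin> ?D" "\<alpha> y \<notin> ?D"
    using c(1) n unfolding min_cut_def b_def[symmetric] by blast
  have *: "\<alpha> z = q'" if "z \<in> ?D" "z \<noteq> q" "\<alpha> z \<notin> ?D" for z
  proof -
    have zb: "z \<noteq> b" using that Q'(1) by blast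
    then have "\<alpha> z \<in> A'" using Q(3)[of z] that by blast
    moreover have "\<alpha> z \<noteq> b"
    proof
      assume "\<alpha> z = b"
      then have "z = \<sigma> r" using aD(6)[of z "\<sigma> r"] unfolding b_def by simp
      then show False using that(1) N(1) by blast
    qed
    moreover have "\<alpha> (\<alpha> z) \<notin> A'" using aD(3)[of z] that by auto
    ultimately show ?thesis using Q'(3) by blast
  qed
  have "\<alpha> x = \<alpha> y" using *[OF xy(1,4,6)] *[OF xy(2,5,7)] by simp
  then show False using xy(3) aD(6) by blast
qed

text \<open>Conjugation by the transposition of q and a re-pairs the edges {b, q} and {a, p} as {b,
  a} and {q, p}: the external edge of the first structure and the edge at the first vertex of the
  line are cut open and joined crosswise.\<close>

definition join_cut :: "'a \<Rightarrow> 'a set \<Rightarrow> ('a \<times> ('a \<Rightarrow> 'a) \<times> ('a \<Rightarrow> 'a)) \<times> ('a \<Rightarrow> 'a) \<times> ('a \<Rightarrow> 'a) \<Rightarrow> ('a \<Rightarrow> 'a) \<times> ('a \<Rightarrow> 'a)" where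
  "join_cut r A = (\<lambda>((b, \<sigma>1, \<alpha>1), \<sigma>2, \<alpha>2).
     (\<sigma>1 \<circ> \<sigma>2, transpose (\<alpha>1 b) (\<sigma>2 r) \<circ> (\<alpha>1 \<circ> \<alpha>2) \<circ> transpose (\<alpha>1 b) (\<sigma>2 r)))"

text \<open>For a union D of cycles the outgoing edges come from the part of D outside A if there is
  one, and otherwise from A itself. Only the edges at a, b, p and q have changed, and a is never in
  D because it lies on the line.\<close>

lemma join_cut:
  assumes S: "finite S" "r \<notin> S" and A: "A \<subseteq> S" "A \<noteq> S"
    and W: "b \<in> A" "(\<sigma>1, \<alpha>1) \<in> Wset (A - {b}) b" and B: "(\<sigma>2, \<alpha>2) \<in> Bset (S - A) r"
  defines "q \<equiv> \<alpha>1 b" and "a \<equiv> \<sigma>2 r" and "\<sigma> \<equiv> \<sigma>1 \<circ> \<sigma>2"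
  defines "\<alpha> \<equiv> transpose q a \<circ> (\<alpha>1 \<circ> \<alpha>2) \<circ> transpose q a"
  shows "(\<sigma>, \<alpha>) \<in> Bset S r" "min_cut S r \<sigma> \<alpha> q A"
    "restr A \<sigma> = \<sigma>1" "restr (insert r (S - A)) \<sigma> = \<sigma>2" "\<alpha> (\<sigma> r) = b" "\<sigma> r = a"
    "restr A (transpose q a \<circ> \<alpha> \<circ> transpose q a) = \<alpha>1"
    "restr (S - A) (transpose q a \<circ> \<alpha> \<circ> transpose q a) = \<alpha>2"
proof -
  let ?C = "S - A"
  have ins: "insert b (A - {b}) = A" using W(1) by blast
  have p1: "\<sigma>1 permutes A" and m1: "pmatch A \<alpha>1" and g1: "good \<sigma>1 \<alpha>1 b (A - {b})"
    using W(2) unfolding Wset_def ins by auto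
  have p2: "\<sigma>2 permutes insert r ?C" and m2: "pmatch ?C \<alpha>2" and g2: "good \<sigma>2 \<alpha>2 r ?C"
    using B unfolding Bset_def by auto
  note D1 = pmatchD[OF m1] and D2 = pmatchD[OF m2]
  have dis: "A \<inter> insert r ?C = {}" "A \<inter> ?C = {}" using A(1) S(2) by auto
  note PU = permutes_Un[OF p1 p2 dis(1), folded \<sigma>_def]
  have un: "A \<union> insert r ?C = insert r S" "A \<union> ?C = S" using A(1) by auto
  have P: "\<sigma> permutes insert r S" using PU(1) un(1) by simp
  show "restr A \<sigma> = \<sigma>1" "restr (insert r ?C) \<sigma> = \<sigma>2" using PU(4,5) by auto
  have rA: "r \<notin> A" using A(1) S(2) by blast
  show sr: "\<sigma> r = a" using PU(3)[OF rA] unfolding a_def .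
  have aC: "a \<in> ?C" unfolding a_def by (rule Bset_root[OF _ _ _ B]) (use S A in auto)
  have qA: "q \<in> A" "q \<noteq> b" unfolding q_def using D1(1,2)[OF W(1)] by auto
  define p where "p = \<alpha>2 a"
  have pC: "p \<in> ?C" "p \<noteq> a" unfolding p_def using D2(1,2)[OF aC] by auto
  define \<alpha>0 where "\<alpha>0 = \<alpha>1 \<circ> \<alpha>2"
  note MU = pmatch_Un[OF m1 m2 dis(2), folded \<alpha>0_def]
  have M0: "pmatch S \<alpha>0" using MU(1) un(2) by simp
  note D0 = pmatchD[OF M0]
  have bb: "b \<noteq> a" "q \<noteq> a" "p \<noteq> b" "p \<noteq> q" using qA aC pC W(1) by auto
  have v0: "\<alpha>0 b = q" "\<alpha>0 q = b" "\<alpha>0 a = p" "\<alpha>0 p = a"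
  proof -
    show "\<alpha>0 b = q" using MU(2)[OF W(1)] unfolding q_def .
    then show "\<alpha>0 q = b" using D0(3)[of b] by simp
    show "\<alpha>0 a = p" using MU(3)[of a] aC unfolding p_def by blast
    then show "\<alpha>0 p = a" using D0(3)[of a] by simp
  qed
  have \<alpha>: "\<alpha> = transpose q a \<circ> \<alpha>0 \<circ> transpose q a" unfolding \<alpha>_def \<alpha>0_def ..
  have v: "\<alpha> b = a" "\<alpha> q = p" "\<alpha> a = b" "\<alpha> p = q"
    using v0 bb qA(2) pC(2) unfolding \<alpha> by (auto simp: transpose_def)
  have vo: "\<alpha> x = \<alpha>0 x" if "x \<noteq> b" "x \<noteq> q" "x \<noteq> a" "x \<noteq> p" for x
  proof -
    have "\<alpha>0 x \<noteq> q" "\<alpha>0 x \<noteq> a" using that D0(6)[of x b] D0(6)[of x p] v0(1,4) by auto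
    then show ?thesis using that unfolding \<alpha> by simp
  qed
  have undone: "transpose q a \<circ> \<alpha> \<circ> transpose q a = \<alpha>0" unfolding \<alpha> by (simp add: fun_eq_iff)
  show "restr A (transpose q a \<circ> \<alpha> \<circ> transpose q a) = \<alpha>1"
    "restr ?C (transpose q a \<circ> \<alpha> \<circ> transpose q a) = \<alpha>2" unfolding undone using MU(4,5) by auto
  show abr: "\<alpha> (\<sigma> r) = b" using sr v(3) by simp
  have M: "pmatch S \<alpha>" unfolding \<alpha>
    by (rule pmatch_conj[OF M0]) (use qA aC A(1) in \<open>auto intro: permutes_swap_id simp: fun_eq_iff\<close>)
  note aD = pmatchD[OF M]
  have vA: "\<alpha> x = \<alpha>1 x" "\<alpha>1 x \<in> A" "\<alpha>1 x \<noteq> b" "\<alpha>1 x \<noteq> q" if "x \<in> A" "x \<noteq> b" "x \<noteq> q" for x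
  proof -
    show "\<alpha>1 x \<in> A" using D1(1) that by blast
    have "x \<noteq> a" "x \<noteq> p" using that aC pC by auto
    then show "\<alpha> x = \<alpha>1 x" using vo[of x] MU(2)[of x] that by simp
    show "\<alpha>1 x \<noteq> b" "\<alpha>1 x \<noteq> q" using that D1(3)[of x] D1(3)[of b] unfolding q_def by auto
  qed
  have vC: "\<alpha> x = \<alpha>2 x" "\<alpha>2 x \<in> ?C" if "x \<in> ?C" "x \<noteq> a" "x \<noteq> p" for x
  proof -
    show "\<alpha>2 x \<in> ?C" using D2(1) that by blast
    have "x \<noteq> b" "x \<noteq> q" using that W(1) qA by auto
    then show "\<alpha> x = \<alpha>2 x" using vo[of x] MU(3)[of x] that by simp
  qed
  have sA: "\<sigma> x = \<sigma>1 x" "\<sigma> x \<in> A" if "x \<in> A" for x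
    using PU(2)[OF that] permutes_in_image[OF p1] that by auto
  have sC: "\<sigma> x = \<sigma>2 x" "\<sigma> x \<notin> A" if "x \<in> ?C" for x
  proof -
    show "\<sigma> x = \<sigma>2 x" using PU(3)[of x] that by blast
    moreover have "\<sigma>2 x \<in> insert r ?C" using permutes_in_image[OF p2, of x] that by blast
    ultimately show "\<sigma> x \<notin> A" using rA by auto
  qed
  have inner: "\<exists>u\<in>D. \<exists>v\<in>D. u \<noteq> v \<and> u \<noteq> q \<and> v \<noteq> q \<and> \<alpha> u \<notin> D \<and> \<alpha> v \<notin> D \<and> \<alpha> u \<in> A \<and> \<alpha> v \<in> A"
    if D: "D \<subseteq> A - {b}" "D \<noteq> {}" "\<And>x. x \<in> D \<Longrightarrow> \<sigma> x \<in> D" for D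
  proof -
    have "outs2 \<alpha>1 b D"
    proof (rule goodD[OF g1 D(1,2)])
      fix x assume x: "x \<in> D"
      then have "\<sigma> x = \<sigma>1 x" using D(1) sA(1) by blast
      then show "\<sigma>1 x \<in> D" using D(3)[OF x] by simp
    qed
    then obtain u v where uv: "u \<in> D" "v \<in> D" "u \<noteq> v" "\<alpha>1 u \<notin> insert b D" "\<alpha>1 v \<notin> insert b D" by (rule outs2E)
    have *: "w \<noteq> q \<and> \<alpha> w \<notin> D \<and> \<alpha> w \<in> A" if "w \<in> D" "\<alpha>1 w \<notin> insert b D" for w
    proof -
      have "w \<noteq> q" using that(2) D1(3)[of b] unfolding q_def by auto
      moreover have "w \<in> A" "w \<noteq> b" using D(1) that(1) by auto
      ultimately show ?thesis using vA[of w] that(2) by auto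
    qed
    show ?thesis using uv *[OF uv(1,4)] *[OF uv(2,5)] by blast
  qed
  have "good \<sigma> \<alpha> r S"
  proof (rule goodI)
    fix D assume D: "D \<subseteq> S" "D \<noteq> {}" "\<And>x. x \<in> D \<Longrightarrow> \<sigma> x \<in> D"
    have fin: "finite D" using D(1) S(1) finite_subset by blast
    have rD: "r \<notin> D" using D(1) S(2) by blast
    have inv: "\<forall>x. \<sigma> x \<in> D \<longrightarrow> x \<in> D" using permutes_closed_iff[OF P fin] D(3) by blast
    then have aD': "a \<notin> D" using sr rD by blast
    have rout: "\<alpha> x \<noteq> r" if "x \<in> D" for x using aD(1)[of x] that D(1) S(2) by auto
    have fin2: "outs2 \<alpha> r D" if "x \<in> D" "y \<in> D" "x \<noteq> y" "\<alpha> x \<notin> D" "\<alpha> y \<notin> D" for x y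
      using that rout by (intro outs2I[of x D y]) auto
    have DA: "\<sigma> x \<in> D \<inter> A" if "x \<in> D \<inter> A" for x using D(3) sA(2) that by blast
    have DC: "\<sigma>2 x \<in> D - A" if "x \<in> D - A" for x
    proof -
      have "x \<in> ?C" using that D(1) by blast
      then show ?thesis using sC[of x] D(3)[of x] that by auto
    qed
    show "outs2 \<alpha> r D"
    proof (cases "D - A = {}")
      case False
      have "outs2 \<alpha>2 r (D - A)" by (rule goodD[OF g2 _ False]) (use D(1) DC in auto)
      then obtain x y where xy: "x \<in> D - A" "y \<in> D - A" "x \<noteq> y" "\<alpha>2 x \<notin> D - A" "\<alpha>2 y \<notin> D - A" by (auto elim!: outs2E)
      have ot: "\<alpha> z \<notin> D" if z: "z \<in> D - A" "\<alpha>2 z \<notin> D - A" "z \<noteq> p" for z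
      proof -
        have "z \<in> ?C" "z \<noteq> a" using z(1) D(1) aD' by auto
        then show ?thesis using vC[of z] z by auto
      qed
      \<comment> \<open>The one outgoing edge that may be lost is that of p, which now ends in q
        instead of a. If q is in D, a replacement is found inside A: the edge from b to a if b is in
        D, and otherwise the two edges leaving D \<inter> A within A.\<close>
      have special: "outs2 \<alpha> r D" if y: "y \<in> D - A" "\<alpha>2 y \<notin> D - A" "y \<noteq> p" and p: "p \<in> D" for y
      proof (cases "q \<in> D")
        case False
        then show ?thesis using fin2[of p y] p y ot[OF y] v(4) by auto
      next
        case True
        show ?thesis
        proof (cases "b \<in> D")
          case True
          moreover have "b \<noteq> y" using y W(1) by blast
          ultimately show ?thesis using fin2[of b y] y ot[OF y] v(1) aD' by auto
        next
          case False
          have "D \<inter> A \<noteq> {}" using True qA by blast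
          moreover have "D \<inter> A \<subseteq> A - {b}" using False by blast
          ultimately obtain u v where "u \<in> D \<inter> A" "v \<in> D \<inter> A" "u \<noteq> v" "\<alpha> u \<notin> D \<inter> A" "\<alpha> v \<notin> D \<inter> A" "\<alpha> u \<in> A" "\<alpha> v \<in> A"
            using inner[of "D \<inter> A"] DA by blast
          then show ?thesis using fin2[of u v] by blast
        qed
      qed
      show ?thesis
      proof (cases "x = p \<or> y = p")
        case True
        then show ?thesis using special[of x] special[of y] xy by blast
      next
        case False
        then show ?thesis using fin2[of x y] ot[of x] ot[of y] xy by blast
      qed
    next
      case True
      then have sub: "D \<subseteq> A" by blast
      show ?thesis
      proof (cases "b \<in> D")
        case False
        then have "D \<subseteq> A - {b}" using sub by blast
        then obtain u v where "u \<in> D" "v \<in> D" "u \<noteq> v" "\<alpha> u \<notin> D" "\<alpha> v \<notin> D"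
          using inner[of D] D(2,3) by blast
        then show ?thesis using fin2[of u v] by blast
      next
        case bD: True
        show ?thesis
        proof (cases "A - D = {}")
          case True
          then have "D = A" using sub by blast
          then have "q \<in> D" "\<alpha> q \<notin> D" "\<alpha> b \<notin> D" using qA v pC aC by auto
          then show ?thesis using fin2[of b q] bD qA(2) by blast
        next
          case False
          \<comment> \<open>The edges that leave A - D within A enter D; read backwards they leave
            D.\<close>
          have "\<sigma> x \<in> A - D" if "x \<in> A - D" for x using inv sA(2) that by blast
          moreover have "A - D \<subseteq> A - {b}" using bD by blast
          ultimately obtain u w where uw: "u \<in> A - D" "w \<in> A - D" "u \<noteq> w" "\<alpha> u \<in> D" "\<alpha> w \<in> D"
            using inner[of "A - D"] False by blast
          then show ?thesis using fin2[of "\<alpha> u" "\<alpha> w"] aD(3)[of u] aD(3)[of w] aD(6)[of u w] by auto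
        qed
      qed
    qed
  qed
  then show "(\<sigma>, \<alpha>) \<in> Bset S r" unfolding Bset_def using P M by simp
  have "cutset S r \<sigma> \<alpha> q A" unfolding cutset_def abr
    using A(1) W(1) sA(2) qA v(2) pC vA(1,2) by auto
  then show "min_cut S r \<sigma> \<alpha> q A" unfolding min_cut_def abr
  proof
    show "\<forall>D. D \<subseteq> A - {b} \<longrightarrow> D \<noteq> {} \<longrightarrow> (\<forall>x\<in>D. \<sigma> x \<in> D) \<longrightarrow>
       (\<exists>x\<in>D. \<exists>y\<in>D. x \<noteq> y \<and> x \<noteq> q \<and> y \<noteq> q \<and> \<alpha> x \<notin> D \<and> \<alpha> y \<notin> D)"
    proof (intro allI impI)
      fix D assume D: "D \<subseteq> A - {b}" "D \<noteq> {}" "\<forall>x\<in>D. \<sigma> x \<in> D"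
      have "\<And>x. x \<in> D \<Longrightarrow> \<sigma> x \<in> D" using D(3) by blast
      from inner[OF D(1,2) this] show "\<exists>x\<in>D. \<exists>y\<in>D. x \<noteq> y \<and> x \<noteq> q \<and> y \<noteq> q \<and> \<alpha> x \<notin> D \<and> \<alpha> y \<notin> D" by blast
    qed
  qed
qed

text \<open>The same re-pairing undoes the joining. In A it makes {b, q} the external edge, and
  minimality of the cut, which discounts b and q, is what \<open>good\<close> asks for there.
  Outside A only p and a change partners, and a, the first vertex of the line, lies in no union of
  cycles.\<close>

lemma split_cut:
  assumes S: "finite S" "r \<notin> S" and B: "(\<sigma>, \<alpha>) \<in> Bset S r" and c: "min_cut S r \<sigma> \<alpha> q A"
  defines "a \<equiv> \<sigma> r" and "b \<equiv> \<alpha> (\<sigma> r)"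
  defines "\<alpha>0 \<equiv> transpose q a \<circ> \<alpha> \<circ> transpose q a"
  shows "A \<subseteq> S" "A \<noteq> S" "A \<noteq> {}" "b \<in> A" "(restr A \<sigma>, restr A \<alpha>0) \<in> Wset (A - {b}) b"
    "(restr (insert r (S - A)) \<sigma>, restr (S - A) \<alpha>0) \<in> Bset (S - A) r"
    "join_cut r A ((b, restr A \<sigma>, restr A \<alpha>0), restr (insert r (S - A)) \<sigma>, restr (S - A) \<alpha>0) = (\<sigma>, \<alpha>)"
proof -
  let ?C = "S - A"
  have P: "\<sigma> permutes insert r S" and M: "pmatch S \<alpha>" and gd: "good \<sigma> \<alpha> r S" using B unfolding Bset_def by auto
  note aD = pmatchD[OF M]
  have cs: "cutset S r \<sigma> \<alpha> q A" using c unfolding min_cut_def by blast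
  have Q: "A \<subseteq> S" "b \<in> A" "\<And>x. x \<in> A \<Longrightarrow> \<sigma> x \<in> A" "q \<in> A" "q \<noteq> b" "\<alpha> q \<notin> A"
    "\<And>x. x \<in> A \<Longrightarrow> x \<noteq> b \<Longrightarrow> x \<noteq> q \<Longrightarrow> \<alpha> x \<in> A"
    using cs unfolding cutset_def b_def by blast+
  note N = cutset_root_notin[OF S P cs, folded a_def]
  have ab: "\<alpha> b = a" "\<alpha> a = b" unfolding b_def a_def using aD(3) by auto
  have aC: "a \<in> ?C" using N(1) aD(5)[of a] ab(2) Q(1,2) by auto
  define p where "p = \<alpha> q"
  have pC: "p \<in> ?C" "p \<noteq> a" "\<alpha> p = q"
    using Q(1,4,6) aD(1)[of q] aD(6)[of q b] ab Q(5) aD(3)[of q] unfolding p_def by auto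
  have dif: "q \<noteq> a" "b \<noteq> a" "p \<noteq> q" "p \<noteq> b" using aC pC Q(2,4) by auto
  have v0: "\<alpha>0 b = q" "\<alpha>0 q = b" "\<alpha>0 a = p" "\<alpha>0 p = a"
    using ab pC Q(5) dif unfolding \<alpha>0_def by (auto simp: transpose_def p_def)
  have vo: "\<alpha>0 x = \<alpha> x" if "x \<noteq> b" "x \<noteq> q" "x \<noteq> a" "x \<noteq> p" for x
  proof -
    have "\<alpha> x \<noteq> q" using that(4) aD(3)[of x] unfolding p_def by auto
    moreover have "\<alpha> x \<noteq> a" using that(1) aD(3)[of x] ab(2) by auto
    ultimately show ?thesis using that unfolding \<alpha>0_def by simp
  qed
  have M0: "pmatch S \<alpha>0" unfolding \<alpha>0_def
    by (rule pmatch_conj[OF M]) (use Q(1,4) aC in \<open>auto intro: permutes_swap_id simp: fun_eq_iff\<close>)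
  note D0 = pmatchD[OF M0]
  have A0: "\<alpha>0 x \<in> A" if "x \<in> A" for x
  proof -
    have "x \<noteq> a" "x \<noteq> p" using that aC pC by auto
    then show ?thesis using v0(1,2) Q(2,4) Q(7)[OF that] vo[of x] by (cases "x = b \<or> x = q") auto
  qed
  have C0: "\<alpha>0 x \<in> ?C" if "x \<in> ?C" for x
    using that A0[of "\<alpha>0 x"] D0(1)[of x] D0(3)[of x] by auto
  have inv: "\<forall>x. \<sigma> x \<in> A \<longrightarrow> x \<in> A" using permutes_closed_iff[OF P N(2)] Q(3) by blast
  have C1: "\<sigma> x \<in> insert r ?C" if "x \<in> insert r ?C" for x
  proof -
    have "x \<notin> A" using that Q(1) S(2) by blast
    then have "\<sigma> x \<notin> A" using inv by blast
    moreover have "\<sigma> x \<in> insert r S" using permutes_in_image[OF P, of x] that by blast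
    ultimately show ?thesis by blast
  qed
  have ins: "insert b (A - {b}) = A" using Q(2) by blast
  have dis: "A \<inter> insert r ?C = {}" "A \<inter> ?C = {}" using Q(1) S(2) by auto
  have un: "A \<union> insert r ?C = insert r S" "A \<union> ?C = S" using Q(1) by auto
  show "A \<subseteq> S" "b \<in> A" "A \<noteq> {}" using Q(1,2) by auto
  show "A \<noteq> S" using aC by blast
  have "good (restr A \<sigma>) (restr A \<alpha>0) b (A - {b})"
  proof (rule goodI)
    fix D assume D: "D \<subseteq> A - {b}" "D \<noteq> {}" "\<And>x. x \<in> D \<Longrightarrow> restr A \<sigma> x \<in> D"
    have "\<forall>x\<in>D. \<sigma> x \<in> D"
    proof
      fix x assume "x \<in> D"
      then show "\<sigma> x \<in> D" using D(1) D(3)[of x] unfolding restr_def by (auto split: if_splits)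
    qed
    then obtain x y where xy: "x \<in> D" "y \<in> D" "x \<noteq> y" "x \<noteq> q" "y \<noteq> q" "\<alpha> x \<notin> D" "\<alpha> y \<notin> D"
      using c D(1,2) unfolding min_cut_def b_def[symmetric] by blast
    have *: "restr A \<alpha>0 z \<notin> insert b D" if "z \<in> D" "z \<noteq> q" "\<alpha> z \<notin> D" for z
    proof -
      have z: "z \<in> A" "z \<noteq> b" "z \<noteq> a" "z \<noteq> p" using that(1) D(1) aC pC by auto
      then have "restr A \<alpha>0 z = \<alpha> z" using vo[of z] that(2) unfolding restr_def by simp
      moreover have "\<alpha> z \<noteq> b" using z(3) ab(1) aD(3)[of z] by auto
      ultimately show ?thesis using that(3) by simp
    qed
    show "outs2 (restr A \<alpha>0) b D"
      by (rule outs2I[OF xy(1-3) *[OF xy(1,4,6)] *[OF xy(2,5,7)]])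
  qed
  moreover have "restr A \<sigma> permutes A" by (rule permutes_restr[OF P _ N(2) Q(3)]) (use Q(1) in auto)
  moreover have "pmatch A (restr A \<alpha>0)" by (rule pmatch_restr[OF M0 Q(1) A0])
  ultimately show "(restr A \<sigma>, restr A \<alpha>0) \<in> Wset (A - {b}) b" unfolding Wset_def ins by simp
  have "good (restr (insert r ?C) \<sigma>) (restr ?C \<alpha>0) r ?C"
  proof (rule goodI)
    fix D assume D: "D \<subseteq> ?C" "D \<noteq> {}" "\<And>x. x \<in> D \<Longrightarrow> restr (insert r ?C) \<sigma> x \<in> D"
    have cl: "\<sigma> x \<in> D" if "x \<in> D" for x
      using that D(1) D(3)[of x] unfolding restr_def by (auto split: if_splits)
    have "finite D" using D(1) S(1) by (meson finite_Diff finite_subset)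
    then have "\<forall>x. \<sigma> x \<in> D \<longrightarrow> x \<in> D" using permutes_closed_iff[OF P] cl by blast
    moreover have "r \<notin> D" using D(1) S(2) by blast
    ultimately have aDn: "a \<notin> D" unfolding a_def by blast
    have "outs2 \<alpha> r D" by (rule goodD[OF gd]) (use D cl in auto)
    then obtain x y where xy: "x \<in> D" "y \<in> D" "x \<noteq> y" "\<alpha> x \<notin> D" "\<alpha> y \<notin> D" by (auto elim!: outs2E)
    have *: "restr ?C \<alpha>0 z \<notin> insert r D" if "z \<in> D" "\<alpha> z \<notin> D" for z
    proof -
      have z: "z \<in> ?C" "z \<noteq> a" "z \<noteq> b" "z \<noteq> q" using that(1) D(1) aDn Q(2,4) by auto
      then have r0: "restr ?C \<alpha>0 z = \<alpha>0 z" unfolding restr_def by simp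
      have "\<alpha>0 z \<noteq> r" using D0(1)[of z] z(1) S(2) by auto
      moreover have "\<alpha>0 z \<notin> D"
      proof (cases "z = p")
        case True
        then show ?thesis using v0(4) aDn by simp
      next
        case False
        then show ?thesis using vo[of z] z that(2) by simp
      qed
      ultimately show ?thesis using r0 by simp
    qed
    show "outs2 (restr ?C \<alpha>0) r D" by (rule outs2I[OF xy(1-3) *[OF xy(1,4)] *[OF xy(2,5)]])
  qed
  moreover have "restr (insert r ?C) \<sigma> permutes insert r ?C"
    by (rule permutes_restr[OF P _ _ C1]) (use S(1) in auto)
  moreover have "pmatch ?C (restr ?C \<alpha>0)" by (rule pmatch_restr[OF M0 _ C0]) auto
  ultimately show "(restr (insert r ?C) \<sigma>, restr ?C \<alpha>0) \<in> Bset ?C r" unfolding Bset_def by simp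
  have "restr A \<sigma> \<circ> restr (insert r ?C) \<sigma> = \<sigma>"
    by (rule restr_Un[OF C1 dis(1)]) (use permutes_not_in[OF P] un(1) in auto)
  moreover have "restr A \<alpha>0 \<circ> restr ?C \<alpha>0 = \<alpha>0"
    by (rule restr_Un[OF C0 dis(2)]) (use D0(4) un(2) in auto)
  moreover have "restr A \<alpha>0 b = q" "restr (insert r ?C) \<sigma> r = a"
    using Q(2) v0(1) unfolding restr_def a_def by auto
  moreover have "transpose q a \<circ> \<alpha>0 \<circ> transpose q a = \<alpha>" unfolding \<alpha>0_def by (simp add: fun_eq_iff)
  ultimately show "join_cut r A ((b, restr A \<sigma>, restr A \<alpha>0), restr (insert r ?C) \<sigma>, restr ?C \<alpha>0) = (\<sigma>, \<alpha>)"
    unfolding join_cut_def by simp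
qed

lemma card_cutset:
  assumes S: "finite S" "r \<notin> S"
  shows "card {(\<sigma>, \<alpha>) \<in> Bset S r. \<exists>q A. cutset S r \<sigma> \<alpha> q A} =
    (\<Sum>A\<in>{A. A \<subseteq> S \<and> A \<noteq> {} \<and> A \<noteq> S}. card (rooted_W A) * card (Bset (S - A) r))"
proof -
  let ?F = "{A. A \<subseteq> S \<and> A \<noteq> {} \<and> A \<noteq> S}"
  define X where "X = (SIGMA A:?F. rooted_W A \<times> Bset (S - A) r)"
  define g where "g = (\<lambda>(A, u). join_cut r A u)"
  define N where "N = {(\<sigma>, \<alpha>) \<in> Bset S r. \<exists>q A. cutset S r \<sigma> \<alpha> q A}"
  have unpack: "\<exists>A b \<sigma>1 \<alpha>1 \<sigma>2 \<alpha>2. u = (A, (b, \<sigma>1, \<alpha>1), \<sigma>2, \<alpha>2) \<and> A \<subseteq> S \<and> A \<noteq> S \<and> b \<in> A \<and>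
      (\<sigma>1, \<alpha>1) \<in> Wset (A - {b}) b \<and> (\<sigma>2, \<alpha>2) \<in> Bset (S - A) r" if "u \<in> X" for u
    using that unfolding X_def rooted_W_def by auto
  have gj: "g (A, (b, \<sigma>1, \<alpha>1), \<sigma>2, \<alpha>2) = (\<sigma>1 \<circ> \<sigma>2, transpose (\<alpha>1 b) (\<sigma>2 r) \<circ> (\<alpha>1 \<circ> \<alpha>2) \<circ> transpose (\<alpha>1 b) (\<sigma>2 r))"
    for A b \<sigma>1 \<alpha>1 \<sigma>2 \<alpha>2 unfolding g_def join_cut_def by simp
  have "bij_betw g X N" unfolding bij_betw_def
  proof
    show "inj_on g X"
    proof (rule inj_onI)
      fix u v assume u: "u \<in> X" and v: "v \<in> X" and eq: "g u = g v"
      obtain A b \<sigma>1 \<alpha>1 \<sigma>2 \<alpha>2 where u': "u = (A, (b, \<sigma>1, \<alpha>1), \<sigma>2, \<alpha>2)" "A \<subseteq> S" "A \<noteq> S" "b \<in> A"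
        "(\<sigma>1, \<alpha>1) \<in> Wset (A - {b}) b" "(\<sigma>2, \<alpha>2) \<in> Bset (S - A) r" using unpack[OF u] by blast
      obtain A' b' \<sigma>1' \<alpha>1' \<sigma>2' \<alpha>2' where v': "v = (A', (b', \<sigma>1', \<alpha>1'), \<sigma>2', \<alpha>2')" "A' \<subseteq> S" "A' \<noteq> S" "b' \<in> A'"
        "(\<sigma>1', \<alpha>1') \<in> Wset (A' - {b'}) b'" "(\<sigma>2', \<alpha>2') \<in> Bset (S - A') r" using unpack[OF v] by blast
      obtain \<sigma> \<alpha> where sa: "g u = (\<sigma>, \<alpha>)" by (cases "g u")
      have e1: "\<sigma>1 \<circ> \<sigma>2 = \<sigma>" "transpose (\<alpha>1 b) (\<sigma>2 r) \<circ> (\<alpha>1 \<circ> \<alpha>2) \<circ> transpose (\<alpha>1 b) (\<sigma>2 r) = \<alpha>"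
        using sa u'(1) gj by simp_all
      have e2: "\<sigma>1' \<circ> \<sigma>2' = \<sigma>" "transpose (\<alpha>1' b') (\<sigma>2' r) \<circ> (\<alpha>1' \<circ> \<alpha>2') \<circ> transpose (\<alpha>1' b') (\<sigma>2' r) = \<alpha>"
        using sa eq v'(1) gj by simp_all
      note J = join_cut[OF S u'(2-6), unfolded e1]
      note J' = join_cut[OF S v'(2-6), unfolded e2]
      have P: "\<sigma> permutes insert r S" and M: "pmatch S \<alpha>" using J(1) unfolding Bset_def by auto
      have AA: "A = A'" using min_cut_subset[OF S P M J(2) J'(2)] min_cut_subset[OF S P M J'(2) J(2)] by blast
      have qq: "\<alpha>1 b = \<alpha>1' b'"
        using J(2) J'(2) unfolding AA min_cut_def cutset_def by blast
      have aa: "\<sigma>2 r = \<sigma>2' r" using J(6) J'(6) by simp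
      show "u = v" unfolding u'(1) v'(1)
        using J(3,4,5,7,8) J'(3,4,5,7,8) unfolding qq aa AA by simp
    qed
    show "g ` X = N"
    proof (intro equalityI subsetI)
      fix w assume "w \<in> g ` X"
      then obtain u where u: "u \<in> X" "w = g u" by blast
      obtain A b \<sigma>1 \<alpha>1 \<sigma>2 \<alpha>2 where u': "u = (A, (b, \<sigma>1, \<alpha>1), \<sigma>2, \<alpha>2)" "A \<subseteq> S" "A \<noteq> S" "b \<in> A"
        "(\<sigma>1, \<alpha>1) \<in> Wset (A - {b}) b" "(\<sigma>2, \<alpha>2) \<in> Bset (S - A) r" using unpack[OF u(1)] by blast
      note J = join_cut(1,2)[OF S u'(2-6)]
      show "w \<in> N" unfolding u(2) u'(1) gj N_def using J unfolding min_cut_def by blast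
    next
      fix w assume "w \<in> N"
      then obtain \<sigma> \<alpha> q0 A0 where w: "w = (\<sigma>, \<alpha>)" "(\<sigma>, \<alpha>) \<in> Bset S r" "cutset S r \<sigma> \<alpha> q0 A0" unfolding N_def by blast
      obtain q A where m: "min_cut S r \<sigma> \<alpha> q A" using cutset_imp_min_cut[OF S w(2,3)] by blast
      note C = split_cut[OF S w(2) m]
      show "w \<in> g ` X"
        by (rule image_eqI[where x = "(A, (\<alpha> (\<sigma> r), restr A \<sigma>, restr A (transpose q (\<sigma> r) \<circ> \<alpha> \<circ> transpose q (\<sigma> r))),
            restr (insert r (S - A)) \<sigma>, restr (S - A) (transpose q (\<sigma> r) \<circ> \<alpha> \<circ> transpose q (\<sigma> r)))"])
          (use C w in \<open>simp_all add: g_def X_def rooted_W_def\<close>)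
    qed
  qed
  then have "card N = card X" by (metis bij_betw_same_card)
  also have "\<dots> = (\<Sum>A\<in>?F. card (rooted_W A \<times> Bset (S - A) r))" unfolding X_def
  proof (rule card_SigmaI)
    show "finite ?F" using S(1) by (auto intro: finite_subset[of _ "Pow S"])
    show "\<forall>A\<in>?F. finite (rooted_W A \<times> Bset (S - A) r)"
    proof
      fix A assume "A \<in> ?F"
      then have "finite A" using S(1) finite_subset by blast
      then have "finite (rooted_W A)" unfolding rooted_W_def by (intro finite_SigmaI finite_Wset) auto
      then show "finite (rooted_W A \<times> Bset (S - A) r)" using S(1) by (intro finite_cartesian_product finite_Bset) auto
    qed
  qed
  finally show ?thesis unfolding N_def by (simp add: card_cartesian_product)
qed

section \<open>Counting fermion lines\<close>

lemma sum_Pow_card: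
  fixes h :: "nat \<Rightarrow> 'b :: comm_semiring_1"
  assumes "finite S"
  shows "(\<Sum>A\<in>Pow S. h (card A)) = (\<Sum>k\<le>card S. of_nat (card S choose k) * h k)"
proof -
  have "(\<Sum>A\<in>Pow S. h (card A)) = (\<Sum>k\<in>{..card S}. \<Sum>A\<in>{A \<in> Pow S. card A = k}. h (card A))"
    by (rule sum.group[symmetric]) (use assms card_mono in auto)
  also have "\<dots> = (\<Sum>k\<le>card S. of_nat (card S choose k) * h k)"
  proof (rule sum.cong[OF refl])
    fix k
    have "(\<Sum>A\<in>{A \<in> Pow S. card A = k}. h (card A)) = of_nat (card {A \<in> Pow S. card A = k}) * h k"
      by (simp add: sum.cong)
    also have "{A \<in> Pow S. card A = k} = {A. A \<subseteq> S \<and> card A = k}" by auto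
    finally show "(\<Sum>A\<in>{A \<in> Pow S. card A = k}. h (card A)) = of_nat (card S choose k) * h k"
      using n_subsets[OF assms] by simp
  qed
  finally show ?thesis .
qed

text \<open>The product rule for exponential generating functions: the binomial coefficient counting
  the subsets of size k cancels against the factorials.\<close>

lemma egf_mult:
  fixes u v :: "nat \<Rightarrow> 'b :: {comm_semiring_1, semiring_char_0}"
  assumes "finite S"
  shows "(\<Sum>A\<in>Pow S. (fact (card A) * u (card A)) * (fact (card (S - A)) * v (card (S - A)))) =
    fact (card S) * (\<Sum>k\<le>card S. u k * v (card S - k))"
proof -
  let ?m = "card S"
  have "(\<Sum>A\<in>Pow S. (fact (card A) * u (card A)) * (fact (card (S - A)) * v (card (S - A)))) =
    (\<Sum>A\<in>Pow S. (fact (card A) * u (card A)) * (fact (?m - card A) * v (?m - card A)))"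
    by (rule sum.cong[OF refl]) (use assms in \<open>auto simp: card_Diff_subset finite_subset[OF _ assms]\<close>)
  also have "\<dots> = (\<Sum>k\<le>?m. of_nat (?m choose k) * ((fact k * u k) * (fact (?m - k) * v (?m - k))))"
    by (rule sum_Pow_card[OF assms])
  also have "\<dots> = (\<Sum>k\<le>?m. fact ?m * (u k * v (?m - k)))"
  proof (rule sum.cong[OF refl])
    fix k assume "k \<in> {..?m}"
    then have "fact k * fact (?m - k) * (?m choose k) = fact ?m" by (intro binomial_fact_lemma) auto
    then have f: "(fact k * fact (?m - k) * of_nat (?m choose k) :: 'b) = fact ?m"
      by (metis of_nat_fact of_nat_mult)
    have "of_nat (?m choose k) * ((fact k * u k) * (fact (?m - k) * v (?m - k))) =
      (fact k * fact (?m - k) * of_nat (?m choose k)) * (u k * v (?m - k))" by (simp only: mult_ac)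
    then show "of_nat (?m choose k) * ((fact k * u k) * (fact (?m - k) * v (?m - k))) = fact ?m * (u k * v (?m - k))"
      unfolding f .
  qed
  finally show ?thesis by (simp add: sum_distrib_left)
qed

text \<open>The coefficients of B(y^2): y marks vertices, and a line without external boson has an
  even number of them.\<close>

definition B_egf :: "nat \<Rightarrow> nat" where "B_egf m = (if even m then B_num (m div 2) else 0)"

lemma Bset_empty: "Bset {} r = {(id, id)}"
proof -
  have "\<sigma> permutes {r} \<longleftrightarrow> \<sigma> = id" for \<sigma> :: "'a \<Rightarrow> 'a"
    by (simp add: permutes_sing)
  then show ?thesis unfolding Bset_def good_def by auto
qed

text \<open>The Stein recurrence indexed by the size k = 2 * i + 2 of the part of type W, its extra
  vertex included; k - 1 is the weight 2 * i + 1.\<close>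

lemma B_egf_rec:
  assumes "m > 0"
  shows "B_egf m = (\<Sum>k\<le>m. (k - 1) * (if k = 0 then 0 else B_egf (k - 2)) * B_egf (m - k))"
proof -
  let ?h = "\<lambda>k. (k - 1) * (if k = 0 then 0 else B_egf (k - 2)) * B_egf (m - k)"
  show ?thesis
  proof (cases "even m")
    case False
    have "?h k = 0" if "k \<le> m" for k
    proof (cases "k = 0 \<or> k = 1")
      case False
      then have k: "k \<ge> 2" by auto
      show ?thesis
      proof (cases "even k")
        case True
        then have "odd (m - k)" using \<open>odd m\<close> that by simp
        then show ?thesis by (simp add: B_egf_def)
      next
        case False
        then have "odd (k - 2)" using k by simp
        then show ?thesis by (simp add: B_egf_def)
      qed
    qed auto
    then have "(\<Sum>k\<le>m. ?h k) = 0" by (intro sum.neutral) blast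
    then show ?thesis using False by (simp add: B_egf_def)
  next
    case True
    then obtain n where "m = 2 * Suc n" using assms by (metis dvdE gr0_implies_Suc mult_is_0 neq0_conv)
    note m = this
    have "(\<Sum>k\<le>m. ?h k) = (\<Sum>k\<in>(\<lambda>i. 2 * i + 2) ` {..n}. ?h k)"
    proof (rule sum.mono_neutral_right)
      show "\<forall>k\<in>{..m} - (\<lambda>i. 2 * i + 2) ` {..n}. ?h k = 0"
      proof
        fix k assume k: "k \<in> {..m} - (\<lambda>i. 2 * i + 2) ` {..n}"
        show "?h k = 0"
        proof (cases "k = 0 \<or> k = 1")
          case False
          have "odd k"
          proof
            assume "even k"
            then obtain j where j: "k = 2 * j" by (elim dvdE)
            then have "k = 2 * (j - 1) + 2" "j - 1 \<in> {..n}" using False k m by auto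
            then show False using k by blast
          qed
          then have "odd (k - 2)" using False by auto
          then show ?thesis by (simp add: B_egf_def)
        qed auto
      qed
    qed (use m in auto)
    also have "\<dots> = (\<Sum>i\<le>n. ?h (2 * i + 2))"
      by (rule sum.reindex_cong[OF _ refl refl]) (auto simp: inj_on_def)
    also have "\<dots> = (\<Sum>i\<le>n. (2 * i + 1) * B_num i * B_num (n - i))"
    proof (rule sum.cong[OF refl])
      fix i assume "i \<in> {..n}"
      then have "m - (2 * i + 2) = 2 * (n - i)" using m by auto
      then show "?h (2 * i + 2) = (2 * i + 1) * B_num i * B_num (n - i)" by (simp add: B_egf_def)
    qed
    finally show ?thesis using m by (simp add: B_egf_def stein_recurrence del: B_num_def)
  qed
qed

text \<open>Structures without a cutset supply the term A = S, since \<open>Bset {} r\<close> has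
  one element; so B - 1 = WB becomes a single sum over the nonempty A. It involves smaller
  structures only and is the recurrence of the connected chord diagrams.\<close>

lemma card_Bset:
  assumes "finite S" "r \<notin> S"
  shows "card (Bset S r) = fact (card S) * B_egf (card S)"
  using assms
proof (induction "card S" arbitrary: S r rule: less_induct)
  case less
  note S = less.prems
  show ?case
  proof (cases "S = {}")
    case True
    then show ?thesis by (simp add: Bset_empty B_egf_def B_num_0)
  next
    case False
    define w where "w = (\<lambda>k. (k - 1) * (if k = 0 then 0 else B_egf (k - 2)))"
    have rW: "card (rooted_W A) = fact (card A) * w (card A)" if A: "A \<subseteq> S" for A
    proof -
      have fA: "finite A" using A S(1) finite_subset by blast
      have cA: "card A \<le> card S" using A S(1) by (rule card_mono[rotated])
      \<comment> \<open>With k = card A there are k choices of the extra vertex, k - 1 of the vertex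
        with the external boson and k - 1 of its place; together with the factorial of k - 2 this is
        fact k times k - 1.\<close>
      have "card (rooted_W A) = (\<Sum>a\<in>A. card (Wset (A - {a}) a))" by (rule card_rooted_W[OF fA])
      also have "\<dots> = (\<Sum>a\<in>A. (card A - 1) * ((card A - 1) * (fact (card A - 2) * B_egf (card A - 2))))"
      proof (rule sum.cong[OF refl])
        fix a assume a: "a \<in> A"
        have c1: "card (A - {a}) = card A - 1" using a fA by simp
        have "card (Wset (A - {a}) a) = (\<Sum>b\<in>A - {a}. card (A - {a}) * card (Bset (A - {a} - {b}) a))"
          by (rule card_Wset) (use fA in auto)
        also have "\<dots> = (\<Sum>b\<in>A - {a}. (card A - 1) * (fact (card A - 2) * B_egf (card A - 2)))"
        proof (rule sum.cong[OF refl])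
          fix b assume b: "b \<in> A - {a}"
          have c2: "card (A - {a} - {b}) = card A - 2" using a b fA by simp
          have "card A > 0" using a fA by (auto simp: card_gt_0_iff)
          then have "card (A - {a} - {b}) < card S" using c2 cA by simp
          then have "card (Bset (A - {a} - {b}) a) = fact (card (A - {a} - {b})) * B_egf (card (A - {a} - {b}))"
            by (rule less.hyps) (use fA in auto)
          then show "card (A - {a}) * card (Bset (A - {a} - {b}) a) = (card A - 1) * (fact (card A - 2) * B_egf (card A - 2))"
            unfolding c1 c2 by simp
        qed
        also have "\<dots> = (card A - 1) * ((card A - 1) * (fact (card A - 2) * B_egf (card A - 2)))"
          using c1 by simp
        finally show "card (Wset (A - {a}) a) = (card A - 1) * ((card A - 1) * (fact (card A - 2) * B_egf (card A - 2)))" .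
      qed
      also have "\<dots> = card A * ((card A - 1) * ((card A - 1) * (fact (card A - 2) * B_egf (card A - 2))))" by simp
      also have "\<dots> = fact (card A) * w (card A)"
      proof (cases "card A \<ge> 2")
        case True
        then obtain k where k: "card A = Suc (Suc k)" by (metis add_2_eq_Suc le_Suc_ex)
        show ?thesis unfolding k w_def by (simp add: algebra_simps)
      next
        case False
        then have "card A = 0 \<or> card A = 1" by linarith
        then show ?thesis unfolding w_def by auto
      qed
      finally show ?thesis .
    qed
    let ?X = "{(\<sigma>, \<alpha>) \<in> Bset S r. \<forall>q A. \<not> cutset S r \<sigma> \<alpha> q A}"
    let ?Y = "{(\<sigma>, \<alpha>) \<in> Bset S r. \<exists>q A. cutset S r \<sigma> \<alpha> q A}"
    have XY: "Bset S r = ?X \<union> ?Y" "?X \<inter> ?Y = {}" by blast+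
    have fB: "finite (Bset S r)" by (rule finite_Bset[OF S(1)])
    have "finite ?X" by (rule finite_subset[OF _ fB]) blast
    moreover have "finite ?Y" by (rule finite_subset[OF _ fB]) blast
    ultimately have "card (?X \<union> ?Y) = card ?X + card ?Y" using XY(2) by (rule card_Un_disjoint)
    then have "card (Bset S r) = card ?X + card ?Y" using XY(1) by simp
    also have "\<dots> = card (rooted_W S) * card (Bset (S - S) r) +
      (\<Sum>A\<in>{A. A \<subseteq> S \<and> A \<noteq> {} \<and> A \<noteq> S}. card (rooted_W A) * card (Bset (S - A) r))"
      unfolding card_no_cutset[OF S False] card_cutset[OF S] by (simp add: Bset_empty)
    also have "\<dots> = (\<Sum>A\<in>{A. A \<subseteq> S \<and> A \<noteq> {}}. card (rooted_W A) * card (Bset (S - A) r))"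
    proof -
      have "{A. A \<subseteq> S \<and> A \<noteq> {}} = insert S {A. A \<subseteq> S \<and> A \<noteq> {} \<and> A \<noteq> S}" using False by auto
      moreover have "finite {A. A \<subseteq> S \<and> A \<noteq> {} \<and> A \<noteq> S}" using S(1) by (auto intro: finite_subset[of _ "Pow S"])
      ultimately show ?thesis by simp
    qed
    also have "\<dots> = (\<Sum>A\<in>{A. A \<subseteq> S \<and> A \<noteq> {}}. (fact (card A) * w (card A)) * (fact (card (S - A)) * B_egf (card (S - A))))"
    proof (rule sum.cong[OF refl])
      fix A assume A: "A \<in> {A. A \<subseteq> S \<and> A \<noteq> {}}"
      then have "card (S - A) < card S" using S(1) by (intro psubset_card_mono) auto
      then have "card (Bset (S - A) r) = fact (card (S - A)) * B_egf (card (S - A))"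
        by (rule less.hyps) (use S in auto)
      then show "card (rooted_W A) * card (Bset (S - A) r) = (fact (card A) * w (card A)) * (fact (card (S - A)) * B_egf (card (S - A)))"
        using rW[of A] A by simp
    qed
    also have "\<dots> = (\<Sum>A\<in>Pow S. (fact (card A) * w (card A)) * (fact (card (S - A)) * B_egf (card (S - A))))"
      by (rule sum.mono_neutral_left) (use S in \<open>auto simp: w_def\<close>)
    also have "\<dots> = fact (card S) * (\<Sum>k\<le>card S. w k * B_egf (card S - k))"
      by (rule egf_mult[OF S(1)])
    also have "(\<Sum>k\<le>card S. w k * B_egf (card S - k)) = B_egf (card S)"
      using B_egf_rec[of "card S"] False S(1) unfolding w_def by (simp add: card_gt_0_iff)
    finally show ?thesis .
  qed
qed

text \<open>That is, \<open>A\<close> is an initial (for a suffix, final) segment of the fermion line together with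
  some fermion cycles.\<close>

definition prefix :: "('a \<Rightarrow> 'a) \<Rightarrow> 'a \<Rightarrow> 'a set \<Rightarrow> bool" where
  "prefix \<sigma> r A \<longleftrightarrow> (\<forall>x. \<sigma> x \<in> A \<longrightarrow> x \<in> insert r A)"

definition suffix :: "('a \<Rightarrow> 'a) \<Rightarrow> 'a \<Rightarrow> 'a set \<Rightarrow> bool" where
  "suffix \<sigma> r A \<longleftrightarrow> (\<forall>x\<in>A. \<sigma> x \<in> insert r A)"

text \<open>A does not contain r, so closure under \<alpha> keeps the external boson away from A.
  Such a set hangs on the rest by the fermion edge at its end only.\<close>

definition no_prefix :: "('a \<Rightarrow> 'a) \<Rightarrow> ('a \<Rightarrow> 'a) \<Rightarrow> 'a \<Rightarrow> 'a set \<Rightarrow> bool" where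
  "no_prefix \<sigma> \<alpha> r S \<longleftrightarrow> (\<forall>A. A \<subseteq> S \<longrightarrow> (\<forall>x\<in>A. \<alpha> x \<in> A) \<longrightarrow> prefix \<sigma> r A \<longrightarrow> A = {})"

definition no_suffix :: "('a \<Rightarrow> 'a) \<Rightarrow> ('a \<Rightarrow> 'a) \<Rightarrow> 'a \<Rightarrow> 'a set \<Rightarrow> bool" where
  "no_suffix \<sigma> \<alpha> r S \<longleftrightarrow> (\<forall>A. A \<subseteq> S \<longrightarrow> (\<forall>x\<in>A. \<alpha> x \<in> A) \<longrightarrow> suffix \<sigma> r A \<longrightarrow> A = {})"

definition max_prefix :: "'a set \<Rightarrow> 'a \<Rightarrow> ('a \<Rightarrow> 'a) \<Rightarrow> ('a \<Rightarrow> 'a) \<Rightarrow> 'a set \<Rightarrow> bool" where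
  "max_prefix S r \<sigma> \<alpha> L \<longleftrightarrow> L \<subseteq> S \<and> (\<forall>x\<in>L. \<alpha> x \<in> L) \<and> prefix \<sigma> r L
     \<and> (\<forall>A. A \<subseteq> S \<longrightarrow> (\<forall>x\<in>A. \<alpha> x \<in> A) \<longrightarrow> prefix \<sigma> r A \<longrightarrow> A \<subseteq> L)"

text \<open>Prefixes and \<alpha>-closed sets are stable under unions, so there is a greatest one;
  it may be empty.\<close>

lemma max_prefix_exists: "\<exists>L. max_prefix S r \<sigma> \<alpha> L"
proof
  let ?L = "\<Union>{A. A \<subseteq> S \<and> (\<forall>x\<in>A. \<alpha> x \<in> A) \<and> prefix \<sigma> r A}"
  have "prefix \<sigma> r ?L" unfolding prefix_def by blast
  then show "max_prefix S r \<sigma> \<alpha> ?L" unfolding max_prefix_def by blast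
qed

lemma max_prefix_subset: "max_prefix S r \<sigma> \<alpha> L \<Longrightarrow> max_prefix S r \<sigma> \<alpha> L' \<Longrightarrow> L' \<subseteq> L"
  by (simp add: max_prefix_def)

text \<open>Where the line leaves L it is sent back to r, which closes its first segment to a line
  of its own.\<close>

definition initial :: "'a set \<Rightarrow> 'a \<Rightarrow> ('a \<Rightarrow> 'a) \<Rightarrow> 'a \<Rightarrow> 'a" where
  "initial L r \<sigma> = (\<lambda>x. if x \<in> insert r L then (if \<sigma> x \<in> L then \<sigma> x else r) else x)"

text \<open>Each point of L has its predecessor in insert r L, because L is a prefix. By counting,
  some point of insert r L is not sent into L, and that one is redirected to r. A map of a finite
  set onto itself is injective.\<close>

lemma initial_permutes:
  assumes P: "\<sigma> permutes insert r S" and L: "finite L" "r \<notin> L" and pre: "prefix \<sigma> r L"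
  shows "initial L r \<sigma> permutes insert r L"
proof (rule bij_imp_permutes)
  let ?i = "initial L r \<sigma>"
  have inj: "\<sigma> x = \<sigma> y \<longleftrightarrow> x = y" for x y using permutes_inj[OF P] by (auto dest: injD)
  have surj: "\<exists>x\<in>insert r L. \<sigma> x \<in> L \<and> \<sigma> x = y" if "y \<in> L" for y
  proof -
    have "\<sigma> (inv \<sigma> y) = y" using permutes_inverses(1)[OF P] .
    then show ?thesis using that pre unfolding prefix_def by metis
  qed
  have sur: "insert r L \<subseteq> ?i ` insert r L"
  proof
    fix y assume y: "y \<in> insert r L"
    show "y \<in> ?i ` insert r L"
    proof (cases "y = r")
      case False
      then obtain x where "x \<in> insert r L" "\<sigma> x \<in> L" "\<sigma> x = y" using surj[of y] y by blast
      then show ?thesis unfolding initial_def by (intro image_eqI[of _ _ x]) auto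
    next
      case True
      have "\<exists>x\<in>insert r L. \<sigma> x \<notin> L"
      proof (rule ccontr)
        assume "\<not> ?thesis"
        then have "\<sigma> ` insert r L \<subseteq> L" by blast
        moreover have "inj_on \<sigma> (insert r L)" using inj by (auto simp: inj_on_def)
        ultimately have "card (insert r L) \<le> card L" using card_inj_on_le L(1) by blast
        then show False using L by simp
      qed
      then obtain x where "x \<in> insert r L" "\<sigma> x \<notin> L" by blast
      then show ?thesis using True unfolding initial_def by (intro image_eqI[of _ _ x]) auto
    qed
  qed
  have sub: "?i ` insert r L \<subseteq> insert r L" unfolding initial_def by auto
  have fin: "finite (insert r L)" using L(1) by simp
  have eq: "?i ` insert r L = insert r L" using sur sub by blast
  then have "inj_on ?i (insert r L)" using fin by (intro eq_card_imp_inj_on) simp_all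
  then show "bij_betw ?i (insert r L) (insert r L)" using eq unfolding bij_betw_def by blast
qed (simp add: initial_def)

text \<open>\<open>\<sigma>2 \<circ> \<sigma>1\<close> follows the line through L and, where
  \<sigma>1 would return to r, continues with the first vertex of the second line. As the second
  part has no prefix, L is the greatest one of the whole. A suffix of the whole leaves a suffix of
  the second part; if that is empty, the suffix lies in L and is \<sigma>1-closed, which
  \<open>good\<close> forbids for an \<alpha>-closed set.\<close>

lemma concat_lines:
  assumes S: "finite S" "r \<notin> S" and L: "L \<subseteq> S"
    and B: "(\<sigma>1, \<alpha>1) \<in> Bset L r" and W: "(\<sigma>2, \<alpha>2) \<in> Wset (S - L) r"
    and np: "no_prefix \<sigma>2 \<alpha>2 r (S - L)"
  defines "\<sigma> \<equiv> \<sigma>2 \<circ> \<sigma>1" and "\<alpha> \<equiv> \<alpha>1 \<circ> \<alpha>2"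
  shows "(\<sigma>, \<alpha>) \<in> Wset S r" "max_prefix S r \<sigma> \<alpha> L" "initial L r \<sigma> = \<sigma>1" "\<sigma> \<circ> inv \<sigma>1 = \<sigma>2"
    "restr L \<alpha> = \<alpha>1" "restr (insert r (S - L)) \<alpha> = \<alpha>2"
    "no_suffix \<sigma> \<alpha> r S \<longleftrightarrow> no_suffix \<sigma>2 \<alpha>2 r (S - L)"
proof -
  let ?R = "S - L"
  have fL: "finite L" using L S(1) finite_subset by blast
  have rL: "r \<notin> L" using L S(2) by blast
  have p1: "\<sigma>1 permutes insert r L" and m1: "pmatch L \<alpha>1" and g1: "good \<sigma>1 \<alpha>1 r L"
    using B unfolding Bset_def by auto
  have p2: "\<sigma>2 permutes insert r ?R" and m2: "pmatch (insert r ?R) \<alpha>2" and g2: "good \<sigma>2 \<alpha>2 r ?R"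
    using W unfolding Wset_def by auto
  note D1 = pmatchD[OF m1] and D2 = pmatchD[OF m2]
  have dis: "L \<inter> insert r ?R = {}" using rL by blast
  have un: "L \<union> insert r ?R = insert r S" using L by blast
  note MU = pmatch_Un[OF m1 m2 dis, folded \<alpha>_def]
  have M: "pmatch (insert r S) \<alpha>" using MU(1) un by simp
  show "restr L \<alpha> = \<alpha>1" "restr (insert r ?R) \<alpha> = \<alpha>2" using MU(4,5) by auto
  have s1: "\<sigma>1 permutes insert r S" using permutes_subset[OF p1] L by blast
  have s2: "\<sigma>2 permutes insert r S" using permutes_subset[OF p2] by blast
  have P: "\<sigma> permutes insert r S" unfolding \<sigma>_def by (rule permutes_compose[OF s1 s2])
  show "\<sigma> \<circ> inv \<sigma>1 = \<sigma>2" unfolding \<sigma>_def using permutes_inverses(1)[OF p1] by (simp add: fun_eq_iff)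
  have f2: "\<sigma>2 x = x" if "x \<in> L" for x
    by (rule permutes_not_in[OF p2]) (use that rL in auto)
  have f2L: "\<sigma>2 x \<notin> L" if "x \<notin> L" for x
    using f2[of "\<sigma>2 x"] that permutes_inj[OF p2] by (metis injD)
  have f1: "\<sigma>1 x = x" if "x \<notin> insert r L" for x using permutes_not_in[OF p1] that by blast
  have f1L: "\<sigma>1 x \<in> insert r L \<longleftrightarrow> x \<in> insert r L" for x using permutes_in_image[OF p1] .
  have sL: "\<sigma> x = \<sigma>1 x" if "\<sigma>1 x \<in> L" for x using f2[OF that] unfolding \<sigma>_def by simp
  have sr: "\<sigma> x = \<sigma>2 r" if "\<sigma>1 x = r" for x using that unfolding \<sigma>_def by simp
  have sR: "\<sigma> x = \<sigma>2 x" if "x \<notin> insert r L" for x using f1[OF that] unfolding \<sigma>_def by simp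
  show "initial L r \<sigma> = \<sigma>1"
  proof
    fix x
    show "initial L r \<sigma> x = \<sigma>1 x"
    proof (cases "x \<in> insert r L")
      case True
      then consider "\<sigma>1 x \<in> L" | "\<sigma>1 x = r" using f1L[of x] by blast
      then show ?thesis
      proof cases
        case 1
        then show ?thesis using True sL[of x] unfolding initial_def by simp
      next
        case 2
        then show ?thesis using True sr[of x] f2L[OF rL] unfolding initial_def by simp
      qed
    next
      case False
      then show ?thesis using f1 unfolding initial_def by simp
    qed
  qed
  have aL: "\<alpha> x = \<alpha>1 x" "\<alpha> x \<in> L" if "x \<in> L" for x using MU(2)[OF that] D1(1)[OF that] by auto
  have aR: "\<alpha> x = \<alpha>2 x" "\<alpha> x \<notin> L" if "x \<notin> L" for x
    using MU(3)[OF that] aL(2)[of "\<alpha> x"] pmatchD(3)[OF M, of x] that by auto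
  have pre: "prefix \<sigma> r L" unfolding prefix_def
  proof (intro allI impI)
    fix x assume "\<sigma> x \<in> L"
    then have "\<sigma>1 x \<in> L" using f2L[of "\<sigma>1 x"] unfolding \<sigma>_def by auto
    then show "x \<in> insert r L" using f1L[of x] by blast
  qed
  show "max_prefix S r \<sigma> \<alpha> L" unfolding max_prefix_def
  proof (intro conjI allI impI)
    fix A assume A: "A \<subseteq> S" "\<forall>x\<in>A. \<alpha> x \<in> A" "prefix \<sigma> r A"
    have "prefix \<sigma>2 r (A - L)" unfolding prefix_def
    proof (intro allI impI)
      fix y assume y: "\<sigma>2 y \<in> A - L"
      show "y \<in> insert r (A - L)"
      proof (cases "y = r")
        case False
        have yL: "y \<notin> L" using f2[of y] y by auto
        then have "\<sigma> y = \<sigma>2 y" using sR[of y] False by blast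
        then have "y \<in> insert r A" using A(3) y unfolding prefix_def by auto
        then show ?thesis using yL by blast
      qed blast
    qed
    moreover have "\<forall>x\<in>A - L. \<alpha>2 x \<in> A - L" using A(2) aR by auto
    moreover have "A - L \<subseteq> ?R" using A(1) by blast
    ultimately have "A - L = {}" using np unfolding no_prefix_def by blast
    then show "A \<subseteq> L" by blast
  qed (use L aL pre in auto)
  have g: "good \<sigma> \<alpha> r S"
  proof (rule goodI)
    fix A assume A: "A \<subseteq> S" "A \<noteq> {}" "\<And>x. x \<in> A \<Longrightarrow> \<sigma> x \<in> A"
    have fA: "finite A" using A(1) S(1) finite_subset by blast
    have rA: "r \<notin> A" using A(1) S(2) by blast
    have inv: "\<And>x. \<sigma> x \<in> A \<Longrightarrow> x \<in> A" using permutes_closed_iff[OF P fA] A(3) by blast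
    have invL: "x \<in> A \<inter> L" if "\<sigma>1 x \<in> A \<inter> L" for x
    proof -
      have "x \<in> A" using inv[of x] sL[of x] that by auto
      moreover have "x \<in> insert r L" using f1L[of x] that by blast
      ultimately show ?thesis using rA by blast
    qed
    have fAL: "finite (A \<inter> L)" using fA by simp
    have clL: "\<sigma>1 x \<in> A \<inter> L" if "x \<in> A \<inter> L" for x
      using permutes_closed_iff[OF p1 fAL] invL that by blast
    show "outs2 \<alpha> r A"
    proof (cases "A \<inter> L = {}")
      case False
      have "outs2 \<alpha>1 r (A \<inter> L)" by (rule goodD[OF g1 _ False]) (use clL in auto)
      then obtain x y where xy: "x \<in> A \<inter> L" "y \<in> A \<inter> L" "x \<noteq> y" "\<alpha>1 x \<notin> A \<inter> L" "\<alpha>1 y \<notin> A \<inter> L" by (auto elim!: outs2E)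
      have *: "\<alpha> z \<notin> insert r A" if "z \<in> A \<inter> L" "\<alpha>1 z \<notin> A \<inter> L" for z
        using that aL[of z] rL by auto
      show ?thesis by (rule outs2I[of x A y]) (use xy * in auto)
    next
      case True
      then have AR: "A \<subseteq> ?R" using A(1) by blast
      have "outs2 \<alpha>2 r A"
      proof (rule goodD[OF g2 AR A(2)])
        fix x assume x: "x \<in> A"
        then have "x \<notin> insert r L" using True rA by blast
        then show "\<sigma>2 x \<in> A" using sR[of x] A(3)[OF x] by simp
      qed
      then obtain x y where xy: "x \<in> A" "y \<in> A" "x \<noteq> y" "\<alpha>2 x \<notin> insert r A" "\<alpha>2 y \<notin> insert r A" by (rule outs2E)
      then have "x \<notin> L" "y \<notin> L" using True by auto
      then show ?thesis using xy aR(1)[of x] aR(1)[of y] by (intro outs2I[of x A y]) auto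
    qed
  qed
  then show "(\<sigma>, \<alpha>) \<in> Wset S r" unfolding Wset_def using P M by simp
  show "no_suffix \<sigma> \<alpha> r S \<longleftrightarrow> no_suffix \<sigma>2 \<alpha>2 r ?R"
  proof
    assume n: "no_suffix \<sigma> \<alpha> r S"
    show "no_suffix \<sigma>2 \<alpha>2 r ?R" unfolding no_suffix_def
    proof (intro allI impI)
      fix A assume A: "A \<subseteq> ?R" "\<forall>x\<in>A. \<alpha>2 x \<in> A" "suffix \<sigma>2 r A"
      have *: "x \<notin> insert r L" if "x \<in> A" for x using that A(1) S(2) by blast
      have "\<forall>x\<in>A. \<alpha> x \<in> A" using A(2) aR * by auto
      moreover have "suffix \<sigma> r A" using A(3) sR * unfolding suffix_def by auto
      moreover have "A \<subseteq> S" using A(1) by blast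
      ultimately show "A = {}" using n unfolding no_suffix_def by blast
    qed
  next
    assume n: "no_suffix \<sigma>2 \<alpha>2 r ?R"
    show "no_suffix \<sigma> \<alpha> r S" unfolding no_suffix_def
    proof (intro allI impI, rule ccontr)
      fix A assume A: "A \<subseteq> S" "\<forall>x\<in>A. \<alpha> x \<in> A" "suffix \<sigma> r A" and ne: "A \<noteq> {}"
      have rA: "r \<notin> A" using A(1) S(2) by blast
      have *: "x \<notin> insert r L" if "x \<in> A - L" for x using that rA by blast
      have "suffix \<sigma>2 r (A - L)" unfolding suffix_def
      proof
        fix x assume x: "x \<in> A - L"
        have "\<sigma>2 x \<in> insert r A" using sR[OF *[OF x]] A(3) x unfolding suffix_def by auto
        moreover have "\<sigma>2 x \<notin> L" using f2L x by blast
        ultimately show "\<sigma>2 x \<in> insert r (A - L)" by blast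
      qed
      moreover have "\<forall>x\<in>A - L. \<alpha>2 x \<in> A - L" using A(2) aR by auto
      moreover have "A - L \<subseteq> ?R" using A(1) by blast
      ultimately have "A - L = {}" using n unfolding no_suffix_def by blast
      then have AL: "A \<subseteq> L" by blast
      have "\<sigma>1 x \<in> A" if x: "x \<in> A" for x
      proof -
        have sx: "\<sigma> x \<in> insert r A" using A(3) x unfolding suffix_def by blast
        have "x \<in> insert r L" using x AL by blast
        then consider "\<sigma>1 x \<in> L" | "\<sigma>1 x = r" using f1L[of x] by blast
        then show ?thesis
        proof cases
          case 1
          then show ?thesis using sL[of x] sx rL by auto
        next
          case 2
          then have "\<sigma>2 r \<in> insert r A" using sr[of x] sx by simp
          \<comment> \<open>The second line would be empty, and the second part a union of cycles
            whose only further boson edge is the external one.\<close>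
          then have rr: "\<sigma>2 r = r" using f2L[OF rL] AL by blast
          have "\<sigma>2 z \<in> ?R" if "z \<in> ?R" for z
          proof -
            have "\<sigma>2 z \<noteq> r" using rr permutes_inj[OF p2] that S(2) by (metis DiffD1 injD)
            then show ?thesis using permutes_in_image[OF p2, of z] that by blast
          qed
          moreover have "?R \<noteq> {}" using D2(1,2)[of r] by auto
          ultimately have "outs2 \<alpha>2 r ?R" using goodD[OF g2] by blast
          then show ?thesis using D2(1) by (auto elim!: outs2E)
        qed
      qed
      then have "outs2 \<alpha>1 r A" by (rule goodD[OF g1 AL ne])
      then obtain x where x: "x \<in> A" "\<alpha>1 x \<notin> A" by (auto elim!: outs2E)
      then have "\<alpha> x = \<alpha>1 x" using aL(1) AL by blast
      then show False using A(2) x by metis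
    qed
  qed
qed

text \<open>A prefix of the remaining part, joined with L, would be a prefix of the whole; since L
  is the greatest, nothing remains to be split off. Composition with the inverse of the initial part
  makes r bypass L.\<close>

lemma split_line:
  assumes S: "finite S" "r \<notin> S" and W: "(\<sigma>, \<alpha>) \<in> Wset S r" and mp: "max_prefix S r \<sigma> \<alpha> L"
  defines "\<sigma>1 \<equiv> initial L r \<sigma>"
  shows "L \<subseteq> S" "(\<sigma>1, restr L \<alpha>) \<in> Bset L r" "(\<sigma> \<circ> inv \<sigma>1, restr (insert r (S - L)) \<alpha>) \<in> Wset (S - L) r"
    "no_prefix (\<sigma> \<circ> inv \<sigma>1) (restr (insert r (S - L)) \<alpha>) r (S - L)"
    "(\<sigma> \<circ> inv \<sigma>1) \<circ> \<sigma>1 = \<sigma>" "restr L \<alpha> \<circ> restr (insert r (S - L)) \<alpha> = \<alpha>"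
proof -
  let ?R = "S - L" and ?\<sigma>2 = "\<sigma> \<circ> inv \<sigma>1"
  have P: "\<sigma> permutes insert r S" and M: "pmatch (insert r S) \<alpha>" and gd: "good \<sigma> \<alpha> r S"
    using W unfolding Wset_def by auto
  note aD = pmatchD[OF M]
  have L: "L \<subseteq> S" "\<And>x. x \<in> L \<Longrightarrow> \<alpha> x \<in> L" "prefix \<sigma> r L"
    and mx: "\<And>A. A \<subseteq> S \<Longrightarrow> (\<forall>x\<in>A. \<alpha> x \<in> A) \<Longrightarrow> prefix \<sigma> r A \<Longrightarrow> A \<subseteq> L"
    using mp unfolding max_prefix_def by blast+
  show "L \<subseteq> S" by fact
  have fL: "finite L" using L(1) S(1) finite_subset by blast
  have rL: "r \<notin> L" using L(1) S(2) by blast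
  have p1: "\<sigma>1 permutes insert r L" unfolding \<sigma>1_def by (rule initial_permutes[OF P fL rL L(3)])
  show comp: "?\<sigma>2 \<circ> \<sigma>1 = \<sigma>" using permutes_inverses(2)[OF p1] by (simp add: fun_eq_iff)
  have s2: "?\<sigma>2 (\<sigma>1 x) = \<sigma> x" for x using comp by (metis comp_apply)
  have i1: "\<sigma> x = \<sigma>1 x" if "\<sigma>1 x \<in> L" for x
    using that rL unfolding \<sigma>1_def initial_def by (auto split: if_splits simp: prefix_def)
  have i2: "\<sigma>1 x = x" if "x \<notin> insert r L" for x using that unfolding \<sigma>1_def initial_def by simp
  have "\<sigma>1 permutes insert r S" using permutes_subset[OF p1] L(1) by blast
  then have P2S: "?\<sigma>2 permutes insert r S" using permutes_compose[OF permutes_inv P] by blast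
  have fixL: "?\<sigma>2 y = y" if "y \<in> L" for y
  proof -
    have e: "\<sigma>1 (inv \<sigma>1 y) = y" using permutes_inverses(1)[OF p1] .
    then show ?thesis using i1[of "inv \<sigma>1 y"] that by simp
  qed
  have P2: "?\<sigma>2 permutes insert r ?R"
    by (rule permutes_superset[OF P2S]) (use fixL rL in auto)
  have M1: "pmatch L (restr L \<alpha>)" by (rule pmatch_restr[OF M]) (use L in auto)
  have presR: "\<alpha> x \<in> insert r ?R" if "x \<in> insert r ?R" for x
  proof -
    have "x \<notin> L" using that rL by blast
    then have "\<alpha> x \<notin> L" using L(2)[of "\<alpha> x"] aD(3)[of x] by auto
    then show ?thesis using aD(1)[of x] that by blast
  qed
  have M2: "pmatch (insert r ?R) (restr (insert r ?R) \<alpha>)"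
    by (rule pmatch_restr[OF M _ presR]) auto
  have dis: "L \<inter> insert r ?R = {}" using rL by blast
  show "restr L \<alpha> \<circ> restr (insert r ?R) \<alpha> = \<alpha>"
    by (rule restr_Un[OF presR dis]) (use aD(4) L(1) in auto)
  have "good \<sigma>1 (restr L \<alpha>) r L"
  proof (rule goodI)
    fix A assume A: "A \<subseteq> L" "A \<noteq> {}" "\<And>x. x \<in> A \<Longrightarrow> \<sigma>1 x \<in> A"
    have "outs2 \<alpha> r A"
    proof (rule goodD[OF gd _ A(2)])
      fix x assume "x \<in> A"
      then have "\<sigma>1 x \<in> A" by (rule A(3))
      then show "\<sigma> x \<in> A" using i1[of x] A(1) by auto
    qed (use A(1) L(1) in blast)
    then obtain x y where "x \<in> A" "y \<in> A" "x \<noteq> y" "\<alpha> x \<notin> insert r A" "\<alpha> y \<notin> insert r A" by (rule outs2E)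
    then show "outs2 (restr L \<alpha>) r A" using A(1) by (intro outs2I[of x A y]) (auto simp: restr_def)
  qed
  then show "(\<sigma>1, restr L \<alpha>) \<in> Bset L r" unfolding Bset_def using p1 M1 by simp
  have sR: "\<sigma> x = ?\<sigma>2 x" if "x \<in> ?R" for x
  proof -
    have "x \<notin> insert r L" using that S(2) by auto
    then show ?thesis using s2[of x] i2[of x] by simp
  qed
  have "good ?\<sigma>2 (restr (insert r ?R) \<alpha>) r ?R"
  proof (rule goodI)
    fix A assume A: "A \<subseteq> ?R" "A \<noteq> {}" "\<And>x. x \<in> A \<Longrightarrow> ?\<sigma>2 x \<in> A"
    have "outs2 \<alpha> r A"
    proof (rule goodD[OF gd _ A(2)])
      fix x assume x: "x \<in> A"
      then have "x \<in> ?R" using A(1) by blast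
      then show "\<sigma> x \<in> A" using A(3)[OF x] sR[of x] by simp
    qed (use A(1) in blast)
    then obtain x y where "x \<in> A" "y \<in> A" "x \<noteq> y" "\<alpha> x \<notin> insert r A" "\<alpha> y \<notin> insert r A" by (rule outs2E)
    then show "outs2 (restr (insert r ?R) \<alpha>) r A" using A(1) by (intro outs2I[of x A y]) (auto simp: restr_def)
  qed
  then show "(?\<sigma>2, restr (insert r ?R) \<alpha>) \<in> Wset ?R r" unfolding Wset_def using P2 M2 by simp
  show "no_prefix ?\<sigma>2 (restr (insert r ?R) \<alpha>) r ?R" unfolding no_prefix_def
  proof (intro allI impI)
    fix A assume A: "A \<subseteq> ?R" "\<forall>x\<in>A. restr (insert r ?R) \<alpha> x \<in> A" "prefix ?\<sigma>2 r A"
    have "prefix \<sigma> r (A \<union> L)" unfolding prefix_def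
    proof (intro allI impI)
      fix x assume x: "\<sigma> x \<in> A \<union> L"
      show "x \<in> insert r (A \<union> L)"
      proof (cases "\<sigma> x \<in> L")
        case True
        then show ?thesis using L(3) unfolding prefix_def by blast
      next
        case False
        then have "?\<sigma>2 (\<sigma>1 x) \<in> A" using x s2[of x] by simp
        then have s: "\<sigma>1 x \<in> insert r A" using A(3) unfolding prefix_def by blast
        show ?thesis
        proof (cases "x \<in> insert r L")
          case False
          then show ?thesis using i2[of x] s by auto
        qed blast
      qed
    qed
    moreover have "\<forall>x\<in>A \<union> L. \<alpha> x \<in> A \<union> L"
    proof
      fix x assume x: "x \<in> A \<union> L"
      show "\<alpha> x \<in> A \<union> L"
      proof (cases "x \<in> A")
        case True
        then have "restr (insert r ?R) \<alpha> x = \<alpha> x" using A(1) unfolding restr_def by auto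
        then show ?thesis using A(2) True by auto
      next
        case False
        then show ?thesis using x L(2) by blast
      qed
    qed
    moreover have "A \<union> L \<subseteq> S" using A(1) L(1) by blast
    ultimately have "A \<union> L \<subseteq> L" by (intro mx)
    then show "A = {}" using A(1) by blast
  qed
qed

text \<open>The flag c lets one bijection serve both divisions by B: splitting off the greatest
  prefix does not affect the absence of suffixes.\<close>

lemma card_split_line:
  assumes S: "finite S" "r \<notin> S"
  shows "card {(\<sigma>, \<alpha>) \<in> Wset S r. c \<longrightarrow> no_suffix \<sigma> \<alpha> r S} =
    (\<Sum>L\<in>Pow S. card (Bset L r) *
      card {(\<sigma>, \<alpha>) \<in> Wset (S - L) r. no_prefix \<sigma> \<alpha> r (S - L) \<and> (c \<longrightarrow> no_suffix \<sigma> \<alpha> r (S - L))})"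
proof -
  let ?P = "\<lambda>R. {(\<sigma>, \<alpha>) \<in> Wset R r. no_prefix \<sigma> \<alpha> r R \<and> (c \<longrightarrow> no_suffix \<sigma> \<alpha> r R)}"
  define X where "X = (SIGMA L:Pow S. Bset L r \<times> ?P (S - L))"
  define N where "N = {(\<sigma>, \<alpha>) \<in> Wset S r. c \<longrightarrow> no_suffix \<sigma> \<alpha> r S}"
  define g where "g = (\<lambda>(L :: 'a set, (\<sigma>1 :: 'a \<Rightarrow> 'a, \<alpha>1 :: 'a \<Rightarrow> 'a), (\<sigma>2 :: 'a \<Rightarrow> 'a, \<alpha>2 :: 'a \<Rightarrow> 'a)). (\<sigma>2 \<circ> \<sigma>1, \<alpha>1 \<circ> \<alpha>2))"
  have unpack: "\<exists>L \<sigma>1 \<alpha>1 \<sigma>2 \<alpha>2. u = (L, (\<sigma>1, \<alpha>1), (\<sigma>2, \<alpha>2)) \<and> L \<subseteq> S \<and> (\<sigma>1, \<alpha>1) \<in> Bset L r \<and>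
      (\<sigma>2, \<alpha>2) \<in> Wset (S - L) r \<and> no_prefix \<sigma>2 \<alpha>2 r (S - L) \<and> (c \<longrightarrow> no_suffix \<sigma>2 \<alpha>2 r (S - L))" if "u \<in> X" for u
    using that unfolding X_def by auto
  have "bij_betw g X N" unfolding bij_betw_def
  proof
    show "inj_on g X"
    proof (rule inj_onI)
      fix u v assume u: "u \<in> X" and v: "v \<in> X" and eq: "g u = g v"
      obtain L \<sigma>1 \<alpha>1 \<sigma>2 \<alpha>2 where u': "u = (L, (\<sigma>1, \<alpha>1), (\<sigma>2, \<alpha>2))" "L \<subseteq> S" "(\<sigma>1, \<alpha>1) \<in> Bset L r"
        "(\<sigma>2, \<alpha>2) \<in> Wset (S - L) r" "no_prefix \<sigma>2 \<alpha>2 r (S - L)" using unpack[OF u] by blast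
      obtain L' \<sigma>1' \<alpha>1' \<sigma>2' \<alpha>2' where v': "v = (L', (\<sigma>1', \<alpha>1'), (\<sigma>2', \<alpha>2'))" "L' \<subseteq> S" "(\<sigma>1', \<alpha>1') \<in> Bset L' r"
        "(\<sigma>2', \<alpha>2') \<in> Wset (S - L') r" "no_prefix \<sigma>2' \<alpha>2' r (S - L')" using unpack[OF v] by blast
      have e: "\<sigma>2' \<circ> \<sigma>1' = \<sigma>2 \<circ> \<sigma>1" "\<alpha>1' \<circ> \<alpha>2' = \<alpha>1 \<circ> \<alpha>2" using eq unfolding g_def u'(1) v'(1) by simp_all
      note J = concat_lines[OF S u'(2-5)]
      note J' = concat_lines[OF S v'(2-5), unfolded e]
      have LL: "L = L'" using max_prefix_subset[OF J(2) J'(2)] max_prefix_subset[OF J'(2) J(2)] by blast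
      have s1: "\<sigma>1 = \<sigma>1'" using J(3) J'(3) LL by simp
      show "u = v" unfolding u'(1) v'(1) using J(4-6) J'(4-6) LL s1 by simp
    qed
    show "g ` X = N"
    proof (intro equalityI subsetI)
      fix w assume "w \<in> g ` X"
      then obtain u where u: "u \<in> X" "w = g u" by blast
      obtain L \<sigma>1 \<alpha>1 \<sigma>2 \<alpha>2 where u': "u = (L, (\<sigma>1, \<alpha>1), (\<sigma>2, \<alpha>2))" "L \<subseteq> S" "(\<sigma>1, \<alpha>1) \<in> Bset L r"
        "(\<sigma>2, \<alpha>2) \<in> Wset (S - L) r" "no_prefix \<sigma>2 \<alpha>2 r (S - L)" "c \<longrightarrow> no_suffix \<sigma>2 \<alpha>2 r (S - L)" using unpack[OF u(1)] by blast
      note J = concat_lines[OF S u'(2-5)]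
      show "w \<in> N" unfolding u(2) u'(1) g_def N_def using J(1,7) u'(6) by simp
    next
      fix w assume "w \<in> N"
      then obtain \<sigma> \<alpha> where w: "w = (\<sigma>, \<alpha>)" "(\<sigma>, \<alpha>) \<in> Wset S r" "c \<longrightarrow> no_suffix \<sigma> \<alpha> r S" unfolding N_def by blast
      obtain L where L: "max_prefix S r \<sigma> \<alpha> L" using max_prefix_exists[of S r \<sigma> \<alpha>] by blast
      note C = split_line[OF S w(2) L]
      let ?s1 = "initial L r \<sigma>" and ?s2 = "\<sigma> \<circ> inv (initial L r \<sigma>)" and ?a2 = "restr (insert r (S - L)) \<alpha>"
      have "no_suffix \<sigma> \<alpha> r S \<longleftrightarrow> no_suffix ?s2 ?a2 r (S - L)"
        using concat_lines(7)[OF S C(1-4)] C(5,6) by simp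
      then have "(L, (?s1, restr L \<alpha>), (?s2, ?a2)) \<in> X"
        unfolding X_def using C(1-4) w(3) by simp
      moreover have "w = g (L, (?s1, restr L \<alpha>), (?s2, ?a2))"
        unfolding g_def w(1) using C(5,6) by simp
      ultimately show "w \<in> g ` X" by blast
    qed
  qed
  then have "card N = card X" by (rule bij_betw_same_card[symmetric])
  also have "\<dots> = (\<Sum>L\<in>Pow S. card (Bset L r \<times> ?P (S - L)))" unfolding X_def
  proof (rule card_SigmaI)
    show "\<forall>L\<in>Pow S. finite (Bset L r \<times> ?P (S - L))"
    proof
      fix L assume "L \<in> Pow S"
      then have "finite L" using S(1) finite_subset by blast
      then have "finite (Bset L r)" by (rule finite_Bset)
      moreover have "finite (?P (S - L))" by (rule finite_subset[OF _ finite_Wset[of "S - L" r]]) (use S(1) in auto)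
      ultimately show "finite (Bset L r \<times> ?P (S - L))" by blast
    qed
  qed (use S(1) in simp)
  finally show ?thesis unfolding N_def by (simp add: card_cartesian_product)
qed

text \<open>Reversing all fermion edges replaces \<sigma> by its inverse. Unions of cycles stay
  closed, while prefixes and suffixes change places.\<close>

lemma card_reverse_line:
  assumes S: "finite S" "r \<notin> S"
  shows "card {(\<sigma>, \<alpha>) \<in> Wset S r. no_prefix \<sigma> \<alpha> r S} = card {(\<sigma>, \<alpha>) \<in> Wset S r. no_suffix \<sigma> \<alpha> r S}"
proof -
  let ?A = "{(\<sigma>, \<alpha>) \<in> Wset S r. no_prefix \<sigma> \<alpha> r S}" and ?B = "{(\<sigma>, \<alpha>) \<in> Wset S r. no_suffix \<sigma> \<alpha> r S}"
  define f where "f = (\<lambda>(\<sigma> :: 'a \<Rightarrow> 'a, \<alpha> :: 'a \<Rightarrow> 'a). (inv \<sigma>, \<alpha>))"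
  have W: "(inv \<sigma>, \<alpha>) \<in> Wset S r" if w: "(\<sigma>, \<alpha>) \<in> Wset S r" for \<sigma> \<alpha>
  proof -
    have P: "\<sigma> permutes insert r S" and M: "pmatch (insert r S) \<alpha>" and gd: "good \<sigma> \<alpha> r S"
      using w unfolding Wset_def by auto
    have "good (inv \<sigma>) \<alpha> r S"
    proof (rule goodI)
      fix A assume A: "A \<subseteq> S" "A \<noteq> {}" "\<And>x. x \<in> A \<Longrightarrow> inv \<sigma> x \<in> A"
      have fA: "finite A" using A(1) S(1) finite_subset by blast
      have "\<forall>x. \<sigma> x \<in> A \<longrightarrow> x \<in> A" using A(3) permutes_inverses(2)[OF P] by metis
      then show "outs2 \<alpha> r A" using permutes_closed_iff[OF P fA] goodD[OF gd A(1,2)] by blast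
    qed
    then show ?thesis unfolding Wset_def using permutes_inv[OF P] M by simp
  qed
  have ps: "prefix \<sigma> r A \<longleftrightarrow> suffix (inv \<sigma>) r A" and sp: "suffix \<sigma> r A \<longleftrightarrow> prefix (inv \<sigma>) r A"
    if P: "\<sigma> permutes insert r S" for \<sigma> A
  proof -
    have i: "\<sigma> (inv \<sigma> x) = x" "inv \<sigma> (\<sigma> x) = x" for x using permutes_inverses[OF P] by auto
    show "prefix \<sigma> r A \<longleftrightarrow> suffix (inv \<sigma>) r A" unfolding prefix_def suffix_def using i by metis
    show "suffix \<sigma> r A \<longleftrightarrow> prefix (inv \<sigma>) r A" unfolding prefix_def suffix_def using i by metis
  qed
  have ii: "inv (inv \<sigma>) = \<sigma>" if "(\<sigma>, \<alpha>) \<in> Wset S r" for \<sigma> \<alpha>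
    using that permutes_inv_inv unfolding Wset_def by blast
  have "bij_betw f ?A ?B"
  proof (rule bij_betw_byWitness[where f' = f])
    show "f ` ?A \<subseteq> ?B"
    proof
      fix w assume "w \<in> f ` ?A"
      then obtain \<sigma> \<alpha> where w: "w = (inv \<sigma>, \<alpha>)" "(\<sigma>, \<alpha>) \<in> Wset S r" "no_prefix \<sigma> \<alpha> r S" unfolding f_def by auto
      have P: "\<sigma> permutes insert r S" using w(2) unfolding Wset_def by blast
      have "no_suffix (inv \<sigma>) \<alpha> r S" using w(3) unfolding no_prefix_def no_suffix_def ps[OF P] .
      then show "w \<in> ?B" unfolding w(1) using W[OF w(2)] by simp
    qed
    show "f ` ?B \<subseteq> ?A"
    proof
      fix w assume "w \<in> f ` ?B"
      then obtain \<sigma> \<alpha> where w: "w = (inv \<sigma>, \<alpha>)" "(\<sigma>, \<alpha>) \<in> Wset S r" "no_suffix \<sigma> \<alpha> r S" unfolding f_def by auto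
      have P: "\<sigma> permutes insert r S" using w(2) unfolding Wset_def by blast
      have "no_prefix (inv \<sigma>) \<alpha> r S" using w(3) unfolding no_prefix_def no_suffix_def sp[OF P] .
      then show "w \<in> ?A" unfolding w(1) using W[OF w(2)] by simp
    qed
  qed (auto simp: f_def ii)
  then show ?thesis by (rule bij_betw_same_card)
qed

section \<open>Division by the series of lines\<close>

definition Uset :: "'a set \<Rightarrow> 'a \<Rightarrow> (('a \<Rightarrow> 'a) \<times> ('a \<Rightarrow> 'a)) set" where
  "Uset S r = {(\<sigma>, \<alpha>) \<in> Wset S r. no_prefix \<sigma> \<alpha> r S \<and> no_suffix \<sigma> \<alpha> r S}"

text \<open>In the convolution the term with empty L is G S itself, because \<open>Bset {} r\<close>
  is a singleton. The other terms concern smaller sets, so G is determined by induction.\<close>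

lemma egf_divide:
  fixes F G :: "'a set \<Rightarrow> nat" and \<beta> \<gamma> :: "rat fps"
  assumes S: "finite S" "r \<notin> S" and b: "\<And>L. finite L \<Longrightarrow> r \<notin> L \<Longrightarrow> of_nat (card (Bset L r)) = fact (card L) * fps_nth \<beta> (card L)"
    and b0: "fps_nth \<beta> 0 = 1"
    and F: "\<And>S. finite S \<Longrightarrow> r \<notin> S \<Longrightarrow> of_nat (F S) = fact (card S) * fps_nth (\<beta> * \<gamma>) (card S)"
    and conv: "\<And>S. finite S \<Longrightarrow> r \<notin> S \<Longrightarrow> F S = (\<Sum>L\<in>Pow S. card (Bset L r) * G (S - L))"
  shows "of_nat (G S) = fact (card S) * fps_nth \<gamma> (card S)"
  using S
proof (induction "card S" arbitrary: S rule: less_induct)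
  case less
  note S = less.prems
  let ?g = "\<lambda>R. fact (card R) * fps_nth \<gamma> (card R)"
  have P: "Pow S = insert {} (Pow S - {{}})" by blast
  have fin: "finite (Pow S - {{}})" using S(1) by simp
  have c0: "of_nat (card (Bset {} r)) = (1 :: rat)" using b[of "{}"] b0 by simp
  have e1: "of_nat (F S) = of_nat (G S) + (\<Sum>L\<in>Pow S - {{}}. of_nat (card (Bset L r)) * (of_nat (G (S - L)) :: rat))"
    unfolding conv[OF S] by (subst P, subst sum.insert[OF fin]) (use c0 in auto)
  have "of_nat (F S) = fact (card S) * (\<Sum>k\<le>card S. fps_nth \<beta> k * fps_nth \<gamma> (card S - k))"
    unfolding F[OF S] fps_mult_nth atLeast0AtMost ..
  also have "\<dots> = (\<Sum>L\<in>Pow S. (fact (card L) * fps_nth \<beta> (card L)) * ?g (S - L))"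
    by (rule egf_mult[OF S(1), symmetric])
  also have "\<dots> = ?g S + (\<Sum>L\<in>Pow S - {{}}. (fact (card L) * fps_nth \<beta> (card L)) * ?g (S - L))"
    by (subst P, subst sum.insert[OF fin]) (use b0 in auto)
  also have "(\<Sum>L\<in>Pow S - {{}}. (fact (card L) * fps_nth \<beta> (card L)) * ?g (S - L)) =
    (\<Sum>L\<in>Pow S - {{}}. of_nat (card (Bset L r)) * of_nat (G (S - L)))"
  proof (rule sum.cong[OF refl])
    fix L assume L: "L \<in> Pow S - {{}}"
    then have "finite L" "r \<notin> L" using S finite_subset by auto
    moreover have "card (S - L) < card S" using L S(1) by (intro psubset_card_mono) auto
    then have "of_nat (G (S - L)) = ?g (S - L)" by (rule less.hyps) (use S in auto)
    ultimately show "(fact (card L) * fps_nth \<beta> (card L)) * ?g (S - L) = of_nat (card (Bset L r)) * of_nat (G (S - L))"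
      using b by simp
  qed
  finally show ?case using e1 by simp
qed

lemma B_fps_0: "fps_nth B_fps 0 = 1" unfolding B_fps_def by (simp add: B_num_0)

text \<open>The operator B + 2xB' multiplies the coefficient of x^i by 2i + 1, so this is the Stein
  recurrence as a differential equation.\<close>

lemma B_fps_stein: "B_fps - 1 = B_fps * (fps_X * B_fps + 2 * fps_X ^ 2 * fps_deriv B_fps)"
proof (rule fps_ext)
  fix n
  have W: "fps_X * B_fps + 2 * fps_X ^ 2 * fps_deriv B_fps = fps_X * Abs_fps (\<lambda>i. of_nat ((2 * i + 1) * B_num i))"
  proof (rule fps_ext)
    fix n
    show "fps_nth (fps_X * B_fps + 2 * fps_X ^ 2 * fps_deriv B_fps) n = fps_nth (fps_X * Abs_fps (\<lambda>i. of_nat ((2 * i + 1) * B_num i))) n"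
      by (cases n; cases "n - 1")
        (auto simp: B_fps_def power2_eq_square mult.assoc numeral_fps_const algebra_simps)
  qed
  show "fps_nth (B_fps - 1) n = fps_nth (B_fps * (fps_X * B_fps + 2 * fps_X ^ 2 * fps_deriv B_fps)) n"
  proof (cases n)
    case 0
    then show ?thesis unfolding W by (simp add: B_fps_0)
  next
    case (Suc m)
    have "fps_nth (B_fps * (fps_X * Abs_fps (\<lambda>i. of_nat ((2 * i + 1) * B_num i)))) (Suc m) =
      fps_nth (fps_X * (Abs_fps (\<lambda>i. of_nat ((2 * i + 1) * B_num i)) * B_fps)) (Suc m)" by (simp only: mult_ac)
    also have "\<dots> = fps_nth (Abs_fps (\<lambda>i. of_nat ((2 * i + 1) * B_num i)) * B_fps) m"
      by (simp del: of_nat_mult of_nat_add)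
    also have "\<dots> = (\<Sum>i=0..m. of_nat ((2 * i + 1) * B_num i) * of_nat (B_num (m - i)))"
      unfolding fps_mult_nth B_fps_def by simp
    also have "\<dots> = of_nat (B_num (Suc m))"
      unfolding stein_recurrence atLeast0AtMost by simp
    finally show ?thesis unfolding W Suc by (simp add: B_fps_def)
  qed
qed

text \<open>The extra vertex is matched as well, so card S + 1 is twice the number of boson edges
  including the external one; this explains the shifted index. Dividing W = (B - 1)/B by B leaves
  the structures without a prefix. By reversal they are as many as those without a suffix, and a
  second division removes prefixes from the latter.\<close>

lemma card_Uset:
  assumes S: "finite S" "r \<notin> S"
  defines "u \<equiv> (B_fps - 1) * inverse B_fps ^ 3"
  shows "of_nat (card (Uset S r)) = fact (card S) * fps_nth (u oo fps_X ^ 2) (card S + 1)"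
proof -
  define \<beta> where "\<beta> = B_fps oo fps_X ^ 2"
  define \<omega> :: "rat fps" where "\<omega> = Abs_fps (\<lambda>m. of_nat m * of_nat (B_egf (m - 1)))"
  have \<beta>n: "fps_nth \<beta> m = of_nat (B_egf m)" for m
    unfolding \<beta>_def fps_nth_compose_X_power B_fps_def B_egf_def by simp
  have b: "of_nat (card (Bset L r)) = fact (card L) * fps_nth \<beta> (card L)" if "finite L" "r \<notin> L" for L
    unfolding card_Bset[OF that] \<beta>n by simp
  have b0: "fps_nth \<beta> 0 = 1" unfolding \<beta>n by (simp add: B_egf_def B_num_0)
  have x0: "fps_nth (fps_X ^ 2 :: rat fps) 0 = 0" by simp
  have b\<beta>: "inverse \<beta> * \<beta> = 1" using b0 by (simp add: inverse_mult_eq_1)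
  have i\<beta>: "inverse \<beta> = inverse B_fps oo fps_X ^ 2"
    unfolding \<beta>_def using fps_inverse_compose[OF x0, of B_fps] B_fps_0 by simp
  \<comment> \<open>By Stein, (B - 1)/B has at x^k, for k > 0, the coefficient (2k - 1)B_(k-1); this
    is the value of \<omega> at 2k - 1.\<close>
  have X\<omega>: "fps_X * \<omega> = ((B_fps - 1) * inverse B_fps) oo fps_X ^ 2"
  proof -
    have "(B_fps - 1) * inverse B_fps = (inverse B_fps * B_fps) * (fps_X * B_fps + 2 * fps_X ^ 2 * fps_deriv B_fps)"
      unfolding B_fps_stein by (simp only: mult_ac)
    also have "inverse B_fps * B_fps = 1" using B_fps_0 by (simp add: inverse_mult_eq_1)
    finally have e: "(B_fps - 1) * inverse B_fps = fps_X * B_fps + 2 * fps_X ^ 2 * fps_deriv B_fps" by simp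
    show ?thesis unfolding e
    proof (rule fps_ext)
      fix n
      show "fps_nth (fps_X * \<omega>) n = fps_nth ((fps_X * B_fps + 2 * fps_X ^ 2 * fps_deriv B_fps) oo fps_X ^ 2) n"
      proof (cases "even n")
        case False
        then have "odd n" "n > 0" by (auto simp: odd_pos)
        then show ?thesis unfolding fps_nth_compose_X_power by (simp add: \<omega>_def B_egf_def)
      next
        case True
        then obtain k where k: "n = 2 * k" by (elim dvdE)
        have "fps_nth (fps_X * \<omega>) (2 * k) = fps_nth (fps_X * B_fps + 2 * fps_X ^ 2 * fps_deriv B_fps) k"
        proof (cases k)
          case 0
          then show ?thesis by simp
        next
          case (Suc j)
          show ?thesis unfolding Suc
            by (cases j) (auto simp: \<omega>_def B_egf_def B_fps_def power2_eq_square mult.assoc numeral_fps_const algebra_simps)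
        qed
        then show ?thesis unfolding fps_nth_compose_X_power k by simp
      qed
    qed
  qed
  have W: "of_nat (card (Wset R r)) = fact (card R) * fps_nth \<omega> (card R)" if R: "finite R" "r \<notin> R" for R
  proof -
    have "card (Wset R r) = (\<Sum>b\<in>R. card R * card (Bset (R - {b}) r))" by (rule card_Wset[OF R])
    also have "\<dots> = (\<Sum>b\<in>R. card R * (fact (card R - 1) * B_egf (card R - 1)))"
      by (rule sum.cong[OF refl]) (use R card_Bset[of "_ - {_}" r] in simp)
    also have "\<dots> = (card R * fact (card R - 1)) * (card R * B_egf (card R - 1))" by simp
    also have "\<dots> = fact (card R) * (card R * B_egf (card R - 1))"
      by (cases "card R") auto
    finally show ?thesis unfolding \<omega>_def by simp
  qed
  have P: "of_nat (card {(\<sigma>, \<alpha>) \<in> Wset R r. no_prefix \<sigma> \<alpha> r R}) = fact (card R) * fps_nth (\<omega> * inverse \<beta>) (card R)"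
    if R: "finite R" "r \<notin> R" for R
  proof (rule egf_divide[OF R b b0, where F = "\<lambda>R. card (Wset R r)"])
    have e: "\<beta> * (\<omega> * inverse \<beta>) = \<omega>" using b\<beta> by (metis mult.assoc mult.commute mult_1)
    fix R :: "'a set" assume R: "finite R" "r \<notin> R"
    show "of_nat (card (Wset R r)) = fact (card R) * fps_nth (\<beta> * (\<omega> * inverse \<beta>)) (card R)"
      unfolding e by (rule W[OF R])
    show "card (Wset R r) = (\<Sum>L\<in>Pow R. card (Bset L r) * card {(\<sigma>, \<alpha>) \<in> Wset (R - L) r. no_prefix \<sigma> \<alpha> r (R - L)})"
      using card_split_line[OF R, of False] by simp
  qed
  have "of_nat (card (Uset S r)) = fact (card S) * fps_nth (\<omega> * inverse \<beta> ^ 2) (card S)"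
  proof (rule egf_divide[OF S b b0, where F = "\<lambda>R. card {(\<sigma>, \<alpha>) \<in> Wset R r. no_suffix \<sigma> \<alpha> r R}"])
    have "\<beta> * (\<omega> * inverse \<beta> ^ 2) = (inverse \<beta> * \<beta>) * (\<omega> * inverse \<beta>)"
      unfolding power2_eq_square by (simp only: mult_ac)
    then have e: "\<beta> * (\<omega> * inverse \<beta> ^ 2) = \<omega> * inverse \<beta>" unfolding b\<beta> by simp
    fix R :: "'a set" assume R: "finite R" "r \<notin> R"
    show "of_nat (card {(\<sigma>, \<alpha>) \<in> Wset R r. no_suffix \<sigma> \<alpha> r R}) = fact (card R) * fps_nth (\<beta> * (\<omega> * inverse \<beta> ^ 2)) (card R)"
      unfolding e card_reverse_line[OF R, symmetric] by (rule P[OF R])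
    show "card {(\<sigma>, \<alpha>) \<in> Wset R r. no_suffix \<sigma> \<alpha> r R} = (\<Sum>L\<in>Pow R. card (Bset L r) * card (Uset (R - L) r))"
      using card_split_line[OF R, of True] unfolding Uset_def by simp
  qed
  also have "fps_nth (\<omega> * inverse \<beta> ^ 2) (card S) = fps_nth (fps_X * (\<omega> * inverse \<beta> ^ 2)) (card S + 1)" by simp
  also have "fps_X * (\<omega> * inverse \<beta> ^ 2) = (fps_X * \<omega>) * inverse \<beta> ^ 2" by (simp only: mult.assoc)
  also have "\<dots> = u oo fps_X ^ 2"
    unfolding X\<omega> i\<beta> fps_compose_power[OF x0] fps_compose_mult_distrib[OF x0, symmetric] u_def
    by (simp add: power2_eq_square power3_eq_cube mult.assoc)
  finally show ?thesis .
qed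

section \<open>Yukawa graphs as permutations with matchings\<close>

lemma yconnected_iff_cut:
  assumes wf: "\<And>u v. yadj F Bs u v \<Longrightarrow> v < V"
  shows "yconnected V F Bs \<longleftrightarrow>
    (\<forall>A. A \<subseteq> {..<V} \<longrightarrow> A \<noteq> {} \<longrightarrow> A \<noteq> {..<V} \<longrightarrow> (\<exists>u\<in>A. \<exists>v. v < V \<and> v \<notin> A \<and> yadj F Bs u v))"
proof
  assume c: "yconnected V F Bs"
  show "\<forall>A. A \<subseteq> {..<V} \<longrightarrow> A \<noteq> {} \<longrightarrow> A \<noteq> {..<V} \<longrightarrow> (\<exists>u\<in>A. \<exists>v. v < V \<and> v \<notin> A \<and> yadj F Bs u v)"
  proof (intro allI impI, rule ccontr)
    fix A assume A: "A \<subseteq> {..<V}" "A \<noteq> {}" "A \<noteq> {..<V}"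
      and n: "\<not> (\<exists>u\<in>A. \<exists>v. v < V \<and> v \<notin> A \<and> yadj F Bs u v)"
    obtain x where x: "x \<in> A" "x < V" using A by blast
    obtain y where y: "y \<notin> A" "y < V" using A by blast
    have "(yadj F Bs)\<^sup>*\<^sup>* x y" using c x y unfolding yconnected_def by blast
    then have "y \<in> A"
    proof (induction)
      case (step v w)
      then show ?case using n wf by blast
    qed (rule x(1))
    then show False using y by blast
  qed
next
  assume *: "\<forall>A. A \<subseteq> {..<V} \<longrightarrow> A \<noteq> {} \<longrightarrow> A \<noteq> {..<V} \<longrightarrow> (\<exists>u\<in>A. \<exists>v. v < V \<and> v \<notin> A \<and> yadj F Bs u v)"
  show "yconnected V F Bs" unfolding yconnected_def
  proof (intro allI impI)
    fix u v assume uv: "u < V" "v < V"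
    define A where "A = {w. w < V \<and> (yadj F Bs)\<^sup>*\<^sup>* u w}"
    have "A = {..<V}"
    proof (rule ccontr)
      assume "A \<noteq> {..<V}"
      moreover have "A \<subseteq> {..<V}" "u \<in> A" using uv unfolding A_def by auto
      ultimately obtain x y where "x \<in> A" "y < V" "y \<notin> A" "yadj F Bs x y" using * by blast
      then show False unfolding A_def by (auto dest: rtranclp.rtrancl_into_rtrancl)
    qed
    then show "(yadj F Bs)\<^sup>*\<^sup>* u v" using uv unfolding A_def by blast
  qed
qed

text \<open>A vertex sent to V by \<sigma> carries the external outgoing fermion leg; the image of V
  under \<sigma> carries the incoming one.\<close>

definition fedges :: "nat \<Rightarrow> (nat \<Rightarrow> nat) \<Rightarrow> (nat \<times> nat) set" where
  "fedges V \<sigma> = {(u, \<sigma> u) | u. u < V \<and> \<sigma> u \<noteq> V}"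

definition bedges :: "nat \<Rightarrow> (nat \<Rightarrow> nat) \<Rightarrow> nat set set" where
  "bedges V \<alpha> = {{u, \<alpha> u} | u. u < V \<and> \<alpha> u \<noteq> V}"

text \<open>The extra vertex \<open>V\<close> closes the fermion line to a cycle and absorbs the external boson leg.\<close>

definition ygraph_of :: "nat \<Rightarrow> (nat \<Rightarrow> nat) \<times> (nat \<Rightarrow> nat) \<Rightarrow> ygraph" where
  "ygraph_of V = (\<lambda>(\<sigma>, \<alpha>). (V, fedges V \<sigma>, bedges V \<alpha>))"

context
  fixes V :: nat and \<sigma> \<alpha> :: "nat \<Rightarrow> nat"
  assumes P: "\<sigma> permutes insert V {..<V}" and M: "pmatch (insert V {..<V}) \<alpha>" and root: "\<sigma> V \<noteq> V"
begin

lemma fedges_iff: "(u, v) \<in> fedges V \<sigma> \<longleftrightarrow> u < V \<and> v < V \<and> \<sigma> u = v"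
proof -
  have "u < V \<Longrightarrow> \<sigma> u \<noteq> V \<Longrightarrow> \<sigma> u < V" using permutes_in_image[OF P, of u] by auto
  then show ?thesis unfolding fedges_def by auto
qed

lemma bedges_iff: "{u, v} \<in> bedges V \<alpha> \<longleftrightarrow> u < V \<and> v < V \<and> \<alpha> u = v"
proof -
  note aD = pmatchD[OF M]
  have 1: "u < V \<Longrightarrow> \<alpha> u \<noteq> V \<Longrightarrow> \<alpha> u < V" for u using aD(1)[of u] by auto
  show ?thesis
  proof
    assume "{u, v} \<in> bedges V \<alpha>"
    then obtain w where w: "w < V" "\<alpha> w \<noteq> V" "{u, v} = {w, \<alpha> w}" unfolding bedges_def by auto
    then have "(u = w \<and> v = \<alpha> w) \<or> (u = \<alpha> w \<and> v = w)" by (auto simp: doubleton_eq_iff)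
    then show "u < V \<and> v < V \<and> \<alpha> u = v" using w 1[of w] aD(3)[of w] by auto
  next
    assume "u < V \<and> v < V \<and> \<alpha> u = v"
    then show "{u, v} \<in> bedges V \<alpha>" unfolding bedges_def by auto
  qed
qed

lemma bedgesE:
  assumes "e \<in> bedges V \<alpha>"
  obtains u where "u < V" "\<alpha> u < V" "e = {u, \<alpha> u}"
proof -
  obtain u where "u < V" "\<alpha> u \<noteq> V" "e = {u, \<alpha> u}" using assms unfolding bedges_def by auto
  moreover then have "\<alpha> u < V" using pmatchD(1)[OF M, of u] by auto
  ultimately show thesis using that by blast
qed

lemma ext_in: "{v \<in> {..<V}. \<not> (\<exists>u. (u, v) \<in> fedges V \<sigma>)} = {\<sigma> V}"
proof -
  have i: "\<sigma> (inv \<sigma> v) = v" for v using permutes_inverses(1)[OF P] .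
  have "\<sigma> V < V" using permutes_in_image[OF P, of V] root by auto
  moreover have "u = V" if "\<sigma> u = \<sigma> V" for u using that permutes_inj[OF P] by (auto dest: injD)
  moreover have "\<exists>u. u < V \<and> \<sigma> u = v" if v: "v < V" "v \<noteq> \<sigma> V" for v
  proof -
    have "inv \<sigma> v \<in> insert V {..<V}" using permutes_in_image[OF P, of "inv \<sigma> v"] i[of v] v by auto
    moreover have "inv \<sigma> v \<noteq> V" using i[of v] v by auto
    ultimately show ?thesis using i[of v] by auto
  qed
  ultimately show ?thesis unfolding fedges_iff by auto
qed

lemma ext_out: "{u \<in> {..<V}. \<not> (\<exists>v. (u, v) \<in> fedges V \<sigma>)} = {inv \<sigma> V}"
proof -
  have i: "\<sigma> (inv \<sigma> v) = v" "inv \<sigma> (\<sigma> v) = v" for v using permutes_inverses[OF P] by auto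
  have "inv \<sigma> V \<in> insert V {..<V}" using permutes_in_image[OF P, of "inv \<sigma> V"] i(1)[of V] by simp
  moreover have "inv \<sigma> V \<noteq> V" using i(1)[of V] root by auto
  ultimately have "inv \<sigma> V < V" by auto
  moreover have "\<sigma> u < V" if "u < V" "u \<noteq> inv \<sigma> V" for u
    using permutes_in_image[OF P, of u] that i(2)[of u] by auto
  ultimately show ?thesis unfolding fedges_iff using i(1)[of V] by auto
qed

lemma ext_boson: "{..<V} - \<Union>(bedges V \<alpha>) = {\<alpha> V}"
proof -
  note aD = pmatchD[OF M]
  have "\<alpha> V < V" using aD(1,2)[of V] by auto
  have mem: "x \<in> \<Union>(bedges V \<alpha>) \<longleftrightarrow> x < V \<and> \<alpha> x < V" for x
  proof
    assume "x \<in> \<Union>(bedges V \<alpha>)"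
    then obtain e where "e \<in> bedges V \<alpha>" "x \<in> e" by blast
    then show "x < V \<and> \<alpha> x < V" by (auto elim!: bedgesE simp: aD(3))
  next
    assume "x < V \<and> \<alpha> x < V"
    then show "x \<in> \<Union>(bedges V \<alpha>)" using bedges_iff[of x "\<alpha> x"] by blast
  qed
  have lt: "\<alpha> x < V" if "x < V" "x \<noteq> \<alpha> V" for x using aD(1)[of x] aD(3)[of x] that by auto
  show ?thesis
  proof (intro equalityI subsetI)
    fix x assume "x \<in> {..<V} - \<Union>(bedges V \<alpha>)"
    then show "x \<in> {\<alpha> V}" using lt[of x] mem[of x] by blast
  next
    fix x assume "x \<in> {\<alpha> V}"
    then have "x < V" "\<not> \<alpha> x < V" using \<open>\<alpha> V < V\<close> aD(3)[of V] by auto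
    then show "x \<in> {..<V} - \<Union>(bedges V \<alpha>)" using mem[of x] by blast
  qed
qed

lemma vertex_type: "yukawa_vertex_type (ygraph_of V (\<sigma>, \<alpha>))"
proof -
  note aD = pmatchD[OF M]
  have "fedges V \<sigma> \<subseteq> {..<V} \<times> {..<V}" using fedges_iff by auto
  moreover have "\<forall>u v w. (u, v) \<in> fedges V \<sigma> \<longrightarrow> (u, w) \<in> fedges V \<sigma> \<longrightarrow> v = w" using fedges_iff by auto
  moreover have "\<forall>u v w. (u, w) \<in> fedges V \<sigma> \<longrightarrow> (v, w) \<in> fedges V \<sigma> \<longrightarrow> u = v"
    using fedges_iff permutes_inj[OF P] by (auto dest: injD)
  moreover have "\<forall>e\<in>bedges V \<alpha>. \<exists>u v. u \<noteq> v \<and> u < V \<and> v < V \<and> e = {u, v}"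
  proof
    fix e assume "e \<in> bedges V \<alpha>"
    then obtain u where u: "u < V" "\<alpha> u < V" "e = {u, \<alpha> u}" by (rule bedgesE)
    then show "\<exists>u v. u \<noteq> v \<and> u < V \<and> v < V \<and> e = {u, v}" using aD(2)[of u] by auto
  qed
  moreover have "\<forall>e\<in>bedges V \<alpha>. \<forall>e'\<in>bedges V \<alpha>. e \<noteq> e' \<longrightarrow> e \<inter> e' = {}"
  proof (intro ballI impI, rule ccontr)
    fix e e' assume e: "e \<in> bedges V \<alpha>" "e' \<in> bedges V \<alpha>" "e \<noteq> e'" "e \<inter> e' \<noteq> {}"
    obtain u where u: "e = {u, \<alpha> u}" using e(1) by (rule bedgesE)
    obtain w where w: "e' = {w, \<alpha> w}" using e(2) by (rule bedgesE)
    have "w = u \<or> w = \<alpha> u \<or> \<alpha> w = u \<or> \<alpha> w = \<alpha> u" using e(4) u w by auto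
    then have "w = u \<or> w = \<alpha> u" using aD(3)[of u] aD(3)[of w] aD(6)[of w u] by auto
    then show False using e(3) u w aD(3)[of u] by auto
  qed
  ultimately show ?thesis unfolding yukawa_vertex_type_def ygraph_of_def
    using ext_in ext_out ext_boson by simp
qed

lemma yadj_iff: "yadj (fedges V \<sigma>) (bedges V \<alpha>) u v \<longleftrightarrow> u < V \<and> v < V \<and> (\<sigma> u = v \<or> \<sigma> v = u \<or> \<alpha> u = v)"
  unfolding yadj_def fedges_iff bedges_iff by auto

lemma connected_iff:
  assumes "F \<subseteq> fedges V \<sigma>" "Bs \<subseteq> bedges V \<alpha>"
  shows "yconnected V F Bs \<longleftrightarrow>
    (\<forall>A. A \<subseteq> {..<V} \<longrightarrow> A \<noteq> {} \<longrightarrow> A \<noteq> {..<V} \<longrightarrow> (\<exists>u\<in>A. \<exists>v. v < V \<and> v \<notin> A \<and> yadj F Bs u v))"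
proof (rule yconnected_iff_cut)
  fix u v assume "yadj F Bs u v"
  then have "yadj (fedges V \<sigma>) (bedges V \<alpha>) u v" using assms unfolding yadj_def by blast
  then show "v < V" unfolding yadj_iff by blast
qed

text \<open>A permutation carries as many points out of a finite set as into it. This turns the
  condition on the edges entering a prefix into a bound on the edges leaving it, and dually for a
  suffix.\<close>

lemma balance:
  assumes A: "finite A"
  shows "card {x \<in> A. \<sigma> x \<notin> A} = card {x. x \<notin> A \<and> \<sigma> x \<in> A}"
proof -
  let ?B = "{x. \<sigma> x \<in> A}"
  have "?B = inv \<sigma> ` A"
    using permutes_inverses[OF P] by (auto simp: image_iff) metis
  then have cB: "card ?B = card A" "finite ?B"
    using A inj_on_subset[OF permutes_inj[OF permutes_inv[OF P]]] by (auto intro: card_image)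
  have "card A = card {x \<in> A. \<sigma> x \<notin> A} + card (A \<inter> ?B)"
    using A by (subst card_Un_disjoint[symmetric]) (auto intro: arg_cong[where f = card])
  moreover have "card ?B = card {x. x \<notin> A \<and> \<sigma> x \<in> A} + card (A \<inter> ?B)"
    using A cB(2) by (subst card_Un_disjoint[symmetric]) (auto intro: arg_cong[where f = card] finite_subset[OF _ cB(2)])
  ultimately show ?thesis using cB(1) by simp
qed

lemma at_most_one:
  assumes "card X \<le> 1" "finite X" "x \<in> X" "y \<in> X"
  shows "x = y"
  using assms card_le_Suc0_iff_eq by (metis One_nat_def)

text \<open>A union of cycles with fewer than two outgoing boson edges is separated by deleting at
  most one of them. A nonempty \<alpha>-closed prefix or suffix is separated by deleting at most one
  fermion edge. The vertex with the first fermion leg, or the one with the boson leg, lies outside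
  the set, so the separation is a genuine one.\<close>

lemma one_PI_imp_Uset:
  assumes pi: "one_PI (ygraph_of V (\<sigma>, \<alpha>))"
  shows "(\<sigma>, \<alpha>) \<in> Uset {..<V} V"
proof -
  let ?F = "fedges V \<sigma>" and ?B = "bedges V \<alpha>"
  note aD = pmatchD[OF M]
  have c0: "yconnected V ?F ?B" and cF: "\<And>e. e \<in> ?F \<Longrightarrow> yconnected V (?F - {e}) ?B"
    and cB: "\<And>e. e \<in> ?B \<Longrightarrow> yconnected V ?F (?B - {e})"
    using pi unfolding one_PI_def ygraph_of_def by auto
  have sV: "\<sigma> V < V" using permutes_in_image[OF P, of V] root by auto
  have aV: "\<alpha> V < V" using aD(1,2)[of V] by auto
  have al: "\<alpha> x < V" if "x < V" "\<alpha> x \<noteq> V" for x using aD(1)[of x] that by auto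
  have crossB: "\<exists>u\<in>A. \<exists>v. v < V \<and> v \<notin> A \<and> yadj ?F (?B - E) u v"
    if "A \<subseteq> {..<V}" "A \<noteq> {}" "A \<noteq> {..<V}" "E = {} \<or> (\<exists>e\<in>?B. E = {e})" for A E
  proof -
    have "yconnected V ?F (?B - E)" using that(4) c0 cB by auto
    then show ?thesis using connected_iff[of ?F "?B - E"] that by blast
  qed
  have crossF: "\<exists>u\<in>A. \<exists>v. v < V \<and> v \<notin> A \<and> yadj (?F - E) ?B u v"
    if "A \<subseteq> {..<V}" "A \<noteq> {}" "A \<noteq> {..<V}" "E = {} \<or> (\<exists>e\<in>?F. E = {e})" for A E
  proof -
    have "yconnected V (?F - E) ?B" using that(4) c0 cF by auto
    then show ?thesis using connected_iff[of "?F - E" ?B] that by blast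
  qed
  have "good \<sigma> \<alpha> V {..<V}"
  proof (rule goodI, rule ccontr)
    fix A assume A: "A \<subseteq> {..<V}" "A \<noteq> {}" "\<And>x. x \<in> A \<Longrightarrow> \<sigma> x \<in> A" and n: "\<not> outs2 \<alpha> V A"
    have fA: "finite A" using A(1) finite_subset by blast
    have inv: "\<And>x. \<sigma> x \<in> A \<Longrightarrow> x \<in> A" using permutes_closed_iff[OF P fA] A(3) by blast
    have "\<sigma> V \<notin> A" using inv[of V] A(1) by auto
    then have ne: "A \<noteq> {..<V}" using sV by auto
    \<comment> \<open>E is empty or a single boson edge, so plain connectivity and connectivity
      after a deletion are used through one statement; the same device recurs for fermion
      edges.\<close>
    define E where "E = {{x, \<alpha> x} | x. x \<in> A \<and> \<alpha> x \<notin> insert V A}"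
    have uniq: "x = y" if "x \<in> A" "\<alpha> x \<notin> insert V A" "y \<in> A" "\<alpha> y \<notin> insert V A" for x y
      using n that unfolding outs2_def by blast
    have "E = {} \<or> (\<exists>e\<in>?B. E = {e})"
    proof (cases "\<exists>x\<in>A. \<alpha> x \<notin> insert V A")
      case True
      then obtain x where x: "x \<in> A" "\<alpha> x \<notin> insert V A" by blast
      then have "E = {{x, \<alpha> x}}" using uniq unfolding E_def by blast
      moreover have "x < V" using x A(1) by auto
      then have "{x, \<alpha> x} \<in> ?B" using bedges_iff[of x "\<alpha> x"] al[of x] x by auto
      ultimately show ?thesis by blast
    qed (auto simp: E_def)
    then obtain u v where uv: "u \<in> A" "v < V" "v \<notin> A" "yadj ?F (?B - E) u v" using crossB[OF A(1,2) ne] by blast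
    then consider "(u, v) \<in> ?F" | "(v, u) \<in> ?F" | "{u, v} \<in> ?B" "{u, v} \<notin> E" unfolding yadj_def by blast
    then show False
    proof cases
      case 1
      then show ?thesis using A(3)[OF uv(1)] uv(3) unfolding fedges_iff by simp
    next
      case 2
      then show ?thesis using inv[of v] uv unfolding fedges_iff by simp
    next
      case 3
      then have "\<alpha> u = v" unfolding bedges_iff by blast
      then show ?thesis using 3(2) uv(1-3) unfolding E_def by auto
    qed
  qed
  moreover have "no_prefix \<sigma> \<alpha> V {..<V}" unfolding no_prefix_def
  proof (intro allI impI, rule ccontr)
    fix A assume A: "A \<subseteq> {..<V}" "\<forall>x\<in>A. \<alpha> x \<in> A" "prefix \<sigma> V A" "A \<noteq> {}"
    have fA: "finite A" using A(1) finite_subset by blast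
    have "\<alpha> V \<notin> A" using A(1,2) aD(3)[of V] by auto
    then have ne: "A \<noteq> {..<V}" using aV by auto
    let ?X = "{x \<in> A. \<sigma> x \<notin> A}"
    \<comment> \<open>Only the edge coming from V can enter a prefix.\<close>
    have "card ?X \<le> card {V}" unfolding balance[OF fA]
      by (rule card_mono) (use A(3) in \<open>auto simp: prefix_def\<close>)
    then have uniq: "x = y" if "x \<in> ?X" "y \<in> ?X" for x y using at_most_one[of ?X x y] fA that by simp
    define E where "E = {(x, \<sigma> x) | x. x \<in> ?X \<and> \<sigma> x \<noteq> V}"
    have "E = {} \<or> (\<exists>e\<in>?F. E = {e})"
    proof (cases "\<exists>x\<in>?X. \<sigma> x \<noteq> V")
      case True
      then obtain x where x: "x \<in> ?X" "\<sigma> x \<noteq> V" by blast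
      then have "E = {(x, \<sigma> x)}" using uniq unfolding E_def by blast
      moreover have "(x, \<sigma> x) \<in> ?F" using x A(1) unfolding fedges_def by auto
      ultimately show ?thesis by blast
    qed (auto simp: E_def)
    then obtain u v where uv: "u \<in> A" "v < V" "v \<notin> A" "yadj (?F - E) ?B u v" using crossF[OF A(1,4) ne] by blast
    then consider "(u, v) \<in> ?F" "(u, v) \<notin> E" | "(v, u) \<in> ?F" | "{u, v} \<in> ?B" unfolding yadj_def by blast
    then show False
    proof cases
      case 1
      then show ?thesis using uv unfolding fedges_iff E_def by auto
    next
      case 2
      then show ?thesis using A(3) uv unfolding fedges_iff prefix_def by auto
    next
      case 3
      then show ?thesis using A(2) uv unfolding bedges_iff by auto
    qed
  qed
  moreover have "no_suffix \<sigma> \<alpha> V {..<V}" unfolding no_suffix_def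
  proof (intro allI impI, rule ccontr)
    fix A assume A: "A \<subseteq> {..<V}" "\<forall>x\<in>A. \<alpha> x \<in> A" "suffix \<sigma> V A" "A \<noteq> {}"
    have fA: "finite A" using A(1) finite_subset by blast
    have "\<alpha> V \<notin> A" using A(1,2) aD(3)[of V] by auto
    then have ne: "A \<noteq> {..<V}" using aV by auto
    let ?X = "{x. x \<notin> A \<and> \<sigma> x \<in> A}"
    have "card {x \<in> A. \<sigma> x \<notin> A} \<le> card {inv \<sigma> V}"
    proof (rule card_mono)
      show "{x \<in> A. \<sigma> x \<notin> A} \<subseteq> {inv \<sigma> V}"
        using A(3) permutes_inverses(2)[OF P] unfolding suffix_def by fastforce
    qed simp
    then have cX: "card ?X \<le> 1" unfolding balance[OF fA] by simp
    have "finite ?X"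
      by (rule finite_subset[of _ "insert V {..<V}"]) (use A(1) permutes_in_image[OF P] in auto)
    then have uniq: "x = y" if "x \<in> ?X" "y \<in> ?X" for x y using at_most_one[OF cX] that by blast
    define E where "E = {(x, \<sigma> x) | x. x \<in> ?X \<and> x \<noteq> V}"
    have "E = {} \<or> (\<exists>e\<in>?F. E = {e})"
    proof (cases "\<exists>x\<in>?X. x \<noteq> V")
      case True
      then obtain x where x: "x \<in> ?X" "x \<noteq> V" by blast
      then have "E = {(x, \<sigma> x)}" using uniq unfolding E_def by blast
      moreover have "\<sigma> x < V" using x A(1) by auto
      then have "x < V" using permutes_in_image[OF P, of x] x(2) by auto
      then have "(x, \<sigma> x) \<in> ?F" using \<open>\<sigma> x < V\<close> unfolding fedges_iff by simp
      ultimately show ?thesis by blast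
    qed (auto simp: E_def)
    then obtain u v where uv: "u \<in> A" "v < V" "v \<notin> A" "yadj (?F - E) ?B u v" using crossF[OF A(1,4) ne] by blast
    then consider "(v, u) \<in> ?F" "(v, u) \<notin> E" | "(u, v) \<in> ?F" | "{u, v} \<in> ?B" unfolding yadj_def by blast
    then show False
    proof cases
      case 1
      then show ?thesis using uv unfolding fedges_iff E_def by auto
    next
      case 2
      then show ?thesis using A(3) uv unfolding fedges_iff suffix_def by auto
    next
      case 3
      then show ?thesis using A(2) uv unfolding bedges_iff by auto
    qed
  qed
  ultimately show ?thesis unfolding Uset_def Wset_def using P M by simp
qed

text \<open>Of the two sides of a separation, the one avoiding a chosen vertex is examined. When a
  fermion edge is deleted, avoiding \<alpha> V makes that side \<alpha>-closed. When a boson edge is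
  deleted, avoiding \<sigma> V makes it \<sigma>-closed, and \<open>good\<close> gives two boson
  edges leaving it, of which only one was deleted.\<close>

lemma Uset_imp_one_PI:
  assumes U: "(\<sigma>, \<alpha>) \<in> Uset {..<V} V"
  shows "one_PI (ygraph_of V (\<sigma>, \<alpha>))"
proof -
  let ?F = "fedges V \<sigma>" and ?B = "bedges V \<alpha>"
  note aD = pmatchD[OF M]
  have gd: "good \<sigma> \<alpha> V {..<V}" and np: "no_prefix \<sigma> \<alpha> V {..<V}" and ns: "no_suffix \<sigma> \<alpha> V {..<V}"
    using U unfolding Uset_def Wset_def by auto
  have al: "\<alpha> x < V" if "x < V" "\<alpha> x \<noteq> V" for x using aD(1)[of x] that by auto
  have sl: "\<sigma> x < V" if "x < V" "\<sigma> x \<noteq> V" for x using permutes_in_image[OF P, of x] that by auto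
  have sym: "yadj F Bs u v \<longleftrightarrow> yadj F Bs v u" for F Bs u v unfolding yadj_def by (auto simp: insert_commute)
  have pick: "\<exists>X. X \<subseteq> {..<V} \<and> X \<noteq> {} \<and> i \<notin> X \<and> (\<forall>u\<in>X. \<forall>v. v < V \<longrightarrow> v \<notin> X \<longrightarrow> \<not> yadj F Bs u v)"
    if A: "A \<subseteq> {..<V}" "A \<noteq> {}" "A \<noteq> {..<V}" and n: "\<not> (\<exists>u\<in>A. \<exists>v. v < V \<and> v \<notin> A \<and> yadj F Bs u v)" for A F Bs i
  proof (cases "i \<in> A")
    case False
    then show ?thesis using A n by blast
  next
    case True
    have "{..<V} - A \<noteq> {}" using A by blast
    moreover have "\<not> yadj F Bs u v" if "u \<in> {..<V} - A" "v < V" "v \<notin> {..<V} - A" for u v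
      using n sym[of F Bs u v] that by blast
    ultimately show ?thesis using True by (intro exI[of _ "{..<V} - A"]) blast
  qed
  have cF: "yconnected V (?F - E) ?B" if E: "E \<subseteq> {(u0, \<sigma> u0)}" for E u0
  proof (rule ccontr)
    assume "\<not> yconnected V (?F - E) ?B"
    then obtain A where "A \<subseteq> {..<V}" "A \<noteq> {}" "A \<noteq> {..<V}" "\<not> (\<exists>u\<in>A. \<exists>v. v < V \<and> v \<notin> A \<and> yadj (?F - E) ?B u v)"
      using connected_iff[of "?F - E" ?B] by blast
    from pick[OF this, of "\<alpha> V"] obtain X where X: "X \<subseteq> {..<V}" "X \<noteq> {}" "\<alpha> V \<notin> X"
      and n: "\<And>u v. u \<in> X \<Longrightarrow> v < V \<Longrightarrow> v \<notin> X \<Longrightarrow> \<not> yadj (?F - E) ?B u v" by blast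
    have acl: "\<forall>x\<in>X. \<alpha> x \<in> X"
    proof
      fix x assume x: "x \<in> X"
      then have xV: "x < V" using X(1) by blast
      have "\<alpha> x \<noteq> V" using x X(3) aD(3)[of x] by auto
      then have lt: "\<alpha> x < V" using al xV by blast
      then have "{x, \<alpha> x} \<in> ?B" using bedges_iff xV by simp
      then show "\<alpha> x \<in> X" using n[OF x lt] unfolding yadj_def by blast
    qed
    have outF: "(u, v) \<in> E" if "u \<in> X" "v < V" "v \<notin> X" "\<sigma> u = v" for u v
    proof -
      have "(u, v) \<in> ?F" using that X(1) unfolding fedges_iff by auto
      then show ?thesis using n[OF that(1-3)] unfolding yadj_def by blast
    qed
    have inF: "(v, u) \<in> E" if "u \<in> X" "v < V" "v \<notin> X" "\<sigma> v = u" for u v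
    proof -
      have "(v, u) \<in> ?F" using that X(1) unfolding fedges_iff by auto
      then show ?thesis using n[OF that(1-3)] unfolding yadj_def by blast
    qed
    \<comment> \<open>If the deleted edge leaves X, then X can be entered from V only and is a
      prefix; otherwise X can be left to V only and is a suffix.\<close>
    show False
    proof (cases "u0 \<in> X \<and> \<sigma> u0 \<notin> X")
      case True
      have "prefix \<sigma> V X" unfolding prefix_def
      proof (intro allI impI)
        fix x assume x: "\<sigma> x \<in> X"
        show "x \<in> insert V X"
        proof (rule ccontr)
          assume nx: "x \<notin> insert V X"
          have "\<sigma> x \<in> insert V {..<V}" using x X(1) by blast
          then have "x < V" using permutes_in_image[OF P, of x] nx by auto
          then have "(x, \<sigma> x) \<in> E" using inF[OF x] nx by blast
          then show False using E True nx by auto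
        qed
      qed
      then show ?thesis using np X(1,2) acl unfolding no_prefix_def by blast
    next
      case False
      have "suffix \<sigma> V X" unfolding suffix_def
      proof
        fix x assume x: "x \<in> X"
        show "\<sigma> x \<in> insert V X"
        proof (rule ccontr)
          assume nx: "\<sigma> x \<notin> insert V X"
          then have "\<sigma> x < V" using sl[of x] x X(1) by auto
          then have "(x, \<sigma> x) \<in> E" using outF[OF x] nx by blast
          then show False using E False nx x by auto
        qed
      qed
      then show ?thesis using ns X(1,2) acl unfolding no_suffix_def by blast
    qed
  qed
  have cB: "yconnected V ?F (?B - {e})" for e
  proof (rule ccontr)
    assume "\<not> yconnected V ?F (?B - {e})"
    then obtain A where "A \<subseteq> {..<V}" "A \<noteq> {}" "A \<noteq> {..<V}" "\<not> (\<exists>u\<in>A. \<exists>v. v < V \<and> v \<notin> A \<and> yadj ?F (?B - {e}) u v)"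
      using connected_iff[of ?F "?B - {e}"] by blast
    from pick[OF this, of "\<sigma> V"] obtain X where X: "X \<subseteq> {..<V}" "X \<noteq> {}" "\<sigma> V \<notin> X"
      and n: "\<And>u v. u \<in> X \<Longrightarrow> v < V \<Longrightarrow> v \<notin> X \<Longrightarrow> \<not> yadj ?F (?B - {e}) u v" by blast
    have fX: "finite X" using X(1) finite_subset by blast
    have "\<forall>x. \<sigma> x \<in> X \<longrightarrow> x \<in> X"
    proof (intro allI impI, rule ccontr)
      fix x assume x: "\<sigma> x \<in> X" "x \<notin> X"
      have "x \<noteq> V" using x X(3) by auto
      moreover have lt: "\<sigma> x < V" using x X(1) by auto
      ultimately have xV: "x < V" using permutes_in_image[OF P, of x] by auto
      then have "(x, \<sigma> x) \<in> ?F" using lt unfolding fedges_iff by simp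
      then show False using n[OF x(1) xV x(2)] unfolding yadj_def by blast
    qed
    then have "\<forall>x\<in>X. \<sigma> x \<in> X" using permutes_closed_iff[OF P fX] by blast
    then have "outs2 \<alpha> V X" using goodD[OF gd X(1,2)] by blast
    then obtain x y where xy: "x \<in> X" "y \<in> X" "x \<noteq> y" "\<alpha> x \<notin> insert V X" "\<alpha> y \<notin> insert V X" by (rule outs2E)
    have *: "{z, \<alpha> z} = e" if "z \<in> X" "\<alpha> z \<notin> insert V X" for z
    proof -
      have zV: "z < V" using that X(1) by auto
      then have lt: "\<alpha> z < V" using al that by blast
      then have "{z, \<alpha> z} \<in> ?B" using bedges_iff zV by simp
      then show ?thesis using n[OF that(1) lt] that(2) unfolding yadj_def by blast
    qed
    have "{x, \<alpha> x} = {y, \<alpha> y}" using *[OF xy(1,4)] *[OF xy(2,5)] by simp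
    then have "y = \<alpha> x" using xy(3) by (auto simp: doubleton_eq_iff)
    then show False using xy by blast
  qed
  have "yconnected V ?F ?B" using cF[of "{}" 0] by simp
  moreover have "\<forall>e\<in>?F. yconnected V (?F - {e}) ?B"
  proof
    fix e assume "e \<in> ?F"
    then obtain u where "e = (u, \<sigma> u)" unfolding fedges_def by blast
    then show "yconnected V (?F - {e}) ?B" using cF[of "{e}" u] by simp
  qed
  ultimately show ?thesis unfolding one_PI_def ygraph_of_def using cB by simp
qed

end

lemma Uset_root:
  fixes V :: nat
  assumes "(\<sigma>, \<alpha>) \<in> Uset {..<V} V"
  shows "\<sigma> permutes insert V {..<V}" "pmatch (insert V {..<V}) \<alpha>" "\<sigma> V \<noteq> V"
proof -
  show P: "\<sigma> permutes insert V {..<V}" and M: "pmatch (insert V {..<V}) \<alpha>"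
    using assms unfolding Uset_def Wset_def by auto
  have gd: "good \<sigma> \<alpha> V {..<V}" using assms unfolding Uset_def Wset_def by auto
  show "\<sigma> V \<noteq> V"
  proof
    assume r: "\<sigma> V = V"
    have "\<sigma> x \<in> {..<V}" if "x \<in> {..<V}" for x
    proof -
      have "\<sigma> x \<noteq> V"
      proof
        assume "\<sigma> x = V"
        then have "x = V" using r injD[OF permutes_inj[OF P], of x V] by simp
        then show False using that by simp
      qed
      then show ?thesis using permutes_in_image[OF P, of x] that by auto
    qed
    moreover have "{..<V} \<noteq> {}" using pmatchD(1,2)[OF M, of V] by auto
    ultimately have "outs2 \<alpha> V {..<V}" using goodD[OF gd] by blast
    then obtain x where "x \<in> {..<V}" "\<alpha> x \<notin> insert V {..<V}" by (rule outs2E)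
    then show False using pmatchD(1)[OF M, of x] by blast
  qed
qed

lemma ygraph_of_inj:
  assumes P: "\<sigma> permutes insert V {..<V}" "\<sigma>' permutes insert V {..<V}"
    and M: "pmatch (insert V {..<V}) \<alpha>" "pmatch (insert V {..<V}) \<alpha>'" and root: "\<sigma> V \<noteq> V" "\<sigma>' V \<noteq> V"
    and eq: "ygraph_of V (\<sigma>, \<alpha>) = ygraph_of V (\<sigma>', \<alpha>')"
  shows "\<sigma> = \<sigma>' \<and> \<alpha> = \<alpha>'"
proof
  have F: "fedges V \<sigma> = fedges V \<sigma>'" and B: "bedges V \<alpha> = bedges V \<alpha>'" using eq unfolding ygraph_of_def by auto
  show "\<sigma> = \<sigma>'"
  proof
    fix x
    consider "x = V" | "x < V" | "x > V" by linarith
    then show "\<sigma> x = \<sigma>' x"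
    proof cases
      case 1
      then show ?thesis using ext_in[OF P(1) M(1) root(1)] ext_in[OF P(2) M(2) root(2)] F by auto
    next
      case 2
      have "\<sigma> x \<in> insert V {..<V}" "\<sigma>' x \<in> insert V {..<V}"
        using permutes_in_image[OF P(1), of x] permutes_in_image[OF P(2), of x] 2 by auto
      then show ?thesis using 2 F fedges_iff[OF P(1) M(1) root(1), of x] fedges_iff[OF P(2) M(2) root(2), of x]
        by (metis insert_iff lessThan_iff)
    next
      case 3
      then show ?thesis using permutes_not_in[OF P(1), of x] permutes_not_in[OF P(2), of x] by simp
    qed
  qed
  show "\<alpha> = \<alpha>'"
  proof
    fix x
    consider "x = V" | "x < V" | "x > V" by linarith
    then show "\<alpha> x = \<alpha>' x"
    proof cases
      case 1
      then show ?thesis using ext_boson[OF P(1) M(1) root(1)] ext_boson[OF P(2) M(2) root(2)] B by auto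
    next
      case 2
      have "\<alpha> x \<in> insert V {..<V}" "\<alpha>' x \<in> insert V {..<V}"
        using pmatchD(1)[OF M(1), of x] pmatchD(1)[OF M(2), of x] 2 by auto
      then show ?thesis using 2 B bedges_iff[OF P(1) M(1) root(1), of x] bedges_iff[OF P(2) M(2) root(2), of x]
        by (metis insert_iff lessThan_iff)
    next
      case 3
      then show ?thesis using pmatchD(4)[OF M(1), of x] pmatchD(4)[OF M(2), of x] by simp
    qed
  qed
qed

lemma ygraph_of_surj:
  assumes "yukawa_vertex_type (V, F, Bs)"
  obtains \<sigma> \<alpha> where "\<sigma> permutes insert V {..<V}" "pmatch (insert V {..<V}) \<alpha>" "\<sigma> V \<noteq> V"
    "ygraph_of V (\<sigma>, \<alpha>) = (V, F, Bs)"
proof -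
  have F: "F \<subseteq> {..<V} \<times> {..<V}" and fun1: "\<And>u v w. (u, v) \<in> F \<Longrightarrow> (u, w) \<in> F \<Longrightarrow> v = w"
    and fun2: "\<And>u v w. (u, w) \<in> F \<Longrightarrow> (v, w) \<in> F \<Longrightarrow> u = v"
    and B: "\<forall>e\<in>Bs. \<exists>u v. u \<noteq> v \<and> u < V \<and> v < V \<and> e = {u, v}"
    and Bd: "\<forall>e\<in>Bs. \<forall>e'\<in>Bs. e \<noteq> e' \<longrightarrow> e \<inter> e' = {}"
    and c: "card {u\<in>{..<V}. \<not> (\<exists>v. (u, v) \<in> F)} = 1" "card {v\<in>{..<V}. \<not> (\<exists>u. (u, v) \<in> F)} = 1" "card ({..<V} - \<Union>Bs) = 1"
    using assms unfolding yukawa_vertex_type_def by auto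
  obtain w where w: "{u\<in>{..<V}. \<not> (\<exists>v. (u, v) \<in> F)} = {w}" using c(1) by (auto simp: card_1_singleton_iff)
  obtain i where i: "{v\<in>{..<V}. \<not> (\<exists>u. (u, v) \<in> F)} = {i}" using c(2) by (auto simp: card_1_singleton_iff)
  obtain b where b: "{..<V} - \<Union>Bs = {b}" using c(3) by (auto simp: card_1_singleton_iff)
  have wv: "u = w" if "u < V" "\<And>v. (u, v) \<notin> F" for u using w that by blast
  have iv: "i < V" "\<And>u. (u, i) \<notin> F" using i by blast+
  \<comment> \<open>The missing successor of w becomes V, and V leads on to i, the vertex with the
    incoming leg.\<close>
  define \<sigma> where "\<sigma> = (\<lambda>u. if u = V then i else if u < V then (if \<exists>v. (u, v) \<in> F then THE v. (u, v) \<in> F else V) else u)"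
  have s1: "\<sigma> u = v" if "(u, v) \<in> F" for u v
  proof -
    have "u < V" using that F by blast
    moreover have "(THE v. (u, v) \<in> F) = v" using that fun1 by blast
    ultimately show ?thesis using that unfolding \<sigma>_def by auto
  qed
  have s2: "\<sigma> u = V" if "u < V" "\<And>v. (u, v) \<notin> F" for u using that unfolding \<sigma>_def by auto
  have sV: "\<sigma> V = i" unfolding \<sigma>_def by simp
  have into: "\<sigma> u \<in> insert V {..<V}" if "u \<in> insert V {..<V}" for u
  proof (cases "\<exists>v. (u, v) \<in> F")
    case True
    then obtain v where "(u, v) \<in> F" by blast
    then show ?thesis using s1 F by blast
  next
    case False
    then show ?thesis using s2[of u] sV iv(1) that by (cases "u = V") auto
  qed
  have inj: "inj_on \<sigma> (insert V {..<V})"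
  proof (rule inj_onI)
    fix x y assume xy: "x \<in> insert V {..<V}" "y \<in> insert V {..<V}" "\<sigma> x = \<sigma> y"
    have cases: "(z = V \<and> \<sigma> z = i) \<or> (z < V \<and> (z, \<sigma> z) \<in> F \<and> \<sigma> z < V) \<or> (z = w \<and> z < V \<and> \<sigma> z = V)"
      if "z \<in> insert V {..<V}" for z
    proof (cases "z = V")
      case False
      then have z: "z < V" using that by auto
      show ?thesis
      proof (cases "\<exists>v. (z, v) \<in> F")
        case True
        then obtain v where "(z, v) \<in> F" by blast
        then show ?thesis using s1[of z v] F z by auto
      next
        case False
        then show ?thesis using s2[OF z] wv[OF z] z by blast
      qed
    qed (use sV in simp)
    show "x = y"
      using cases[OF xy(1)] cases[OF xy(2)] xy(3) iv fun2[of x "\<sigma> x" y] by auto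
  qed
  have "\<sigma> ` insert V {..<V} = insert V {..<V}"
    by (rule endo_inj_surj) (use into inj in auto)
  then have P: "\<sigma> permutes insert V {..<V}"
    using inj by (intro bij_imp_permutes) (auto simp: bij_betw_def \<sigma>_def)
  have root: "\<sigma> V \<noteq> V" using sV iv(1) by simp
  have "(u, v) \<in> F \<longleftrightarrow> u < V \<and> v < V \<and> \<sigma> u = v" for u v
  proof
    assume "(u, v) \<in> F"
    then show "u < V \<and> v < V \<and> \<sigma> u = v" using s1 F by auto
  next
    assume uv: "u < V \<and> v < V \<and> \<sigma> u = v"
    then obtain v' where "(u, v') \<in> F" using s2[of u] by auto
    then show "(u, v) \<in> F" using s1[of u v'] uv by simp
  qed
  note Fiff = this
  have bV: "b < V" "b \<notin> \<Union>Bs" and UB: "\<Union>Bs = {..<V} - {b}"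
  proof -
    show "b < V" "b \<notin> \<Union>Bs" using b by blast+
    have "\<Union>Bs \<subseteq> {..<V}"
    proof
      fix x assume "x \<in> \<Union>Bs"
      then obtain e where e: "e \<in> Bs" "x \<in> e" by blast
      then have "\<exists>u v. u \<noteq> v \<and> u < V \<and> v < V \<and> e = {u, v}" using B by simp
      then show "x \<in> {..<V}" using e(2) by auto
    qed
    then show "\<Union>Bs = {..<V} - {b}" using b by blast
  qed
  \<comment> \<open>Joining the external boson leg to V completes the boson edges to a perfect
    matching.\<close>
  let ?M = "insert {b, V} Bs"
  have VB: "V \<notin> e" if "e \<in> Bs" for e using that UB by auto
  have "pairing (insert V {..<V}) ?M" unfolding pairing_def
  proof (intro conjI)
    have "b \<noteq> V" using bV by simp
    then show "\<forall>c\<in>?M. \<exists>a b. a \<noteq> b \<and> c = {a, b}" using B by blast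
    have d: "{b, V} \<inter> e = {}" "e \<inter> {b, V} = {}" if "e \<in> Bs" for e using that VB bV by auto
    show "\<forall>c\<in>?M. \<forall>d\<in>?M. c \<noteq> d \<longrightarrow> c \<inter> d = {}"
    proof (intro ballI impI)
      fix c e assume ce: "c \<in> ?M" "e \<in> ?M" "c \<noteq> e"
      show "c \<inter> e = {}"
      proof (cases "c = {b, V}")
        case True
        then have "e \<in> Bs" using ce by blast
        then show ?thesis unfolding True by (rule d(1))
      next
        case False
        then have cB: "c \<in> Bs" using ce(1) by blast
        show ?thesis
        proof (cases "e = {b, V}")
          case True
          show ?thesis unfolding True by (rule d(2)[OF cB])
        next
          case False
          then have "e \<in> Bs" using ce(2) by blast
          then show ?thesis using Bd cB ce(3) by blast
        qed
      qed
    qed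
    show "\<Union>?M = insert V {..<V}" using UB bV by auto
  qed
  then obtain \<alpha> where \<alpha>: "pmatch (insert V {..<V}) \<alpha>" "edges (insert V {..<V}) \<alpha> = ?M" by (rule pairing_obtain)
  note aD = pmatchD[OF \<alpha>(1)]
  have em: "{x, y} \<in> ?M \<longleftrightarrow> y = \<alpha> x" if "x < V" for x y
    using edges_mem[OF \<alpha>(1), of x y] that \<alpha>(2) by simp
  have "e \<in> Bs \<longleftrightarrow> e \<in> bedges V \<alpha>" for e
  proof
    assume e: "e \<in> Bs"
    then obtain u v where uv: "u < V" "v < V" "e = {u, v}" using B by blast
    then show "e \<in> bedges V \<alpha>" using em[of u v] e bedges_iff[OF P \<alpha>(1) root, of u v] by simp
  next
    assume "e \<in> bedges V \<alpha>"
    then obtain u where u: "u < V" "\<alpha> u < V" "e = {u, \<alpha> u}" by (rule bedgesE[OF P \<alpha>(1) root])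
    then have "e \<in> ?M" using em[of u "\<alpha> u"] by simp
    moreover have "V \<notin> e" using u by auto
    ultimately show "e \<in> Bs" by auto
  qed
  then have "bedges V \<alpha> = Bs" by blast
  moreover have "fedges V \<sigma> = F" using Fiff fedges_iff[OF P \<alpha>(1) root] by auto
  ultimately have "ygraph_of V (\<sigma>, \<alpha>) = (V, F, Bs)" unfolding ygraph_of_def by simp
  then show thesis using that P \<alpha>(1) root by blast
qed

section \<open>Isomorphism classes\<close>

text \<open>Isomorphisms act by simultaneous conjugation. A permutation of the ordinary vertices
  fixes the extra one, hence respects the legs.\<close>

definition relabel :: "('a \<Rightarrow> 'a) \<Rightarrow> ('a \<Rightarrow> 'a) \<times> ('a \<Rightarrow> 'a) \<Rightarrow> ('a \<Rightarrow> 'a) \<times> ('a \<Rightarrow> 'a)" where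
  "relabel \<tau> = (\<lambda>(\<sigma>, \<alpha>). (\<tau> \<circ> \<sigma> \<circ> inv \<tau>, \<tau> \<circ> \<alpha> \<circ> inv \<tau>))"

lemma relabel_apply:
  assumes "\<tau> permutes S"
  shows "(\<tau> \<circ> f \<circ> inv \<tau>) (\<tau> x) = \<tau> (f x)"
  using permutes_inverses(2)[OF assms] by simp

lemma permutes_eq_iff_notin:
  assumes "\<tau> permutes S" "r \<notin> S"
  shows "\<tau> x = r \<longleftrightarrow> x = r"
  using permutes_not_in[OF assms] permutes_inj[OF assms(1)] by (metis injD)

lemma relabel_Uset:
  assumes r: "r \<notin> S" and t: "\<tau> permutes S" and U: "(\<sigma>, \<alpha>) \<in> Uset S r"
  shows "relabel \<tau> (\<sigma>, \<alpha>) \<in> Uset S r"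
proof -
  let ?s = "\<tau> \<circ> \<sigma> \<circ> inv \<tau>" and ?a = "\<tau> \<circ> \<alpha> \<circ> inv \<tau>"
  have P: "\<sigma> permutes insert r S" and M: "pmatch (insert r S) \<alpha>" and gd: "good \<sigma> \<alpha> r S"
    and np: "no_prefix \<sigma> \<alpha> r S" and ns: "no_suffix \<sigma> \<alpha> r S"
    using U unfolding Uset_def Wset_def by auto
  note aD = pmatchD[OF M]
  note tr = permutes_eq_iff_notin[OF t r]
  have eq: "\<tau> x = \<tau> y \<longleftrightarrow> x = y" for x y using permutes_inj[OF t] by (auto dest: injD)
  have sur: "\<exists>x. y = \<tau> x" for y using permutes_surj[OF t] by blast
  have tS: "\<tau> x \<in> insert r S \<longleftrightarrow> x \<in> insert r S" for x using permutes_in_image[OF t] tr by blast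
  have sx: "?s (\<tau> x) = \<tau> (\<sigma> x)" and ax: "?a (\<tau> x) = \<tau> (\<alpha> x)" for x using relabel_apply[OF t] by auto
  have t': "\<tau> permutes insert r S" using permutes_subset[OF t] by blast
  have P': "?s permutes insert r S"
    by (rule permutes_compose[OF permutes_inv[OF t'] permutes_compose[OF P t']])
  have M': "pmatch (insert r S) ?a"
  proof (rule pmatchI)
    fix y assume y: "y \<in> insert r S"
    obtain x where x: "y = \<tau> x" using sur by blast
    then have xS: "x \<in> insert r S" using y tS by simp
    show "?a y \<in> insert r S" "?a y \<noteq> y" "?a (?a y) = y"
      unfolding x ax using tS aD(1)[OF xS] aD(2)[OF xS] aD(3)[of x] eq by simp_all
  next
    fix y assume y: "y \<notin> insert r S"
    obtain x where x: "y = \<tau> x" using sur by blast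
    then have "x \<notin> insert r S" using y tS[of x] by blast
    then show "?a y = y" unfolding x ax using aD(4)[of x] by simp
  qed
  define pull where "pull = (\<lambda>A. {x. \<tau> x \<in> A})"
  have pl: "x \<in> pull A \<longleftrightarrow> \<tau> x \<in> A" for x A unfolding pull_def by simp
  have plS: "pull A \<subseteq> S" if "A \<subseteq> S" for A
  proof
    fix x assume "x \<in> pull A"
    then have "\<tau> x \<in> S" using that pl by blast
    then show "x \<in> S" using permutes_in_image[OF t] by simp
  qed
  have ple: "pull A = {} \<longleftrightarrow> A = {}" for A
  proof
    assume e: "pull A = {}"
    show "A = {}"
    proof (rule equals0I)
      fix y assume "y \<in> A"
      moreover obtain x where "y = \<tau> x" using sur by blast
      ultimately have "x \<in> pull A" using pl by simp
      then show False using e by simp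
    qed
  qed (simp add: pull_def)
  have "good ?s ?a r S"
  proof (rule goodI)
    fix A assume A: "A \<subseteq> S" "A \<noteq> {}" "\<And>x. x \<in> A \<Longrightarrow> ?s x \<in> A"
    have "outs2 \<alpha> r (pull A)"
    proof (rule goodD[OF gd])
      fix x assume "x \<in> pull A"
      then show "\<sigma> x \<in> pull A" using A(3)[of "\<tau> x"] sx unfolding pl by simp
    qed (use A plS ple in auto)
    then obtain x y where xy: "x \<in> pull A" "y \<in> pull A" "x \<noteq> y" "\<alpha> x \<notin> insert r (pull A)" "\<alpha> y \<notin> insert r (pull A)"
      by (rule outs2E)
    have o: "?a (\<tau> z) \<notin> insert r A" if "\<alpha> z \<notin> insert r (pull A)" for z
      unfolding ax using that tr[of "\<alpha> z"] pl[of "\<alpha> z" A] by blast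
    show "outs2 ?a r A"
      by (rule outs2I[of "\<tau> x" A "\<tau> y"]) (use xy pl eq o in auto)
  qed
  moreover have acl: "\<forall>x\<in>pull A. \<alpha> x \<in> pull A" if "\<forall>x\<in>A. ?a x \<in> A" for A
    using that ax unfolding pull_def by auto
  have "no_prefix ?s ?a r S" unfolding no_prefix_def
  proof (intro allI impI)
    fix A assume A: "A \<subseteq> S" "\<forall>x\<in>A. ?a x \<in> A" "prefix ?s r A"
    have "prefix \<sigma> r (pull A)" unfolding prefix_def
    proof (intro allI impI)
      fix x assume "\<sigma> x \<in> pull A"
      then have "?s (\<tau> x) \<in> A" unfolding sx pl .
      then have "\<tau> x \<in> insert r A" using A(3) unfolding prefix_def by blast
      then show "x \<in> insert r (pull A)" using tr pl by blast
    qed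
    then have "pull A = {}" using np plS[OF A(1)] acl[OF A(2)] unfolding no_prefix_def by blast
    then show "A = {}" unfolding ple .
  qed
  moreover have "no_suffix ?s ?a r S" unfolding no_suffix_def
  proof (intro allI impI)
    fix A assume A: "A \<subseteq> S" "\<forall>x\<in>A. ?a x \<in> A" "suffix ?s r A"
    have "suffix \<sigma> r (pull A)" unfolding suffix_def
    proof
      fix x assume "x \<in> pull A"
      then have "?s (\<tau> x) \<in> insert r A" using A(3) unfolding suffix_def pl by blast
      then show "\<sigma> x \<in> insert r (pull A)" unfolding sx using tr pl by blast
    qed
    then have "pull A = {}" using ns plS[OF A(1)] acl[OF A(2)] unfolding no_suffix_def by blast
    then show "A = {}" unfolding ple .
  qed
  ultimately show ?thesis unfolding relabel_def Uset_def Wset_def using P' M' by simp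
qed

text \<open>Connected graphs with fixed legs have no automorphisms: the points where two relabelings agree
  include the root and are closed under \<open>\<sigma>\<close> and \<open>\<alpha>\<close>.\<close>

lemma relabel_free:
  assumes S: "finite S" "r \<notin> S" and t: "\<tau> permutes S" "\<tau>' permutes S" and U: "(\<sigma>, \<alpha>) \<in> Uset S r"
    and eq: "relabel \<tau> (\<sigma>, \<alpha>) = relabel \<tau>' (\<sigma>, \<alpha>)"
  shows "\<tau> = \<tau>'"
proof -
  have P: "\<sigma> permutes insert r S" and M: "pmatch (insert r S) \<alpha>" and gd: "good \<sigma> \<alpha> r S"
    using U unfolding Uset_def Wset_def by auto
  note aD = pmatchD[OF M]
  have es: "\<tau> \<circ> \<sigma> \<circ> inv \<tau> = \<tau>' \<circ> \<sigma> \<circ> inv \<tau>'" and ea: "\<tau> \<circ> \<alpha> \<circ> inv \<tau> = \<tau>' \<circ> \<alpha> \<circ> inv \<tau>'"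
    using eq unfolding relabel_def by auto
  have s: "\<tau> (\<sigma> x) = \<tau>' (\<sigma> x)" if "\<tau> x = \<tau>' x" for x
    using relabel_apply[OF t(1), of \<sigma> x] relabel_apply[OF t(2), of \<sigma> x] es that by metis
  have a: "\<tau> (\<alpha> x) = \<tau>' (\<alpha> x)" if "\<tau> x = \<tau>' x" for x
    using relabel_apply[OF t(1), of \<alpha> x] relabel_apply[OF t(2), of \<alpha> x] ea that by metis
  define A where "A = {x \<in> S. \<tau> x \<noteq> \<tau>' x}"
  let ?D = "insert r S - A"
  have out: "\<tau> x = \<tau>' x" if "x \<notin> A" for x
  proof (cases "x \<in> S")
    case False
    then show ?thesis using permutes_not_in[OF t(1)] permutes_not_in[OF t(2)] by simp
  qed (use that in \<open>simp add: A_def\<close>)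
  have nA: "x \<notin> A" if "\<tau> x = \<tau>' x" for x using that unfolding A_def by simp
  have "A = {}"
  proof (rule ccontr)
    assume ne: "A \<noteq> {}"
    have "finite A" using S(1) unfolding A_def by simp
    moreover have "\<forall>x. \<sigma> x \<in> A \<longrightarrow> x \<in> A" using s nA out by blast
    ultimately have "\<forall>x\<in>A. \<sigma> x \<in> A" using permutes_closed_iff[OF P] by blast
    moreover have "A \<subseteq> S" unfolding A_def by blast
    ultimately have "outs2 \<alpha> r A" using goodD[OF gd] ne by blast
    then obtain x where x: "x \<in> A" "\<alpha> x \<notin> A" by (auto elim!: outs2E)
    then have "x \<notin> A" using a[OF out[OF x(2)]] nA aD(3)[of x] by simp
    then show False using x by blast
  qed
  then show ?thesis using out by auto
qed

lemma relabel_comp: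
  assumes "\<tau> permutes S" "\<tau>' permutes S"
  shows "relabel \<tau>' (relabel \<tau> u) = relabel (\<tau>' \<circ> \<tau>) u"
proof -
  have "inv (\<tau>' \<circ> \<tau>) = inv \<tau> \<circ> inv \<tau>'"
    using permutes_bij[OF assms(1)] permutes_bij[OF assms(2)] by (rule o_inv_distrib[rotated])
  then show ?thesis unfolding relabel_def by (cases u) (simp add: o_assoc)
qed

lemma relabel_id: "relabel id u = u"
  unfolding relabel_def by (cases u) simp

lemma ygraph_of_relabel:
  assumes t: "\<tau> permutes {..<V}"
  shows "ygraph_of V (relabel \<tau> (\<sigma>, \<alpha>)) =
    (V, map_prod \<tau> \<tau> ` fedges V \<sigma>, (\<lambda>e. \<tau> ` e) ` bedges V \<alpha>)"
proof -
  have "V \<notin> {..<V}" by simp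
  note tV = permutes_eq_iff_notin[OF t this]
  have tl: "\<tau> x < V \<longleftrightarrow> x < V" for x using permutes_in_image[OF t, of x] by simp
  have sur: "\<exists>x. y = \<tau> x" for y using permutes_surj[OF t] by blast
  note ra = relabel_apply[OF t]
  have "fedges V (\<tau> \<circ> \<sigma> \<circ> inv \<tau>) = map_prod \<tau> \<tau> ` fedges V \<sigma>"
  proof (intro equalityI subsetI)
    fix e assume "e \<in> fedges V (\<tau> \<circ> \<sigma> \<circ> inv \<tau>)"
    then obtain w where w: "w < V" "(\<tau> \<circ> \<sigma> \<circ> inv \<tau>) w \<noteq> V" "e = (w, (\<tau> \<circ> \<sigma> \<circ> inv \<tau>) w)" unfolding fedges_def by blast
    obtain u where u: "w = \<tau> u" using sur by blast
    have "(u, \<sigma> u) \<in> fedges V \<sigma>" using w(1,2) unfolding u ra tV tl fedges_def by blast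
    moreover have "e = map_prod \<tau> \<tau> (u, \<sigma> u)" using w(3) ra[of \<sigma> u] unfolding u by simp
    ultimately show "e \<in> map_prod \<tau> \<tau> ` fedges V \<sigma>" by blast
  next
    fix e assume "e \<in> map_prod \<tau> \<tau> ` fedges V \<sigma>"
    then obtain u where u: "u < V" "\<sigma> u \<noteq> V" "e = (\<tau> u, \<tau> (\<sigma> u))" unfolding fedges_def by auto
    then have "\<tau> u < V" "(\<tau> \<circ> \<sigma> \<circ> inv \<tau>) (\<tau> u) \<noteq> V" "e = (\<tau> u, (\<tau> \<circ> \<sigma> \<circ> inv \<tau>) (\<tau> u))"
      unfolding ra using tV tl by simp_all
    then show "e \<in> fedges V (\<tau> \<circ> \<sigma> \<circ> inv \<tau>)" unfolding fedges_def by blast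
  qed
  moreover have "bedges V (\<tau> \<circ> \<alpha> \<circ> inv \<tau>) = (\<lambda>e. \<tau> ` e) ` bedges V \<alpha>"
  proof (intro equalityI subsetI)
    fix e assume "e \<in> bedges V (\<tau> \<circ> \<alpha> \<circ> inv \<tau>)"
    then obtain w where w: "w < V" "(\<tau> \<circ> \<alpha> \<circ> inv \<tau>) w \<noteq> V" "e = {w, (\<tau> \<circ> \<alpha> \<circ> inv \<tau>) w}" unfolding bedges_def by blast
    obtain u where u: "w = \<tau> u" using sur by blast
    have "{u, \<alpha> u} \<in> bedges V \<alpha>" using w(1,2) unfolding u ra tV tl bedges_def by blast
    moreover have "e = \<tau> ` {u, \<alpha> u}" using w(3) ra[of \<alpha> u] unfolding u by simp
    ultimately show "e \<in> (\<lambda>e. \<tau> ` e) ` bedges V \<alpha>" by blast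
  next
    fix e assume "e \<in> (\<lambda>e. \<tau> ` e) ` bedges V \<alpha>"
    then obtain u where u: "u < V" "\<alpha> u \<noteq> V" "e = {\<tau> u, \<tau> (\<alpha> u)}" unfolding bedges_def by auto
    then have "\<tau> u < V" "(\<tau> \<circ> \<alpha> \<circ> inv \<tau>) (\<tau> u) \<noteq> V" "e = {\<tau> u, (\<tau> \<circ> \<alpha> \<circ> inv \<tau>) (\<tau> u)}"
      unfolding ra using tV tl by simp_all
    then show "e \<in> bedges V (\<tau> \<circ> \<alpha> \<circ> inv \<tau>)" unfolding bedges_def by blast
  qed
  ultimately show ?thesis unfolding relabel_def ygraph_of_def by simp
qed

text \<open>All vertices but one lie on internal boson edges, so there are (V - 1)/2 of these; the
  external leg adds one.\<close>

lemma boson_count_ygraph_of: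
  assumes "(\<sigma>, \<alpha>) \<in> Uset {..<V} V"
  shows "2 * boson_count (ygraph_of V (\<sigma>, \<alpha>)) = V + 1"
proof -
  note R = Uset_root[OF assms]
  have type: "yukawa_vertex_type (V, fedges V \<sigma>, bedges V \<alpha>)"
    using vertex_type[OF R] unfolding ygraph_of_def by simp
  then have "pairing (\<Union>(bedges V \<alpha>)) (bedges V \<alpha>)"
    unfolding yukawa_vertex_type_def pairing_def by (simp, meson)
  moreover have sub: "\<Union>(bedges V \<alpha>) \<subseteq> {..<V}"
  proof
    fix x assume "x \<in> \<Union>(bedges V \<alpha>)"
    then obtain e where "e \<in> bedges V \<alpha>" "x \<in> e" by blast
    then show "x \<in> {..<V}" by (auto elim!: bedgesE[OF R])
  qed
  moreover have "finite (\<Union>(bedges V \<alpha>))" using sub finite_subset by blast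
  ultimately have "2 * card (bedges V \<alpha>) = card (\<Union>(bedges V \<alpha>))" by (intro card_pairing)
  moreover have "card {..<V} = card (\<Union>(bedges V \<alpha>)) + card ({..<V} - \<Union>(bedges V \<alpha>))"
    using sub by (metis card_Diff_subset card_mono finite_lessThan finite_subset le_add_diff_inverse)
  ultimately show ?thesis
    using ext_boson[OF R] unfolding boson_count_def ygraph_of_def by simp
qed

lemma U11_graphs_Suc: "U11_graphs (Suc n) = ygraph_of (2 * n + 1) ` Uset {..<2 * n + 1} (2 * n + 1)"
proof (intro equalityI subsetI)
  fix G assume G: "G \<in> U11_graphs (Suc n)"
  obtain V F Bs where g: "G = (V, F, Bs)" by (cases G)
  have type: "yukawa_vertex_type (V, F, Bs)" and pi: "one_PI G" and bc: "boson_count G = Suc n"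
    using G unfolding U11_graphs_def g by auto
  obtain \<sigma> \<alpha> where sa: "\<sigma> permutes insert V {..<V}" "pmatch (insert V {..<V}) \<alpha>" "\<sigma> V \<noteq> V"
    "ygraph_of V (\<sigma>, \<alpha>) = (V, F, Bs)" using ygraph_of_surj[OF type] .
  have U: "(\<sigma>, \<alpha>) \<in> Uset {..<V} V"
    by (rule one_PI_imp_Uset[OF sa(1-3)]) (use pi g sa(4) in simp)
  have "2 * Suc n = V + 1" using boson_count_ygraph_of[OF U] bc sa(4) g by simp
  then have "V = 2 * n + 1" by simp
  then show "G \<in> ygraph_of (2 * n + 1) ` Uset {..<2 * n + 1} (2 * n + 1)"
    using U sa(4) g by (metis image_eqI)
next
  fix G assume "G \<in> ygraph_of (2 * n + 1) ` Uset {..<2 * n + 1} (2 * n + 1)"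
  then obtain \<sigma> \<alpha> where G: "G = ygraph_of (2 * n + 1) (\<sigma>, \<alpha>)" and U: "(\<sigma>, \<alpha>) \<in> Uset {..<2 * n + 1} (2 * n + 1)" by auto
  note R = Uset_root[OF U]
  have "2 * boson_count G = 2 * Suc n" unfolding G boson_count_ygraph_of[OF U] by simp
  then show "G \<in> U11_graphs (Suc n)"
    unfolding U11_graphs_def using vertex_type[OF R] Uset_imp_one_PI[OF R U] unfolding G by simp
qed

lemma yiso_iff_relabel:
  assumes u: "u \<in> Uset {..<V} V" and w: "w \<in> Uset {..<V} V"
  shows "yiso (ygraph_of V u) (ygraph_of V w) \<longleftrightarrow> (\<exists>\<tau>. \<tau> permutes {..<V} \<and> w = relabel \<tau> u)"
proof -
  obtain \<sigma> \<alpha> where u': "u = (\<sigma>, \<alpha>)" by (cases u)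
  obtain \<sigma>' \<alpha>' where w': "w = (\<sigma>', \<alpha>')" by (cases w)
  note Ru = Uset_root[OF u[unfolded u']] and Rw = Uset_root[OF w[unfolded w']]
  show ?thesis
  proof
    assume "yiso (ygraph_of V u) (ygraph_of V w)"
    then obtain \<rho> where \<rho>: "bij_betw \<rho> {..<V} {..<V}" "fedges V \<sigma>' = map_prod \<rho> \<rho> ` fedges V \<sigma>"
      "bedges V \<alpha>' = (\<lambda>e. \<rho> ` e) ` bedges V \<alpha>"
      unfolding yiso_def ygraph_of_def u' w' by auto
    \<comment> \<open>The isomorphism is arbitrary off {..<V}; replacing it there by the identity
      gives a permutation without changing the graph.\<close>
    define \<tau> where "\<tau> = restr {..<V} \<rho>"
    have tr: "\<tau> x = \<rho> x" if "x < V" for x using that unfolding \<tau>_def restr_def by simp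
    have "bij_betw \<tau> {..<V} {..<V}"
      using \<rho>(1) tr bij_betw_cong[of "{..<V}" \<tau> \<rho>] by simp
    then have t: "\<tau> permutes {..<V}"
      by (rule bij_imp_permutes) (simp add: \<tau>_def restr_def)
    have "map_prod \<rho> \<rho> ` fedges V \<sigma> = map_prod \<tau> \<tau> ` fedges V \<sigma>"
      by (rule image_cong[OF refl]) (use fedges_iff[OF Ru] tr in auto)
    moreover have "(\<lambda>e. \<rho> ` e) ` bedges V \<alpha> = (\<lambda>e. \<tau> ` e) ` bedges V \<alpha>"
    proof (rule image_cong[OF refl])
      fix e assume "e \<in> bedges V \<alpha>"
      then obtain x where "x < V" "\<alpha> x < V" "e = {x, \<alpha> x}" by (rule bedgesE[OF Ru])
      then show "\<rho> ` e = \<tau> ` e" using tr by simp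
    qed
    ultimately have eq: "ygraph_of V w = ygraph_of V (relabel \<tau> u)"
      unfolding u' ygraph_of_relabel[OF t] using \<rho> unfolding w' ygraph_of_def by simp
    have Ur: "relabel \<tau> u \<in> Uset {..<V} V" unfolding u' by (rule relabel_Uset[OF _ t]) (use u u' in auto)
    obtain \<sigma>'' \<alpha>'' where r: "relabel \<tau> u = (\<sigma>'', \<alpha>'')" by (cases "relabel \<tau> u")
    note Rr = Uset_root[OF Ur[unfolded r]]
    have "w = relabel \<tau> u"
      using ygraph_of_inj[OF Rw(1) Rr(1) Rw(2) Rr(2) Rw(3) Rr(3)] eq unfolding w' r by simp
    then show "\<exists>\<tau>. \<tau> permutes {..<V} \<and> w = relabel \<tau> u" using t by blast
  next
    assume "\<exists>\<tau>. \<tau> permutes {..<V} \<and> w = relabel \<tau> u"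
    then obtain \<tau> where t: "\<tau> permutes {..<V}" "w = relabel \<tau> u" by blast
    have g: "ygraph_of V w = (V, map_prod \<tau> \<tau> ` fedges V \<sigma>, (\<lambda>e. \<tau> ` e) ` bedges V \<alpha>)"
      unfolding t(2) u' by (rule ygraph_of_relabel[OF t(1)])
    show "yiso (ygraph_of V u) (ygraph_of V w)"
      unfolding g unfolding u' ygraph_of_def yiso_def using permutes_imp_bij[OF t(1)] by auto
  qed
qed

text \<open>Permutations of the vertices act freely, so every isomorphism class consists of fact V
  graphs on {..<V}.\<close>

lemma card_Uset_orbits: "card (Uset {..<2 * n + 1} (2 * n + 1)) = fact (2 * n + 1) * U11_count (Suc n)"
proof -
  define V where "V = 2 * n + 1"
  let ?U = "Uset {..<V} V" and ?X = "U11_graphs (Suc n)" and ?S = "{..<V}"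
  define R where "R = {(G, H). G \<in> ?X \<and> H \<in> ?X \<and> yiso G H}"
  have X: "?X = ygraph_of V ` ?U" unfolding V_def by (rule U11_graphs_Suc)
  have VS: "V \<notin> ?S" "finite ?S" by auto
  have inj: "inj_on (ygraph_of V) ?U"
  proof (rule inj_onI)
    fix u w assume u: "u \<in> ?U" and w: "w \<in> ?U" and eq: "ygraph_of V u = ygraph_of V w"
    obtain \<sigma> \<alpha> where u': "u = (\<sigma>, \<alpha>)" by (cases u)
    obtain \<sigma>' \<alpha>' where w': "w = (\<sigma>', \<alpha>')" by (cases w)
    note Ru = Uset_root[OF u[unfolded u']] and Rw = Uset_root[OF w[unfolded w']]
    show "u = w" using ygraph_of_inj[OF Ru(1) Rw(1) Ru(2) Rw(2) Ru(3) Rw(3)] eq unfolding u' w' by simp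
  qed
  have rel: "relabel \<tau> u \<in> ?U" if "\<tau> permutes ?S" "u \<in> ?U" for \<tau> u
    using relabel_Uset[OF VS(1) that(1)] that(2) by (cases u) auto
  have RU: "(ygraph_of V u, ygraph_of V w) \<in> R \<longleftrightarrow> (\<exists>\<tau>. \<tau> permutes ?S \<and> w = relabel \<tau> u)" if "u \<in> ?U" "w \<in> ?U" for u w
    unfolding R_def X using yiso_iff_relabel[OF that] that by auto
  have finU: "finite ?U" by (rule finite_subset[OF _ finite_Wset[OF VS(2), of V]]) (auto simp: Uset_def)
  have finX: "finite ?X" unfolding X using finU by simp
  have RX: "R \<subseteq> ?X \<times> ?X" unfolding R_def by blast
  have equiv: "equiv ?X R"
  proof (rule equivI)
    show "R \<subseteq> ?X \<times> ?X" by (rule RX)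
    show "refl_on ?X R"
    proof (rule refl_onI)
      fix G assume "G \<in> ?X"
      then obtain u where u: "u \<in> ?U" "G = ygraph_of V u" unfolding X by blast
      have "id permutes ?S" "u = relabel id u" using relabel_id[of u] by simp_all
      then show "(G, G) \<in> R" unfolding u(2) using RU[OF u(1) u(1)] by blast
    qed
    show "sym R"
    proof (rule symI)
      fix G H assume GH: "(G, H) \<in> R"
      obtain u w where uw: "u \<in> ?U" "w \<in> ?U" "G = ygraph_of V u" "H = ygraph_of V w" using GH RX unfolding X by blast
      obtain \<tau> where t: "\<tau> permutes ?S" "w = relabel \<tau> u" using GH RU[OF uw(1,2)] unfolding uw(3,4) by blast
      have "inv \<tau> \<circ> \<tau> = id" using permutes_inverses(2)[OF t(1)] by (simp add: fun_eq_iff)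
      then have "u = relabel (inv \<tau>) w" unfolding t(2) relabel_comp[OF t(1) permutes_inv[OF t(1)]] by (simp add: relabel_id)
      then show "(H, G) \<in> R" unfolding uw(3,4) using RU[OF uw(2,1)] permutes_inv[OF t(1)] by blast
    qed
    show "trans R"
    proof (rule transI)
      fix G H K assume GH: "(G, H) \<in> R" and HK: "(H, K) \<in> R"
      obtain u w where uw: "u \<in> ?U" "w \<in> ?U" "G = ygraph_of V u" "H = ygraph_of V w" using GH RX unfolding X by blast
      obtain z where z: "z \<in> ?U" "K = ygraph_of V z" using HK RX unfolding X by blast
      obtain \<tau> where t: "\<tau> permutes ?S" "w = relabel \<tau> u" using GH RU[OF uw(1,2)] unfolding uw(3,4) by blast
      obtain \<tau>' where t': "\<tau>' permutes ?S" "z = relabel \<tau>' w" using HK RU[OF uw(2) z(1)] unfolding uw(4) z(2) by blast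
      have "z = relabel (\<tau>' \<circ> \<tau>) u" unfolding t'(2) t(2) by (rule relabel_comp[OF t(1) t'(1)])
      then show "(G, K) \<in> R" unfolding uw(3) z(2) using RU[OF uw(1) z(1)] permutes_compose[OF t(1) t'(1)] by blast
    qed
  qed
  have cls: "card c = fact V" if c: "c \<in> ?X // R" for c
  proof -
    obtain G where G: "G \<in> ?X" "c = R `` {G}" using c by (rule quotientE)
    obtain u where u: "u \<in> ?U" "G = ygraph_of V u" using G(1) unfolding X by blast
    let ?h = "\<lambda>\<tau>. ygraph_of V (relabel \<tau> u)"
    have "c = ?h ` {\<tau>. \<tau> permutes ?S}"
    proof (intro equalityI subsetI)
      fix H assume H: "H \<in> c"
      then have GH: "(G, H) \<in> R" unfolding G(2) by blast
      then obtain w where w: "w \<in> ?U" "H = ygraph_of V w" using RX unfolding X by blast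
      then show "H \<in> ?h ` {\<tau>. \<tau> permutes ?S}" using GH RU[OF u(1) w(1)] unfolding u(2) w(2) by blast
    next
      fix H assume "H \<in> ?h ` {\<tau>. \<tau> permutes ?S}"
      then obtain \<tau> where t: "\<tau> permutes ?S" "H = ?h \<tau>" by blast
      then have "(G, H) \<in> R" unfolding u(2) t(2) using RU[OF u(1) rel[OF t(1) u(1)]] by blast
      then show "H \<in> c" unfolding G(2) by blast
    qed
    moreover have "inj_on ?h {\<tau>. \<tau> permutes ?S}"
    proof (rule inj_onI)
      fix \<tau> \<tau>' assume "\<tau> \<in> {\<tau>. \<tau> permutes ?S}" "\<tau>' \<in> {\<tau>. \<tau> permutes ?S}" and e: "?h \<tau> = ?h \<tau>'"
      then have t: "\<tau> permutes ?S" "\<tau>' permutes ?S" by auto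
      have "relabel \<tau> u = relabel \<tau>' u" using inj_onD[OF inj e rel[OF t(1) u(1)] rel[OF t(2) u(1)]] .
      then show "\<tau> = \<tau>'" using relabel_free[OF VS(2,1) t] u(1) by (cases u) auto
    qed
    ultimately have "card c = card {\<tau>. \<tau> permutes ?S}" by (simp add: card_image)
    then show ?thesis using card_permutations[of ?S V] by simp
  qed
  have "fact V * card (?X // R) = card (\<Union>(?X // R))"
  proof (rule card_partition)
    show "finite (?X // R)" by (rule finite_quotient[OF finX RX])
    show "finite (\<Union>(?X // R))" unfolding Union_quotient[OF equiv] by (rule finX)
    show "\<And>c. c \<in> ?X // R \<Longrightarrow> card c = fact V" by (rule cls)
    show "\<And>c1 c2. c1 \<in> ?X // R \<Longrightarrow> c2 \<in> ?X // R \<Longrightarrow> c1 \<noteq> c2 \<Longrightarrow> c1 \<inter> c2 = {}"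
      using quotient_disj[OF equiv] by blast
  qed
  also have "card (\<Union>(?X // R)) = card ?X" by (simp only: Union_quotient[OF equiv])
  also have "\<dots> = card ?U" unfolding X by (rule card_image[OF inj])
  finally show ?thesis unfolding U11_count_def R_def V_def by simp
qed

section \<open>The series of 1PI graphs and the final formula\<close>

lemma U11_B_fps: "U11 = (B_fps - 1) * inverse B_fps ^ 3"
proof (rule fps_ext)
  fix n
  show "fps_nth U11 n = fps_nth ((B_fps - 1) * inverse B_fps ^ 3) n"
  proof (cases n)
    case 0
    have "U11_graphs 0 = {}" unfolding U11_graphs_def boson_count_def by simp
    then have "U11_count 0 = 0" unfolding U11_count_def by simp
    then show ?thesis using 0 B_fps_0 unfolding U11_def by simp
  next
    case (Suc k)
    let ?V = "2 * k + 1"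
    have "fact ?V * of_nat (U11_count (Suc k)) = (of_nat (card (Uset {..<?V} ?V)) :: rat)"
      by (simp only: card_Uset_orbits of_nat_mult of_nat_fact)
    also have "\<dots> = fact (card {..<?V}) * fps_nth (((B_fps - 1) * inverse B_fps ^ 3) oo fps_X ^ 2) (card {..<?V} + 1)"
      by (rule card_Uset) auto
    also have "\<dots> = fact ?V * fps_nth ((B_fps - 1) * inverse B_fps ^ 3) (Suc k)"
      unfolding fps_nth_compose_X_power by simp
    finally have "of_nat (U11_count (Suc k)) = fps_nth ((B_fps - 1) * inverse B_fps ^ 3) (Suc k)"
      by (simp only: mult_left_cancel[OF fact_nonzero])
    then show ?thesis unfolding U11_def Suc by simp
  qed
qed

theorem theorem4p7p10:
  shows "U11 = fps_X * ((C_2conn / fps_X ^ 2) oo (C_conn ^ 2 / fps_X))"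
proof -
  define t :: "rat fps" where "t = fps_X * B_fps ^ 2"
  have "C_conn ^ 2 = fps_X * t" unfolding C_conn_B t_def by (simp add: power2_eq_square mult_ac)
  then have t: "C_conn ^ 2 / fps_X = t"
    using nonzero_mult_div_cancel_left[of "fps_X :: rat fps" t] by (simp only: fps_X_neq_zero not_False_eq_True simp_thms)
  have t0: "fps_nth t 0 = 0" unfolding t_def by simp
  define H where "H = fps_shift 2 C_2conn"
  have e0: "conn2_num 0 = 0" unfolding conn2_num_def block_free_num_def block_free_def by simp
  \<comment> \<open>No 2-connected diagram has fewer than two chords, so dividing by the square of
    the variable is a mere shift.\<close>
  have CH: "C_2conn = fps_X ^ 2 * H"
  proof (rule fps_ext)
    fix n
    have "fps_nth C_2conn n = 0" if "n < 2"
    proof -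
      have "n = 0 \<or> n = Suc 0" using that by linarith
      then show ?thesis using C_2conn_nth e0 by auto
    qed
    moreover have "n - 2 + 2 = n" if "\<not> n < 2" using that by linarith
    ultimately show "fps_nth C_2conn n = fps_nth (fps_X ^ 2 * H) n"
      unfolding H_def fps_X_power_mult_nth fps_shift_nth by metis
  qed
  have "(fps_X ^ 2 :: rat fps) \<noteq> 0" by simp
  then have H: "C_2conn / fps_X ^ 2 = H"
    unfolding CH by (rule nonzero_mult_div_cancel_left)
  have b: "B_fps * inverse B_fps = 1" using inverse_mult_eq_1[of B_fps] B_fps_0 by (simp add: mult.commute)
  have "t ^ 2 * (H oo t) = fps_X * (B_fps * (B_fps - 1))"
    using C_2conn_compose unfolding t_def[symmetric] CH
    by (simp add: fps_compose_mult_distrib[OF t0] fps_compose_power[OF t0, symmetric] fps_X_fps_compose_startby0[OF t0])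
  \<comment> \<open>With t = xB^2 both sides contain the factor xB, which is cancelled.\<close>
  then have "(fps_X * B_fps) * (fps_X * (H oo t) * B_fps ^ 3) = (fps_X * B_fps) * (B_fps - 1)"
    unfolding t_def by (simp add: power2_eq_square power3_eq_cube mult_ac)
  moreover have "fps_X * B_fps \<noteq> 0" using b by auto
  ultimately have "fps_X * (H oo t) * B_fps ^ 3 = B_fps - 1" by simp
  then have "U11 = fps_X * (H oo t) * (B_fps ^ 3 * inverse B_fps ^ 3)"
    unfolding U11_B_fps by (metis mult.assoc)
  also have "B_fps ^ 3 * inverse B_fps ^ 3 = 1" by (simp only: power_mult_distrib[symmetric] b power_one)
  finally show ?thesis unfolding t H by simp
qed

end
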